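(* There exist an open set $\mathcal{P}\subset\mathbb{C}^4$ containing $(0,0,0,0)$ and each of the parameters $(A(a),B(a),C(a),D(a))$, $a\in(-2,2)$, where $A(a)=B(a)=C(a)=2a+4$ and $D(a)=-(a^2+8a+8)$, and a countable union $\mathcal{H}\subset\mathbb{C}^4$ of real-algebraic hypersurfaces, with the following properties. (I) For any $(A,B,C,D)\in\mathbb{C}^4\setminus\mathcal{H}$, every fixed point of every element of $\mathcal{G}_{A,B,C,D}\setminus\{\mathrm{id}\}$ lies in $\mathcal{J}_{A,B,C,D}$. (II) For any $(A,B,C,D)\in\mathcal{P}$ there are disjoint non-empty open sets $U,V_{\rm BQ}\subset S_{A,B,C,D}$ such that $\mathcal{G}_{A,B,C,D}$ is locally non-discrete on $U$, the action of $\mathcal{G}_{A,B,C,D}$ on $V_{\rm BQ}$ is properly discontinuous (in particular $\mathcal{G}_{A,B,C,D}$ is locally discrete on any open neighborhood of any point of $V_{\rm BQ}$), and for every $\delta>0$ there are two non-commuting elements $\gamma_1,\gamma_2\in\mathcal{G}_{A,B,C,D}$ with $\sup_{q\in U}\|\gamma_i(q)-q\|<\delta$ for $i=1,2$; and, if in addition $(A,B,C,D)\in\mathcal{P}\setminus\mathcal{H}$, then $$U\subset\mathcal{J}_{A,B,C,D}\qquad\text{and}\qquad V_{\rm BQ}\subset\mathcal{F}_{A,B,C,D}.$$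
   Context: For $(A,B,C,D)\in\mathbb{C}^4$ let $S_{A,B,C,D}=\{(x,y,z)\in\mathbb{C}^3: x^2+y^2+z^2+xyz=Ax+By+Cz+D\}$. The involutions $s_x(x,y,z)=(-x-yz+A,\,y,\,z)$, $s_y(x,y,z)=(x,\,-y-xz+B,\,z)$, $s_z(x,y,z)=(x,\,y,\,-z-xy+C)$ preserve $S_{A,B,C,D}$. Let $\mathcal{G}_{A,B,C,D}=\langle g_x,g_y,g_z\rangle$ be the group of automorphisms of $S_{A,B,C,D}$ generated by $g_x=s_z\circ s_y$, $g_y=s_x\circ s_z$, $g_z=s_y\circ s_x$. A sequence of maps $f_i$ converges to infinity on an open set $U\subset S_{A,B,C,D}$ if for every compact $\overline V\subset U$ and every compact $K\subset S_{A,B,C,D}$ only finitely many $i$ satisfy $f_i(\overline V)\cap K\neq\emptyset$. The group $\mathcal{G}_{A,B,C,D}$ forms a normal family on $U$ if every sequence of its elements has a subsequence that, on $U$, either converges uniformly on compact subsets or converges to infinity. The Fatou set $\mathcal{F}_{A,B,C,D}$ is the set of $p\in S_{A,B,C,D}$ having an open neighborhood on which $\mathcal{G}_{A,B,C,D}$ forms a normal family; the Julia set is $\mathcal{J}_{A,B,C,D}=S_{A,B,C,D}\setminus\mathcal{F}_{A,B,C,D}$. The group $\mathcal{G}_{A,B,C,D}$ is locally non-discrete on an open set $U\subset S_{A,B,C,D}$ if there is a sequence $f_n\in\mathcal{G}_{A,B,C,D}\setminus\{\mathrm{id}\}$ converging uniformly to the identity on compact subsets of $U$; otherwise it is locally discrete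 on $U$. The action on an open set $V$ is properly discontinuous if for every compact $K\subset V$ only finitely many $\gamma\in\mathcal{G}_{A,B,C,D}$ satisfy $\gamma(K)\cap K\neq\emptyset$. A real-algebraic hypersurface in $\mathbb{C}^4\cong\mathbb{R}^8$ is the zero set of a non-zero real polynomial. $\|\cdot\|$ is the Euclidean norm of $\mathbb{C}^3$. *)

theory Defs
  imports "HOL-Analysis.Analysis" "HOL-Algebra.Bij" "HOL-Algebra.Generated_Groups"
begin

text \<open>The norm of a product type is the \<open>\<ell>\<^sup>2\<close> combination of the norms of its factors,
  so that \<^typ>\<open>complex \<times> complex \<times> complex\<close> carries the Euclidean norm of \<open>\<complex>\<^sup>3\<close>.\<close>

type_synonym point = "complex \<times> complex \<times> complex"
type_synonym param = "complex \<times> complex \<times> complex \<times> complex"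

fun cubic_surface :: "param \<Rightarrow> point set" where
  "cubic_surface (A, B, C, D) =
     {(x, y, z). x^2 + y^2 + z^2 + x * y * z = A * x + B * y + C * z + D}"

fun s_x :: "param \<Rightarrow> point \<Rightarrow> point" where
  "s_x (A, B, C, D) (x, y, z) = (- x - y * z + A, y, z)"

fun s_y :: "param \<Rightarrow> point \<Rightarrow> point" where
  "s_y (A, B, C, D) (x, y, z) = (x, - y - x * z + B, z)"

fun s_z :: "param \<Rightarrow> point \<Rightarrow> point" where
  "s_z (A, B, C, D) (x, y, z) = (x, y, - z - x * y + C)"

text \<open>Automorphisms are maps of the surface to itself, so the generators are restricted to it:
  elements of the group are equal iff they agree on the surface, and they carry no
  information outside of it.\<close>

definition g_x :: "param \<Rightarrow> point \<Rightarrow> point" where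
  "g_x P = restrict (s_z P \<circ> s_y P) (cubic_surface P)"

definition g_y :: "param \<Rightarrow> point \<Rightarrow> point" where
  "g_y P = restrict (s_x P \<circ> s_z P) (cubic_surface P)"

definition g_z :: "param \<Rightarrow> point \<Rightarrow> point" where
  "g_z P = restrict (s_y P \<circ> s_x P) (cubic_surface P)"

definition bijections :: "param \<Rightarrow> (point \<Rightarrow> point) monoid" where
  "bijections P = BijGroup (cubic_surface P)"

definition group_G :: "param \<Rightarrow> (point \<Rightarrow> point) set" where
  "group_G P = generate (bijections P) {g_x P, g_y P, g_z P}"

lemma s_in_surface:
  assumes "p \<in> cubic_surface P"
  shows "s_x P p \<in> cubic_surface P" and "s_y P p \<in> cubic_surface P"
    and "s_z P p \<in> cubic_surface P"
proof -
  obtain A B C D x y z where [simp]: "P = (A, B, C, D)" "p = (x, y, z)"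
    by (metis prod.exhaust)
  have eq: "x^2 + y^2 + z^2 + x * y * z = A * x + B * y + C * z + D"
    using assms by simp
  show "s_x P p \<in> cubic_surface P"
    using eq by (simp, algebra)
  show "s_y P p \<in> cubic_surface P"
    using eq by (simp, algebra)
  show "s_z P p \<in> cubic_surface P"
    using eq by (simp, algebra)
qed

lemma s_involution: "s_x P (s_x P p) = p" "s_y P (s_y P p) = p" "s_z P (s_z P p) = p"
  by (cases P; cases p; simp add: algebra_simps)+

lemma generators_in_carrier: "{g_x P, g_y P, g_z P} \<subseteq> carrier (bijections P)"
proof -
  have "bij_betw f (cubic_surface P) (cubic_surface P)" if "f \<in> {s_x P, s_y P, s_z P}" for f
    by (rule bij_betw_byWitness[where f' = f]) (use that in \<open>auto simp: s_in_surface s_involution\<close>)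
  then show ?thesis
    by (auto simp: bijections_def BijGroup_def Bij_def g_x_def g_y_def g_z_def bij_betw_restrict_eq
          intro: bij_betw_trans)
qed

definition converges_uniformly_on_compacts ::
  "(nat \<Rightarrow> point \<Rightarrow> point) \<Rightarrow> (point \<Rightarrow> point) \<Rightarrow> point set \<Rightarrow> bool" where
  "converges_uniformly_on_compacts f g U \<longleftrightarrow>
     (\<forall>K. compact K \<and> K \<subseteq> U \<longrightarrow> uniform_limit K f g sequentially)"

definition converges_to_infinity ::
  "param \<Rightarrow> (nat \<Rightarrow> point \<Rightarrow> point) \<Rightarrow> point set \<Rightarrow> bool" where
  "converges_to_infinity P f U \<longleftrightarrow>
     (\<forall>V K. compact V \<and> V \<subseteq> U \<and> compact K \<and> K \<subseteq> cubic_surface P \<longrightarrow>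
        finite {i. f i ` V \<inter> K \<noteq> {}})"

definition normal_family_on :: "param \<Rightarrow> point set \<Rightarrow> bool" where
  "normal_family_on P U \<longleftrightarrow>
     (\<forall>f :: nat \<Rightarrow> point \<Rightarrow> point. range f \<subseteq> group_G P \<longrightarrow>
        (\<exists>r :: nat \<Rightarrow> nat. strict_mono r \<and>
           ((\<exists>g. converges_uniformly_on_compacts (f \<circ> r) g U) \<or>
            converges_to_infinity P (f \<circ> r) U)))"

definition fatou_set :: "param \<Rightarrow> point set" where
  "fatou_set P = {p \<in> cubic_surface P.
     \<exists>U. openin (top_of_set (cubic_surface P)) U \<and> p \<in> U \<and> normal_family_on P U}"

definition julia_set :: "param \<Rightarrow> point set" where
  "julia_set P = cubic_surface P - fatou_set P"

definition locally_nondiscrete_on :: "param \<Rightarrow> point set \<Rightarrow> bool" where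
  "locally_nondiscrete_on P U \<longleftrightarrow>
     (\<exists>f :: nat \<Rightarrow> point \<Rightarrow> point. range f \<subseteq> group_G P - {\<one>\<^bsub>bijections P\<^esub>} \<and>
        converges_uniformly_on_compacts f (\<lambda>p. p) U)"

abbreviation locally_discrete_on :: "param \<Rightarrow> point set \<Rightarrow> bool" where
  "locally_discrete_on P U \<equiv> \<not> locally_nondiscrete_on P U"

definition properly_discontinuous_on :: "param \<Rightarrow> point set \<Rightarrow> bool" where
  "properly_discontinuous_on P V \<longleftrightarrow>
     (\<forall>K. compact K \<and> K \<subseteq> V \<longrightarrow> finite {\<gamma> \<in> group_G P. \<gamma> ` K \<inter> K \<noteq> {}})"

text \<open>A real polynomial is non-zero iff the function it induces on \<open>\<real>\<^sup>8\<close> is; the predicate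
  \<^const>\<open>real_polynomial_function\<close> views \<^typ>\<open>param\<close> as a real vector space, so these are the
  polynomials in the real and imaginary parts of the four coordinates.\<close>

definition real_algebraic_hypersurface :: "param set \<Rightarrow> bool" where
  "real_algebraic_hypersurface X \<longleftrightarrow>
     (\<exists>q. real_polynomial_function q \<and> q \<noteq> (\<lambda>_. 0) \<and> X = {P. q P = 0})"

definition special_param :: "real \<Rightarrow> param" where
  "special_param a =
     (let A = complex_of_real (2 * a + 4); D = complex_of_real (- (a^2 + 8 * a + 8))
      in (A, A, A, D))"

end

theory Submission
  imports Defs "HOL-Complex_Analysis.Complex_Analysis" "HOL-Computational_Algebra.Fundamental_Theorem_Algebra"
begin

text \<open>Elements of the group are reduced words of even length in the three involutions.

  For (I), let \<open>w\<close> fix \<open>p\<close>. After conjugation \<open>w\<close> is cyclically reduced. If it uses only two letters, it is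
  an iterate of a map preserving one coordinate and affine in the other two, hence parabolic at \<open>p\<close>, and its
  derivatives are unbounded. If it uses all three letters, its fixed points depend properly on the parameters.
  For a parameter \<open>P\<close> algebraically independent from its conjugate, one can therefore specialize \<open>P\<close> to
  the Cayley cubic by a place of \<open>\<complex>\<close> that is trivial on \<open>\<rat>(cnj P)\<close>. A trace in \<open>[-2, 2]\<close> is real, so it
  is algebraic over that field as well and survives the specialization. But the Cayley cubic is a quotient of a
  torus on which words act by monomial maps, and there the trace is an integer outside \<open>[-2, 2]\<close>. So \<open>p\<close>
  is hyperbolic and its derivatives are unbounded; on the Fatou set bounded orbits have bounded derivatives.

  For (II), the set \<open>V\<close> is a neighbourhood of a point with three coordinates so large that every reduced word
  increases them. The set \<open>U\<close> surrounds a point \<open>q\<close> fixed by \<open>s\<^sub>z\<close>, whose third coordinate is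
  \<open>2 cos (\<pi> k / n)\<close> and which is close to a critical point of that coordinate. Then \<open>(s\<^sub>y \<circ> s\<^sub>x)\<^sup>n\<close> and its
  conjugate by \<open>s\<^sub>z\<close> fix \<open>q\<close>, their derivatives are two transvections close to the identity, and iterated
  commutators converge to the identity near \<open>q\<close>. For generic parameters the two transvections generate a group
  of linear maps, one of which contracts any given vector, so that orbits near \<open>q\<close> accumulate at \<open>q\<close>; following
  such an orbit by powers of the shear contradicts bounded derivatives.\<close>

text \<open>That an eigenvalue has modulus one is a real condition, out of reach of complex
  polynomials in \<open>P\<close> alone. Hence \<open>P\<close> and its conjugate are treated as
  eight independent quantities, and the excluded set consists of the zeros of the countably many
  non-zero integer polynomials in them. Two degenerations complicate (I). A fixed point may
  specialize to a singular point of the Cayley cubic, where the derivative is a symmetric square and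
  its trace changes accordingly. And a word in two letters may fix a point that both letters fix;
  there it is not parabolic, and a separate specialization shows that it expands. In (II) the
  strength of the shear is of order \<open>n\<close> times the gradient at \<open>q\<close>. The
  commutators converge only if this product is small, so for the special parameters \<open>q\<close>
  has to approach a singular point faster than \<open>1 / n\<close>; Dirichlet's approximation
  theorem provides such angles. The two open sets are told apart by the third coordinate: its
  modulus is below 2 near \<open>q\<close> and above 2 on the wandering set.\<close>

datatype letter = X | Y | Z

instance letter :: finite
proof
  have "l \<in> {X, Y, Z}" for l :: letter by (cases l) auto
  then have "(UNIV :: letter set) \<subseteq> {X, Y, Z}" by blast
  then show "finite (UNIV :: letter set)" by (rule finite_subset) simp
qed

section \<open>The three involutions in coordinates\<close>

fun invol :: "param \<Rightarrow> letter \<Rightarrow> point \<Rightarrow> point" where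
  "invol P X = s_x P"
| "invol P Y = s_y P"
| "invol P Z = s_z P"

fun co :: "letter \<Rightarrow> point \<Rightarrow> complex" where
  "co X (x, y, z) = x"
| "co Y (x, y, z) = y"
| "co Z (x, y, z) = z"

fun par :: "letter \<Rightarrow> param \<Rightarrow> complex" where
  "par X (A, B, C, D) = A"
| "par Y (A, B, C, D) = B"
| "par Z (A, B, C, D) = C"

fun par0 :: "param \<Rightarrow> complex" where
  "par0 (A, B, C, D) = D"

text \<open>The last letter acts first, so that concatenating words composes maps and reversing a
  word inverts it.\<close>

definition act :: "param \<Rightarrow> letter list \<Rightarrow> point \<Rightarrow> point" where
  "act P w = foldr (invol P) w"

lemma act_Nil [simp]: "act P [] p = p"
  by (simp add: act_def)

lemma act_Cons [simp]: "act P (l # w) p = invol P l (act P w p)"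
  by (simp add: act_def)

lemma act_append [simp]: "act P (u @ v) p = act P u (act P v p)"
  by (induction u) auto

lemma invol_invol [simp]: "invol P l (invol P l p) = p"
  by (cases l) (auto simp: s_involution)

lemma act_rev [simp]: "act P w (act P (rev w) p) = p" "act P (rev w) (act P w p) = p"
  by (induction w arbitrary: p) auto

lemma invol_surface: "p \<in> cubic_surface P \<Longrightarrow> invol P l p \<in> cubic_surface P"
  by (cases l) (auto simp: s_in_surface)

lemma act_surface: "p \<in> cubic_surface P \<Longrightarrow> act P w p \<in> cubic_surface P"
  by (induction w) (auto simp: invol_surface)

lemma co_eqI: "(\<And>l. co l p = co l q) \<Longrightarrow> p = q"
  by (cases p; cases q) (metis co.simps)

lemma letter_distinct_cases:
  fixes i j k l :: letter
  assumes "i \<noteq> j" "j \<noteq> k" "i \<noteq> k"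
  shows "l = i \<or> l = j \<or> l = k"
  by (cases i; cases j; cases k; cases l; insert assms; simp)

lemma third_letter: "i \<noteq> j \<Longrightarrow> \<exists>k. k \<noteq> i \<and> k \<noteq> (j::letter)"
  by (rule exI[of _ "if X \<notin> {i, j} then X else if Y \<notin> {i, j} then Y else Z"]) (cases i; cases j; simp)

lemma co_invol_other: "i \<noteq> j \<Longrightarrow> co i (invol P j p) = co i p"
  by (cases p; cases P; cases i; cases j) auto

text \<open>The formulas are symmetric under permutations of the coordinates. Working with three
  arbitrary distinct letters allows later arguments to be given once instead of once per order of
  the letters.\<close>

lemma co_invol_same:
  assumes "i \<noteq> j" "j \<noteq> k" "i \<noteq> k"
  shows "co i (invol P i p) = - co i p - co j p * co k p + par i P"
  by (cases p; cases P; cases i; cases j; cases k; insert assms; simp)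

lemma surface_iff:
  assumes "i \<noteq> j" "j \<noteq> k" "i \<noteq> k"
  shows "p \<in> cubic_surface P \<longleftrightarrow>
    (co i p)^2 + (co j p)^2 + (co k p)^2 + co i p * co j p * co k p =
      par i P * co i p + par j P * co j p + par k P * co k p + par0 P"
  by (cases p; cases P; cases i; cases j; cases k; insert assms; simp; simp add: algebra_simps)

section \<open>The group as words of even length\<close>

lemma act_bij: "restrict (act P w) (cubic_surface P) \<in> carrier (bijections P)"
proof -
  have "bij_betw (act P w) (cubic_surface P) (cubic_surface P)"
    by (rule bij_betw_byWitness[where f' = "act P (rev w)"]) (auto simp: act_surface)
  then show ?thesis
    by (auto simp: bijections_def BijGroup_def Bij_def bij_betw_restrict_eq)
qed

lemma bij_one: "\<one>\<^bsub>bijections P\<^esub> = restrict (act P []) (cubic_surface P)"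
  by (auto simp: bijections_def BijGroup_def restrict_def fun_eq_iff)

lemma act_mult:
  "restrict (act P u) (cubic_surface P) \<otimes>\<^bsub>bijections P\<^esub> restrict (act P v) (cubic_surface P)
     = restrict (act P (u @ v)) (cubic_surface P)"
  using act_bij[of P u] act_bij[of P v]
  by (auto simp: bijections_def BijGroup_def compose_def restrict_def fun_eq_iff act_surface)

lemma act_inv:
  "inv\<^bsub>bijections P\<^esub> (restrict (act P u) (cubic_surface P)) = restrict (act P (rev u)) (cubic_surface P)"
proof -
  have "group (bijections P)" unfolding bijections_def by (rule group_BijGroup)
  moreover have "restrict (act P (rev u)) (cubic_surface P) \<otimes>\<^bsub>bijections P\<^esub> restrict (act P u) (cubic_surface P) = \<one>\<^bsub>bijections P\<^esub>"
    unfolding act_mult bij_one by (auto simp: restrict_def fun_eq_iff)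
  ultimately show ?thesis
    by (rule group.inv_equality) (rule act_bij)+
qed

lemma generators_act:
  "g_x P = restrict (act P [Z, Y]) (cubic_surface P)"
  "g_y P = restrict (act P [X, Z]) (cubic_surface P)"
  "g_z P = restrict (act P [Y, X]) (cubic_surface P)"
  by (auto simp: g_x_def g_y_def g_z_def restrict_def fun_eq_iff)

lemma generator_word:
  assumes "h \<in> {g_x P, g_y P, g_z P}"
  shows "\<exists>w. length w = 2 \<and> h = restrict (act P w) (cubic_surface P)"
proof -
  have "length [a, b] = 2" for a b :: letter by simp
  then show ?thesis using assms unfolding generators_act by blast
qed

lemma group_G_subset:
  assumes "\<gamma> \<in> group_G P"
  shows "\<exists>w. even (length w) \<and> \<gamma> = restrict (act P w) (cubic_surface P)"
  using assms unfolding group_G_def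
proof (induction rule: generate.induct)
  case one
  show ?case by (intro exI[of _ "[]"]) (simp add: bij_one restrict_def fun_eq_iff)
next
  case (incl h)
  then obtain w where "length w = 2" "h = restrict (act P w) (cubic_surface P)"
    using generator_word by blast
  then show ?case by (intro exI[of _ w]) simp
next
  case (inv h)
  then obtain w where "length w = 2" "h = restrict (act P w) (cubic_surface P)"
    using generator_word by blast
  then show ?case by (intro exI[of _ "rev w"]) (simp add: act_inv)
next
  case (eng h1 h2)
  then obtain u v where "even (length u)" "h1 = restrict (act P u) (cubic_surface P)"
    "even (length v)" "h2 = restrict (act P v) (cubic_surface P)" by blast
  then show ?case by (intro exI[of _ "u @ v"]) (simp add: act_mult del: act_append)
qed

text \<open>Cut the word into pairs of letters: of the nine possible pairs three are the generators,
  three are their inverses and three cancel.\<close>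

lemma even_word_in_group:
  assumes "even (length w)"
  shows "restrict (act P w) (cubic_surface P) \<in> group_G P"
  using assms
proof (induction w rule: induct_list012)
  case 1
  show ?case
    unfolding group_G_def bij_one[of P, symmetric] by (rule generate.one)
next
  case (2 l)
  then show ?case by simp
next
  case (3 a b w)
  have two: "restrict (act P [a, b]) (cubic_surface P) \<in> group_G P"
  proof -
    have g: "restrict (act P u) (cubic_surface P) \<in> group_G P" if "u \<in> {[Z, Y], [X, Z], [Y, X]}" for u
    proof -
      have "restrict (act P u) (cubic_surface P) \<in> {g_x P, g_y P, g_z P}"
        using that unfolding generators_act by auto
      then show ?thesis unfolding group_G_def by (rule generate.incl)
    qed
    have i: "restrict (act P (rev u)) (cubic_surface P) \<in> group_G P" if "u \<in> {[Z, Y], [X, Z], [Y, X]}" for u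
    proof -
      have "restrict (act P u) (cubic_surface P) \<in> {g_x P, g_y P, g_z P}"
        using that unfolding generators_act by auto
      then show ?thesis unfolding group_G_def act_inv[symmetric] by (rule generate.inv)
    qed
    have e: "restrict (act P [a, a]) (cubic_surface P) \<in> group_G P" for a
    proof -
      have "restrict (act P [a, a]) (cubic_surface P) = \<one>\<^bsub>bijections P\<^esub>"
        by (auto simp: bij_one restrict_def fun_eq_iff)
      then show ?thesis by (simp add: generate.one group_G_def)
    qed
    show ?thesis
      using g[of "[Z, Y]"] g[of "[X, Z]"] g[of "[Y, X]"] i[of "[Z, Y]"] i[of "[X, Z]"] i[of "[Y, X]"] e[of a]
      by (cases a; cases b) simp_all
  qed
  have w: "restrict (act P w) (cubic_surface P) \<in> group_G P"
  proof -
    have "even (length w)" using 3 by simp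
    then show ?thesis by (rule 3)
  qed
  have "restrict (act P (a # b # w)) (cubic_surface P) =
      restrict (act P [a, b]) (cubic_surface P) \<otimes>\<^bsub>bijections P\<^esub> restrict (act P w) (cubic_surface P)"
    unfolding act_mult by (simp del: act_append)
  then show ?case
    using two w unfolding group_G_def by (metis generate.eng)
qed

lemma group_G_iff:
  "\<gamma> \<in> group_G P \<longleftrightarrow> (\<exists>w. even (length w) \<and> \<gamma> = restrict (act P w) (cubic_surface P))"
  using group_G_subset even_word_in_group by blast

section \<open>Reduced words\<close>

text \<open>Left multiplication by a letter in the free product of three groups of order two,
  carried out on normal forms. Hence \<open>tact w []\<close> is the reduced form of
  \<open>w\<close>.\<close>

definition app :: "letter \<Rightarrow> letter list \<Rightarrow> letter list" where
  "app l w = (case w of [] \<Rightarrow> [l] | k # v \<Rightarrow> if k = l then v else l # w)"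

definition tact :: "letter list \<Rightarrow> letter list \<Rightarrow> letter list" where
  "tact w = foldr app w"

lemma tact_simps [simp]: "tact [] t = t" "tact (l # w) t = app l (tact w t)"
  "tact (u @ v) t = tact u (tact v t)"
  by (auto simp: tact_def)

lemma distinct_adj_app: "distinct_adj w \<Longrightarrow> distinct_adj (app l w)"
  by (cases w rule: list.exhaust; cases "tl w")
     (auto simp: app_def distinct_adj_Cons)

lemma distinct_adj_tact: "distinct_adj t \<Longrightarrow> distinct_adj (tact w t)"
  by (induction w) (auto simp: distinct_adj_app)

lemma act_app: "act P (app l w) p = invol P l (act P w p)"
  by (auto simp: app_def split: list.split)

lemma act_tact: "act P (tact w t) p = act P w (act P t p)"
  by (induction w) (auto simp: act_app)

lemma app_app: "distinct_adj w \<Longrightarrow> app l (app l w) = w"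
  by (cases w) (auto simp: app_def distinct_adj_Cons split: list.split)

lemma tact_rev: 
  assumes "distinct_adj t" shows "tact (rev w) (tact w t) = t" "tact w (tact (rev w) t) = t"
proof -
  show *: "tact (rev w) (tact w t) = t" for w
    by (induction w) (use assms in \<open>auto simp: app_app distinct_adj_tact\<close>)
  show "tact w (tact (rev w) t) = t" using *[of "rev w"] by simp
qed

lemma length_tact_parity: "even (length (tact w [])) \<longleftrightarrow> even (length w)"
proof (induction w)
  case (Cons l w)
  then show ?case by (cases "tact w []") (auto simp: app_def)
qed auto

lemma reduce_word:
  obtains v where "distinct_adj v" "act P v = act P w" "even (length v) \<longleftrightarrow> even (length w)"
  using that[of "tact w []"] by (auto simp: distinct_adj_tact act_tact length_tact_parity fun_eq_iff)

section \<open>Growth of reduced words\<close>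

definition dominated :: "real \<Rightarrow> letter \<Rightarrow> point \<Rightarrow> bool" where
  "dominated m i p \<longleftrightarrow> (\<forall>l. m \<le> cmod (co l p) \<and> cmod (co l p) \<le> cmod (co i p))"

lemma norm_neg_add3: "cmod (- a - b + c) \<le> cmod a + cmod b + cmod c"
proof -
  have "cmod (- a - b + c) \<le> cmod (- a - b) + cmod c" by (rule norm_triangle_ineq)
  moreover have "cmod (- a - b) \<le> cmod (- a) + cmod b" by (rule norm_triangle_ineq4)
  ultimately show ?thesis by simp
qed

text \<open>The product of the largest coordinate with the third one, which is at least
  \<open>m\<close>, outweighs the old coordinate and the parameter. What is left over, at least
  \<open>m * (m - 2)\<close> minus the parameter, pays for the growth by \<open>c\<close>.\<close>

lemma dominated_step:
  assumes dom: "dominated m i p" and "i \<noteq> j" and m: "2 < m" "0 \<le> c"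
    and par: "cmod (par j P) + c \<le> m * (m - 2)"
  shows "dominated m j (invol P j p) \<and> cmod (co i p) + c \<le> cmod (co j (invol P j p))"
proof -
  obtain k where k: "k \<noteq> i" "k \<noteq> j" using third_letter[OF \<open>i \<noteq> j\<close>] by blast
  let ?x = "cmod (co i p)" let ?y = "cmod (co j p)" let ?z = "cmod (co k p)"
  have le: "?y \<le> ?x" "m \<le> ?z" "m \<le> ?x" "m \<le> ?y" "?z \<le> ?x" using dom by (auto simp: dominated_def)
  have "co i p * co k p = - co j (invol P j p) - co j p + par j P"
    using k \<open>i \<noteq> j\<close> by (subst co_invol_same[of j i k]) auto
  then have "?x * ?z \<le> cmod (co j (invol P j p)) + ?y + cmod (par j P)"
    using norm_neg_add3[of "co j (invol P j p)" "co j p" "par j P"] by (simp flip: norm_mult)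
  moreover have "?x * m \<le> ?x * ?z" using le by (intro mult_left_mono) auto
  moreover have "m * (m - 2) \<le> ?x * (m - 2)" using le m by (intro mult_right_mono) auto
  ultimately have grow: "?x + c \<le> cmod (co j (invol P j p))"
    using par le by (simp add: algebra_simps)
  have "m \<le> cmod (co l (invol P j p)) \<and> cmod (co l (invol P j p)) \<le> cmod (co j (invol P j p))" for l
  proof (cases "l = j")
    case True
    then show ?thesis using grow le m by auto
  next
    case False
    then have "co l (invol P j p) = co l p" by (rule co_invol_other)
    moreover have "m \<le> cmod (co l p)" "cmod (co l p) \<le> ?x" using dom by (auto simp: dominated_def)
    ultimately show ?thesis using grow m by simp
  qed
  with grow show ?thesis by (auto simp: dominated_def)
qed

text \<open>In a reduced word each letter differs from the one that has just created the largest
  coordinate, so \<open>dominated_step\<close> applies every time. The letter acting first is the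
  last one, hence the condition on \<open>last w\<close>.\<close>

lemma dominated_word:
  assumes "dominated m i p" "2 < m" "0 \<le> c" "\<And>j. cmod (par j P) + c \<le> m * (m - 2)"
    and "distinct_adj w" "w \<noteq> []" "last w \<noteq> i"
  shows "dominated m (hd w) (act P w p) \<and>
    cmod (co i p) + c * length w \<le> cmod (co (hd w) (act P w p))"
  using assms(5-7)
proof (induction w)
  case (Cons l w)
  show ?case
  proof (cases "w = []")
    case True
    then show ?thesis using dominated_step[OF assms(1) _ assms(2,3,4), of l] Cons.prems by auto
  next
    case False
    then have IH: "dominated m (hd w) (act P w p)"
        "cmod (co i p) + c * length w \<le> cmod (co (hd w) (act P w p))"
      and ne: "hd w \<noteq> l"
      using Cons by (auto simp: distinct_adj_Cons)
    show ?thesis using dominated_step[OF IH(1) ne assms(2,3,4)] IH(2) by (auto simp: algebra_simps)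
  qed
qed simp

section \<open>Points with large coordinates and faithfulness of reduced words\<close>

lemma quadratic_roots:
  obtains r s :: complex where "r + s = - b" "r * s = c"
proof
  show "(- b + csqrt (b^2 - 4 * c)) / 2 + (- b - csqrt (b^2 - 4 * c)) / 2 = - b" by (simp add: field_simps)
  have "(csqrt (b^2 - 4 * c))^2 = b^2 - 4 * c" by simp
  then show "(- b + csqrt (b^2 - 4 * c)) / 2 * ((- b - csqrt (b^2 - 4 * c)) / 2) = c"
    by (simp add: field_simps power2_eq_square)
qed

lemma quadratic_factor:
  fixes b c x :: complex
  assumes "r + s = - b" "r * s = c"
  shows "x^2 + b * x + c = (x - r) * (x - s)"
proof -
  have b: "b = - (r + s)" using assms(1) by simp
  show ?thesis unfolding b assms(2)[symmetric] by (simp add: algebra_simps power2_eq_square)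
qed

text \<open>One of the roots has at least half the modulus of their sum.\<close>

lemma quadratic_large_root:
  obtains r :: complex where "r^2 + b * r + c = 0" "cmod b \<le> 2 * cmod r"
proof -
  obtain r s where rs: "r + s = - b" "r * s = c" using quadratic_roots by blast
  have root: "x^2 + b * x + c = 0" if "x = r \<or> x = s" for x
    using that unfolding quadratic_factor[OF rs] by auto
  have "cmod b \<le> cmod r + cmod s" using rs using norm_triangle_ineq[of r s] by simp
  then consider "cmod b \<le> 2 * cmod r" | "cmod b \<le> 2 * cmod s" by linarith
  then show ?thesis using root that by cases blast+
qed

text \<open>The value at \<open>x\<close> is the product of the distances to the two roots, so one
  of them is smaller than \<open>e\<close>.\<close>

lemma quadratic_near_root:
  assumes "cmod (x^2 + b * x + c) < e^2" "0 < e"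
  obtains r :: complex where "r^2 + b * r + c = 0" "cmod (r - x) < e"
proof -
  obtain r s where rs: "r + s = - b" "r * s = c" using quadratic_roots by blast
  have "x^2 + b * x + c = (x - r) * (x - s)"
    by (rule quadratic_factor[OF rs])
  then have "cmod (x - r) * cmod (x - s) < e * e" using assms by (simp add: norm_mult power2_eq_square)
  then have "cmod (x - r) < e \<or> cmod (x - s) < e"
    using assms(2) mult_mono[of e "cmod (x - r)" e "cmod (x - s)"] by force
  moreover have "y^2 + b * y + c = 0" if "y = r \<or> y = s" for y
    using that unfolding quadratic_factor[OF rs] by auto
  ultimately show ?thesis using that[of r] that[of s] by (auto simp: norm_minus_commute)
qed

text \<open>Two coordinates are set to a large real number and the dominant one is a root of the
  remaining quadratic. Two choices of \<open>j\<close> suffice, since later a single letter has to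
  be avoided.\<close>

lemma exists_dominated:
  assumes "j = X \<or> j = Y"
  obtains p where "p \<in> cubic_surface P" "dominated m j p"
proof -
  obtain A B C D where P: "P = (A, B, C, D)" by (cases P)
  define t where "t = max m (3 + cmod A + cmod B)"
  have t: "m \<le> t" "3 + cmod A + cmod B \<le> t" by (auto simp: t_def)
  have t0: "3 \<le> t" using t(2) norm_ge_zero[of A] norm_ge_zero[of B] by linarith
  define u where "u = complex_of_real t"
  have cu: "cmod u = t" using t0 by (simp add: u_def)
  \<comment> \<open>For \<open>3 \<le> t\<close> the middle coefficient \<open>u * u - E\<close> has
    modulus at least \<open>3 * t - (t - 3)\<close>, and half of that exceeds
    \<open>t\<close>.\<close>
  have big: "t \<le> cmod r" if "cmod (u * u - E) \<le> 2 * cmod r" "cmod E \<le> t - 3" for r E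
  proof -
    have "t * t \<le> cmod (u * u - E) + cmod E"
      using norm_triangle_ineq[of "u * u - E" E] by (simp add: norm_mult cu)
    moreover have "3 * t \<le> t * t" using t0 by (intro mult_right_mono) auto
    ultimately show ?thesis using that t0 by linarith
  qed
  show ?thesis
  proof (cases "j = X")
    case True
    obtain r where r: "r^2 + (u * u - A) * r + (2 * u^2 - B * u - C * u - D) = 0"
        "cmod (u * u - A) \<le> 2 * cmod r" using quadratic_large_root by blast
    have "(r, u, u) \<in> cubic_surface P" using r(1) unfolding P by (simp add: algebra_simps power2_eq_square)
    moreover have "t \<le> cmod r" using big[OF r(2)] t(2) norm_ge_zero[of B] by linarith
    then have "m \<le> cmod (co l (r, u, u)) \<and> cmod (co l (r, u, u)) \<le> cmod (co j (r, u, u))" for l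
      using t(1) cu True by (cases l) auto
    ultimately show ?thesis using that by (auto simp: dominated_def)
  next
    case False
    obtain r where r: "r^2 + (u * u - B) * r + (2 * u^2 - A * u - C * u - D) = 0"
        "cmod (u * u - B) \<le> 2 * cmod r" using quadratic_large_root by blast
    have "(u, r, u) \<in> cubic_surface P" using r(1) unfolding P by (simp add: algebra_simps power2_eq_square)
    moreover have "t \<le> cmod r" using big[OF r(2)] t(2) norm_ge_zero[of A] by linarith
    then have "m \<le> cmod (co l (u, r, u)) \<and> cmod (co l (u, r, u)) \<le> cmod (co j (u, r, u))" for l
      using t(1) cu False assms by (cases l) auto
    ultimately show ?thesis using that by (auto simp: dominated_def)
  qed
qed

text \<open>At a point dominated by a letter other than the one acting first, the word makes some
  coordinate larger than all coordinates of the starting point.\<close>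

lemma reduced_word_moves:
  assumes "distinct_adj w" "w \<noteq> []"
  obtains p where "p \<in> cubic_surface P" "act P w p \<noteq> p"
proof -
  obtain j where j: "j = X \<or> j = Y" "last w \<noteq> j" by (cases "last w = X") auto
  define s where "s = cmod (par X P) + cmod (par Y P) + cmod (par Z P)"
  define m where "m = 3 + s"
  have s0: "0 \<le> s" by (simp add: s_def)
  have "cmod (par l P) \<le> s" for l by (cases l) (auto simp: s_def)
  moreover have "s + 1 \<le> m * (m - 2)" using s0 mult_nonneg_nonneg[OF s0 s0] by (simp add: m_def algebra_simps)
  ultimately have par: "cmod (par l P) + 1 \<le> m * (m - 2)" for l by (smt (verit))
  obtain p where p: "p \<in> cubic_surface P" "dominated m j p" using exists_dominated[OF j(1)] by blast
  have "dominated m (hd w) (act P w p) \<and> cmod (co j p) + (1::real) * length w \<le> cmod (co (hd w) (act P w p))"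
    by (rule dominated_word) (use p par assms j s0 in \<open>auto simp: m_def\<close>)
  moreover have "cmod (co (hd w) p) \<le> cmod (co j p)" using p by (simp add: dominated_def)
  moreover have "1 \<le> real (length w)" using assms by (cases w) auto
  ultimately have "act P w p \<noteq> p" by auto
  then show ?thesis using that p by blast
qed

text \<open>A coincidence of two words on the surface makes the reduced form of
  \<open>rev v @ u\<close> act trivially, and only the empty reduced word does. The involutions thus
  generate a free product on every surface.\<close>

lemma faithful:
  assumes "\<And>p. p \<in> cubic_surface P \<Longrightarrow> act P u p = act P v p"
  shows "tact u [] = tact v []"
proof -
  define r where "r = tact (rev v @ u) []"
  have "r = []"
  proof (rule ccontr)
    assume "r \<noteq> []"
    moreover have "distinct_adj r" by (simp add: r_def distinct_adj_tact)
    ultimately obtain p where p: "p \<in> cubic_surface P" "act P r p \<noteq> p" using reduced_word_moves by blast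
    then show False using assms[OF p(1)] by (simp add: r_def act_tact del: tact_simps(3))
  qed
  then have "tact v (tact (rev v) (tact u [])) = tact v []" by (simp add: r_def)
  then show ?thesis by (simp add: tact_rev distinct_adj_tact)
qed

lemma group_G_reduced:
  assumes "\<gamma> \<in> group_G P"
  obtains w where "distinct_adj w" "even (length w)" "\<gamma> = restrict (act P w) (cubic_surface P)"
  using assms unfolding group_G_iff by (metis reduce_word)

section \<open>A wandering open set\<close>

text \<open>The set \<open>V\<close> lies in the polydisc of radius \<open>R\<close>, and every nontrivial reduced word moves all of it
  outside.\<close>

definition wandering :: "param \<Rightarrow> point set \<Rightarrow> bool" where
  "wandering P V \<longleftrightarrow> (\<exists>R c. 0 < c \<and> (\<forall>p\<in>V. (\<forall>l. cmod (co l p) < R) \<and>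
     (\<forall>w. distinct_adj w \<and> w \<noteq> [] \<longrightarrow>
        (\<exists>l. R + c * (real (length w) - 1) \<le> cmod (co l (act P w p))))))"

text \<open>All coordinates have modulus about \<open>t\<close>. The first letter produces one of
  modulus at least \<open>(t - e)^2 - (t + e)\<close> minus the parameter, hence at least
  \<open>t + e\<close>, and from then on there is always a dominant coordinate.\<close>

lemma wandering_box:
  assumes t: "2 < t" and e: "0 < e" "e \<le> (t - 2) / 2"
    and par: "\<And>l. cmod (par l P) \<le> (t - e)^2 - 2 * (t + e)"
    and V: "\<And>p l. p \<in> V \<Longrightarrow> cmod (co l p) \<in> {t - e<..<t + e}"
  shows "wandering P V"
proof -
  have m2: "2 < t - e" using t e by (simp add: field_simps)
  \<comment> \<open>\<open>(t - e) * ((t - e) - 2)\<close> exceeds the assumed bound on the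
    parameters by exactly \<open>4 * e\<close>; this is the growth per further letter.\<close>
  have parm: "cmod (par l P) + 4 * e \<le> (t - e) * ((t - e) - 2)" for l
    using par[of l] by (simp add: algebra_simps power2_eq_square)
  have "(\<exists>l. t + e + 4 * e * (real (length w) - 1) \<le> cmod (co l (act P w p)))"
    if p: "p \<in> V" and w: "distinct_adj w" "w \<noteq> []" for p w
  proof -
    obtain v i where vi: "w = v @ [i]" using w(2) by (metis rev_exhaust)
    obtain j where j: "j \<noteq> i" by (metis letter.distinct(1))
    then obtain k where k: "k \<noteq> i" "k \<noteq> j" using third_letter by metis
    let ?q = "invol P i p"
    have b: "t - e < cmod (co l p)" "cmod (co l p) < t + e" for l using V[OF p, of l] by auto
    have "co j p * co k p = - co i ?q - co i p + par i P"
      using j k by (subst co_invol_same[of i j k]) auto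
    then have "cmod (co j p) * cmod (co k p) \<le> cmod (co i ?q) + cmod (co i p) + cmod (par i P)"
      using norm_neg_add3[of "co i ?q" "co i p" "par i P"] by (simp flip: norm_mult)
    moreover have "(t - e)^2 \<le> cmod (co j p) * cmod (co k p)"
      using b(1)[of j] b(1)[of k] m2 by (auto simp: power2_eq_square intro!: mult_mono)
    ultimately have big: "t + e \<le> cmod (co i ?q)"
      using par[of i] b(2)[of i] by (smt (verit))
    have dom: "dominated (t - e) i ?q"
      unfolding dominated_def
    proof
      fix l
      show "t - e \<le> cmod (co l ?q) \<and> cmod (co l ?q) \<le> cmod (co i ?q)"
        using big b[of l] e co_invol_other[of l i P p] by (cases "l = i") auto
    qed
    show ?thesis
    proof (cases "v = []")
      case True
      then show ?thesis using big vi by auto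
    next
      case False
      have "dominated (t - e) (hd v) (act P v ?q) \<and>
          cmod (co i ?q) + (4 * e) * length v \<le> cmod (co (hd v) (act P v ?q))"
      proof (rule dominated_word[OF dom m2 _ parm])
        show "distinct_adj v" "last v \<noteq> i" using w vi False by (auto simp: distinct_adj_append_iff)
      qed (use e False in auto)
      then show ?thesis using big vi by (intro exI[of _ "hd v"]) (auto simp: algebra_simps)
    qed
  qed
  moreover have "cmod (co l p) < t + e" if "p \<in> V" for l p using V[OF that, of l] by auto
  ultimately show ?thesis unfolding wandering_def using e by (intro exI[of _ "t + e"] exI[of _ "4 * e"]) auto
qed

section \<open>Persistence of wandering sets under small changes of the parameter\<close>

lemma par_simps: "par X P = fst P" "par Y P = fst (snd P)" "par Z P = fst (snd (snd P))"
  "par0 P = snd (snd (snd P))"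
  by (cases P; simp)+

lemma co_simps: "co X p = fst p" "co Y p = fst (snd p)" "co Z p = snd (snd p)"
  by (cases p; simp)+

lemma continuous_co [continuous_intros]: "continuous_on U (co l)"
proof -
  have "co l = (case l of X \<Rightarrow> fst | Y \<Rightarrow> (\<lambda>p. fst (snd p)) | Z \<Rightarrow> (\<lambda>p. snd (snd p)))"
    by (cases l) (auto simp: fun_eq_iff co_simps)
  then show ?thesis by (cases l) (auto intro!: continuous_intros)
qed

lemma tendsto_par: "(par l \<longlongrightarrow> par l P0) (nhds P0)" "(par0 \<longlongrightarrow> par0 P0) (nhds P0)"
proof -
  have "par l = (case l of X \<Rightarrow> fst | Y \<Rightarrow> (\<lambda>P. fst (snd P)) | Z \<Rightarrow> (\<lambda>P. fst (snd (snd P))))"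
    by (cases l) (auto simp: fun_eq_iff par_simps)
  then show "(par l \<longlongrightarrow> par l P0) (nhds P0)"
    by (cases l) (simp_all only: letter.case, (intro tendsto_fst tendsto_snd filterlim_ident)+)
  have "((\<lambda>P :: param. snd (snd (snd P))) \<longlongrightarrow> snd (snd (snd P0))) (nhds P0)"
    by (intro tendsto_snd filterlim_ident)
  then show "(par0 \<longlongrightarrow> par0 P0) (nhds P0)" by (simp add: par_simps(4)[abs_def])
qed

text \<open>The bound on the third coordinate keeps the set disjoint from the one on which the group
  is non-discrete, where that coordinate has modulus below 2.\<close>

definition has_wandering :: "param \<Rightarrow> bool" where
  "has_wandering P \<longleftrightarrow> (\<exists>V. openin (top_of_set (cubic_surface P)) V \<and> V \<noteq> {} \<and>
     (\<forall>p\<in>V. 2 < cmod (co Z p)) \<and> wandering P V)"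

text \<open>For \<open>P\<close> near \<open>P0\<close> two coordinates stay at \<open>- t\<close>
  and the first moves to a nearby root of the surface equation. The inequality on the parameters is
  the condition of \<open>wandering_box\<close> in the limit of small boxes.\<close>

lemma eventually_has_wandering:
  assumes t: "2 < t" and par: "\<And>l. cmod (par l P0) < t^2 - 2 * t"
    and surf: "(- of_real t, - of_real t, - of_real t) \<in> cubic_surface P0"
  shows "eventually has_wandering (nhds P0)"
proof -
  define M where "M = Max (range (\<lambda>l. cmod (par l P0)))"
  have M: "cmod (par l P0) \<le> M" for l unfolding M_def by (intro Max_ge) auto
  have "M \<in> range (\<lambda>l. cmod (par l P0))" unfolding M_def by (intro Max_in) auto
  then have M': "M < t^2 - 2 * t" using par by auto
  define g where "g = t^2 - 2 * t - M"
  have g: "0 < g" using M' by (simp add: g_def)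
  \<comment> \<open>The first bound keeps \<open>t - e\<close> above 2. The second spends at most
    half of the slack \<open>g\<close>; the other half is left for the variation of the
    parameters.\<close>
  define e where "e = min ((t - 2) / 2) (g / (4 * t + 4))"
  have e1: "0 < e" using t g by (simp add: e_def)
  have e2: "e \<le> (t - 2) / 2" unfolding e_def by (rule min.cobounded1)
  have e3: "e \<le> g / (4 * t + 4)" unfolding e_def by (rule min.cobounded2)
  note e = e1 e2 e3
  have "e * (4 * t + 4) \<le> g" using e(3) t by (simp add: pos_le_divide_eq)
  then have bound: "M + g / 2 \<le> (t - e)^2 - 2 * (t + e)"
  proof -
    have "(t - e)^2 - 2 * (t + e) = t^2 - 2 * t - e * (4 * t + 4) / 2 + e^2"
      by (simp add: power2_eq_square field_simps)
    moreover have "0 \<le> e^2" by simp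
    ultimately show ?thesis using \<open>e * (4 * t + 4) \<le> g\<close> unfolding g_def by argo
  qed
  let ?t = "complex_of_real t"
  \<comment> \<open>The surface equation as a quadratic in the first coordinate, evaluated at
    \<open>- t\<close> with the other two coordinates also equal to \<open>- t\<close>.\<close>
  define F where "F P = (- ?t)^2 + (?t * ?t - par X P) * (- ?t) + (2 * ?t^2 + par Y P * ?t + par Z P * ?t - par0 P)" for P
  have F0: "F P0 = 0"
    using surf unfolding F_def surface_iff[of X Y Z, simplified] by (simp add: algebra_simps power2_eq_square)
  have "(F \<longlongrightarrow> F P0) (nhds P0)" unfolding F_def by (intro tendsto_intros tendsto_par)
  then have "((\<lambda>P. cmod (F P)) \<longlongrightarrow> 0) (nhds P0)" unfolding F0 by (rule tendsto_norm_zero)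
  then have ev1: "\<forall>\<^sub>F P in nhds P0. cmod (F P) < e^2" using e(1) by (intro order_tendstoD) auto
  have "\<forall>\<^sub>F P in nhds P0. cmod (par l P) < M + g / 2" for l
    by (rule order_tendstoD[OF tendsto_norm[OF tendsto_par(1)]]) (use M[of l] g in linarith)
  then have ev2: "\<forall>\<^sub>F P in nhds P0. \<forall>l. cmod (par l P) < M + g / 2"
    by (intro eventually_all_finite) auto
  show ?thesis
    using ev1 ev2
  proof eventually_elim
    case (elim P)
    have "cmod ((- ?t)^2 + (?t * ?t - par X P) * (- ?t) + (2 * ?t^2 + par Y P * ?t + par Z P * ?t - par0 P)) < e^2"
      using elim(1) by (simp add: F_def)
    then obtain r where r: "r^2 + (?t * ?t - par X P) * r + (2 * ?t^2 + par Y P * ?t + par Z P * ?t - par0 P) = 0"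
        "cmod (r - - ?t) < e"
      using quadratic_near_root[OF _ e(1)] by metis
    define V where "V = cubic_surface P \<inter> {p. \<forall>l. cmod (co l p) \<in> {t - e<..<t + e}}"
    have op: "open {p. \<forall>l. cmod (co l p) \<in> {t - e<..<t + e}}"
    proof -
      have "open ((\<lambda>p. cmod (co l p)) -` {t - e<..<t + e})" for l
        by (intro open_vimage continuous_intros)
      then have "open (\<Inter>l. (\<lambda>p. cmod (co l p)) -` {t - e<..<t + e})" by (intro open_INT) auto
      moreover have "(\<Inter>l. (\<lambda>p. cmod (co l p)) -` {t - e<..<t + e}) = {p. \<forall>l. cmod (co l p) \<in> {t - e<..<t + e}}"
        by auto
      ultimately show ?thesis by simp
    qed
    have "(r, - ?t, - ?t) \<in> cubic_surface P"
      using r(1) unfolding surface_iff[of X Y Z, simplified] by (simp add: algebra_simps power2_eq_square)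
    moreover have "cmod (co l (r, - ?t, - ?t)) \<in> {t - e<..<t + e}" for l
    proof -
      have "\<bar>cmod r - t\<bar> < e" using r(2) norm_triangle_ineq3[of r "- ?t"] t by simp
      then show ?thesis using e(1) t by (cases l) auto
    qed
    ultimately have ne: "(r, - ?t, - ?t) \<in> V" by (simp add: V_def)
    have wand: "wandering P V"
    proof (rule wandering_box[OF t e(1,2)])
      show "cmod (par l P) \<le> (t - e)^2 - 2 * (t + e)" for l
        using elim(2)[rule_format, of l] bound by linarith
    qed (auto simp: V_def)
    have "2 < cmod (co Z p)" if "p \<in> V" for p
    proof -
      have "t - e < cmod (co Z p)" using that by (auto simp: V_def)
      moreover have "2 < t - e" using t e by (simp add: field_simps)
      ultimately show ?thesis by linarith
    qed
    then show ?case unfolding has_wandering_def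
      using ne wand op by (intro exI[of _ V]) (auto simp: V_def intro: openin_open_Int)
  qed
qed

text \<open>\<open>(-3, -3, -3)\<close> lies on the surface because
  \<open>3 * 9 = 27\<close>.\<close>

lemma wandering_zero: "eventually has_wandering (nhds (0, 0, 0, 0))"
proof (rule eventually_has_wandering[of 3])
  show "cmod (par l (0, 0, 0, 0)) < 3^2 - 2 * 3" for l by (cases l) auto
qed auto

lemma wandering_special:
  assumes a: "a \<in> {-2<..<2}"
  shows "eventually has_wandering (nhds (special_param a))"
proof -
  \<comment> \<open>Up to sign the surface equation at the diagonal point
    \<open>(- t, - t, - t)\<close>.\<close>
  define q where "q t = t^3 - 3 * t^2 - (6 * a + 12) * t - (a^2 + 8 * a + 8)" for t :: real
  \<comment> \<open>The positive solution of \<open>t^2 - 2 * t = 2 * a + 4\<close>, the threshold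
    that the parameters impose on \<open>t\<close>; the root of \<open>q\<close> must lie beyond
    it.\<close>
  define t0 where "t0 = 1 + sqrt (5 + 2 * a)"
  have s1: "1 < sqrt (5 + 2 * a)" using a by (simp add: real_less_rsqrt)
  have "(sqrt (5 + 2 * a))^2 = 5 + 2 * a" using a by simp
  then have t0: "2 < t0" "t0^2 = 2 * t0 + 4 + 2 * a"
    using s1 by (auto simp: t0_def power2_eq_square algebra_simps)
  have "t0^3 = t0 * t0^2" by (simp add: power2_eq_square power3_eq_cube)
  then have t3: "t0^3 = (8 + 2 * a) * t0 + 8 + 4 * a" using t0(2)
    by (simp add: algebra_simps power2_eq_square)
  have neg: "q t0 < 0"
  proof -
    have "q t0 = - (4 * a + 10) * t0 - (a^2 + 10 * a + 12)"
      unfolding q_def t3 t0(2) by (simp add: algebra_simps)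
    moreover have "(4 * a + 10) * 2 \<le> (4 * a + 10) * t0" using a t0(1) by (intro mult_left_mono) auto
    moreover have "0 < a^2 + 18 * a + 32"
    proof -
      have "a^2 + 18 * a + 32 = (a + 2) * (a + 16)" by (simp add: algebra_simps power2_eq_square)
      then show ?thesis using a by simp
    qed
    ultimately show ?thesis by argo
  qed
  have "0 \<le> q 7"
  proof -
    have "q 7 = (2 - a) * (52 + a)" unfolding q_def by (simp add: algebra_simps power2_eq_square)
    then show ?thesis using a by simp
  qed
  have "t0 \<le> 7"
  proof -
    have "sqrt (5 + 2 * a) \<le> 6" using a by (intro real_le_lsqrt) auto
    then show ?thesis by (simp add: t0_def)
  qed
  obtain t where t: "t0 \<le> t" "q t = 0"
  proof -
    have "continuous_on {t0..7} q" unfolding q_def by (intro continuous_intros)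
    then show ?thesis using IVT'[of q t0 0 7] neg that \<open>0 \<le> q 7\<close> \<open>t0 \<le> 7\<close> by auto
  qed
  have "t \<noteq> t0" using t neg by auto
  then have tt: "t0 < t" using t by simp
  have "0 < (t - t0) * (t + t0 - 2)" using tt t0 by simp
  then have u: "2 * a + 4 < t^2 - 2 * t" using t0(2) by (simp add: algebra_simps power2_eq_square)
  have "complex_of_real (q t) = 0" using t by simp
  then have surf: "(- of_real t, - of_real t, - of_real t) \<in> cubic_surface (special_param a)"
    unfolding q_def by (simp add: special_param_def Let_def algebra_simps power2_eq_square power3_eq_cube)
  show ?thesis
  proof (rule eventually_has_wandering[OF _ _ surf])
    show "2 < t" using t0 tt by simp
    have "cmod (complex_of_real (2 * a + 4)) = 2 * a + 4" unfolding norm_of_real using a by simp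
    then show "cmod (par l (special_param a)) < t^2 - 2 * t" for l
      using u by (cases l) (simp_all add: special_param_def Let_def del: of_real_add of_real_mult)
  qed
qed

section \<open>Valuation rings of the complex numbers\<close>

definition is_subring :: "complex set \<Rightarrow> bool" where
  "is_subring R \<longleftrightarrow> 1 \<in> R \<and> (\<forall>x\<in>R. \<forall>y\<in>R. x - y \<in> R \<and> x * y \<in> R)"

lemma is_subringD:
  assumes "is_subring R"
  shows "1 \<in> R" "0 \<in> R" "x \<in> R \<Longrightarrow> y \<in> R \<Longrightarrow> x - y \<in> R" "x \<in> R \<Longrightarrow> y \<in> R \<Longrightarrow> x * y \<in> R"
    "x \<in> R \<Longrightarrow> - x \<in> R" "x \<in> R \<Longrightarrow> y \<in> R \<Longrightarrow> x + y \<in> R"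
proof -
  have d: "x - y \<in> R" if "x \<in> R" "y \<in> R" for x y using assms that unfolding is_subring_def by blast
  show "1 \<in> R" using assms unfolding is_subring_def by blast
  then show z: "0 \<in> R" using d[of 1 1] by simp
  show m: "- x \<in> R" if "x \<in> R" for x using d[OF z that] by simp
  show "x + y \<in> R" if "x \<in> R" "y \<in> R" for x y using d[OF that(1) m[OF that(2)]] by simp
  show "x - y \<in> R" if "x \<in> R" "y \<in> R" for x y using that by (rule d)
  show "x * y \<in> R" if "x \<in> R" "y \<in> R" for x y using assms that unfolding is_subring_def by blast
qed

lemma is_subring_sum: "is_subring R \<Longrightarrow> (\<And>i. i \<in> A \<Longrightarrow> f i \<in> R) \<Longrightarrow> sum f A \<in> R"
  by (induction A rule: infinite_finite_induct) (auto intro: is_subringD)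

lemma is_subring_power: "is_subring R \<Longrightarrow> x \<in> R \<Longrightarrow> x ^ n \<in> R"
  by (induction n) (auto intro: is_subringD)

definition valring :: "complex set \<Rightarrow> bool" where
  "valring V \<longleftrightarrow> is_subring V \<and> (\<forall>x. x \<in> V \<or> inverse x \<in> V)"

text \<open>For a valuation ring these are the non-units. Zero is listed separately because
  \<open>inverse 0 = 0\<close> lies in \<open>V\<close>.\<close>

definition maxid :: "complex set \<Rightarrow> complex set" where
  "maxid V = {x. x = 0 \<or> inverse x \<notin> V}"

lemma valring_subring: "valring V \<Longrightarrow> is_subring V"
  by (simp add: valring_def)

lemma maxid_subset: "valring V \<Longrightarrow> x \<in> maxid V \<Longrightarrow> x \<in> V"
  by (auto simp: valring_def maxid_def is_subringD)

lemma maxid_zero: "0 \<in> maxid V" by (simp add: maxid_def)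

lemma one_notin_maxid: "valring V \<Longrightarrow> 1 \<notin> maxid V"
  by (auto simp: valring_def maxid_def is_subringD)

lemma inverse_notin_maxid: "x \<noteq> 0 \<Longrightarrow> x \<notin> maxid V \<Longrightarrow> inverse x \<in> V"
  by (auto simp: maxid_def)

lemma maxid_of_notin: "valring V \<Longrightarrow> x \<notin> V \<Longrightarrow> inverse x \<in> maxid V"
  by (auto simp: valring_def maxid_def is_subringD)

lemma maxid_mult:
  assumes "valring V" "a \<in> V" "x \<in> maxid V"
  shows "a * x \<in> maxid V" "x * a \<in> maxid V"
proof -
  show "a * x \<in> maxid V"
  proof (cases "a * x = 0")
    case False
    have "inverse (a * x) \<notin> V"
    proof
      assume "inverse (a * x) \<in> V"
      then have "a * inverse (a * x) \<in> V" using assms by (meson is_subringD(4) valring_subring)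
      moreover have "a * inverse (a * x) = inverse x" using False by simp
      ultimately have "inverse x \<in> V" by (simp only:)
      then show False using assms(3) False by (auto simp: maxid_def)
    qed
    then show ?thesis by (simp add: maxid_def)
  qed (auto simp: maxid_def)
  then show "x * a \<in> maxid V" by (simp add: mult.commute)
qed

lemma maxid_uminus: "valring V \<Longrightarrow> x \<in> maxid V \<Longrightarrow> - x \<in> maxid V"
  using maxid_mult(1)[of V "-1" x] by (simp add: is_subringD valring_subring)

text \<open>Of two non-zero elements one is a multiple of the other in \<open>V\<close>; factoring
  out the latter leaves a multiple of an element of the ideal.\<close>

lemma maxid_add:
  assumes V: "valring V" and xy: "x \<in> maxid V" "y \<in> maxid V"
  shows "x + y \<in> maxid V"
proof -
  have main: "x + y \<in> maxid V" if "x / y \<in> V" "y \<noteq> 0" "y \<in> maxid V" for x y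
  proof -
    have "(1 + x / y) \<in> V" using V that by (meson is_subringD(1,6) valring_subring)
    then have "(1 + x / y) * y \<in> maxid V" using V that(3) by (intro maxid_mult)
    moreover have "(1 + x / y) * y = x + y" using that by (simp add: field_simps)
    ultimately show ?thesis by simp
  qed
  consider "x = 0" | "y = 0" | "x \<noteq> 0" "y \<noteq> 0" "x / y \<in> V" | "x \<noteq> 0" "y \<noteq> 0" "y / x \<in> V"
    using V unfolding valring_def by (metis inverse_divide)
  then show ?thesis
  proof cases
    case 4
    then show ?thesis using main[of y x] xy by (simp add: add.commute)
  qed (use xy main in auto)
qed

lemma maxid_diff: "valring V \<Longrightarrow> x \<in> maxid V \<Longrightarrow> y \<in> maxid V \<Longrightarrow> x - y \<in> maxid V"
  using maxid_add[of V x "- y"] maxid_uminus by simp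

lemma maxid_prime:
  assumes V: "valring V" and "x * y \<in> maxid V"
  shows "x \<in> maxid V \<or> y \<in> maxid V"
proof (rule ccontr)
  assume "\<not> ?thesis"
  then have "inverse x \<in> V" "inverse y \<in> V" "x * y \<noteq> 0" by (auto simp: maxid_def)
  then have "inverse (x * y) \<in> V" using V by (simp add: is_subringD valring_subring)
  with \<open>x * y \<noteq> 0\<close> assms show False by (auto simp: maxid_def)
qed

lemma maxid_square: "valring V \<Longrightarrow> x^2 \<in> maxid V \<Longrightarrow> x \<in> maxid V"
  using maxid_prime[of V x x] by (auto simp: power2_eq_square)

subsection \<open>Chevalley's extension theorem\<close>

text \<open>The ideal that \<open>I\<close> generates in \<open>R\<close>, built one summand at a
  time so that facts about it follow by induction over the summands.\<close>

inductive_set idl :: "complex set \<Rightarrow> complex set \<Rightarrow> complex set" for I R where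
  zero: "0 \<in> idl I R"
| add: "a \<in> idl I R \<Longrightarrow> i \<in> I \<Longrightarrow> r \<in> R \<Longrightarrow> a + i * r \<in> idl I R"

lemma idl_plus:
  assumes "a \<in> idl I R" "b \<in> idl I R"
  shows "a + b \<in> idl I R"
  using assms(2)
proof (induction b rule: idl.induct)
  case (add b i r)
  then have "(a + b) + i * r \<in> idl I R" by (intro idl.add)
  then show ?case by (simp add: add.assoc)
qed (simp add: assms)

lemma idl_mult:
  assumes "is_subring R"
  shows "a \<in> idl I R \<Longrightarrow> s \<in> R \<Longrightarrow> a * s \<in> idl I R"
proof (induction a rule: idl.induct)
  case (add a i r)
  then have "a * s + i * (r * s) \<in> idl I R" using assms by (intro idl.add) (auto intro: is_subringD)
  then show ?case by (simp add: algebra_simps)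
qed (simp add: idl.zero)

lemma idl_incl: "is_subring R \<Longrightarrow> i \<in> I \<Longrightarrow> i \<in> idl I R"
  using idl.add[OF idl.zero, of i I 1 R] by (simp add: is_subringD)

lemma idl_subset:
  assumes "is_subring R" "I \<subseteq> R" "a \<in> idl I R"
  shows "a \<in> R"
  using assms(3) by (induction a rule: idl.induct) (use assms in \<open>auto intro: is_subringD\<close>)

text \<open>Only finitely many coefficients occur in one element, so a single member of the chain
  contains them all.\<close>

lemma idl_Union_chain:
  assumes "a \<in> idl I (\<Union>C)" "C \<noteq> {}" "\<And>S T. S \<in> C \<Longrightarrow> T \<in> C \<Longrightarrow> S \<subseteq> T \<or> T \<subseteq> S"
  shows "\<exists>S\<in>C. a \<in> idl I S"
  using assms(1)
proof (induction a rule: idl.induct)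
  case zero
  then show ?case using assms(2) idl.zero by blast
next
  case (add a i r)
  then obtain S T where ST: "S \<in> C" "a \<in> idl I S" "T \<in> C" "r \<in> T" by blast
  have mono: "idl I S \<subseteq> idl I T" if "S \<subseteq> T" for S T
  proof
    fix x show "x \<in> idl I S \<Longrightarrow> x \<in> idl I T"
      by (induction x rule: idl.induct) (use that in \<open>auto intro: idl.intros\<close>)
  qed
  from assms(3)[OF ST(1,3)] show ?case
  proof
    assume "S \<subseteq> T"
    then show ?thesis using ST mono add(2) by (intro bexI[of _ T] idl.add) auto
  next
    assume "T \<subseteq> S"
    then show ?thesis using ST add(2) by (intro bexI[of _ S] idl.add) auto
  qed
qed

definition adjoin :: "complex set \<Rightarrow> complex \<Rightarrow> complex set" where
  "adjoin R x = {poly p x | p. \<forall>i. coeff p i \<in> R}"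

lemma adjoin_subring:
  assumes "is_subring R"
  shows "is_subring (adjoin R x)" "R \<subseteq> adjoin R x" "x \<in> adjoin R x"
proof -
  note D = is_subringD[OF assms]
  have "1 = poly [:1:] x" "\<forall>i. coeff [:1::complex:] i \<in> R"
    using D by (auto simp: coeff_pCons split: nat.split)
  then have one: "1 \<in> adjoin R x" unfolding adjoin_def by blast
  have "poly p x - poly q x \<in> adjoin R x \<and> poly p x * poly q x \<in> adjoin R x"
    if "\<forall>i. coeff p i \<in> R" "\<forall>i. coeff q i \<in> R" for p q
  proof -
    have "\<forall>i. coeff (p - q) i \<in> R" "\<forall>i. coeff (p * q) i \<in> R"
      using that D by (auto simp: coeff_mult intro!: is_subring_sum[OF assms])
    moreover have "poly p x - poly q x = poly (p - q) x" "poly p x * poly q x = poly (p * q) x" by auto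
    ultimately show ?thesis unfolding adjoin_def by blast
  qed
  with one show "is_subring (adjoin R x)" unfolding is_subring_def adjoin_def by blast
  show "R \<subseteq> adjoin R x"
  proof
    fix a assume "a \<in> R"
    then have "a = poly [:a:] x" "\<forall>i. coeff [:a:] i \<in> R"
      using D by (auto simp: coeff_pCons split: nat.split)
    then show "a \<in> adjoin R x" unfolding adjoin_def by blast
  qed
  have "x = poly [:0, 1:] x" "\<forall>i. coeff [:0, 1::complex:] i \<in> R"
    using D by (auto simp: coeff_pCons split: nat.split)
  then show "x \<in> adjoin R x" unfolding adjoin_def by blast
qed

lemma idl_adjoin:
  assumes "is_subring R" "y \<in> idl I (adjoin R x)"
  obtains a n where "\<And>i. a i \<in> idl I R" "(\<Sum>i\<le>n. a i * x ^ i) = y"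
proof -
  have "\<exists>f. (\<forall>i. coeff f i \<in> idl I R) \<and> y = poly f x"
    using assms(2)
  proof (induction y rule: idl.induct)
    case zero
    then show ?case by (intro exI[of _ 0]) (auto simp: idl.zero)
  next
    case (add a i r)
    then obtain f p where "\<forall>i. coeff f i \<in> idl I R" "a = poly f x" "\<forall>i. coeff p i \<in> R" "r = poly p x"
      by (auto simp: adjoin_def)
    then show ?case using add(2) by (intro exI[of _ "f + smult i p"]) (auto intro: idl.add)
  qed
  then obtain f where f: "\<forall>i. coeff f i \<in> idl I R" "y = poly f x" by blast
  then have "(\<Sum>i\<le>degree f. coeff f i * x ^ i) = y" by (simp add: poly_altdef)
  then show ?thesis using f(1) that by blast
qed

text \<open>Multiplying the relation for \<open>inverse x\<close> by \<open>x ^ n\<close> and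
  dividing by the unit \<open>1 - b 0\<close> expresses \<open>x ^ n\<close> through lower powers of
  \<open>x\<close>. Inserting this into the other relation lowers its degree.\<close>

lemma relation_reduce:
  assumes R: "is_subring R" and I: "I \<subseteq> R"
    and units: "\<And>j. j \<in> idl I R \<Longrightarrow> inverse (1 - j) \<in> R \<and> 1 - j \<noteq> 0"
    and a: "\<And>i. a i \<in> idl I R" "(\<Sum>i\<le>n. a i * x ^ i) = 1"
    and b: "\<And>i. b i \<in> idl I R" "(\<Sum>i\<le>m. b i * inverse x ^ i) = 1"
    and "m \<le> n" "x \<noteq> 0"
  obtains a' n' where "n' < n" "\<And>i. a' i \<in> idl I R" "(\<Sum>i\<le>n'. a' i * x ^ i) = 1"
proof -
  have "n \<noteq> 0"
  proof
    assume "n = 0"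
    then have "a 0 = 1" using a(2) by simp
    then show False using units[OF a(1)[of 0]] by simp
  qed
  then obtain n1 where n1: "n = Suc n1" by (cases n) auto
  \<comment> \<open>Padding with zeros brings the second relation to the same length
    \<open>n\<close>.\<close>
  define B where "B i = (if i \<le> m then b i else 0)" for i
  have B: "B i \<in> idl I R" for i using b(1) by (auto simp: B_def idl.zero)
  define c where "c = inverse (1 - b 0)"
  have c: "c \<in> R" "c * (1 - b 0) = 1" using units[OF b(1)[of 0]] by (auto simp: c_def)
  have "(\<Sum>i\<le>n. B i * inverse x ^ i) = (\<Sum>i\<le>m. b i * inverse x ^ i)"
    using \<open>m \<le> n\<close> by (intro sum.mono_neutral_cong_right) (auto simp: B_def)
  then have "(\<Sum>i\<le>Suc n1. B i * inverse x ^ i) = 1" using b n1 by simp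
  then have "(\<Sum>i\<le>n1. B (Suc i) * inverse x ^ Suc i) = 1 - b 0"
    unfolding sum.atMost_Suc_shift by (simp add: B_def algebra_simps)
  then have "x ^ n * (\<Sum>i\<le>n1. B (Suc i) * inverse x ^ Suc i) = x ^ n * (1 - b 0)" by simp
  moreover have "x ^ n * (\<Sum>i\<le>n1. B (Suc i) * inverse x ^ Suc i) = (\<Sum>i\<le>n1. B (Suc i) * x ^ (n1 - i))"
    unfolding sum_distrib_left
  proof (rule sum.cong)
    fix i assume "i \<in> {..n1}"
    then have "x ^ n = x ^ (n1 - i) * x ^ Suc i" unfolding n1 by (simp flip: power_add power_Suc)
    then show "x ^ n * (B (Suc i) * inverse x ^ Suc i) = B (Suc i) * x ^ (n1 - i)"
      using \<open>x \<noteq> 0\<close> by (simp add: field_simps)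
  qed simp
  moreover have "(\<Sum>i\<le>n1. B (Suc i) * x ^ (n1 - i)) = (\<Sum>i\<le>n1. B (n - i) * x ^ i)"
    by (rule sum.reindex_bij_witness[of _ "\<lambda>i. n1 - i" "\<lambda>i. n1 - i"]) (auto simp: n1 Suc_diff_le)
  ultimately have "(\<Sum>i\<le>n1. B (n - i) * x ^ i) = x ^ n * (1 - b 0)" by (simp only:)
  then have "c * (\<Sum>i\<le>n1. B (n - i) * x ^ i) = x ^ n * (c * (1 - b 0))" by simp
  then have xn: "c * (\<Sum>i\<le>n1. B (n - i) * x ^ i) = x ^ n" using c by simp
  define a' where "a' i = a i + a n * (c * B (n - i))" for i
  have "(\<Sum>i\<le>n1. a' i * x ^ i) = (\<Sum>i\<le>n1. a i * x ^ i) + a n * (c * (\<Sum>i\<le>n1. B (n - i) * x ^ i))"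
    by (simp add: a'_def sum.distrib sum_distrib_left algebra_simps)
  also have "\<dots> = (\<Sum>i\<le>n1. a i * x ^ i) + a n * x ^ n" unfolding xn ..
  also have "\<dots> = 1" using a(2) by (simp add: n1)
  finally have "(\<Sum>i\<le>n1. a' i * x ^ i) = 1" .
  moreover have "a' i \<in> idl I R" for i
  proof -
    have "c * B (n - i) \<in> R" using c(1) B idl_subset[OF R I] is_subringD(4)[OF R] by blast
    then show ?thesis unfolding a'_def using a(1) by (intro idl_plus idl_mult[OF R])
  qed
  ultimately show ?thesis using that n1 by blast
qed

text \<open>By Zorn's lemma there is a maximal overring \<open>M\<close> in which \<open>I\<close>
  still generates a proper ideal. Maximality makes \<open>1 - j\<close> a unit for all
  \<open>j\<close> in that ideal, and if neither \<open>x\<close> nor \<open>inverse x\<close> were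
  in \<open>M\<close>, the two resulting relations of minimal degree could be shortened by
  \<open>relation_reduce\<close>.\<close>

theorem chevalley_extension:
  assumes R: "is_subring R" and I: "I \<subseteq> R" and proper: "1 \<notin> idl I R"
  obtains V where "valring V" "R \<subseteq> V" "I \<subseteq> maxid V"
proof -
  define SS where "SS = {S. is_subring S \<and> R \<subseteq> S \<and> 1 \<notin> idl I S}"
  have "\<exists>M\<in>SS. \<forall>S\<in>SS. M \<subseteq> S \<longrightarrow> S = M"
  proof (rule subset_Zorn_nonempty)
    show "SS \<noteq> {}" using assms by (auto simp: SS_def)
    fix C assume "C \<noteq> {}" and ch: "subset.chain SS C"
    have lin: "S \<subseteq> T \<or> T \<subseteq> S" if "S \<in> C" "T \<in> C" for S T
      using ch that by (auto simp: subset_chain_def)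
    have sub: "S \<in> SS" if "S \<in> C" for S using ch that by (auto simp: subset_chain_def)
    have "x - y \<in> \<Union>C \<and> x * y \<in> \<Union>C" if xy: "x \<in> \<Union>C" "y \<in> \<Union>C" for x y
    proof -
      obtain S T where "S \<in> C" "T \<in> C" "x \<in> S" "y \<in> T" using xy by blast
      then obtain W where W: "W \<in> C" "x \<in> W" "y \<in> W" using lin by blast
      then have "is_subring W" using sub by (auto simp: SS_def)
      then have "x - y \<in> W" "x * y \<in> W" using W by (auto intro: is_subringD)
      then show ?thesis using W by blast
    qed
    moreover obtain S where S: "S \<in> C" using \<open>C \<noteq> {}\<close> by blast
    then have "1 \<in> S" "R \<subseteq> S" using sub[OF S] by (auto simp: SS_def is_subringD)
    then have "1 \<in> \<Union>C" "R \<subseteq> \<Union>C" using S by blast+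
    ultimately have "is_subring (\<Union>C)" "R \<subseteq> \<Union>C" by (auto simp: is_subring_def)
    moreover have "1 \<notin> idl I (\<Union>C)"
      using idl_Union_chain[OF _ \<open>C \<noteq> {}\<close> lin] sub by (fastforce simp: SS_def)
    ultimately show "\<Union>C \<in> SS" by (simp add: SS_def)
  qed
  then obtain M where "M \<in> SS" and maximal: "\<And>S. S \<in> SS \<Longrightarrow> M \<subseteq> S \<Longrightarrow> S = M" by blast
  then have M: "is_subring M" "R \<subseteq> M" "1 \<notin> idl I M" by (auto simp: SS_def)
  note D = is_subringD[OF M(1)]
  have IM: "I \<subseteq> M" using I M by blast
  have units: "inverse (1 - j) \<in> M \<and> 1 - j \<noteq> 0" if j: "j \<in> idl I M" for j
  proof -
    define s where "s = 1 - j"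
    have s0: "s \<noteq> 0" using j M(3) by (auto simp: s_def)
    have sM: "s \<in> M" using j idl_subset[OF M(1) IM] D by (auto simp: s_def)
    have sk: "s ^ k \<in> M" for k by (rule is_subring_power[OF M(1) sM])
    have pow: "1 - s ^ k \<in> idl I M" for k
    proof (induction k)
      case (Suc k)
      have "(1 - s ^ k) + j * s ^ k \<in> idl I M" using Suc j sk by (intro idl_plus idl_mult[OF M(1)])
      then show ?case by (simp add: s_def algebra_simps)
    qed (simp add: idl.zero)
    \<comment> \<open>The localization of \<open>M\<close> at the powers of \<open>s\<close>. If
      \<open>I\<close> generated the unit ideal there, some \<open>s ^ k\<close> would lie in the
      ideal of \<open>M\<close>, and then so would 1, because \<open>1 - s ^ k\<close> does.\<close>
    define S where "S = {a * inverse s ^ k | a k. a \<in> M}"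
    have "is_subring S"
    proof -
      have "a * inverse s ^ k - b * inverse s ^ l \<in> S \<and> (a * inverse s ^ k) * (b * inverse s ^ l) \<in> S"
        if ab: "a \<in> M" "b \<in> M" for a b k l
      proof -
        have "a * inverse s ^ k - b * inverse s ^ l = (a * s ^ l - b * s ^ k) * inverse s ^ (k + l)"
          using s0 by (simp add: field_simps power_add)
        moreover have "(a * inverse s ^ k) * (b * inverse s ^ l) = (a * b) * inverse s ^ (k + l)"
          by (simp add: power_add)
        moreover have "a * s ^ l - b * s ^ k \<in> M" "a * b \<in> M" using ab sk D by auto
        ultimately show ?thesis unfolding S_def by blast
      qed
      moreover have "1 \<in> S" unfolding S_def using D(1) by (intro CollectI exI[of _ 1] exI[of _ 0]) simp
      ultimately show ?thesis unfolding is_subring_def S_def by blast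
    qed
    moreover have "a \<in> S" if "a \<in> M" for a
      unfolding S_def using that by (intro CollectI exI[of _ a] exI[of _ 0]) simp
    then have MS: "M \<subseteq> S" by blast
    moreover have "1 \<notin> idl I S"
    proof
      assume "1 \<in> idl I S"
      moreover have "\<exists>k. y * s ^ k \<in> idl I M" if "y \<in> idl I S" for y
        using that
      proof (induction y rule: idl.induct)
        case (add y i r)
        then obtain k b l where k: "y * s ^ k \<in> idl I M" and b: "b \<in> M" "r = b * inverse s ^ l"
          by (auto simp: S_def)
        have "(y * s ^ k) * s ^ l + i * (b * s ^ k) \<in> idl I M"
          by (rule idl.add[OF idl_mult[OF M(1) k sk] add(2) D(4)[OF b(1) sk]])
        moreover have "(y * s ^ k) * s ^ l + i * (b * s ^ k) = (y + i * r) * s ^ (k + l)"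
          using s0 unfolding b by (simp add: field_simps power_add)
        ultimately show ?case by metis
      qed (auto simp: idl.zero)
      ultimately obtain k where "1 * s ^ k \<in> idl I M" by blast
      then have "(1 - s ^ k) + 1 * s ^ k \<in> idl I M" using pow by (intro idl_plus)
      then show False using M(3) by simp
    qed
    ultimately have "S = M" using M(2) MS by (intro maximal) (auto simp: SS_def)
    moreover have "inverse s \<in> S" unfolding S_def using D(1) by (auto intro!: exI[of _ 1])
    ultimately show ?thesis using s0 by (simp add: s_def)
  qed
  define rel where "rel x n \<longleftrightarrow> (\<exists>a. (\<forall>i. a i \<in> idl I M) \<and> (\<Sum>i\<le>n. a i * x ^ i) = 1)" for x :: complex and n :: nat
  have rel_ex: "\<exists>n. rel x n" if "x \<notin> M" for x
  proof -
    have "adjoin M x \<noteq> M" using adjoin_subring(3)[OF M(1), of x] that by auto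
    then have "adjoin M x \<notin> SS" using maximal adjoin_subring(2)[OF M(1)] by blast
    then have "1 \<in> idl I (adjoin M x)"
      using adjoin_subring(1,2)[OF M(1), of x] M(2) by (auto simp: SS_def)
    then show ?thesis unfolding rel_def by (rule idl_adjoin[OF M(1)]) blast
  qed
  have reduce: "\<exists>n'<n. rel x n'" if hyps: "rel x n" "rel (inverse x) m" "m \<le> n" "x \<noteq> 0" for x n m
  proof -
    from hyps(1) obtain a where a: "\<And>i. a i \<in> idl I M" "(\<Sum>i\<le>n. a i * x ^ i) = 1"
      unfolding rel_def by blast
    from hyps(2) obtain b where b: "\<And>i. b i \<in> idl I M" "(\<Sum>i\<le>m. b i * inverse x ^ i) = 1"
      unfolding rel_def by blast
    obtain a' n' where "n' < n" "\<And>i. a' i \<in> idl I M" "(\<Sum>i\<le>n'. a' i * x ^ i) = 1"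
      using relation_reduce[OF M(1) IM units a b hyps(3,4)] by blast
    then show ?thesis unfolding rel_def by blast
  qed
  have "x \<in> M \<or> inverse x \<in> M" for x
  proof (rule ccontr)
    assume "\<not> ?thesis"
    then have x: "x \<notin> M" "inverse x \<notin> M" by auto
    then have x0: "x \<noteq> 0" "inverse x \<noteq> 0" using D by auto
    \<comment> \<open>With both degrees minimal, the larger one could still be lowered.\<close>
    define n where "n = (LEAST n. rel x n)"
    define m where "m = (LEAST n. rel (inverse x) n)"
    have n: "rel x n" "\<And>k. k < n \<Longrightarrow> \<not> rel x k"
      unfolding n_def using rel_ex[OF x(1)] by (auto intro: LeastI_ex dest: not_less_Least)
    have m: "rel (inverse x) m" "\<And>k. k < m \<Longrightarrow> \<not> rel (inverse x) k"
      unfolding m_def using rel_ex[OF x(2)] by (auto intro: LeastI_ex dest: not_less_Least)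
    show False
      using reduce[OF n(1) m(1) _ x0(1)] reduce[OF m(1) _ _ x0(2), of n] n m
      by (metis inverse_inverse_eq nle_le)
  qed
  then have V: "valring M" using M by (simp add: valring_def)
  moreover have "i \<in> maxid M" if i: "i \<in> I" for i
  proof (rule ccontr)
    assume "i \<notin> maxid M"
    then have "i \<noteq> 0" "inverse i \<in> M" by (auto simp: maxid_def)
    then have "i * inverse i \<in> idl I M" using idl_mult[OF M(1) idl_incl[OF M(1) i]] by blast
    then show False using \<open>i \<noteq> 0\<close> M(3) by simp
  qed
  ultimately show ?thesis using that M(2) by blast
qed

text \<open>If \<open>inverse y\<close> generates the unit ideal of \<open>k[inverse y]\<close>,
  clearing denominators in \<open>1 = x * poly p x\<close> gives a monic equation for
  \<open>y\<close>. Otherwise Chevalley's theorem puts \<open>inverse y\<close> into the maximal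
  ideal of a valuation ring.\<close>

lemma algebraic_or_pole:
  assumes k: "is_subring k" and y: "y \<noteq> 0"
  shows "(\<exists>n c. (\<forall>i. c i \<in> k) \<and> y ^ n = (\<Sum>i<n. c i * y ^ i)) \<or>
     (\<exists>V. valring V \<and> k \<subseteq> V \<and> inverse y \<in> maxid V)"
proof (cases "1 \<in> idl {inverse y} (adjoin k (inverse y))")
  case True
  define x where "x = inverse y"
  have "\<exists>r \<in> adjoin k x. a = x * r" if "a \<in> idl {x} (adjoin k x)" for a
    using that
  proof (induction a rule: idl.induct)
    case zero
    then show ?case using is_subringD(2)[OF adjoin_subring(1)[OF k]] by (auto intro!: bexI[of _ 0])
  next
    case (add a i r)
    then obtain r' where "r' \<in> adjoin k x" "a = x * r'" by blast
    then show ?case using add is_subringD(6)[OF adjoin_subring(1)[OF k]]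
      by (intro bexI[of _ "r' + r"]) (auto simp: algebra_simps)
  qed
  then obtain r where r: "r \<in> adjoin k x" "1 = x * r"
    using True unfolding x_def[symmetric] by blast
  then obtain p where p: "\<forall>i. coeff p i \<in> k" "1 = x * poly p x" by (auto simp: adjoin_def)
  define n where "n = Suc (degree p)"
  have "y ^ n * 1 = y ^ n * (x * (\<Sum>i\<le>degree p. coeff p i * x ^ i))" using p(2) by (simp add: poly_altdef)
  also have "\<dots> = (\<Sum>i\<le>degree p. coeff p i * y ^ (degree p - i))"
    unfolding sum_distrib_left
  proof (rule sum.cong)
    fix i assume "i \<in> {..degree p}"
    then have "y ^ n = y ^ (degree p - i) * y ^ Suc i" unfolding n_def by (simp flip: power_add power_Suc)
    then show "y ^ n * (x * (coeff p i * x ^ i)) = coeff p i * y ^ (degree p - i)"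
      using y by (simp add: field_simps x_def)
  qed simp
  also have "\<dots> = (\<Sum>i<n. coeff p (degree p - i) * y ^ i)"
    by (rule sum.reindex_bij_witness[of _ "\<lambda>i. degree p - i" "\<lambda>i. degree p - i"]) (auto simp: n_def)
  finally have "y ^ n = (\<Sum>i<n. coeff p (degree p - i) * y ^ i)" by simp
  then have "\<exists>n c. (\<forall>i. c i \<in> k) \<and> y ^ n = (\<Sum>i<n. c i * y ^ i)"
    using p(1) by (intro exI[of _ n] exI[of _ "\<lambda>i. coeff p (degree p - i)"]) auto
  then show ?thesis ..
next
  case False
  then obtain V where "valring V" "adjoin k (inverse y) \<subseteq> V" "{inverse y} \<subseteq> maxid V"
    using chevalley_extension[OF adjoin_subring(1)[OF k]] adjoin_subring(3)[OF k] by (metis empty_subsetI insert_subset)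
  then show ?thesis using adjoin_subring(2)[OF k] by blast
qed

text \<open>The constant term of the equation lies in the maximal ideal and in the field
  \<open>k\<close>, so it is zero. Dividing by \<open>y\<close> shortens the equation until it reads
  \<open>1 = 0\<close>.\<close>

lemma algebraic_in_maxid:
  assumes V: "valring V" and k: "k \<subseteq> V" "\<And>c. c \<in> k \<Longrightarrow> inverse c \<in> k" and y: "y \<in> maxid V"
    and "\<forall>i. c i \<in> k" "y ^ n = (\<Sum>i<n. c i * y ^ i)"
  shows "y = 0"
  using assms(5,6)
proof (induction n arbitrary: c)
  case (Suc n)
  show ?case
  proof (rule ccontr)
    assume y0: "y \<noteq> 0"
    have S: "is_subring V" using V by (rule valring_subring)
    have yV: "y \<in> V" using V y by (rule maxid_subset)
    have split: "y ^ Suc n = c 0 + y * (\<Sum>i<n. c (Suc i) * y ^ i)"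
      using Suc.prems(2) unfolding sum.lessThan_Suc_shift by (simp add: sum_distrib_left algebra_simps)
    then have "c 0 = y * (y ^ n - (\<Sum>i<n. c (Suc i) * y ^ i))" by (simp add: algebra_simps)
    moreover have "y ^ n - (\<Sum>i<n. c (Suc i) * y ^ i) \<in> V"
      using Suc.prems(1) k(1) yV by (intro is_subringD(3)[OF S] is_subring_sum[OF S] is_subringD(4)[OF S] is_subring_power[OF S]) auto
    ultimately have "c 0 \<in> maxid V" using maxid_mult(2)[OF V] y by simp
    then have c0: "c 0 = 0" using k Suc.prems(1) unfolding maxid_def by blast
    then have "y ^ n = (\<Sum>i<n. c (Suc i) * y ^ i)" using split y0 by simp
    then show False using Suc.IH[of "\<lambda>i. c (Suc i)"] Suc.prems(1) y0 by blast
  qed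
qed simp

text \<open>Valuation rings are integrally closed: if \<open>x\<close> had a pole, division by
  \<open>x^2\<close> would put 1 into the maximal ideal.\<close>

lemma quadratic_integral:
  assumes V: "valring V" and bc: "b \<in> V" "c \<in> V" and eq: "x^2 + b * x + c = 0"
  shows "x \<in> V"
proof (rule ccontr)
  assume "x \<notin> V"
  then have i: "inverse x \<in> maxid V" using V by (intro maxid_of_notin)
  have x0: "x \<noteq> 0" using \<open>x \<notin> V\<close> V by (auto simp: valring_subring is_subringD)
  have "1 = - (b * inverse x + c * inverse x * inverse x)"
    using eq x0 by (simp add: field_simps power2_eq_square add_eq_0_iff)
  moreover have "- (b * inverse x + c * inverse x * inverse x) \<in> maxid V"
    using V bc i maxid_subset[OF V i] by (intro maxid_uminus maxid_add maxid_mult) auto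
  ultimately show False using one_notin_maxid[OF V] by simp
qed

section \<open>Generic parameters\<close>

text \<open>Integer polynomials in eight variables, the coordinates of a pair of parameters. For the pair
  \<open>(P, cnj P)\<close> these are, up to complex linear changes of variables, real polynomials in \<open>P\<close>.\<close>

datatype pexp = Cst int | Var nat | Add pexp pexp | Mul pexp pexp

instance pexp :: countable
  by countable_datatype

definition comp4 :: "nat \<Rightarrow> param \<Rightarrow> complex" where
  "comp4 n P = (if n = 0 then fst P else if n = 1 then fst (snd P)
     else if n = 2 then fst (snd (snd P)) else snd (snd (snd P)))"

text \<open>The variables 0 to 3 are the coordinates of the first parameter and 4 to 6 the first
  three of the second; every index from 7 on stands for its last coordinate.\<close>

fun eval :: "pexp \<Rightarrow> param \<times> param \<Rightarrow> complex" where
  "eval (Cst c) z = of_int c"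
| "eval (Var n) z = (if n < 4 then comp4 n (fst z) else comp4 (n - 4) (snd z))"
| "eval (Add e f) z = eval e z + eval f z"
| "eval (Mul e f) z = eval e z * eval f z"

fun cnjP :: "param \<Rightarrow> param" where
  "cnjP (A, B, C, D) = (cnj A, cnj B, cnj C, cnj D)"

definition pexp_zeros :: "pexp \<Rightarrow> param set" where
  "pexp_zeros e = {P. eval e (P, cnjP P) = 0}"

text \<open>A countable union, as there are countably many expressions. A parameter outside
  satisfies no non-trivial integer relation with its conjugate.\<close>

definition nongeneric :: "param set" where
  "nongeneric = \<Union>{pexp_zeros e | e. \<exists>z. eval e z \<noteq> 0}"

lemma nongenericI: "eval e (P, cnjP P) = 0 \<Longrightarrow> eval e z \<noteq> 0 \<Longrightarrow> P \<in> nongeneric"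
  unfolding nongeneric_def pexp_zeros_def by blast

fun smul :: "complex \<Rightarrow> param \<times> param \<Rightarrow> param \<times> param" where
  "smul u ((a, b, c, d), (a', b', c', d')) = ((u * a, u * b, u * c, u * d), (u * a', u * b', u * c', u * d'))"

lemma eval_line: "\<exists>p. \<forall>u. eval e (z + smul u d) = poly p u"
proof (induction e)
  case (Cst c)
  show ?case by (intro exI[of _ "[:of_int c:]"]) simp
next
  case (Var n)
  have "eval (Var n) (z + smul u d) = eval (Var n) z + u * eval (Var n) d" for u
    by (cases d; cases z) (auto simp: comp4_def)
  then show ?case by (intro exI[of _ "[:eval (Var n) z, eval (Var n) d:]"]) simp
next
  case (Add e f)
  then obtain p q where "\<forall>u. eval e (z + smul u d) = poly p u" "\<forall>u. eval f (z + smul u d) = poly q u" by blast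
  then show ?case by (intro exI[of _ "p + q"]) simp
next
  case (Mul e f)
  then obtain p q where "\<forall>u. eval e (z + smul u d) = poly p u" "\<forall>u. eval f (z + smul u d) = poly q u" by blast
  then show ?case by (intro exI[of _ "p * q"]) simp
qed

lemma eval_real_line:
  assumes "\<And>u :: real. eval e (z + smul (of_real u) d) = 0"
  shows "eval e (z + smul u d) = 0"
proof -
  obtain p where p: "\<And>u. eval e (z + smul u d) = poly p u" using eval_line by blast
  have "p = 0"
  proof (rule ccontr)
    assume "p \<noteq> 0"
    then have "finite {x. poly p x = 0}" by (rule poly_roots_finite)
    moreover have "range complex_of_real \<subseteq> {x. poly p x = 0}" using assms p by auto
    moreover have "infinite (range complex_of_real)"
      using finite_imageD[of complex_of_real UNIV] infinite_UNIV_char_0 inj_of_real by blast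
    ultimately show False using finite_subset by blast
  qed
  then show ?thesis using p by simp
qed

fun comb :: "complex list \<Rightarrow> (param \<times> param) list \<Rightarrow> param \<times> param" where
  "comb (u # us) (d # ds) = smul u d + comb us ds"
| "comb _ _ = 0"

text \<open>The coefficients are freed one at a time: a polynomial that vanishes on a real line
  vanishes on the complex line through it.\<close>

lemma eval_real_span:
  assumes "\<And>us :: real list. length us = length ds \<Longrightarrow> eval e (z + comb (map of_real us) ds) = 0"
  shows "length us = length ds \<Longrightarrow> eval e (z + comb us ds) = 0"
  using assms
proof (induction ds arbitrary: us z)
  case Nil
  have "eval e (z + comb (map of_real []) []) = 0" by (rule Nil.prems(2)) simp
  then show ?case using Nil.prems(1) by simp
next
  case (Cons d ds)
  obtain u vs where us: "us = u # vs" "length vs = length ds" using Cons.prems(1) by (cases us) auto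
  have "eval e ((z + comb vs ds) + smul (of_real t) d) = 0" for t :: real
  proof -
    have "eval e ((z + smul (of_real t) d) + comb vs ds) = 0"
    proof (rule Cons.IH[OF us(2)])
      fix ws :: "real list" assume "length ws = length ds"
      then have "eval e (z + comb (map of_real (t # ws)) (d # ds)) = 0" by (intro Cons.prems(2)) simp
      then show "eval e (z + smul (of_real t) d + comb (map of_real ws) ds) = 0" by (simp add: add.assoc)
    qed
    then show ?thesis by (simp add: add_ac)
  qed
  then have "eval e ((z + comb vs ds) + smul u d) = 0" by (rule eval_real_line)
  then show ?case using us by (simp add: add_ac)
qed

text \<open>The pairs \<open>(P, cnjP P)\<close> form a real subspace of dimension 8 whose complex
  span consists of all pairs, so a polynomial that vanishes on it vanishes everywhere.\<close>

lemma polarization: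
  assumes "\<And>P. eval e (P, cnjP P) = 0"
  shows "eval e z = 0"
proof -
  define ds :: "(param \<times> param) list" where
    "ds = [((1,0,0,0),(1,0,0,0)), ((0,1,0,0),(0,1,0,0)), ((0,0,1,0),(0,0,1,0)), ((0,0,0,1),(0,0,0,1)),
      ((\<i>,0,0,0),(-\<i>,0,0,0)), ((0,\<i>,0,0),(0,-\<i>,0,0)), ((0,0,\<i>,0),(0,0,-\<i>,0)), ((0,0,0,\<i>),(0,0,0,-\<i>))]"
  obtain a b c d a' b' c' d' where z: "z = ((a, b, c, d), (a', b', c', d'))" by (metis prod.exhaust)
  \<comment> \<open>The formulas for real and imaginary parts, with an arbitrary second entry in
    place of the conjugate.\<close>
  define us where "us = [(a + a') / 2, (b + b') / 2, (c + c') / 2, (d + d') / 2,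
    (a - a') / (2 * \<i>), (b - b') / (2 * \<i>), (c - c') / (2 * \<i>), (d - d') / (2 * \<i>)]"
  have "eval e (0 + comb us ds) = 0"
  proof (rule eval_real_span)
    fix us :: "real list" assume "length us = length ds"
    then obtain u1 u2 u3 u4 v1 v2 v3 v4 where us: "us = [u1, u2, u3, u4, v1, v2, v3, v4]"
      by (auto simp: ds_def length_Suc_conv)
    define P :: param where "P = (u1 + \<i> * v1, u2 + \<i> * v2, u3 + \<i> * v3, u4 + \<i> * v4)"
    have "0 + comb (map complex_of_real us) ds = (P, cnjP P)"
      by (simp add: us ds_def P_def zero_prod_def mult.commute)
    then show "eval e (0 + comb (map complex_of_real us) ds) = 0" using assms by simp
  qed (simp add: us_def ds_def)
  moreover have "0 + comb us ds = z"
    by (simp add: us_def ds_def z zero_prod_def field_simps)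
  ultimately show ?thesis by simp
qed

section \<open>Integer relations as real hypersurfaces\<close>

lemma bounded_linear_comp4: "bounded_linear (comp4 n)"
proof -
  have "comp4 n = (if n = 0 then fst else if n = 1 then fst \<circ> snd else if n = 2 then fst \<circ> (snd \<circ> snd) else snd \<circ> (snd \<circ> snd))"
    by (auto simp: comp4_def fun_eq_iff)
  then show ?thesis
    by (auto intro!: bounded_linear_compose[unfolded o_def[symmetric]] bounded_linear_fst bounded_linear_snd)
qed

lemma comp4_cnjP: "comp4 n (cnjP P) = cnj (comp4 n P)"
  by (cases P) (simp add: comp4_def)

lemma real_polynomial_eval:
  "real_polynomial_function (\<lambda>P. Re (eval e (P, cnjP P))) \<and>
   real_polynomial_function (\<lambda>P. Im (eval e (P, cnjP P)))"
proof (induction e)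
  case (Var n)
  have "bounded_linear (\<lambda>P. Re (comp4 m P))" "bounded_linear (\<lambda>P. Im (comp4 m P))"
    "bounded_linear (\<lambda>P. - Im (comp4 m P))" for m
    using bounded_linear_compose[OF bounded_linear_Re bounded_linear_comp4]
      bounded_linear_compose[OF bounded_linear_Im bounded_linear_comp4]
    by (auto intro: bounded_linear_minus)
  then show ?case by (cases "n < 4") (auto simp: comp4_cnjP intro: real_polynomial_function.intros(1))
qed (auto intro!: real_polynomial_function.intros(2-4) real_polynomial_function_diff)

text \<open>The sum of the squares of real and imaginary part turns the complex equation into a
  single real one, which is non-trivial by \<open>polarization\<close>.\<close>

lemma pexp_zeros_hypersurface:
  assumes "eval e z \<noteq> 0"
  shows "real_algebraic_hypersurface (pexp_zeros e)"
proof -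
  define q where "q P = (Re (eval e (P, cnjP P)))^2 + (Im (eval e (P, cnjP P)))^2" for P
  have "real_polynomial_function q"
    unfolding q_def using real_polynomial_eval[of e]
    by (auto intro!: real_polynomial_function.intros(3) real_polynomial_function_power)
  moreover have q0: "q P = 0 \<longleftrightarrow> eval e (P, cnjP P) = 0" for P
    by (simp add: q_def complex_eq_iff sum_power2_eq_zero_iff)
  moreover have "q \<noteq> (\<lambda>_. 0)"
  proof
    assume "q = (\<lambda>_. 0)"
    then have "eval e (P, cnjP P) = 0" for P using q0 by simp
    then show False using assms polarization by blast
  qed
  ultimately show ?thesis
    unfolding real_algebraic_hypersurface_def pexp_zeros_def by (intro exI[of _ q]) simp
qed

lemma nongeneric_hypersurfaces:
  "\<exists>F. countable F \<and> (\<forall>X\<in>F. real_algebraic_hypersurface X) \<and> nongeneric = \<Union>F"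
proof (intro exI conjI)
  let ?F = "{pexp_zeros e | e. \<exists>z. eval e z \<noteq> 0}"
  have "?F \<subseteq> range pexp_zeros" by blast
  then show "countable ?F" by (rule countable_subset) simp
  show "\<forall>X\<in>?F. real_algebraic_hypersurface X" using pexp_zeros_hypersurface by blast
  show "nongeneric = \<Union>?F" by (simp add: nongeneric_def)
qed

subsection \<open>Specialization of generic parameters\<close>

text \<open>A polynomial vanishing on \<open>ZZ\<close> cannot agree with a denominator at the
  generic pair: the two would then agree identically, although the denominator is non-zero somewhere
  on \<open>ZZ\<close>. So such polynomials generate a proper ideal in the ring of fractions with
  denominators in \<open>Den\<close>, and Chevalley's theorem applies.\<close>

lemma specialization:
  assumes gen: "P \<notin> nongeneric"
    and den1: "Cst 1 \<in> Den" and denm: "\<And>e f. e \<in> Den \<Longrightarrow> f \<in> Den \<Longrightarrow> Mul e f \<in> Den"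
    and den0: "\<And>g. g \<in> Den \<Longrightarrow> eval g (P, cnjP P) \<noteq> 0"
    and denz: "\<And>g. g \<in> Den \<Longrightarrow> \<exists>z\<in>ZZ. eval g z \<noteq> 0"
  obtains V where "valring V" "\<And>f g. g \<in> Den \<Longrightarrow> eval f (P, cnjP P) / eval g (P, cnjP P) \<in> V"
    "\<And>f. (\<And>z. z \<in> ZZ \<Longrightarrow> eval f z = 0) \<Longrightarrow> eval f (P, cnjP P) \<in> maxid V"
proof -
  define ev where "ev f = eval f (P, cnjP P)" for f
  have ev: "ev (Add e f) = ev e + ev f" "ev (Mul e f) = ev e * ev f" "ev (Cst c) = of_int c" for e f c
    by (auto simp: ev_def)
  have ne: "ev g \<noteq> 0" if "g \<in> Den" for g using den0 that by (simp add: ev_def)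
  define R where "R = {ev f / ev g | f g. g \<in> Den}"
  define I where "I = {ev f / ev g | f g. g \<in> Den \<and> (\<forall>z\<in>ZZ. eval f z = 0)}"
  have "x - y \<in> R \<and> x * y \<in> R" if xy: "x \<in> R" "y \<in> R" for x y
  proof -
    obtain f g f' g' where fg: "x = ev f / ev g" "g \<in> Den" "y = ev f' / ev g'" "g' \<in> Den"
      using xy by (auto simp: R_def)
    have "x - y = ev (Add (Mul f g') (Mul (Mul (Cst (- 1)) f') g)) / ev (Mul g g')"
      "x * y = ev (Mul f f') / ev (Mul g g')"
      unfolding fg(1,3) using ne[OF fg(2)] ne[OF fg(4)] by (simp_all add: ev field_simps)
    then show ?thesis unfolding R_def using denm fg by blast
  qed
  moreover have one: "1 \<in> R"
  proof -
    have "1 = ev (Cst 1) / ev (Cst 1)" by (simp add: ev)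
    then show ?thesis unfolding R_def using den1 by blast
  qed
  ultimately have R: "is_subring R" by (simp add: is_subring_def)
  have IR: "I \<subseteq> R" by (auto simp: I_def R_def)
  have "a \<in> I" if "a \<in> idl I R" for a
    using that
  proof (induction a rule: idl.induct)
    case zero
    have "0 = ev (Cst 0) / ev (Cst 1)" "\<forall>z\<in>ZZ. eval (Cst 0) z = 0" by (auto simp: ev)
    then show ?case unfolding I_def using den1 by blast
  next
    case (add a i r)
    obtain f g where a: "a = ev f / ev g" "g \<in> Den" "\<forall>z\<in>ZZ. eval f z = 0"
      using add by (auto simp: I_def)
    obtain f' g' where i: "i = ev f' / ev g'" "g' \<in> Den" "\<forall>z\<in>ZZ. eval f' z = 0"
      using add by (auto simp: I_def)
    obtain f'' g'' where r: "r = ev f'' / ev g''" "g'' \<in> Den" using add by (auto simp: R_def)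
    have "a + i * r = ev (Add (Mul f (Mul g' g'')) (Mul (Mul f' f'') g)) / ev (Mul g (Mul g' g''))"
      unfolding a(1) i(1) r(1) using ne[OF a(2)] ne[OF i(2)] ne[OF r(2)] by (simp add: ev field_simps)
    moreover have "\<forall>z\<in>ZZ. eval (Add (Mul f (Mul g' g'')) (Mul (Mul f' f'') g)) z = 0"
      using a i by simp
    moreover have "Mul g (Mul g' g'') \<in> Den" using denm a i r by blast
    ultimately show ?case unfolding I_def by blast
  qed
  moreover have "1 \<notin> I"
  proof
    assume "1 \<in> I"
    then obtain f g where fg: "1 = ev f / ev g" "g \<in> Den" "\<forall>z\<in>ZZ. eval f z = 0" by (auto simp: I_def)
    then have "eval (Add f (Mul (Cst (- 1)) g)) (P, cnjP P) = 0"
      using ne[OF fg(2)] by (simp add: ev_def)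
    then have "eval (Add f (Mul (Cst (- 1)) g)) z = 0" for z using nongenericI gen by blast
    then have "eval f z = eval g z" for z by simp
    then show False using denz[OF fg(2)] fg(3) by auto
  qed
  ultimately have "1 \<notin> idl I R" by blast
  then obtain V where V: "valring V" "R \<subseteq> V" "I \<subseteq> maxid V" using chevalley_extension[OF R IR] by blast
  have "eval f (P, cnjP P) \<in> maxid V" if "\<And>z. z \<in> ZZ \<Longrightarrow> eval f z = 0" for f
  proof -
    have "ev f = ev f / ev (Cst 1)" by (simp add: ev)
    then have "ev f \<in> I" unfolding I_def using den1 that by blast
    then show ?thesis using V(3) by (auto simp: ev_def)
  qed
  moreover have "eval f (P, cnjP P) / eval g (P, cnjP P) \<in> V" if "g \<in> Den" for f g
    using V(2) that by (auto simp: R_def ev_def)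
  ultimately show ?thesis using V(1) that by blast
qed

text \<open>Independence is required of the polynomial function, not of the expression.\<close>

definition conj_only :: "pexp \<Rightarrow> bool" where
  "conj_only e \<longleftrightarrow> (\<forall>P P' Q. eval e (P, Q) = eval e (P', Q))"

lemma conj_only_intros: "conj_only (Cst c)" "conj_only e \<Longrightarrow> conj_only f \<Longrightarrow> conj_only (Add e f)"
  "conj_only e \<Longrightarrow> conj_only f \<Longrightarrow> conj_only (Mul e f)" "4 \<le> n \<Longrightarrow> conj_only (Var n)"
  unfolding conj_only_def by (auto, metis+)

text \<open>The field generated over the rationals by the conjugates of the coordinates of
  \<open>P\<close>.\<close>

definition conj_field :: "param \<Rightarrow> complex set" where
  "conj_field P = {eval f (P, cnjP P) / eval g (P, cnjP P) | f g.
     conj_only f \<and> conj_only g \<and> eval g (P, cnjP P) \<noteq> 0}"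

lemma conj_fieldI:
  assumes "conj_only f" "conj_only g" "eval g (P, cnjP P) \<noteq> 0" "x = eval f (P, cnjP P) / eval g (P, cnjP P)"
  shows "x \<in> conj_field P"
  using assms unfolding conj_field_def by blast

lemma conj_field_eval: "conj_only f \<Longrightarrow> eval f (P, cnjP P) \<in> conj_field P"
  by (rule conj_fieldI[of f "Cst 1"]) (auto intro: conj_only_intros)

lemma conj_field_subring: "is_subring (conj_field P)"
  unfolding is_subring_def
proof (intro conjI ballI)
  show "1 \<in> conj_field P" using conj_field_eval[of "Cst 1" P] by (simp add: conj_only_intros)
next
  fix x y assume "x \<in> conj_field P" "y \<in> conj_field P"
  then obtain f g f' g' where fg: "x = eval f (P, cnjP P) / eval g (P, cnjP P)" "conj_only f" "conj_only g" "eval g (P, cnjP P) \<noteq> 0"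
    "y = eval f' (P, cnjP P) / eval g' (P, cnjP P)" "conj_only f'" "conj_only g'" "eval g' (P, cnjP P) \<noteq> 0"
    unfolding conj_field_def by blast
  show "x - y \<in> conj_field P" unfolding fg(1,5)
    by (rule conj_fieldI[of "Add (Mul f g') (Mul (Mul (Cst (- 1)) f') g)" "Mul g g'"])
      (use fg in \<open>auto intro!: conj_only_intros simp: field_simps\<close>)
  show "x * y \<in> conj_field P" unfolding fg(1,5)
    by (rule conj_fieldI[of "Mul f f'" "Mul g g'"]) (use fg in \<open>auto intro!: conj_only_intros\<close>)
qed

lemma conj_field_inverse: "x \<in> conj_field P \<Longrightarrow> inverse x \<in> conj_field P"
proof -
  assume "x \<in> conj_field P"
  then obtain f g where fg: "x = eval f (P, cnjP P) / eval g (P, cnjP P)" "conj_only f" "conj_only g" "eval g (P, cnjP P) \<noteq> 0"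
    unfolding conj_field_def by blast
  show "inverse x \<in> conj_field P"
  proof (cases "eval f (P, cnjP P) = 0")
    case True
    then have "inverse x = eval (Cst 0) (P, cnjP P)" using fg by simp
    then show ?thesis using conj_field_eval conj_only_intros(1) by metis
  next
    case False
    then show ?thesis by (intro conj_fieldI[of g f]) (use fg in auto)
  qed
qed

lemma conj_field_of_int: "of_int c \<in> conj_field P"
  using conj_field_eval[of "Cst c" P] by (simp add: conj_only_intros)

lemma conj_field_par: "par l (cnjP P) \<in> conj_field P" "par0 (cnjP P) \<in> conj_field P"
proof -
  have "conj_only (Var 4)" "conj_only (Var 5)" "conj_only (Var 6)" "conj_only (Var 7)"
    by (auto intro: conj_only_intros)
  from this[THEN conj_field_eval[of _ P]]
  show "par l (cnjP P) \<in> conj_field P" "par0 (cnjP P) \<in> conj_field P"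
    by (cases P; cases l; simp add: comp4_def)+
qed

fun int_param :: "int \<times> int \<times> int \<times> int \<Rightarrow> param" where
  "int_param (a, b, c, d) = (of_int a, of_int b, of_int c, of_int d)"

text \<open>The points \<open>(int_param c, Q)\<close> with arbitrary \<open>Q\<close> specialize
  \<open>P\<close> and leave its conjugate free. A polynomial in the conjugates that is non-zero at
  the generic pair is also non-zero somewhere on these points, so all of \<open>conj_field P\<close>
  survives.\<close>

lemma specialization_over_conj:
  assumes gen: "P \<notin> nongeneric"
  obtains V where "valring V" "conj_field P \<subseteq> V" "\<And>l. par l P - par l (int_param c) \<in> maxid V"
    "par0 P - par0 (int_param c) \<in> maxid V"
proof -
  obtain c0 c1 c2 c3 where c: "c = (c0, c1, c2, c3)" by (cases c)
  obtain V where V: "valring V"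
    "\<And>f g. conj_only g \<and> eval g (P, cnjP P) \<noteq> 0 \<Longrightarrow> eval f (P, cnjP P) / eval g (P, cnjP P) \<in> V"
    "\<And>f. (\<And>z. z \<in> range (\<lambda>Q. (int_param c, Q)) \<Longrightarrow> eval f z = 0) \<Longrightarrow> eval f (P, cnjP P) \<in> maxid V"
  proof (rule specialization[OF gen, of "{g. conj_only g \<and> eval g (P, cnjP P) \<noteq> 0}" "range (\<lambda>Q. (int_param c, Q))"])
    fix g assume "g \<in> {g. conj_only g \<and> eval g (P, cnjP P) \<noteq> 0}"
    then have g: "eval g (P, cnjP P) = eval g (int_param c, cnjP P)" "eval g (P, cnjP P) \<noteq> 0"
      unfolding conj_only_def by blast+
    then have "eval g (int_param c, cnjP P) \<noteq> 0" by simp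
    then show "\<exists>z\<in>range (\<lambda>Q. (int_param c, Q)). eval g z \<noteq> 0" by blast
  qed (auto intro: conj_only_intros that)
  have "conj_field P \<subseteq> V" unfolding conj_field_def using V(2) by blast
  moreover have "eval (Add (Var n) (Cst (- m))) (P, cnjP P) \<in> maxid V"
    if "n < 4" "comp4 n (int_param c) = of_int m" for n m
    by (rule V(3)) (use that in auto)
  from this[of 0 c0] this[of 1 c1] this[of 2 c2] this[of 3 c3]
  have "comp4 0 P - of_int c0 \<in> maxid V" "comp4 1 P - of_int c1 \<in> maxid V"
    "comp4 2 P - of_int c2 \<in> maxid V" "comp4 3 P - of_int c3 \<in> maxid V"
    by (simp_all add: c comp4_def)
  then have "par l P - par l (int_param c) \<in> maxid V" "par0 P - par0 (int_param c) \<in> maxid V" for l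
    by (cases P; cases l; simp add: c comp4_def)+
  ultimately show ?thesis using V(1) that by blast
qed

text \<open>Both halves of the pair go to independent integer points. The denominators are the
  non-zero integers, so that the residue field has characteristic zero.\<close>

lemma specialization_pair:
  assumes gen: "P \<notin> nongeneric"
  obtains V where "valring V" "\<And>l. par l P - par l (int_param c) \<in> maxid V"
    "par0 P - par0 (int_param c) \<in> maxid V"
    "\<And>l. par l (cnjP P) - par l (int_param d) \<in> maxid V"
    "par0 (cnjP P) - par0 (int_param d) \<in> maxid V"
    "\<And>n. n \<noteq> 0 \<Longrightarrow> inverse (of_int n) \<in> V"
proof -
  obtain c0 c1 c2 c3 where c: "c = (c0, c1, c2, c3)" by (cases c)
  obtain d0 d1 d2 d3 where d: "d = (d0, d1, d2, d3)" by (cases d)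
  let ?z = "(int_param c, int_param d)"
  obtain V where V: "valring V"
    "\<And>f g. g \<in> {g. \<exists>n. n \<noteq> 0 \<and> (\<forall>z. eval g z = of_int n)} \<Longrightarrow>
       eval f (P, cnjP P) / eval g (P, cnjP P) \<in> V"
    "\<And>f. (\<And>z. z \<in> {?z} \<Longrightarrow> eval f z = 0) \<Longrightarrow> eval f (P, cnjP P) \<in> maxid V"
  proof (rule specialization[OF gen, of "{g. \<exists>n. n \<noteq> 0 \<and> (\<forall>z. eval g z = of_int n)}" "{?z}"])
    fix g assume "g \<in> {g. \<exists>n. n \<noteq> 0 \<and> (\<forall>z. eval g z = of_int n)}"
    then obtain n where n: "n \<noteq> 0" "\<And>z. eval g z = of_int n" by blast
    then show "eval g (P, cnjP P) \<noteq> 0" by simp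
    show "\<exists>z\<in>{?z}. eval g z \<noteq> 0" using n by simp
    fix e assume "e \<in> {g. \<exists>n. n \<noteq> 0 \<and> (\<forall>z. eval g z = of_int n)}"
    then obtain m where m: "m \<noteq> 0" "\<And>z. eval e z = of_int m" by blast
    have "m * n \<noteq> 0 \<and> (\<forall>z. eval (Mul e g) z = of_int (m * n))"
      using m n by (simp del: split_paired_All)
    then show "Mul e g \<in> {g. \<exists>n. n \<noteq> 0 \<and> (\<forall>z. eval g z = of_int n)}" by blast
  next
    have "(1::int) \<noteq> 0 \<and> (\<forall>z. eval (Cst 1) z = of_int 1)" by simp
    then show "Cst 1 \<in> {g. \<exists>n. n \<noteq> 0 \<and> (\<forall>z. eval g z = of_int n)}" by blast
  qed (use that in blast)
  have "eval (Add (Var n) (Cst (- m))) (P, cnjP P) \<in> maxid V"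
    if "eval (Var n) ?z = of_int m" for n m
    by (rule V(3)) (use that in auto)
  from this[of 0 c0] this[of 1 c1] this[of 2 c2] this[of 3 c3] this[of 4 d0] this[of 5 d1] this[of 6 d2] this[of 7 d3]
  have "comp4 0 P - of_int c0 \<in> maxid V" "comp4 1 P - of_int c1 \<in> maxid V"
    "comp4 2 P - of_int c2 \<in> maxid V" "comp4 3 P - of_int c3 \<in> maxid V"
    "comp4 0 (cnjP P) - of_int d0 \<in> maxid V" "comp4 1 (cnjP P) - of_int d1 \<in> maxid V"
    "comp4 2 (cnjP P) - of_int d2 \<in> maxid V" "comp4 3 (cnjP P) - of_int d3 \<in> maxid V"
    by (simp_all add: c d comp4_def)
  then have "par l P - par l (int_param c) \<in> maxid V" "par0 P - par0 (int_param c) \<in> maxid V"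
    "par l (cnjP P) - par l (int_param d) \<in> maxid V" "par0 (cnjP P) - par0 (int_param d) \<in> maxid V" for l
    by (cases P; cases l; simp add: c d comp4_def)+
  moreover have "inverse (of_int n) \<in> V" if "n \<noteq> 0" for n
  proof -
    have "\<forall>z. eval (Cst n) z = of_int n" by simp
    then have "Cst n \<in> {g. \<exists>n. n \<noteq> 0 \<and> (\<forall>z. eval g z = of_int n)}" using that by blast
    from V(2)[OF this, of "Cst 1"] show ?thesis by (simp add: divide_inverse)
  qed
  ultimately show ?thesis using V(1) that by blast
qed

section \<open>Periodic orbits of cyclically reduced words\<close>

text \<open>Polymorphic because it is used with \<open>invol\<close> on points of the surface and
  with \<open>lin\<close> on integer vectors.\<close>

primrec orb :: "(letter \<Rightarrow> 'a \<Rightarrow> 'a) \<Rightarrow> (nat \<Rightarrow> letter) \<Rightarrow> 'a \<Rightarrow> nat \<Rightarrow> 'a" where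
  "orb f c p 0 = p"
| "orb f c p (Suc k) = f (c k) (orb f c p k)"

text \<open>Reversed, because the last letter of a word acts first, and continued
  periodically.\<close>

definition cyc :: "letter list \<Rightarrow> nat \<Rightarrow> letter" where
  "cyc w k = rev w ! (k mod length w)"

lemma orb_add:
  assumes "\<And>k. c (k + n) = c k"
  shows "orb f c p (k + n) = orb f c (orb f c p n) k"
  by (induction k) (auto simp: assms)

lemma cyc_period: "cyc w (k + length w) = cyc w k"
  by (simp add: cyc_def)

lemma orb_cyc: "orb f (cyc w) p (length w) = foldr f w p"
proof -
  have "orb f (cyc w) p k = foldr f (rev (take k (rev w))) p" if "k \<le> length w" for k
    using that
  proof (induction k)
    case (Suc k)
    then have "take (Suc k) (rev w) = take k (rev w) @ [cyc w k]"
      by (subst take_Suc_conv_app_nth) (auto simp: cyc_def)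
    then show ?case using Suc by simp
  qed simp
  from this[of "length w"] show ?thesis by simp
qed

lemma orb_cyc_mult: "orb f (cyc w) p (m * length w) = (foldr f w ^^ m) p"
proof (induction m arbitrary: p)
  case (Suc m)
  have "orb f (cyc w) p (m * length w + length w) = orb f (cyc w) (foldr f w p) (m * length w)"
    by (subst orb_add) (auto simp: cyc_period orb_cyc)
  then show ?case using Suc by (simp add: add.commute funpow_swap1)
qed simp

definition full_cyclic :: "letter list \<Rightarrow> bool" where
  "full_cyclic w \<longleftrightarrow> distinct_adj w \<and> hd w \<noteq> last w \<and> set w = UNIV"

lemma full_cyclic_length: "full_cyclic w \<Longrightarrow> w \<noteq> []"
  by (auto simp: full_cyclic_def)

lemma full_cyclic_cyc:
  assumes "full_cyclic w"
  shows "cyc w k \<noteq> cyc w (Suc k)" "\<exists>k'\<ge>k. cyc w k' = l"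
proof -
  let ?n = "length w"
  have n: "0 < ?n" using full_cyclic_length[OF assms] by simp
  have adj: "distinct_adj (rev w)" using assms by (simp add: full_cyclic_def)
  show "cyc w k \<noteq> cyc w (Suc k)"
  proof (cases "Suc (k mod ?n) = ?n")
    case True
    then have "Suc k mod ?n = 0" by (simp add: mod_Suc)
    moreover have "k mod ?n = ?n - 1" using True by simp
    moreover have "rev w ! (?n - 1) = hd w" using n by (simp add: rev_nth hd_conv_nth)
    moreover have "rev w ! 0 = last w" using n by (simp add: rev_nth last_conv_nth)
    ultimately show ?thesis using assms by (simp add: cyc_def full_cyclic_def)
  next
    case False
    then have "Suc k mod ?n = Suc (k mod ?n)" by (simp add: mod_Suc)
    moreover have "Suc (k mod ?n) < ?n" using False n by (metis Suc_lessI mod_less_divisor)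
    ultimately show ?thesis using distinct_adj_nth[OF adj, of "k mod ?n"] by (simp add: cyc_def)
  qed
  have "l \<in> set (rev w)" using assms by (simp add: full_cyclic_def)
  then obtain i where i: "i < ?n" "rev w ! i = l" by (metis in_set_conv_nth length_rev)
  have "k * 1 \<le> k * ?n" using n by (intro mult_left_mono) (auto simp: Suc_le_eq)
  then have "k \<le> k * ?n + i" by linarith
  moreover have "cyc w (k * ?n + i) = l" using i by (simp add: cyc_def)
  ultimately show "\<exists>k'\<ge>k. cyc w k' = l" by blast
qed

text \<open>For a periodic orbit moved by the letters \<open>c\<close>, read \<open>big i l\<close> as: the \<open>i\<close>-th coordinate is maximal
  at time \<open>l\<close>. If a maximal coordinate survived a move, only two letters would alternate from then on.\<close>

lemma alternation:
  fixes c :: "nat \<Rightarrow> letter" and big :: "letter \<Rightarrow> nat \<Rightarrow> bool"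
  assumes ne: "\<And>k. c k \<noteq> c (Suc k)" and all: "\<And>l k. \<exists>k'\<ge>k. c k' = l"
    and stay: "\<And>i l. big i (Suc l) \<Longrightarrow> c l \<noteq> i \<Longrightarrow> big i l"
    and step: "\<And>i l. big i l \<Longrightarrow> c l \<noteq> i \<Longrightarrow> c (Suc l) = i \<and> big (c l) (Suc l)"
  shows "\<not> big i (Suc l)"
proof
  assume big: "big i (Suc l)"
  obtain m j where mj: "big j m" "c m \<noteq> j"
  proof (cases "c (Suc l) = i")
    case True
    then have "c l \<noteq> i" using ne by metis
    then show ?thesis using that[of i l] stay big by blast
  next
    case False
    then show ?thesis using that[of i "Suc l"] big by blast
  qed
  have "\<exists>j'. big j' n \<and> c n \<noteq> j' \<and> {c n, j'} = {c m, j}" if "m \<le> n" for n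
    using that
  proof (induction n rule: dec_induct)
    case base
    then show ?case using mj by blast
  next
    case (step n)
    then obtain j' where j': "big j' n" "c n \<noteq> j'" "{c n, j'} = {c m, j}" by blast
    then have "c (Suc n) = j'" "big (c n) (Suc n)" using assms(4) by blast+
    then show ?case using j' by (intro exI[of _ "c n"]) auto
  qed
  then have only: "c n \<in> {c m, j}" if "m \<le> n" for n using that by blast
  obtain k where "k \<noteq> c m" "k \<noteq> j" using third_letter mj(2) by metis
  moreover obtain n where "n \<ge> m" "c n = k" using all by blast
  ultimately show False using only by blast
qed

text \<open>Divisibility in a valuation ring is total, so a finite set contains an element of which
  all the others are multiples.\<close>

lemma valring_max:
  assumes V: "valring V" and "finite C" "\<exists>x\<in>C. x \<noteq> 0"
  shows "\<exists>M\<in>C. M \<noteq> 0 \<and> (\<forall>x\<in>C. x / M \<in> V)"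
  using assms(2,3)
proof (induction C rule: finite_induct)
  case (insert a C)
  note S = valring_subring[OF V]
  show ?case
  proof (cases "\<exists>x\<in>C. x \<noteq> 0")
    case True
    then obtain M where M: "M \<in> C" "M \<noteq> 0" "\<forall>x\<in>C. x / M \<in> V" using insert by blast
    show ?thesis
    proof (cases "a / M \<in> V")
      case True
      then show ?thesis using M by blast
    next
      case False
      then have a0: "a \<noteq> 0" and "inverse (a / M) \<in> V"
        using V is_subringD(2)[OF S] unfolding valring_def by auto
      then have Ma: "M / a \<in> V" by simp
      have "x / a \<in> V" if "x \<in> C" for x
      proof -
        have "x / M * (M / a) \<in> V" using is_subringD(4)[OF S] M(3) that Ma by blast
        moreover have "x / M * (M / a) = x / a" using M(2) by simp
        ultimately show ?thesis by (simp only:)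
      qed
      moreover have "a / a \<in> V" using a0 is_subringD(1)[OF S] by simp
      ultimately show ?thesis using a0 by blast
    qed
  next
    case False
    then have "a \<noteq> 0" "\<forall>x\<in>C. x = 0" using insert by auto
    then show ?thesis using is_subringD(1,2)[OF S] by (intro bexI[of _ a]) auto
  qed
qed simp

text \<open>Suppose that the orbit has a pole. If a coordinate with a maximal pole survives a move,
  then the third coordinate is finite, the moved one has a maximal pole afterwards, and the next
  letter can only be the surviving one. By \<open>alternation\<close> this is impossible.\<close>

lemma fixed_point_proper:
  assumes V: "valring V" and par: "\<And>l. par l P \<in> V" "par0 P \<in> V"
    and p: "p \<in> cubic_surface P" and fix_p: "act P w p = p" and w: "full_cyclic w"
  shows "co l p \<in> V"
proof (rule ccontr)
  assume notin: "co l p \<notin> V"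
  note S = valring_subring[OF V] and D = is_subringD[OF valring_subring[OF V]]
  define s where "s = orb (invol P) (cyc w) p"
  let ?n = "length w"
  have s: "s 0 = p" "s (Suc k) = invol P (cyc w k) (s k)" for k by (auto simp: s_def)
  have "s ?n = p" unfolding s_def orb_cyc using fix_p by (simp add: act_def)
  then have per: "s (k + ?n) = s k" for k
    unfolding s_def by (subst orb_add) (auto simp: cyc_period)
  have n: "0 < ?n" using full_cyclic_length[OF w] by simp
  have smod: "s k = s (k mod ?n)" for k
  proof (induction k rule: less_induct)
    case (less k)
    show ?case
    proof (cases "k < ?n")
      case False
      then have "s k = s (k - ?n)" using per[of "k - ?n"] by simp
      also have "\<dots> = s ((k - ?n) mod ?n)" using False n by (intro less diff_less order.strict_trans2[OF n]) auto
      also have "(k - ?n) mod ?n = k mod ?n" using False by (simp add: le_mod_geq)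
      finally show ?thesis .
    qed simp
  qed
  have "s k \<in> s ` {..<?n}" for k
    using n by (intro image_eqI[of _ s "k mod ?n"] smod) auto
  then have "range s \<subseteq> s ` {..<?n}" by blast
  then have fin: "finite (range s)" by (rule finite_subset) simp
  have surf: "s k \<in> cubic_surface P" for k
    by (induction k) (auto simp: s p invol_surface)
  define C where "C = (\<lambda>(l, q). co l q) ` (UNIV \<times> range s)"
  have C: "co l (s k) \<in> C" for l k unfolding C_def by force
  have "finite C" unfolding C_def by (intro finite_imageI finite_cartesian_product fin finite)
  moreover have "co l p \<noteq> 0" using notin D(2) by auto
  then have "\<exists>x\<in>C. x \<noteq> 0" using C[of l 0] by (auto simp: s)
  ultimately obtain M where M: "M \<in> C" "M \<noteq> 0" "\<forall>x\<in>C. x / M \<in> V" using valring_max[OF V] by blast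
  have MV: "M \<notin> V"
  proof
    assume "M \<in> V"
    moreover have "co l p / M \<in> V" using M(3) C[of l 0] by (simp add: s)
    ultimately have "co l p / M * M \<in> V" by (intro D(4))
    then show False using M(2) notin by simp
  qed
  \<comment> \<open>Scaling by the worst pole: all coordinates times \<open>\<mu>\<close> lie in
    \<open>V\<close>, and those that remain outside the maximal ideal have a pole of the same
    order.\<close>
  define \<mu> where "\<mu> = inverse M"
  have mu: "\<mu> \<in> maxid V" unfolding \<mu>_def using V MV by (rule maxid_of_notin)
  have muV: "\<mu> \<in> V" using V mu by (rule maxid_subset)
  have aV: "co l (s k) * \<mu> \<in> V" for l k using M(3) C[of l k] by (simp add: \<mu>_def divide_inverse)
  define big where "big i k \<longleftrightarrow> co i (s k) * \<mu> \<notin> maxid V" for i k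
  have unit: "x \<in> V" if "big i k" "co i (s k) * \<mu> * x \<in> V" for i k x
  proof -
    have ne: "co i (s k) * \<mu> \<noteq> 0" using that(1) by (auto simp: big_def maxid_zero)
    then have "inverse (co i (s k) * \<mu>) \<in> V"
      using that(1) unfolding big_def by (rule inverse_notin_maxid)
    then have "inverse (co i (s k) * \<mu>) * (co i (s k) * \<mu> * x) \<in> V" using that(2) by (rule D(4))
    moreover have "inverse (co i (s k) * \<mu>) * (co i (s k) * \<mu> * x) = x" using ne by (simp add: field_simps)
    ultimately show ?thesis by (simp only:)
  qed
  \<comment> \<open>Times \<open>\<mu>\<close>, the formula for the moved coordinate shows that the
    product of the maximal coordinate with \<open>co m\<close> has no worse pole than the maximal
    coordinate; hence \<open>co m\<close> is finite.\<close>
  have third_in: "co m (s k) \<in> V" if "big i k" "cyc w k = j" "i \<noteq> j" "j \<noteq> m" "i \<noteq> m" for i j m k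
  proof -
    have "co j (s (Suc k)) = - co j (s k) - co i (s k) * co m (s k) + par j P"
      unfolding s that(2) using that by (intro co_invol_same) auto
    then have "(co i (s k) * co m (s k)) * \<mu> = (par j P - co j (s (Suc k)) - co j (s k)) * \<mu>"
      by simp
    then have "co i (s k) * \<mu> * co m (s k) = par j P * \<mu> - co j (s (Suc k)) * \<mu> - co j (s k) * \<mu>"
      by (simp add: algebra_simps)
    moreover have "par j P * \<mu> - co j (s (Suc k)) * \<mu> - co j (s k) * \<mu> \<in> V"
      by (intro D(3) aV D(4)[OF par(1) muV])
    ultimately show ?thesis using unit[OF that(1)] by simp
  qed
  \<comment> \<open>If the third coordinate is finite, the square of the maximal coordinate can be
    balanced in the surface equation only by a remaining coordinate that is maximal as well.\<close>
  have surface_contra: False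
    if h: "big i k" "i \<noteq> j" "j \<noteq> m" "i \<noteq> m" "co m (s k) \<in> V" "co j (s k) * \<mu> \<in> maxid V" for i j m k
  proof -
    let ?x = "co i (s k)" let ?y = "co j (s k)" let ?z = "co m (s k)"
    have "?x^2 + ?y^2 + ?z^2 + ?x * ?y * ?z = par i P * ?x + par j P * ?y + par m P * ?z + par0 P"
      using surf[of k] surface_iff[of i j m "s k" P] h by simp
    then have "?x^2 = par i P * ?x + par j P * ?y + par m P * ?z + par0 P - ?y^2 - ?z^2 - ?x * ?y * ?z"
      by (simp add: algebra_simps)
    then have "?x^2 * \<mu>^2 = (par i P * ?x + par j P * ?y + par m P * ?z + par0 P - ?y^2 - ?z^2 - ?x * ?y * ?z) * \<mu>^2"
      by simp
    also have "\<dots> = (par i P * (?x * \<mu>) + par j P * (?y * \<mu>) + par m P * (?z * \<mu>) + par0 P * \<mu>) * \<mu>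
        - (?y * \<mu>) * (?y * \<mu>) - ?z * \<mu> * (?z * \<mu>) - (?x * \<mu>) * ?z * (?y * \<mu>)"
      by (simp add: algebra_simps power2_eq_square)
    also have "\<dots> \<in> maxid V"
    proof (intro maxid_diff[OF V])
      show "(par i P * (?x * \<mu>) + par j P * (?y * \<mu>) + par m P * (?z * \<mu>) + par0 P * \<mu>) * \<mu> \<in> maxid V"
        by (intro maxid_mult(1)[OF V _ mu] D(6) D(4)[OF par(1) aV] D(4)[OF par(2) muV])
      show "(?y * \<mu>) * (?y * \<mu>) \<in> maxid V" by (rule maxid_mult(1)[OF V aV h(6)])
      show "?z * \<mu> * (?z * \<mu>) \<in> maxid V" by (rule maxid_mult(1)[OF V aV maxid_mult(1)[OF V h(5) mu]])
      show "(?x * \<mu>) * ?z * (?y * \<mu>) \<in> maxid V" by (rule maxid_mult(1)[OF V D(4)[OF aV h(5)] h(6)])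
    qed
    finally have "(?x * \<mu>)^2 \<in> maxid V" by (simp add: power_mult_distrib)
    then have "?x * \<mu> \<in> maxid V" by (rule maxid_square[OF V])
    then show False using h(1) by (simp add: big_def)
  qed
  have "\<not> big i (Suc k)" for i k
  proof (rule alternation[where c = "cyc w"])
    show "cyc w k \<noteq> cyc w (Suc k)" for k by (rule full_cyclic_cyc(1)[OF w])
    show "\<exists>k'\<ge>k. cyc w k' = l" for l k by (rule full_cyclic_cyc(2)[OF w])
    fix i k
    {
      assume "big i (Suc k)" "cyc w k \<noteq> i"
      then show "big i k" by (auto simp: big_def s co_invol_other)
    }
    assume b: "big i k" and ci: "cyc w k \<noteq> i"
    define j where "j = cyc w k"
    obtain m where m: "m \<noteq> i" "m \<noteq> j" using third_letter ci unfolding j_def by metis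
    have ij: "i \<noteq> j" using ci by (simp add: j_def)
    have xi: "co i (s (Suc k)) = co i (s k)" "co m (s (Suc k)) = co m (s k)"
      using ij m by (auto simp: s co_invol_other j_def)
    have b': "big i (Suc k)" using b xi by (simp add: big_def)
    have zV: "co m (s (Suc k)) \<in> V" using third_in[of i k j m] b ij m xi by (auto simp: j_def)
    have "big j (Suc k)"
      using surface_contra[of i "Suc k" j m] b' ij m zV by (auto simp: big_def)
    moreover have "cyc w (Suc k) = i"
    proof (rule ccontr)
      assume "cyc w (Suc k) \<noteq> i"
      moreover have "cyc w (Suc k) \<noteq> j" using full_cyclic_cyc(1)[OF w, of k] by (simp add: j_def)
      ultimately have cm: "cyc w (Suc k) = m" using letter_distinct_cases[of i j m] ij m by metis
      have "co j (s (Suc k)) \<in> V" using third_in[of i "Suc k" m j] b' ij m cm by auto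
      then have "co j (s (Suc k)) * \<mu> \<in> maxid V" using mu by (intro maxid_mult[OF V])
      then show False using surface_contra[of i "Suc k" j m] b' ij m zV by auto
    qed
    ultimately show "cyc w (Suc k) = i \<and> big (cyc w k) (Suc k)" by (simp add: j_def)
  qed
  \<comment> \<open>The largest coordinate occurs again one period later, at a time that is a
    successor.\<close>
  moreover obtain i k where "M = co i (s k)" using M(1) unfolding C_def by auto
  then have "co i (s (k + ?n)) * \<mu> = 1" using M(2) by (simp add: per \<mu>_def)
  then have "big i (k + ?n)" using one_notin_maxid[OF V] by (simp add: big_def)
  ultimately show False using n by (metis Suc_pred add_Suc_right)
qed

section \<open>The monomial action\<close>

text \<open>The action on the logarithms of \<open>u\<close> and \<open>v\<close> in the monomial
  parametrization of the Cayley cubic; compare \<open>mon\<close>.\<close>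

fun lin :: "letter \<Rightarrow> 'a::comm_ring_1 \<times> 'a \<Rightarrow> 'a \<times> 'a" where
  "lin X (a, b) = (a + 2 * b, - b)"
| "lin Y (a, b) = (- a, 2 * a + b)"
| "lin Z (a, b) = (a, - b)"

definition linw :: "letter list \<Rightarrow> 'a::comm_ring_1 \<times> 'a \<Rightarrow> 'a \<times> 'a" where
  "linw w = foldr lin w"

lemma linw_simps [simp]: "linw [] v = v" "linw (l # w) v = lin l (linw w v)"
  by (auto simp: linw_def)

definition mat11 :: "letter list \<Rightarrow> int" where "mat11 w = fst (linw w (1, 0))"
definition mat21 :: "letter list \<Rightarrow> int" where "mat21 w = snd (linw w (1, 0))"
definition mat12 :: "letter list \<Rightarrow> int" where "mat12 w = fst (linw w (0, 1))"
definition mat22 :: "letter list \<Rightarrow> int" where "mat22 w = snd (linw w (0, 1))"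

lemma linw_eq:
  "linw w (a, b) = (of_int (mat11 w) * a + of_int (mat12 w) * b, of_int (mat21 w) * a + of_int (mat22 w) * b)"
proof (induction w)
  case Nil
  then show ?case by (simp add: mat11_def mat12_def mat21_def mat22_def)
next
  case (Cons l w)
  have m: "linw w (1, 0 :: int) = (mat11 w, mat21 w)" "linw w (0, 1 :: int) = (mat12 w, mat22 w)"
    by (simp_all add: mat11_def mat12_def mat21_def mat22_def)
  have "mat11 (l # w) = fst (lin l (mat11 w, mat21 w))" "mat21 (l # w) = snd (lin l (mat11 w, mat21 w))"
    "mat12 (l # w) = fst (lin l (mat12 w, mat22 w))" "mat22 (l # w) = snd (lin l (mat12 w, mat22 w))"
    using m by (simp_all add: mat11_def mat12_def mat21_def mat22_def)
  then show ?case unfolding linw_simps Cons by (cases l) (auto simp: algebra_simps)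
qed

lemma mat_det: "even (length w) \<Longrightarrow> mat11 w * mat22 w - mat12 w * mat21 w = 1"
proof -
  have "mat11 w * mat22 w - mat12 w * mat21 w = (- 1) ^ length w"
  proof (induction w)
    case Nil
    then show ?case by (simp add: mat11_def mat12_def mat21_def mat22_def)
  next
    case (Cons l w)
    have m: "linw w (1, 0 :: int) = (mat11 w, mat21 w)" "linw w (0, 1 :: int) = (mat12 w, mat22 w)"
      by (simp_all add: mat11_def mat12_def mat21_def mat22_def)
    have "mat11 (l # w) = fst (lin l (mat11 w, mat21 w))" "mat21 (l # w) = snd (lin l (mat11 w, mat21 w))"
      "mat12 (l # w) = fst (lin l (mat12 w, mat22 w))" "mat22 (l # w) = snd (lin l (mat12 w, mat22 w))"
      using m by (simp_all add: mat11_def mat12_def mat21_def mat22_def)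
    then show ?case using Cons by (cases l) (auto simp: algebra_simps)
  qed
  then show "even (length w) \<Longrightarrow> mat11 w * mat22 w - mat12 w * mat21 w = 1" by simp
qed

text \<open>Absolute logarithms of the three monomials \<open>u\<close>, \<open>v\<close> and
  \<open>u * v\<close> behind the coordinates of \<open>mpt\<close>: a tropical version of these
  coordinates.\<close>

fun ht :: "letter \<Rightarrow> int \<times> int \<Rightarrow> int" where
  "ht X (a, b) = \<bar>a\<bar>"
| "ht Y (a, b) = \<bar>b\<bar>"
| "ht Z (a, b) = \<bar>a + b\<bar>"

lemma ht_lin_other: "i \<noteq> j \<Longrightarrow> ht i (lin j v) = ht i v"
  by (cases v; cases i; cases j) auto

text \<open>Up to signs the three linear forms add up to zero. The old and the new value of
  \<open>ht i\<close> are therefore the absolute sum and the absolute difference of the other two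
  forms, in some order.\<close>

lemma ht_lin_same:
  assumes "i \<noteq> j" "j \<noteq> k" "i \<noteq> k"
  shows "max (ht i v) (ht i (lin i v)) = ht j v + ht k v"
    "min (ht i v) (ht i (lin i v)) = \<bar>ht j v - ht k v\<bar>"
  by (cases v; cases i; cases j; cases k; insert assms; simp add: max_def min_def abs_if)+

lemma ht_nonneg: "0 \<le> ht l v" by (cases v; cases l) auto

text \<open>The argument of \<open>fixed_point_proper\<close> with maximal height in place of
  maximal pole: if \<open>ht i\<close> is maximal and survives the letter \<open>j\<close>, the
  third height is zero, \<open>ht j\<close> becomes maximal, and only \<open>i\<close> can
  follow.\<close>

lemma no_periodic_heights:
  assumes w: "full_cyclic w" and "0 < N" and per: "\<And>l k. ht l (orb lin (cyc w) v (k + N)) = ht l (orb lin (cyc w) v k)"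
    and v: "v \<noteq> 0"
  shows False
proof -
  define s where "s = orb lin (cyc w) v"
  have s: "s 0 = v" "s (Suc k) = lin (cyc w k) (s k)" for k by (auto simp: s_def)
  have per': "ht l (s (k + N)) = ht l (s k)" for l k using per by (simp add: s_def)
  have permod: "ht l (s k) = ht l (s (k mod N))" for l k
  proof (induction k rule: less_induct)
    case (less k)
    show ?case
    proof (cases "k < N")
      case False
      then have "ht l (s k) = ht l (s (k - N))" using per'[of l "k - N"] by simp
      also have "\<dots> = ht l (s ((k - N) mod N))" using False \<open>0 < N\<close> by (intro less) auto
      also have "(k - N) mod N = k mod N" using False by (simp add: le_mod_geq)
      finally show ?thesis .
    qed simp
  qed
  define C where "C = (\<lambda>(l, k). ht l (s k)) ` (UNIV \<times> {..<N})"
  have C: "ht l (s k) \<in> C" for l k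
    unfolding C_def using permod[of l k] \<open>0 < N\<close> by (intro image_eqI[of _ _ "(l, k mod N)"]) auto
  have fin: "finite C" unfolding C_def by simp
  define M where "M = Max C"
  have le: "ht l (s k) \<le> M" for l k unfolding M_def using fin C by simp
  have "M \<in> C" unfolding M_def using fin C by (intro Max_in) auto
  then obtain i0 k0 where ik0: "ht i0 (s k0) = M" unfolding C_def by auto
  obtain a b where ab: "v = (a, b)" by (cases v)
  have "0 < ht X v \<or> 0 < ht Y v" using v ab by (auto simp: zero_prod_def)
  then have M0: "0 < M" using le[of X 0] le[of Y 0] by (auto simp: s)
  define big where "big i k \<longleftrightarrow> ht i (s k) = M" for i k
  have "\<not> big i (Suc k)" for i k
  proof (rule alternation[where c = "cyc w"])
    show "cyc w k \<noteq> cyc w (Suc k)" for k by (rule full_cyclic_cyc(1)[OF w])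
    show "\<exists>k'\<ge>k. cyc w k' = l" for l k by (rule full_cyclic_cyc(2)[OF w])
    fix i k
    {
      assume "big i (Suc k)" "cyc w k \<noteq> i"
      then show "big i k" by (auto simp: big_def s ht_lin_other)
    }
    assume b: "big i k" and ci: "cyc w k \<noteq> i"
    define j where "j = cyc w k"
    obtain m where m: "m \<noteq> i" "m \<noteq> j" using third_letter ci unfolding j_def by metis
    have ij: "i \<noteq> j" using ci by (simp add: j_def)
    have xi: "ht i (s (Suc k)) = ht i (s k)" "ht m (s (Suc k)) = ht m (s k)"
      using ij m by (auto simp: s ht_lin_other j_def)
    have mx: "max (ht j (s k)) (ht j (s (Suc k))) = ht i (s k) + ht m (s k)"
      "min (ht j (s k)) (ht j (s (Suc k))) = \<bar>ht i (s k) - ht m (s k)\<bar>"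
      unfolding s j_def[symmetric] using ij m by (intro ht_lin_same; auto)+
    have m0: "ht m (s k) = 0"
      using mx(1) b le[of j k] le[of j "Suc k"] ht_nonneg[of m "s k"] by (auto simp: big_def max_def split: if_splits)
    then have bj: "ht j (s (Suc k)) = M"
      using mx b M0 by (auto simp: big_def max_def min_def split: if_splits)
    moreover have "cyc w (Suc k) = i"
    proof (rule ccontr)
      assume "cyc w (Suc k) \<noteq> i"
      moreover have "cyc w (Suc k) \<noteq> j" using full_cyclic_cyc(1)[OF w, of k] by (simp add: j_def)
      ultimately have cm: "cyc w (Suc k) = m" using letter_distinct_cases[of i j m] ij m by metis
      have "max (ht m (s (Suc k))) (ht m (s (Suc (Suc k)))) = ht i (s (Suc k)) + ht j (s (Suc k))"
        unfolding s(2)[of "Suc k"] cm using ij m by (intro ht_lin_same(1)) auto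
      then show False using le[of m "Suc k"] le[of m "Suc (Suc k)"] bj b xi(1) M0
        by (auto simp: big_def max_def split: if_splits)
    qed
    ultimately show "cyc w (Suc k) = i \<and> big (cyc w k) (Suc k)" by (simp add: j_def big_def)
  qed
  moreover have "big i0 (k0 + N)" using ik0 per' by (simp add: big_def)
  ultimately show False using \<open>0 < N\<close> by (metis Suc_pred add_Suc_right)
qed

lemma lin_uminus: "lin l (- v) = - lin l v"
  by (cases v; cases l) auto

lemma ht_uminus: "ht l (- v) = ht l v"
  by (cases v; cases l) auto

text \<open>For a trace of absolute value at most 2, the sixth power sends some non-zero vector to
  itself or to its negative: the matrix has order 4, 6 or 3 for the traces 0, 1 and -1 and an
  eigenvector for 2 and -2. Heights ignore signs, so this vector would have periodic
  heights.\<close>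

theorem hyperbolic_trace:
  assumes w: "full_cyclic w" and ev: "even (length w)"
  shows "3 \<le> \<bar>mat11 w + mat22 w\<bar>"
proof (rule ccontr)
  assume "\<not> ?thesis"
  then have "\<bar>mat11 w + mat22 w\<bar> \<le> 2" by simp
  define t where "t = mat11 w + mat22 w"
  define g :: "int \<times> int \<Rightarrow> int \<times> int" where "g = linw w"
  have g: "g (a, b) = (mat11 w * a + mat12 w * b, mat21 w * a + mat22 w * b)" for a b
    unfolding g_def linw_eq by simp
  have det: "mat11 w * mat22 w - mat12 w * mat21 w = 1" using mat_det[OF ev] .
  have gm: "g (- v) = - g v" for v by (cases v) (simp add: g)
  have CH: "g (g v) = (t * fst (g v) - fst v, t * snd (g v) - snd v)" for v
  proof (cases v)
    case (Pair a b)
    have "mat12 w * mat21 w = mat11 w * mat22 w - 1" using det by simp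
    moreover have "mat11 w * (mat11 w * a + mat12 w * b) + mat12 w * (mat21 w * a + mat22 w * b)
       = t * (mat11 w * a + mat12 w * b) - (mat11 w * mat22 w - mat12 w * mat21 w) * a"
      "mat21 w * (mat11 w * a + mat12 w * b) + mat22 w * (mat21 w * a + mat22 w * b)
       = t * (mat21 w * a + mat22 w * b) - (mat11 w * mat22 w - mat12 w * mat21 w) * b"
      by (simp_all add: t_def algebra_simps)
    ultimately show ?thesis using Pair det by (simp add: g)
  qed
  have "\<exists>v. v \<noteq> 0 \<and> ((g ^^ 6) v = v \<or> (g ^^ 6) v = - v)"
  proof -
    have six: "(g ^^ 6) v = g (g (g (g (g (g v)))))" for v by (simp add: eval_nat_numeral)
    consider "t = 0" | "t = 1" | "t = -1" | "t = 2" | "t = -2"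
      using \<open>\<bar>mat11 w + mat22 w\<bar> \<le> 2\<close> unfolding t_def[symmetric] by linarith
    then show ?thesis
    proof cases
      case 1
      then have "g (g v) = - v" for v using CH[of v] by (cases v) simp
      then show ?thesis unfolding six by (intro exI[of _ "(1, 0)"]) (auto simp: zero_prod_def gm)
    next
      case 2
      then have e: "g (g v) = g v - v" for v using CH[of v] by (cases v; cases "g v") simp
      have "g (g (g v)) = - v" for v using e[of "g v"] e[of v] by simp
      then show ?thesis unfolding six by (intro exI[of _ "(1, 0)"]) (auto simp: zero_prod_def gm)
    next
      case 3
      then have e: "g (g v) = - g v - v" for v using CH[of v] by (cases v; cases "g v") simp
      have "g (g (g v)) = v" for v using e[of "g v"] e[of v] by simp
      then show ?thesis unfolding six by (intro exI[of _ "(1, 0)"]) (auto simp: zero_prod_def gm)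
    next
      case 4
      have "\<exists>v. v \<noteq> 0 \<and> g v = v"
      proof (cases "mat12 w = 0 \<and> mat11 w = 1")
        case True
        then show ?thesis using 4 by (intro exI[of _ "(0, 1)"]) (simp add: g t_def zero_prod_def)
      next
        case False
        have m22: "mat22 w = 2 - mat11 w" using 4 by (simp add: t_def)
        have "mat21 w * mat12 w + mat22 w * (1 - mat11 w) = 1 - mat11 w"
          using det unfolding m22 by (simp add: algebra_simps)
        moreover have "mat11 w * mat12 w + mat12 w * (1 - mat11 w) = mat12 w" by (simp add: algebra_simps)
        ultimately have "g (mat12 w, 1 - mat11 w) = (mat12 w, 1 - mat11 w)" by (simp add: g)
        then show ?thesis using False by (intro exI[of _ "(mat12 w, 1 - mat11 w)"]) (auto simp: zero_prod_def)
      qed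
      then show ?thesis unfolding six by (metis (no_types))
    next
      case 5
      have "\<exists>v. v \<noteq> 0 \<and> g v = - v"
      proof (cases "mat12 w = 0 \<and> mat11 w = - 1")
        case True
        then show ?thesis using 5 by (intro exI[of _ "(0, 1)"]) (simp add: g t_def zero_prod_def)
      next
        case False
        have m22: "mat22 w = - 2 - mat11 w" using 5 by (simp add: t_def)
        have "mat21 w * mat12 w + mat22 w * (- 1 - mat11 w) = 1 + mat11 w"
          using det unfolding m22 by (simp add: algebra_simps)
        moreover have "mat11 w * mat12 w + mat12 w * (- 1 - mat11 w) = - mat12 w" by (simp add: algebra_simps)
        ultimately have "g (mat12 w, - 1 - mat11 w) = - (mat12 w, - 1 - mat11 w)" by (simp add: g)
        then show ?thesis using False by (intro exI[of _ "(mat12 w, - 1 - mat11 w)"]) (auto simp: zero_prod_def)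
      qed
      then obtain v where "v \<noteq> 0" "g v = - v" by blast
      then show ?thesis unfolding six by (intro exI[of _ v]) (simp add: gm)
    qed
  qed
  then obtain v where v: "v \<noteq> 0" "(g ^^ 6) v = v \<or> (g ^^ 6) v = - v" by blast
  let ?N = "6 * length w"
  have "cyc w (k + ?N) = cyc w k" for k by (simp add: cyc_def)
  then have "orb lin (cyc w) v (k + ?N) = orb lin (cyc w) ((g ^^ 6) v) k" for k
    by (subst orb_add) (auto simp: orb_cyc_mult g_def linw_def)
  moreover have "orb lin (cyc w) (- v) k = - orb lin (cyc w) v k" for k
    by (induction k) (auto simp: lin_uminus)
  ultimately have "ht l (orb lin (cyc w) v (k + ?N)) = ht l (orb lin (cyc w) v k)" for l k
    using v(2) by (auto simp: ht_uminus)
  then show False using no_periodic_heights[OF w _ _ v(1), of ?N] full_cyclic_length[OF w] by simp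
qed

section \<open>Derivatives\<close>

fun dinvol :: "letter \<Rightarrow> point \<Rightarrow> point \<Rightarrow> point" where
  "dinvol X (x, y, z) (a, b, c) = (- a - z * b - y * c, b, c)"
| "dinvol Y (x, y, z) (a, b, c) = (a, - b - z * a - x * c, c)"
| "dinvol Z (x, y, z) (a, b, c) = (a, b, - c - y * a - x * b)"

primrec dact :: "param \<Rightarrow> letter list \<Rightarrow> point \<Rightarrow> point \<Rightarrow> point" where
  "dact P [] p v = v"
| "dact P (l # w) p v = dinvol l (act P w p) (dact P w p v)"

fun grad :: "param \<Rightarrow> point \<Rightarrow> point" where
  "grad (A, B, C, D) (x, y, z) = (2 * x + y * z - A, 2 * y + x * z - B, 2 * z + x * y - C)"

fun dt :: "point \<Rightarrow> point \<Rightarrow> complex" where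
  "dt (a, b, c) (a', b', c') = a * a' + b * b' + c * c'"

fun cr :: "point \<Rightarrow> point \<Rightarrow> point" where
  "cr (a, b, c) (a', b', c') = (b * c' - c * b', c * a' - a * c', a * b' - b * a')"

fun csc :: "complex \<Rightarrow> point \<Rightarrow> point" where
  "csc u (a, b, c) = (u * a, u * b, u * c)"

lemma csc_simps [simp]: "csc 1 v = v" "csc 0 v = 0" "csc a (csc b v) = csc (a * b) v" "csc u 0 = 0"
  by (cases v; simp add: zero_prod_def)+

lemma dact_append [simp]: "dact P (u @ w) p v = dact P u (act P w p) (dact P w p v)"
  by (induction u) auto

lemma dinvol_linear: "dinvol l p (v + v') = dinvol l p v + dinvol l p v'" "dinvol l p (csc u v) = csc u (dinvol l p v)"
  by (cases l; cases p; cases v; cases v'; simp add: algebra_simps)+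

lemma dact_linear: "dact P w p (v + v') = dact P w p v + dact P w p v'" "dact P w p (csc u v) = csc u (dact P w p v)"
  by (induction w) (auto simp: dinvol_linear)

lemma dinvol_dinvol: "dinvol l (invol P l p) (dinvol l p v) = v"
  by (cases l; cases p; cases P; cases v; simp add: algebra_simps)

lemma dact_rev [simp]: "dact P (rev w) (act P w p) (dact P w p v) = v"
  by (induction w arbitrary: v) (auto simp: dinvol_dinvol)

text \<open>The involutions preserve the polynomial that defines the surface, so this is the chain
  rule. In particular tangent vectors go to tangent vectors.\<close>

lemma grad_dinvol: "dt (grad P (invol P l p)) (dinvol l p v) = dt (grad P p) v"
  by (cases l; cases p; cases P; cases v; simp add: algebra_simps)

lemma grad_dact: "dt (grad P (act P w p)) (dact P w p v) = dt (grad P p) v"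
  by (induction w) (auto simp: grad_dinvol)

text \<open>The cross product of tangent vectors is a multiple of the gradient, and at smooth points
  the factor \<open>\<omega>\<close> is their area in the invariant holomorphic area form. An
  involution reverses its sign, hence even words preserve it.\<close>

lemma cr_dinvol:
  assumes "cr v v' = csc \<omega> (grad P p)"
  shows "cr (dinvol l p v) (dinvol l p v') = csc (- \<omega>) (grad P (invol P l p))"
proof -
  obtain A B C D where P: "P = (A, B, C, D)" by (cases P)
  obtain x y z where p: "p = (x, y, z)" by (cases p)
  obtain a b c where v: "v = (a, b, c)" by (cases v)
  obtain a' b' c' where v': "v' = (a', b', c')" by (cases v')
  have e: "b * c' - c * b' = \<omega> * (2 * x + y * z - A)" "c * a' - a * c' = \<omega> * (2 * y + x * z - B)"
    "a * b' - b * a' = \<omega> * (2 * z + x * y - C)"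
    using assms by (simp_all add: P p v v')
  show ?thesis
  proof (cases l)
    case X
    have "b * c' - c * b' = - (\<omega> * (2 * (A - (x + y * z)) + y * z - A))"
      unfolding e(1) by (simp add: algebra_simps)
    moreover have "c * (- a' - z * b' - y * c') - (- a - z * b - y * c) * c' = - (\<omega> * (2 * y + (A - (x + y * z)) * z - B))"
    proof -
      have "c * (- a' - z * b' - y * c') - (- a - z * b - y * c) * c' = z * (b * c' - c * b') - (c * a' - a * c')"
        by (simp add: algebra_simps)
      then show ?thesis unfolding e by (simp add: algebra_simps)
    qed
    moreover have "(- a - z * b - y * c) * b' - b * (- a' - z * b' - y * c') = - (\<omega> * (2 * z + (A - (x + y * z)) * y - C))"
    proof -
      have "(- a - z * b - y * c) * b' - b * (- a' - z * b' - y * c') = y * (b * c' - c * b') - (a * b' - b * a')"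
        by (simp add: algebra_simps)
      then show ?thesis unfolding e by (simp add: algebra_simps)
    qed
    ultimately show ?thesis using X by (simp add: P p v v' algebra_simps)
  next
    case Y
    have "(- b - z * a - x * c) * c' - c * (- b' - z * a' - x * c') = - (\<omega> * (2 * x + (B - (y + x * z)) * z - A))"
    proof -
      have "(- b - z * a - x * c) * c' - c * (- b' - z * a' - x * c') = z * (c * a' - a * c') - (b * c' - c * b')"
        by (simp add: algebra_simps)
      then show ?thesis unfolding e by (simp add: algebra_simps)
    qed
    moreover have "c * a' - a * c' = - (\<omega> * (2 * (B - (y + x * z)) + x * z - B))"
      unfolding e(2) by (simp add: algebra_simps)
    moreover have "a * (- b' - z * a' - x * c') - (- b - z * a - x * c) * a' = - (\<omega> * (2 * z + x * (B - (y + x * z)) - C))"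
    proof -
      have "a * (- b' - z * a' - x * c') - (- b - z * a - x * c) * a' = x * (c * a' - a * c') - (a * b' - b * a')"
        by (simp add: algebra_simps)
      then show ?thesis unfolding e by (simp add: algebra_simps)
    qed
    ultimately show ?thesis using Y by (simp add: P p v v' algebra_simps)
  next
    case Z
    have "b * (- c' - y * a' - x * b') - (- c - y * a - x * b) * b' = - (\<omega> * (2 * x + y * (C - (z + x * y)) - A))"
    proof -
      have "b * (- c' - y * a' - x * b') - (- c - y * a - x * b) * b' = y * (a * b' - b * a') - (b * c' - c * b')"
        by (simp add: algebra_simps)
      then show ?thesis unfolding e by (simp add: algebra_simps)
    qed
    moreover have "(- c - y * a - x * b) * a' - a * (- c' - y * a' - x * b') = - (\<omega> * (2 * y + x * (C - (z + x * y)) - B))"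
    proof -
      have "(- c - y * a - x * b) * a' - a * (- c' - y * a' - x * b') = x * (a * b' - b * a') - (c * a' - a * c')"
        by (simp add: algebra_simps)
      then show ?thesis unfolding e by (simp add: algebra_simps)
    qed
    moreover have "a * b' - b * a' = - (\<omega> * (2 * (C - (z + x * y)) + x * y - C))"
      unfolding e(3) by (simp add: algebra_simps)
    ultimately show ?thesis using Z by (simp add: P p v v' algebra_simps)
  qed
qed

lemma cr_dact:
  assumes "cr v v' = csc \<omega> (grad P p)" "even (length w)"
  shows "cr (dact P w p v) (dact P w p v') = csc \<omega> (grad P (act P w p))"
proof -
  have "cr (dact P w p v) (dact P w p v') = csc ((- 1) ^ length w * \<omega>) (grad P (act P w p))"
  proof (induction w)
    case (Cons l w)
    then show ?case using cr_dinvol[OF Cons, of l] by simp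
  qed (simp add: assms)
  then show ?thesis using assms(2) by simp
qed

definition tr3 :: "(point \<Rightarrow> point) \<Rightarrow> complex" where
  "tr3 L = co X (L (1, 0, 0)) + co Y (L (0, 1, 0)) + co Z (L (0, 0, 1))"

text \<open>The trace is the derivative of the determinant.\<close>

lemma trace_identity:
  assumes L: "\<And>v v'. L (v + v') = L v + L v'" "\<And>u v. L (csc u v) = csc u (L v)"
  shows "tr3 L * dt (cr a b) c = dt (cr (L a) b) c + dt (cr a (L b)) c + dt (cr a b) (L c)"
proof -
  obtain l11 l21 l31 where 1: "L (1, 0, 0) = (l11, l21, l31)" by (cases "L (1, 0, 0)")
  obtain l12 l22 l32 where 2: "L (0, 1, 0) = (l12, l22, l32)" by (cases "L (0, 1, 0)")
  obtain l13 l23 l33 where 3: "L (0, 0, 1) = (l13, l23, l33)" by (cases "L (0, 0, 1)")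
  have L': "L (x, y, z) = (l11 * x + l12 * y + l13 * z, l21 * x + l22 * y + l23 * z, l31 * x + l32 * y + l33 * z)" for x y z
  proof -
    have "L (x, y, z) = L (csc x (1, 0, 0) + (csc y (0, 1, 0) + csc z (0, 0, 1)))" by simp
    also have "\<dots> = csc x (L (1, 0, 0)) + (csc y (L (0, 1, 0)) + csc z (L (0, 0, 1)))" by (simp only: L)
    finally show ?thesis by (simp add: 1 2 3 algebra_simps)
  qed
  show ?thesis
    by (cases a; cases b; cases c) (simp add: L' tr3_def algebra_simps)
qed

section \<open>Reduction to the Cayley cubic\<close>

definition cg :: "complex set \<Rightarrow> complex \<Rightarrow> complex \<Rightarrow> bool" where
  "cg V x y \<longleftrightarrow> x \<in> V \<and> y \<in> V \<and> x - y \<in> maxid V"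

definition cg3 :: "complex set \<Rightarrow> point \<Rightarrow> point \<Rightarrow> bool" where
  "cg3 V p q \<longleftrightarrow> (\<forall>l. cg V (co l p) (co l q))"

definition cgP :: "complex set \<Rightarrow> param \<Rightarrow> param \<Rightarrow> bool" where
  "cgP V P Q \<longleftrightarrow> (\<forall>l. cg V (par l P) (par l Q)) \<and> cg V (par0 P) (par0 Q)"

lemma all_letter: "(\<forall>l. Q l) \<longleftrightarrow> Q X \<and> Q Y \<and> Q Z"
  by (metis letter.exhaust)

lemma cg3_simps [simp]: "cg3 V (x, y, z) (x', y', z') \<longleftrightarrow> cg V x x' \<and> cg V y y' \<and> cg V z z'"
  by (simp add: cg3_def all_letter)

lemma cgP_simps [simp]: "cgP V (A, B, C, D) (A', B', C', D') \<longleftrightarrow> cg V A A' \<and> cg V B B' \<and> cg V C C' \<and> cg V D D'"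
  by (auto simp: cgP_def all_letter)

context
  fixes V assumes V: "valring V"
begin

lemma cg_refl: "x \<in> V \<Longrightarrow> cg V x x" by (simp add: cg_def maxid_zero)

lemma cg_sym: "cg V x y \<Longrightarrow> cg V y x"
  using maxid_uminus[OF V, of "x - y"] by (simp add: cg_def)

lemma cg_trans: "cg V x y \<Longrightarrow> cg V y z \<Longrightarrow> cg V x z"
  using maxid_add[OF V, of "x - y" "y - z"] by (simp add: cg_def)

lemma cg_add: "cg V x y \<Longrightarrow> cg V x' y' \<Longrightarrow> cg V (x + x') (y + y')"
  using maxid_add[OF V, of "x - y" "x' - y'"] is_subringD(6)[OF valring_subring[OF V]]
  by (auto simp: cg_def algebra_simps)

lemma cg_uminus: "cg V x y \<Longrightarrow> cg V (- x) (- y)"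
  using maxid_uminus[OF V, of "x - y"] is_subringD(5)[OF valring_subring[OF V]]
  by (auto simp: cg_def)

lemma cg_diff: "cg V x y \<Longrightarrow> cg V x' y' \<Longrightarrow> cg V (x - x') (y - y')"
  using cg_add[OF _ cg_uminus, of x y x' y'] by simp

lemma cg_mult:
  assumes "cg V x y" "cg V x' y'"
  shows "cg V (x * x') (y * y')"
proof -
  have "(x - y) * x' + y * (x' - y') \<in> maxid V"
    using assms by (intro maxid_add[OF V] maxid_mult(2)[OF V] maxid_mult(1)[OF V]) (auto simp: cg_def)
  then show ?thesis using assms is_subringD(4)[OF valring_subring[OF V]] by (simp add: cg_def algebra_simps)
qed

lemmas cg_ops = cg_add cg_diff cg_uminus cg_mult

lemma cg3_invol: "cgP V P Q \<Longrightarrow> cg3 V p q \<Longrightarrow> cg3 V (invol P l p) (invol Q l q)"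
  by (cases P; cases Q; cases p; cases q; cases l) (auto intro!: cg_ops)

lemma cg3_act: "cgP V P Q \<Longrightarrow> cg3 V p q \<Longrightarrow> cg3 V (act P w p) (act Q w q)"
  by (induction w) (auto intro: cg3_invol)

lemma cg3_dinvol: "cg3 V p q \<Longrightarrow> cg3 V v v' \<Longrightarrow> cg3 V (dinvol l p v) (dinvol l q v')"
  by (cases p; cases q; cases v; cases v'; cases l) (auto intro!: cg_ops)

lemma cg3_dact: "cgP V P Q \<Longrightarrow> cg3 V p q \<Longrightarrow> cg3 V v v' \<Longrightarrow> cg3 V (dact P w p v) (dact Q w q v')"
  by (induction w) (auto intro!: cg3_dinvol cg3_act)

lemma cg3_refl: "(\<And>l. co l p \<in> V) \<Longrightarrow> cg3 V p p" by (simp add: cg3_def cg_refl)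

lemma cg3_sym: "cg3 V p q \<Longrightarrow> cg3 V q p" by (simp add: cg3_def cg_sym)

lemma cg3_trans: "cg3 V p q \<Longrightarrow> cg3 V q r \<Longrightarrow> cg3 V p r" unfolding cg3_def using cg_trans by blast

lemma cg_tr3:
  assumes "cgP V P Q" "cg3 V p q"
  shows "cg V (tr3 (dact P w p)) (tr3 (dact Q w q))"
proof -
  have "0 \<in> V" "1 \<in> V" using is_subringD[OF valring_subring[OF V]] by auto
  then have "cg3 V (1, 0, 0) (1, 0, 0)" "cg3 V (0, 1, 0) (0, 1, 0)" "cg3 V (0, 0, 1) (0, 0, 1)"
    by (auto intro: cg_refl)
  then show ?thesis
    using cg3_dact[OF assms] unfolding tr3_def by (intro cg_add) (auto simp: cg3_def)
qed

lemma cg_in: "cg V x y \<Longrightarrow> x \<in> V" "cg V x y \<Longrightarrow> y \<in> V" by (auto simp: cg_def)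

lemma cg_dt: "cg3 V p q \<Longrightarrow> cg3 V v v' \<Longrightarrow> cg V (dt p v) (dt q v')"
  by (cases p; cases q; cases v; cases v') (auto intro!: cg_ops)

lemma cg3_cr: "cg3 V p q \<Longrightarrow> cg3 V v v' \<Longrightarrow> cg3 V (cr p v) (cr q v')"
  by (cases p; cases q; cases v; cases v') (auto intro!: cg_ops)

end

subsection \<open>Monomial parametrization of the Cayley cubic\<close>

abbreviation cayley :: param where "cayley \<equiv> (0, 0, 0, 4)"

fun mon :: "letter \<Rightarrow> complex \<times> complex \<Rightarrow> complex \<times> complex" where
  "mon X (u, v) = (u * v^2, inverse v)"
| "mon Y (u, v) = (inverse u, u^2 * v)"
| "mon Z (u, v) = (u, inverse v)"

text \<open>The quotient map from the torus to the Cayley cubic; it identifies \<open>(u, v)\<close>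
  with the pair of inverses. The minus signs match the sign of \<open>x * y * z\<close> in the
  surface equation.\<close>

fun mpt :: "complex \<times> complex \<Rightarrow> point" where
  "mpt (u, v) = (- (u + inverse u), - (v + inverse v), - (u * v + inverse (u * v)))"

text \<open>The derivative of \<^const>\<open>mpt\<close> with respect to the logarithms of \<open>u\<close> and \<open>v\<close>.\<close>

fun dmpt :: "complex \<times> complex \<Rightarrow> complex \<times> complex \<Rightarrow> point" where
  "dmpt (u, v) (a, b) = (- ((u - inverse u) * a), - ((v - inverse v) * b), - ((u * v - inverse (u * v)) * (a + b)))"

definition monw :: "letter list \<Rightarrow> complex \<times> complex \<Rightarrow> complex \<times> complex" where
  "monw w = foldr mon w"

lemma mon_nonzero: "u \<noteq> 0 \<Longrightarrow> v \<noteq> 0 \<Longrightarrow> mon l (u, v) = (u', v') \<Longrightarrow> u' \<noteq> 0 \<and> v' \<noteq> 0"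
  by (cases l) auto

lemma monw_nonzero:
  assumes "u \<noteq> 0" "v \<noteq> 0"
  shows "fst (monw w (u, v)) \<noteq> 0 \<and> snd (monw w (u, v)) \<noteq> 0"
proof (induction w)
  case (Cons l w)
  obtain a b where ab: "monw w (u, v) = (a, b)" by (cases "monw w (u, v)")
  obtain a' b' where ab': "mon l (a, b) = (a', b')" by (cases "mon l (a, b)")
  have "monw (l # w) (u, v) = (a', b')" using ab ab' by (simp add: monw_def)
  then show ?case using mon_nonzero[OF _ _ ab'] Cons ab by simp
qed (simp add: monw_def assms)

lemma invol_mpt: "u \<noteq> 0 \<Longrightarrow> v \<noteq> 0 \<Longrightarrow> invol cayley l (mpt (u, v)) = mpt (mon l (u, v))"
  by (cases l) (auto simp: field_simps power2_eq_square)

lemma dinvol_mpt: "u \<noteq> 0 \<Longrightarrow> v \<noteq> 0 \<Longrightarrow> dinvol l (mpt (u, v)) (dmpt (u, v) ab) = dmpt (mon l (u, v)) (lin l ab)"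
  by (cases l; cases ab) (auto simp: field_simps power2_eq_square)

lemma act_mpt:
  assumes "u \<noteq> 0" "v \<noteq> 0"
  shows "act cayley w (mpt (u, v)) = mpt (monw w (u, v))"
    "dact cayley w (mpt (u, v)) (dmpt (u, v) ab) = dmpt (monw w (u, v)) (linw w ab)"
proof -
  show 1: "act cayley w (mpt (u, v)) = mpt (monw w (u, v))" for w
  proof (induction w)
    case (Cons l w)
    then show ?case using monw_nonzero[OF assms, of w] invol_mpt[of "fst (monw w (u, v))" "snd (monw w (u, v))" l]
      by (simp add: monw_def del: mpt.simps)
  qed (simp add: monw_def)
  show "dact cayley w (mpt (u, v)) (dmpt (u, v) ab) = dmpt (monw w (u, v)) (linw w ab)"
  proof (induction w)
    case (Cons l w)
    then show ?case using monw_nonzero[OF assms, of w] dinvol_mpt[of "fst (monw w (u, v))" "snd (monw w (u, v))" l]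
      by (simp add: monw_def 1[unfolded monw_def] del: mpt.simps dmpt.simps)
  qed (simp add: monw_def)
qed

text \<open>In logarithmic coordinates the invariant area form is constant.\<close>

lemma grad_mpt:
  assumes "u \<noteq> 0" "v \<noteq> 0"
  shows "cr (dmpt (u, v) (1, 0)) (dmpt (u, v) (0, 1)) = csc (- 1) (grad cayley (mpt (u, v)))"
  using assms by (simp add: field_simps power2_eq_square)

subsection \<open>The singular points of the Cayley cubic\<close>

text \<open>Up to sign the second order term of \<open>mpt\<close> at a singular point, in
  logarithmic coordinates; it parametrizes the tangent cone.\<close>

fun quad :: "complex \<Rightarrow> complex \<Rightarrow> complex \<times> complex \<Rightarrow> point" where
  "quad e f (a, b) = (e * a^2, f * b^2, e * f * (a + b)^2)"

text \<open>At these four points the first derivative of \<open>mpt\<close> vanishes, and the second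
  order term is transformed through \<open>lin\<close> applied to the logarithms.\<close>

lemma singular_cayley:
  assumes "e^2 = 1" "f^2 = 1"
  shows "invol cayley l (- (2 * e), - (2 * f), - (2 * e * f)) = (- (2 * e), - (2 * f), - (2 * e * f))"
    "dinvol l (- (2 * e), - (2 * f), - (2 * e * f)) (quad e f ab) = quad e f (lin l ab)"
proof -
  have ef: "e * e = 1" "f * f = 1" using assms by (auto simp: power2_eq_square)
  have s': "x * (e * e) = x" "x * (f * f) = x" "e * (e * x) = x" "f * (f * x) = x" "e * (f * (e * x)) = f * x" "f * (e * (f * x)) = e * x" for x
    using ef by (metis mult.assoc mult.commute mult_1)+
  show "invol cayley l (- (2 * e), - (2 * f), - (2 * e * f)) = (- (2 * e), - (2 * f), - (2 * e * f))"
    by (cases l) (auto simp: ef s' algebra_simps)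
  show "dinvol l (- (2 * e), - (2 * f), - (2 * e * f)) (quad e f ab) = quad e f (lin l ab)"
    by (cases l; cases ab) (auto simp: ef s' algebra_simps power2_eq_square)
qed

text \<open>The derivative at a singular point is the symmetric square of the integer matrix, whose
  trace is the square of the trace minus the determinant.\<close>

lemma singular_trace:
  assumes e: "e^2 = 1" "f^2 = 1" and ev: "even (length w)"
  shows "tr3 (dact cayley w (- (2 * e), - (2 * f), - (2 * e * f))) = of_int ((mat11 w + mat22 w)^2 - 1)"
proof -
  let ?p = "(- (2 * e), - (2 * f), - (2 * e * f))"
  define L where "L = dact cayley w ?p"
  have act: "act cayley w ?p = ?p" for w by (induction w) (auto simp: singular_cayley[OF e] simp del: invol.simps)
  have L: "L (quad e f ab) = quad e f (linw w ab)" for ab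
    unfolding L_def by (induction w) (auto simp: act singular_cayley[OF e] simp del: invol.simps dinvol.simps)
  have ef: "e * e = 1" "f * f = 1" using e by (auto simp: power2_eq_square)
  have s': "e * (e * x) = x" "f * (f * x) = x" "e * (f * (e * x)) = f * x" "f * (e * (f * x)) = e * x" for x
    using ef by (metis mult.assoc mult.commute mult_1)+
  have lin: "L (v + v') = L v + L v'" "L (csc u v) = csc u (L v)" for u v v'
    by (simp_all add: L_def dact_linear)
  define a b c d where abcd: "a = (of_int (mat11 w) :: complex)" "b = (of_int (mat12 w) :: complex)"
    "c = (of_int (mat21 w) :: complex)" "d = (of_int (mat22 w) :: complex)"
  have lw: "linw w (x, y) = (a * x + b * y, c * x + d * y)" for x y :: complex
    unfolding abcd by (rule linw_eq)
  have det: "a * d - b * c = 1"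
  proof -
    have "(of_int (mat11 w * mat22 w - mat12 w * mat21 w) :: complex) = of_int 1" using mat_det[OF ev] by simp
    then show ?thesis by (simp add: abcd)
  qed
  \<comment> \<open>The derivative is known only on the tangent cone, so the standard basis is
    written in terms of three vectors of the cone.\<close>
  have v1: "(1, 0, 0) = csc (e / 2) (csc 3 (quad e f (1, 0)) + (quad e f (0, 1) + csc (- 1) (quad e f (1, 1))))"
    by (simp add: ef s' field_simps)
  have v2: "(0, 1, 0) = csc (f / 2) (csc 3 (quad e f (0, 1)) + (quad e f (1, 0) + csc (- 1) (quad e f (1, 1))))"
    by (simp add: ef s' field_simps)
  have v3: "(0, 0, 1) = csc (e * f / 2) (quad e f (1, 1) + csc (- 1) (quad e f (1, 0) + quad e f (0, 1)))"
    by (simp add: ef s' field_simps)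
  have "tr3 L = (3 * a^2 + b^2 - (a + b)^2) / 2 + (3 * d^2 + c^2 - (c + d)^2) / 2
      + ((a + b + c + d)^2 - (a + c)^2 - (b + d)^2) / 2"
    unfolding tr3_def v1 v2 v3 lin L lw
    by (simp add: ef s' field_simps power2_eq_square)
  also have "\<dots> = (a + d)^2 - (a * d - b * c)" by (simp add: field_simps power2_eq_square)
  finally show ?thesis unfolding det by (simp add: L_def abcd)
qed

subsection \<open>Traces at fixed points modulo the maximal ideal\<close>

lemma cg3_mpt:
  assumes V: "valring V" and "cg V u u'" "cg V v v'" "cg V (inverse u) (inverse u')" "cg V (inverse v) (inverse v')"
  shows "cg3 V (mpt (u, v)) (mpt (u', v'))"
  using assms(2-) by (auto intro!: cg_ops[OF V])

lemma cg3_dmpt: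
  assumes V: "valring V" and "cg V u u'" "cg V v v'" "cg V (inverse u) (inverse u')" "cg V (inverse v) (inverse v')"
    and "a \<in> V" "b \<in> V"
  shows "cg3 V (dmpt (u, v) (a, b)) (dmpt (u', v') (a, b))"
  using assms(2-) is_subringD(6)[OF valring_subring[OF V]] by (auto intro!: cg_ops[OF V] cg_refl[OF V])

lemma cg_inverse:
  assumes V: "valring V" and "cg V u u'" "inverse u \<in> V" "inverse u' \<in> V" "u \<noteq> 0" "u' \<noteq> 0"
  shows "cg V (inverse u) (inverse u')"
proof -
  have "inverse u * inverse u' \<in> V" using assms by (simp add: is_subringD valring_subring)
  then have "(inverse u * inverse u') * - (u - u') \<in> maxid V"
    using assms(2) by (intro maxid_mult[OF V] maxid_uminus[OF V]) (auto simp: cg_def)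
  moreover have "(inverse u * inverse u') * - (u - u') = inverse u - inverse u'"
    using assms by (simp add: field_simps)
  ultimately show ?thesis using assms by (simp add: cg_def)
qed

lemma cg_plus_inverse:
  assumes V: "valring V" and u: "u \<noteq> 0" "u \<in> V" "inverse u \<in> V" and u': "u' \<noteq> 0" "u' \<in> V"
    and eq: "u' + inverse u' - (u + inverse u) \<in> maxid V"
  shows "cg V u' u \<or> cg V u' (inverse u)"
proof -
  have "u' * (u' + inverse u' - (u + inverse u)) \<in> maxid V" using u' eq by (intro maxid_mult[OF V])
  moreover have "u' * (u' + inverse u' - (u + inverse u)) = (u' - u) * (u' - inverse u)"
    using u u' by (simp add: field_simps)
  ultimately show ?thesis using maxid_prime[OF V] u u' unfolding cg_def by metis
qed

definition unit_pair :: "complex set \<Rightarrow> complex \<times> complex \<Rightarrow> bool" where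
  "unit_pair V uv \<longleftrightarrow> fst uv \<noteq> 0 \<and> snd uv \<noteq> 0 \<and> fst uv \<in> V \<and> snd uv \<in> V \<and>
     inverse (fst uv) \<in> V \<and> inverse (snd uv) \<in> V"

lemma unit_pair_mon: "valring V \<Longrightarrow> unit_pair V uv \<Longrightarrow> unit_pair V (mon l uv)"
  by (cases uv; cases l) (auto simp: unit_pair_def is_subringD valring_subring is_subring_power power_inverse[symmetric])

lemma unit_pair_monw: "valring V \<Longrightarrow> unit_pair V uv \<Longrightarrow> unit_pair V (monw w uv)"
  by (induction w) (auto simp: monw_def unit_pair_mon)

text \<open>Choose \<open>u\<close> and \<open>v\<close> to match \<open>x\<close> and
  \<open>y\<close>. Modulo the ideal, the surface equation then factors in \<open>z\<close> into the
  possibilities \<open>u * v\<close> and \<open>u * inverse v\<close>, and a prime ideal contains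
  one of the factors.\<close>

lemma cayley_parametrization:
  assumes V: "valring V" and P: "cgP V P cayley" and p: "p \<in> cubic_surface P" "\<And>l. co l p \<in> V"
  obtains u v where "unit_pair V (u, v)" "cg3 V p (mpt (u, v))"
proof -
  obtain A B C D where P': "P = (A, B, C, D)" by (cases P)
  obtain x y z where p': "p = (x, y, z)" by (cases p)
  note D = is_subringD[OF valring_subring[OF V]]
  have xyz: "x \<in> V" "y \<in> V" "z \<in> V" using p(2)[of X] p(2)[of Y] p(2)[of Z] by (auto simp: p')
  have root: "\<exists>u. u \<noteq> 0 \<and> u \<in> V \<and> inverse u \<in> V \<and> x = - (u + inverse u)" if "x \<in> V" for x
  proof -
    obtain r s where rs: "r + s = - x" "r * s = 1" using quadratic_roots by blast
    have "r^2 + x * r + 1 = 0" "s^2 + x * s + 1 = 0" unfolding quadratic_factor[OF rs] by auto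
    then have "r \<in> V" "s \<in> V" using that D(1) by (auto intro: quadratic_integral[OF V])
    moreover have "s = inverse r" "r \<noteq> 0" using rs(2) by (auto simp: inverse_unique)
    ultimately show ?thesis using rs(1) by (intro exI[of _ r]) (auto simp: add_eq_0_iff)
  qed
  obtain u where u: "u \<noteq> 0" "u \<in> V" "inverse u \<in> V" "x = - (u + inverse u)" using root[OF xyz(1)] by blast
  obtain v where v: "v \<noteq> 0" "v \<in> V" "inverse v \<in> V" "y = - (v + inverse v)" using root[OF xyz(2)] by blast
  have "(z + (u * v + inverse (u * v))) * (z + (u * inverse v + inverse (u * inverse v)))
      = z^2 + x * y * z + x^2 + y^2 - 4"
    unfolding u(4) v(4) using u(1) v(1) by (simp add: field_simps power2_eq_square)
  also have "\<dots> = A * x + B * y + C * z + (D - 4)" using p(1) by (simp add: P' p' algebra_simps)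
  also have "\<dots> \<in> maxid V"
    using P xyz by (intro maxid_add[OF V] maxid_mult(2)[OF V]) (auto simp: P' cg_def)
  finally consider "z + (u * v + inverse (u * v)) \<in> maxid V" | "z + (u * inverse v + inverse (u * inverse v)) \<in> maxid V"
    using maxid_prime[OF V] by blast
  then show ?thesis
  proof cases
    case 1
    have t: "- (u * v + inverse (u * v)) \<in> V" using u v D by (auto simp: inverse_mult_distrib)
    then have "cg V z (- (u * v + inverse (u * v)))"
      unfolding cg_def diff_minus_eq_add using 1 xyz by blast
    then have "cg3 V p (mpt (u, v))"
      unfolding p' mpt.simps cg3_simps u(4)[symmetric] v(4)[symmetric] using xyz by (intro conjI cg_refl[OF V])
    then show ?thesis using that[of u v] u v by (simp add: unit_pair_def)
  next
    case 2
    have t: "- (u * inverse v + inverse (u * inverse v)) \<in> V" using u v D by (auto simp: inverse_mult_distrib)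
    then have "cg V z (- (u * inverse v + inverse (u * inverse v)))"
      unfolding cg_def diff_minus_eq_add using 2 xyz by blast
    moreover have "y = - (inverse v + inverse (inverse v))" using v(4) by simp
    ultimately have "cg3 V p (mpt (u, inverse v))"
      unfolding p' mpt.simps cg3_simps u(4)[symmetric] using xyz cg_refl[OF V] by metis
    then show ?thesis using that[of u "inverse v"] u v by (simp add: unit_pair_def)
  qed
qed

lemma cg3_grad: "valring V \<Longrightarrow> cgP V P Q \<Longrightarrow> 2 \<in> V \<Longrightarrow> cg3 V p q \<Longrightarrow> cg3 V (grad P p) (grad Q q)"
  by (cases P; cases Q; cases p; cases q) (auto intro!: cg_ops cg_refl)

text \<open>Each coordinate determines its monomial up to inversion. If only one of \<open>u\<close>
  and \<open>v\<close> is inverted, the coordinate of \<open>u * v\<close> shows that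
  \<open>u\<close> or \<open>v\<close> is congruent to its own inverse, and the mixed case falls
  under one of the other two.\<close>

lemma monomial_fixed:
  assumes V: "valring V" and uv: "unit_pair V (u, v)" "unit_pair V (u', v')"
    and eq: "cg3 V (mpt (u', v')) (mpt (u, v))"
  shows "cg V u' u \<and> cg V v' v \<or> cg V u' (inverse u) \<and> cg V v' (inverse v)"
proof -
  have u: "u \<noteq> 0" "u \<in> V" "inverse u \<in> V" "v \<noteq> 0" "v \<in> V" "inverse v \<in> V"
    and u': "u' \<noteq> 0" "u' \<in> V" "inverse u' \<in> V" "v' \<noteq> 0" "v' \<in> V" "inverse v' \<in> V"
    using uv by (auto simp: unit_pair_def)
  note refl = cg_refl[OF V] and mult = cg_mult[OF V] and trans = cg_trans[OF V] and sym = cg_sym[OF V]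
  have "x' + inverse x' - (x + inverse x) \<in> maxid V" if "cg V (- (x' + inverse x')) (- (x + inverse x))" for x x'
    using cg_uminus[OF V that] by (simp add: cg_def algebra_simps)
  note pm = this
  have 1: "cg V u' u \<or> cg V u' (inverse u)"
    by (rule cg_plus_inverse[OF V]) (use u u' eq pm[of u' u] in auto)
  have 2: "cg V v' v \<or> cg V v' (inverse v)"
    by (rule cg_plus_inverse[OF V]) (use u u' eq pm[of v' v] in auto)
  have 3: "cg V (u' * v') (u * v) \<or> cg V (u' * v') (inverse (u * v))"
    by (rule cg_plus_inverse[OF V]) (use u u' eq pm[of "u' * v'" "u * v"] in \<open>auto simp: is_subringD valring_subring[OF V]\<close>)
  have cancel: "cg V b c" if "cg V (a * b) (a * c)" "a \<noteq> 0" "inverse a \<in> V" for a b c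
  proof -
    have "cg V (inverse a * (a * b)) (inverse a * (a * c))" by (rule mult[OF refl[OF that(3)] that(1)])
    then show ?thesis using that by (simp add: mult.assoc[symmetric])
  qed
  consider "cg V u' u" "cg V v' v" | "cg V u' (inverse u)" "cg V v' (inverse v)"
    | "cg V u' u" "cg V v' (inverse v)" | "cg V u' (inverse u)" "cg V v' v"
    using 1 2 by blast
  then show ?thesis
  proof cases
    case 3
    have p: "cg V (u * inverse v) (u' * v')" by (rule sym[OF mult[OF 3]])
    from \<open>cg V (u' * v') (u * v) \<or> cg V (u' * v') (inverse (u * v))\<close> show ?thesis
    proof
      assume "cg V (u' * v') (u * v)"
      then have "cg V (inverse v) v" using cancel[of u "inverse v" v] p trans u by blast
      then show ?thesis using 3 trans by blast
    next
      assume "cg V (u' * v') (inverse (u * v))"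
      then have "cg V (inverse v * u) (inverse v * inverse u)" using p trans by (metis inverse_mult_distrib mult.commute)
      then have "cg V u (inverse u)" using cancel[of "inverse v" u "inverse u"] u by simp
      then show ?thesis using 3 trans by blast
    qed
  next
    case 4
    have p: "cg V (inverse u * v) (u' * v')" by (rule sym[OF mult[OF 4]])
    from \<open>cg V (u' * v') (u * v) \<or> cg V (u' * v') (inverse (u * v))\<close> show ?thesis
    proof
      assume "cg V (u' * v') (u * v)"
      then have "cg V (v * inverse u) (v * u)" using p trans by (metis mult.commute)
      then have "cg V (inverse u) u" using cancel[of v "inverse u" u] u by simp
      then show ?thesis using 4 trans by blast
    next
      assume "cg V (u' * v') (inverse (u * v))"
      then have "cg V (inverse u * v) (inverse u * inverse v)" using p trans by (metis inverse_mult_distrib)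
      then have "cg V v (inverse v)" using cancel[of "inverse u" v "inverse v"] u by simp
      then show ?thesis using 4 trans by blast
    qed
  qed auto
qed

lemma dt_csc: "dt (csc u v) w = u * dt v w" "dt v (csc u w) = u * dt v w"
  by (cases v; cases w; simp add: algebra_simps)+

lemma cr_add_csc: "cr (csc k (csc m a + csc n b)) b = csc (k * m) (cr a b)"
  "cr a (csc k (csc m a + csc n b)) = csc (k * n) (cr a b)"
  by (cases a; cases b; simp add: algebra_simps)+

lemma dmpt_lin: "dmpt uv (m, n) = csc m (dmpt uv (1, 0)) + csc n (dmpt uv (0, 1))"
  by (cases uv) (simp add: algebra_simps)

text \<open>At a smooth reduction the derivative acts on the tangent plane by the integer matrix up
  to sign, and by 1 transversally because the gradient is preserved. At a singular reduction
  \<open>singular_trace\<close> applies.\<close>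

theorem trace_at_fixed_point:
  assumes V: "valring V" and int: "\<And>n. of_int n \<in> V" and P: "cgP V P cayley"
    and p: "p \<in> cubic_surface P" "\<And>l. co l p \<in> V" and fix_p: "act P w p = p" and ev: "even (length w)"
  shows "\<exists>T \<in> {mat11 w + mat22 w, - (mat11 w + mat22 w), (mat11 w + mat22 w)^2 - 2}.
    tr3 (dact P w p) - 1 - of_int T \<in> maxid V"
proof -
  note D = is_subringD[OF valring_subring[OF V]]
  note refl = cg_refl[OF V] and mult = cg_mult[OF V] and trans = cg_trans[OF V] and sym = cg_sym[OF V]
  obtain u v where uv: "unit_pair V (u, v)" and pq: "cg3 V p (mpt (u, v))"
    using cayley_parametrization[OF V P p] by blast
  have u: "u \<noteq> 0" "u \<in> V" "inverse u \<in> V" "v \<noteq> 0" "v \<in> V" "inverse v \<in> V"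
    using uv by (auto simp: unit_pair_def)
  define q where "q = mpt (u, v)"
  obtain u' v' where uv': "monw w (u, v) = (u', v')" by (cases "monw w (u, v)")
  have unit': "unit_pair V (u', v')" using unit_pair_monw[OF V uv, of w] uv' by simp
  have u': "u' \<noteq> 0" "u' \<in> V" "inverse u' \<in> V" "v' \<noteq> 0" "v' \<in> V" "inverse v' \<in> V"
    using unit' by (auto simp: unit_pair_def)
  have "cg3 V (act P w p) (act cayley w q)" using P pq unfolding q_def by (intro cg3_act[OF V])
  then have pq': "cg3 V (act cayley w q) q"
    using fix_p pq cg3_trans[OF V] cg3_sym[OF V] unfolding q_def by metis
  have "cg3 V (mpt (u', v')) (mpt (u, v))"
    using pq' act_mpt(1)[OF u(1,4), of w] uv' unfolding q_def by metis
  then have cases': "cg V u' u \<and> cg V v' v \<or> cg V u' (inverse u) \<and> cg V v' (inverse v)"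
    by (rule monomial_fixed[OF V uv unit'])
  \<comment> \<open>The sign records whether the image reduces to the same pair or to the pair of
    inverses, as inversion changes the sign of \<open>dmpt\<close>.\<close>
  have "\<exists>e \<in> {1, -1}. \<forall>m n. m \<in> V \<longrightarrow> n \<in> V \<longrightarrow> cg3 V (dmpt (u', v') (m, n)) (csc (of_int e) (dmpt (u, v) (m, n)))"
    using cases'
  proof
    assume h: "cg V u' u \<and> cg V v' v"
    then have "cg V (inverse u') (inverse u)" "cg V (inverse v') (inverse v)"
      using u u' by (auto intro: cg_inverse[OF V])
    then show ?thesis using h by (intro bexI[of _ 1]) (auto intro!: cg3_dmpt[OF V] simp del: dmpt.simps)
  next
    assume h: "cg V u' (inverse u) \<and> cg V v' (inverse v)"
    have "cg V (inverse u') (inverse (inverse u))"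
      by (rule cg_inverse[OF V]) (use h u u' in auto)
    moreover have "cg V (inverse v') (inverse (inverse v))"
      by (rule cg_inverse[OF V]) (use h u u' in auto)
    moreover have "csc (-1) (dmpt (u, v) (m, n)) = dmpt (inverse u, inverse v) (m, n)" for m n
      using u by (simp add: algebra_simps)
    ultimately show ?thesis using h
      by (intro bexI[of _ "-1"]) (auto intro!: cg3_dmpt[OF V] simp del: dmpt.simps)
  qed
  then obtain e where e: "e \<in> {1, -1 :: int}"
    "\<And>m n. m \<in> V \<Longrightarrow> n \<in> V \<Longrightarrow> cg3 V (dmpt (u', v') (m, n)) (csc (of_int e) (dmpt (u, v) (m, n)))"
    by blast
  define L where "L = dact cayley w q"
  have lin: "L (v + v') = L v + L v'" "L (csc u v) = csc u (L v)" for u v v'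
    by (simp_all add: L_def dact_linear)
  define a where "a = dmpt (u, v) (1, 0)"
  define b where "b = dmpt (u, v) (0, 1)"
  define t where "t = mat11 w + mat22 w"
  have trcg: "cg V (tr3 (dact P w p)) (tr3 L)" unfolding L_def q_def by (rule cg_tr3[OF V P pq])
  have coV: "co l q \<in> V" for l using pq unfolding q_def cg3_def cg_def by blast
  have abV: "cg3 V a a" "cg3 V b b" unfolding a_def b_def
    using u D by (auto intro!: cg3_dmpt[OF V] refl simp del: dmpt.simps)
  have crab: "cr a b = csc (-1) (grad cayley q)"
    unfolding a_def b_def q_def by (rule grad_mpt[OF u(1,4)])
  have La: "cg3 V (L a) (csc (of_int e) (csc (of_int (mat11 w)) a + csc (of_int (mat21 w)) b))"
  proof -
    have "L a = dmpt (u', v') (of_int (mat11 w), of_int (mat21 w))"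
      unfolding L_def q_def a_def act_mpt(2)[OF u(1,4)] uv' linw_eq by simp
    then show ?thesis using e(2)[OF int int, of "mat11 w" "mat21 w"] unfolding a_def b_def dmpt_lin[of _ "of_int _"] by simp
  qed
  have Lb: "cg3 V (L b) (csc (of_int e) (csc (of_int (mat12 w)) a + csc (of_int (mat22 w)) b))"
  proof -
    have "L b = dmpt (u', v') (of_int (mat12 w), of_int (mat22 w))"
      unfolding L_def q_def b_def act_mpt(2)[OF u(1,4)] uv' linw_eq by simp
    then show ?thesis using e(2)[OF int int, of "mat12 w" "mat22 w"] unfolding a_def b_def dmpt_lin[of _ "of_int _"] by simp
  qed
  have cayV: "cgP V cayley cayley" using D int[of 4] by (auto intro!: refl)
  \<comment> \<open>The trace identity with an arbitrary third vector \<open>c\<close>: the first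
    two terms give the trace on the tangent plane, the last one contributes 1.\<close>
  have key: "(tr3 L - 1 - of_int (e * t)) * dt (cr a b) c \<in> maxid V" if c: "cg3 V c c" for c
  proof -
    have "cg V (dt (cr (L a) b) c) (dt (csc (of_int e * of_int (mat11 w)) (cr a b)) c)"
      using cg_dt[OF V cg3_cr[OF V La abV(2)] c] unfolding cr_add_csc .
    moreover have "cg V (dt (cr a (L b)) c) (dt (csc (of_int e * of_int (mat22 w)) (cr a b)) c)"
      using cg_dt[OF V cg3_cr[OF V abV(1) Lb] c] unfolding cr_add_csc .
    moreover have "cg V (dt (cr a b) (L c)) (dt (cr a b) c)"
    proof -
      have "2 \<in> V" using int[of 2] by simp
      then have "cg3 V (grad cayley q) (grad cayley (act cayley w q))"
        using cg3_sym[OF V pq'] by (intro cg3_grad[OF V cayV])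
      moreover have "cg3 V (L c) (L c)"
        unfolding L_def by (rule cg3_dact[OF V cayV cg3_refl[OF V coV] c])
      ultimately have "cg V (dt (grad cayley q) (L c)) (dt (grad cayley (act cayley w q)) (L c))"
        by (intro cg_dt[OF V])
      then have "cg V (dt (grad cayley q) (L c)) (dt (grad cayley q) c)"
        unfolding L_def grad_dact .
      then have "cg V (- dt (grad cayley q) (L c)) (- dt (grad cayley q) c)" by (rule cg_uminus[OF V])
      then show ?thesis unfolding crab dt_csc by simp
    qed
    ultimately have "cg V (dt (cr (L a) b) c + dt (cr a (L b)) c + dt (cr a b) (L c))
       (dt (csc (of_int e * of_int (mat11 w)) (cr a b)) c + dt (csc (of_int e * of_int (mat22 w)) (cr a b)) c + dt (cr a b) c)"
      by (intro cg_add[OF V])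
    then have "cg V (tr3 L * dt (cr a b) c) ((of_int (e * t) + 1) * dt (cr a b) c)"
      unfolding trace_identity[OF lin, symmetric] dt_csc t_def by (simp add: algebra_simps)
    then show ?thesis by (simp add: cg_def algebra_simps)
  qed
  show ?thesis
  proof (cases "\<exists>l. co l (cr a b) \<notin> maxid V")
    case True
    then obtain l where l: "co l (cr a b) \<notin> maxid V" by blast
    define c :: point where "c = (if l = X then (1, 0, 0) else if l = Y then (0, 1, 0) else (0, 0, 1))"
    have "dt (cr a b) c = co l (cr a b)" unfolding c_def by (cases "cr a b"; cases l) auto
    moreover have "cg3 V c c" unfolding c_def using D by (auto intro: refl)
    ultimately have "tr3 L - 1 - of_int (e * t) \<in> maxid V" using key[of c] l maxid_prime[OF V] by auto
    then have "(tr3 (dact P w p) - tr3 L) + (tr3 L - 1 - of_int (e * t)) \<in> maxid V"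
      using trcg by (intro maxid_add[OF V]) (auto simp: cg_def)
    then have "tr3 (dact P w p) - 1 - of_int (e * t) \<in> maxid V" by (simp add: algebra_simps)
    then show ?thesis using e(1) by (intro bexI[of _ "e * t"]) (auto simp: t_def)
  next
    case False
    define U where "U = u - inverse u" define W where "W = u * v - inverse (u * v)" define V' where "V' = v - inverse v"
    have "cr a b = (- (W * V'), - (U * W), U * V')"
      unfolding a_def b_def U_def W_def V'_def by (simp add: algebra_simps)
    then have m: "- (W * V') \<in> maxid V" "- (U * W) \<in> maxid V" "U * V' \<in> maxid V"
      using False by (metis co.simps)+
    then have m: "W * V' \<in> maxid V" "U * W \<in> maxid V" "U * V' \<in> maxid V"
      using maxid_uminus[OF V m(1)] maxid_uminus[OF V m(2)] by auto
    have sq: "x^2 - 1 \<in> maxid V" if "x - inverse x \<in> maxid V" "x \<in> V" "x \<noteq> 0" for x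
      using maxid_mult(1)[OF V that(2,1)] that(3) by (simp add: right_diff_distrib power2_eq_square)
    have uvV: "u * v \<in> V" "u * v \<noteq> 0" "u^2 \<in> V" "v^2 \<in> V" using u D by (auto simp: power2_eq_square)
    \<comment> \<open>Two of the three differences vanish modulo the ideal, which makes
      \<open>u^2\<close> and \<open>v^2\<close> congruent to 1: the point reduces to a singular
      point.\<close>
    have "U \<in> maxid V \<and> V' \<in> maxid V \<or> U \<in> maxid V \<and> W \<in> maxid V \<or> V' \<in> maxid V \<and> W \<in> maxid V"
      using m maxid_prime[OF V] by blast
    then have "u^2 - 1 \<in> maxid V \<and> v^2 - 1 \<in> maxid V"
    proof (elim disjE conjE)
      assume "U \<in> maxid V" "V' \<in> maxid V"
      then show ?thesis using sq u by (auto simp: U_def V'_def)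
    next
      assume "U \<in> maxid V" "W \<in> maxid V"
      then have 1: "u^2 - 1 \<in> maxid V" "(u * v)^2 - 1 \<in> maxid V" using sq[of u] sq[of "u * v"] u uvV by (auto simp: U_def W_def)
      then have "((u * v)^2 - 1) - v^2 * (u^2 - 1) \<in> maxid V"
        by (intro maxid_diff[OF V 1(2) maxid_mult(1)[OF V uvV(4) 1(1)]])
      then show ?thesis using 1 by (simp add: algebra_simps power_mult_distrib)
    next
      assume "V' \<in> maxid V" "W \<in> maxid V"
      then have 1: "v^2 - 1 \<in> maxid V" "(u * v)^2 - 1 \<in> maxid V" using sq[of v] sq[of "u * v"] u uvV by (auto simp: V'_def W_def)
      then have "((u * v)^2 - 1) - u^2 * (v^2 - 1) \<in> maxid V"
        by (intro maxid_diff[OF V 1(2) maxid_mult(1)[OF V uvV(3) 1(1)]])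
      then show ?thesis using 1 by (simp add: algebra_simps power_mult_distrib)
    qed
    moreover have sgn: "\<exists>s. s^2 = 1 \<and> inverse s = s \<and> s \<in> V \<and> s \<noteq> 0 \<and> cg V x s" if "x^2 - 1 \<in> maxid V" "x \<in> V" for x
    proof -
      have "(x - 1) * (x - (-1)) \<in> maxid V" using that by (simp add: algebra_simps power2_eq_square)
      then have "x - 1 \<in> maxid V \<or> x - (-1) \<in> maxid V" by (rule maxid_prime[OF V])
      then show ?thesis
      proof
        assume "x - 1 \<in> maxid V"
        then show ?thesis using D that by (intro exI[of _ 1]) (auto simp: cg_def)
      next
        assume "x - (-1) \<in> maxid V"
        then show ?thesis using D that by (intro exI[of _ "-1"]) (auto simp: cg_def)
      qed
    qed
    ultimately obtain s r where s: "s^2 = 1" "inverse s = s" "s \<in> V" "s \<noteq> 0" "cg V u s"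
      and r: "r^2 = 1" "inverse r = r" "r \<in> V" "r \<noteq> 0" "cg V v r"
      using sgn[of u] sgn[of v] u by blast
    have "cg V (inverse u) (inverse s)"
      by (rule cg_inverse[OF V]) (use s u in auto)
    moreover have "cg V (inverse v) (inverse r)"
      by (rule cg_inverse[OF V]) (use r u in auto)
    ultimately have "cg3 V q (mpt (s, r))" unfolding q_def using s(5) r(5) by (intro cg3_mpt[OF V])
    moreover have "mpt (s, r) = (- (2 * s), - (2 * r), - (2 * s * r))" using s r by simp
    ultimately have "cg3 V p (- (2 * s), - (2 * r), - (2 * s * r))"
      using pq cg3_trans[OF V] unfolding q_def by metis
    then have "cg V (tr3 (dact P w p)) (tr3 (dact cayley w (- (2 * s), - (2 * r), - (2 * s * r))))"
      by (rule cg_tr3[OF V P])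
    then have "tr3 (dact P w p) - of_int (t^2 - 1) \<in> maxid V"
      unfolding singular_trace[OF s(1) r(1) ev] t_def cg_def by blast
    then show ?thesis by (intro bexI[of _ "t^2 - 2"]) (auto simp: t_def algebra_simps)
  qed
qed

section \<open>Traces at fixed points for generic parameters\<close>

fun cnj3 :: "point \<Rightarrow> point" where "cnj3 (x, y, z) = (cnj x, cnj y, cnj z)"

lemma co_cnj3: "co l (cnj3 p) = cnj (co l p)" by (cases p; cases l) auto

lemma invol_cnj3: "invol (cnjP P) l (cnj3 p) = cnj3 (invol P l p)"
  by (cases P; cases p; cases l) auto

lemma act_cnj3: "act (cnjP P) w (cnj3 p) = cnj3 (act P w p)"
  by (induction w) (auto simp: invol_cnj3)

lemma dinvol_cnj3: "dinvol l (cnj3 p) (cnj3 v) = cnj3 (dinvol l p v)"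
  by (cases p; cases v; cases l) auto

lemma dact_cnj3: "dact (cnjP P) w (cnj3 p) (cnj3 v) = cnj3 (dact P w p v)"
  by (induction w) (auto simp: act_cnj3 dinvol_cnj3)

lemma tr3_cnj3: "tr3 (dact (cnjP P) w (cnj3 p)) = cnj (tr3 (dact P w p))"
  using dact_cnj3[of P w p "(1, 0, 0)"] dact_cnj3[of P w p "(0, 1, 0)"] dact_cnj3[of P w p "(0, 0, 1)"]
  by (simp add: tr3_def co_cnj3)

lemma surface_cnj3: 
  assumes "p \<in> cubic_surface P" shows "cnj3 p \<in> cubic_surface (cnjP P)"
proof -
  obtain A B C D where P: "P = (A, B, C, D)" by (cases P)
  obtain x y z where p: "p = (x, y, z)" by (cases p)
  have "cnj (x^2 + y^2 + z^2 + x * y * z) = cnj (A * x + B * y + C * z + D)"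
    using assms by (simp add: P p)
  then show ?thesis by (simp add: P p)
qed

lemma tr3_in_valring:
  assumes V: "valring V" and "\<And>l. par l P \<in> V" "par0 P \<in> V" "\<And>l. co l p \<in> V"
  shows "tr3 (dact P w p) \<in> V"
proof -
  have "cgP V P P" "cg3 V p p" using assms by (auto simp: cgP_def cg3_def intro: cg_refl[OF V])
  then show ?thesis using cg_tr3[OF V] cg_in(1)[OF V] by blast
qed

text \<open>A real trace \<open>t\<close> is algebraic over both \<open>\<rat>(P)\<close> and \<open>\<rat>(cnj P)\<close>; specializing \<open>P\<close> to the Cayley
  parameter over the second field leaves \<open>t\<close> unchanged, so \<open>t\<close> is an integer read off the monomial action.\<close>

theorem fixed_point_trace:
  assumes gen: "P \<notin> nongeneric" and w: "full_cyclic w" "even (length w)"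
    and p: "p \<in> cubic_surface P" "act P w p = p"
  shows "tr3 (dact P w p) - 1 \<notin> of_real ` {-2..2}"
proof
  assume "tr3 (dact P w p) - 1 \<in> of_real ` {-2..2}"
  then obtain r where r: "-2 \<le> r" "r \<le> 2" "tr3 (dact P w p) - 1 = of_real r" by auto
  obtain V where V: "valring V" "conj_field P \<subseteq> V"
      "\<And>l. par l P - par l (int_param (0, 0, 0, 4)) \<in> maxid V" "par0 P - par0 (int_param (0, 0, 0, 4)) \<in> maxid V"
    using specialization_over_conj[OF gen, where c = "(0, 0, 0, 4)"] by blast
  note D = is_subringD[OF valring_subring[OF V(1)]]
  have int: "of_int n \<in> V" for n using conj_field_of_int V(2) by blast
  have ip: "int_param (0, 0, 0, 4) = cayley" by simp
  have cayV: "par l cayley \<in> V" "par0 cayley \<in> V" for l using int[of 4] D(2) by (cases l; simp)+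
  have parV: "par l P \<in> V" "par0 P \<in> V" for l
    using D(6)[OF maxid_subset[OF V(1) V(3)[of l, unfolded ip]] cayV(1)[of l]] D(6)[OF maxid_subset[OF V(1) V(4)[unfolded ip]] cayV(2)] by auto
  then have P: "cgP V P cayley" using V(3,4) cayV unfolding ip by (simp add: cgP_def cg_def)
  have "co l p \<in> V" for l by (rule fixed_point_proper[OF V(1) parV p w(1)])
  then obtain T where T: "T \<in> {mat11 w + mat22 w, - (mat11 w + mat22 w), (mat11 w + mat22 w)^2 - 2}"
      "tr3 (dact P w p) - 1 - of_int T \<in> maxid V"
    using trace_at_fixed_point[OF V(1) int P p(1) _ p(2) w(2)] by blast
  define y where "y = tr3 (dact P w p) - 1 - of_int T"
  have "y = 0"
  proof (rule ccontr)
    assume y: "y \<noteq> 0"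
    \<comment> \<open>A pole of \<open>y\<close> would be a pole of the trace at the conjugate fixed
      point, which has the same trace because it is real. Properness over the conjugate parameters,
      which lie in \<open>conj_field P\<close>, excludes it.\<close>
    have "\<not> (\<exists>V. valring V \<and> conj_field P \<subseteq> V \<and> inverse y \<in> maxid V)"
    proof
      assume "\<exists>V. valring V \<and> conj_field P \<subseteq> V \<and> inverse y \<in> maxid V"
      then obtain V where V: "valring V" "conj_field P \<subseteq> V" "inverse y \<in> maxid V" by blast
      have parV: "par l (cnjP P) \<in> V" "par0 (cnjP P) \<in> V" for l using conj_field_par V(2) by blast+
      have "act (cnjP P) w (cnj3 p) = cnj3 p" by (simp add: act_cnj3 p)
      then have "co l (cnj3 p) \<in> V" for l
        by (rule fixed_point_proper[OF V(1) parV surface_cnj3[OF p(1)] _ w(1)])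
      then have "tr3 (dact (cnjP P) w (cnj3 p)) \<in> V" using parV by (intro tr3_in_valring[OF V(1)])
      moreover have "tr3 (dact (cnjP P) w (cnj3 p)) = tr3 (dact P w p)"
      proof -
        have "tr3 (dact P w p) = 1 + of_real r" using r(3) by (simp add: algebra_simps)
        then show ?thesis unfolding tr3_cnj3 by simp
      qed
      moreover have "1 \<in> V" "of_int T \<in> V" using conj_field_of_int[of T P] conj_field_of_int[of 1 P] V(2) by auto
      ultimately have "y \<in> V" unfolding y_def using is_subringD(3)[OF valring_subring[OF V(1)]] by metis
      then have "y * inverse y \<in> maxid V" using V(3) by (intro maxid_mult(1)[OF V(1)])
      then show False using y one_notin_maxid[OF V(1)] by simp
    qed
    then obtain n c where "\<forall>i. c i \<in> conj_field P" "y ^ n = (\<Sum>i<n. c i * y ^ i)"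
      using algebraic_or_pole[OF conj_field_subring y] by blast
    then show False
      using algebraic_in_maxid[OF V(1,2) conj_field_inverse] T(2) y unfolding y_def by blast
  qed
  \<comment> \<open>So the trace minus 1 is one of the three integers; these have absolute value at
    least 3, the last one at least 7.\<close>
  then have "complex_of_real r = complex_of_real (of_int T)" using r(3) by (simp add: y_def)
  then have "r = of_int T" by (simp only: of_real_eq_iff)
  then have "- 2 \<le> T" "T \<le> 2" using r by linarith+
  moreover have h: "3 \<le> \<bar>mat11 w + mat22 w\<bar>" by (rule hyperbolic_trace[OF w])
  moreover have "3 * 3 \<le> \<bar>mat11 w + mat22 w\<bar> * \<bar>mat11 w + mat22 w\<bar>" using h by (intro mult_mono) auto
  ultimately show False using T(1) by (auto simp: power2_eq_square abs_mult_self_eq)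
qed

section \<open>Generic surfaces are smooth\<close>

lemma is_subring_of_int:
  assumes R: "is_subring R" shows "of_int n \<in> R"
proof -
  have nat: "of_nat m \<in> R" for m by (induction m) (auto intro: is_subringD[OF R])
  show ?thesis
  proof (cases n)
    case (nonneg m)
    then show ?thesis using nat[of m] by simp
  next
    case (neg m)
    then have "of_int n = - (of_nat (Suc m) :: complex)" by simp
    then show ?thesis using nat[of "Suc m"] is_subringD(5)[OF R] by metis
  qed
qed

lemma grad_zero_iff: "grad P p = 0 \<longleftrightarrow> (\<forall>l. invol P l p = p)"
proof -
  obtain A B C D where P: "P = (A, B, C, D)" by (cases P)
  obtain x y z where p: "p = (x, y, z)" by (cases p)
  have "- x - y * z + A = x \<longleftrightarrow> 2 * x + y * z - A = 0" "- y - x * z + B = y \<longleftrightarrow> 2 * y + x * z - B = 0"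
    "- z - x * y + C = z \<longleftrightarrow> 2 * z + x * y - C = 0"
    by (simp_all only: mult_2) (auto simp: algebra_simps eq_neg_iff_add_eq_0 add_eq_0_iff)
  then show ?thesis by (simp add: P p all_letter zero_prod_def)
qed

text \<open>All involutions fix a singular point, so it stays finite under specialization. With
  \<open>A\<close>, \<open>B\<close>, \<open>C\<close> specialized to 0, the product
  \<open>e\<close> of its coordinates would be 0 or -8 and also \<open>- 2 * D\<close>; the value
  \<open>D = 1\<close> is incompatible with both.\<close>

lemma smooth_of_generic:
  assumes gen: "P \<notin> nongeneric" and p: "p \<in> cubic_surface P"
  shows "grad P p \<noteq> 0"
proof
  assume "grad P p = 0"
  then have fix_p: "act P w p = p" for w by (induction w) (auto simp: grad_zero_iff)
  obtain A B C D where P: "P = (A, B, C, D)" by (cases P)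
  obtain x y z where p': "p = (x, y, z)" by (cases p)
  obtain V where V: "valring V" "conj_field P \<subseteq> V"
      "\<And>l. par l P - par l (int_param (0, 0, 0, 1)) \<in> maxid V" "par0 P - par0 (int_param (0, 0, 0, 1)) \<in> maxid V"
    using specialization_over_conj[OF gen, where c = "(0, 0, 0, 1)"] by blast
  note Dr = is_subringD[OF valring_subring[OF V(1)]]
  have int: "of_int n \<in> V" for n using conj_field_of_int V(2) by blast
  have ABC: "A \<in> maxid V" "B \<in> maxid V" "C \<in> maxid V" "D - 1 \<in> maxid V"
    using V(3)[of X] V(3)[of Y] V(3)[of Z] V(4) by (auto simp: P)
  then have "A \<in> V" "B \<in> V" "C \<in> V" "D - 1 + 1 \<in> V"
    using maxid_subset[OF V(1)] Dr(1,6) by blast+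
  then have parV: "par l P \<in> V" "par0 P \<in> V" for l by (cases l; simp add: P)+
  have "full_cyclic [X, Y, Z, Y]" by (auto simp: full_cyclic_def intro: letter.exhaust)
  then have "co l p \<in> V" for l by (rule fixed_point_proper[OF V(1) parV p fix_p])
  from this[of X] this[of Y] this[of Z] have xyz: "x \<in> V" "y \<in> V" "z \<in> V" by (auto simp: p')
  have g: "A = 2 * x + y * z" "B = 2 * y + x * z" "C = 2 * z + x * y"
    using \<open>grad P p = 0\<close> by (auto simp: P p' zero_prod_def)
  define e where "e = x * y * z"
  have "x * A \<in> maxid V" "y * B \<in> maxid V" "z * C \<in> maxid V" using xyz ABC by (auto intro: maxid_mult[OF V(1)])
  then have q: "2 * x^2 - (- e) \<in> maxid V" "2 * y^2 - (- e) \<in> maxid V" "2 * z^2 - (- e) \<in> maxid V"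
    unfolding g by (simp_all add: e_def algebra_simps power2_eq_square)
  have eV: "e \<in> V" "- e \<in> V" "2 \<in> V" using xyz Dr int[of 2] by (auto simp: e_def)
  have sqV: "2 * x^2 \<in> V" "2 * y^2 \<in> V" "2 * z^2 \<in> V" using xyz Dr eV by (auto simp: power2_eq_square)
  have "cg V (2 * x^2) (- e)" "cg V (2 * y^2) (- e)" "cg V (2 * z^2) (- e)" using q eV sqV by (auto simp: cg_def)
  then have "cg V (2 * x^2 * (2 * y^2) * (2 * z^2)) (- e * - e * - e)" by (intro cg_mult[OF V(1)])
  moreover have "2 * x^2 * (2 * y^2) * (2 * z^2) = 8 * e^2" by (simp add: e_def power_mult_distrib algebra_simps)
  ultimately have "8 * e^2 - (- e * - e * - e) \<in> maxid V" by (simp add: cg_def)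
  then have e1: "(e * e) * (e + 8) \<in> maxid V" by (simp add: algebra_simps power2_eq_square)
  have "x^2 + y^2 + z^2 + e = x * A + y * B + z * C + D" using p by (simp add: P p' e_def algebra_simps)
  then have "e + 2 = (2 * x^2 - (- e)) + (2 * y^2 - (- e)) + (2 * z^2 - (- e)) - 2 * (x * A + y * B + z * C + (D - 1))"
    by algebra
  also have "\<dots> \<in> maxid V"
    by (intro maxid_diff[OF V(1) maxid_add[OF V(1) maxid_add[OF V(1) q(1,2)] q(3)]]
        maxid_mult(1)[OF V(1) eV(3)] maxid_add[OF V(1) maxid_add[OF V(1) maxid_add[OF V(1)]]]
        ABC(4) \<open>x * A \<in> maxid V\<close> \<open>y * B \<in> maxid V\<close> \<open>z * C \<in> maxid V\<close>)
  finally have e2: "e + 2 \<in> maxid V" .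
  have unit: "of_int n \<notin> maxid V" if "n \<noteq> 0" for n
  proof -
    have "inverse (of_int n) \<in> V" using conj_field_of_int conj_field_inverse V(2) by blast
    then show ?thesis using that by (simp add: maxid_def)
  qed
  from e1 have "e \<in> maxid V \<or> e + 8 \<in> maxid V" using maxid_prime[OF V(1)] by blast
  then show False
  proof
    assume "e \<in> maxid V"
    then have "e + 2 - e \<in> maxid V" using e2 by (intro maxid_diff[OF V(1)])
    then show False using unit[of 2] by simp
  next
    assume "e + 8 \<in> maxid V"
    then have "e + 8 - (e + 2) \<in> maxid V" using e2 by (intro maxid_diff[OF V(1)])
    then show False using unit[of 6] by simp
  qed
qed

text \<open>The equation is what remains after eliminating the other two coordinates at a point
  fixed by two involutions. For real \<open>z\<close> it also holds with the conjugate parameters.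
  Specializing \<open>P\<close> to zero leaves only 0, 2 and -2 for \<open>z\<close>. Specializing
  the conjugate to \<open>(1, 2, 4, 0)\<close> makes the left side vanish at these values but not
  the right side, because 1, 2 and 4 are distinct and positive.\<close>

lemma center_not_real:
  assumes gen: "P \<notin> nongeneric" and ijk: "i \<noteq> j" "j \<noteq> k" "i \<noteq> k"
    and eq: "(4 - z^2) * (z^2 - par k P * z - par0 P) = (par i P)^2 + (par j P)^2 - par i P * par j P * z"
    and real: "cnj z = z"
  shows False
proof -
  obtain V where V: "valring V"
      "\<And>l. par l P - par l (int_param (0, 0, 0, 0)) \<in> maxid V" "par0 P - par0 (int_param (0, 0, 0, 0)) \<in> maxid V"
      "\<And>l. par l (cnjP P) - par l (int_param (1, 2, 4, 0)) \<in> maxid V"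
      "par0 (cnjP P) - par0 (int_param (1, 2, 4, 0)) \<in> maxid V" "\<And>n. n \<noteq> 0 \<Longrightarrow> inverse (of_int n) \<in> V"
    using specialization_pair[OF gen, where c = "(0, 0, 0, 0)" and d = "(1, 2, 4, 0)"] by blast
  note D = is_subringD[OF valring_subring[OF V(1)]]
  have unit: "of_int n \<notin> maxid V" if "n \<noteq> 0" for n using V(6)[OF that] that by (simp add: maxid_def)
  have int: "of_int n \<in> V" for n by (rule is_subring_of_int[OF valring_subring[OF V(1)]])
  define c :: "letter \<Rightarrow> int" where "c l = (if l = X then 1 else if l = Y then 2 else 4)" for l
  have c: "par l (int_param (1, 2, 4, 0)) = of_int (c l)" for l by (cases l) (auto simp: c_def)
  define A B C E where "A = par i P" "B = par j P" "C = par k P" "E = par0 P"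
  define A' B' C' E' where "A' = cnj A" "B' = cnj B" "C' = cnj C" "E' = cnj E"
  have cp: "par l (cnjP P) = cnj (par l P)" "par0 (cnjP P) = cnj (par0 P)" for l by (cases P; cases l; simp)+
  have zero: "par l (int_param (0, 0, 0, 0)) = 0" for l by (cases l) auto
  have "par l P \<in> maxid V" for l using V(2)[of l] unfolding zero by simp
  moreover have "par0 P \<in> maxid V" using V(3) by simp
  ultimately have m: "A \<in> maxid V" "B \<in> maxid V" "C \<in> maxid V" "E \<in> maxid V" by (auto simp: A_B_C_E_def)
  have cgz: "cg V A 0" "cg V B 0" "cg V C 0" "cg V E 0" using m maxid_subset[OF V(1)] D(2) by (auto simp: cg_def)
  have cgc: "cg V (cnj (par l P)) (of_int (c l))" "cg V E' 0" for l
  proof -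
    have "cnj (par l P) - of_int (c l) \<in> maxid V" using V(4)[of l] unfolding c cp .
    moreover from this have "cnj (par l P) - of_int (c l) + of_int (c l) \<in> V"
      using maxid_subset[OF V(1)] int D(6) by blast
    ultimately show "cg V (cnj (par l P)) (of_int (c l))" using int by (simp add: cg_def)
    have "E' \<in> maxid V" using V(5) unfolding cp A'_B'_C'_E'_def A_B_C_E_def by simp
    then show "cg V E' 0" using maxid_subset[OF V(1)] D(2) by (auto simp: cg_def)
  qed
  have eq1: "(4 - z^2) * (z^2 - C * z - E) = A^2 + B^2 - A * B * z" using eq by (simp add: A_B_C_E_def)
  have "cnj ((4 - z^2) * (z^2 - C * z - E)) = cnj (A^2 + B^2 - A * B * z)" unfolding eq1 ..
  then have eq2: "(4 - z^2) * (z^2 - C' * z - E') = A'^2 + B'^2 - A' * B' * z"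
    by (simp add: A'_B'_C'_E'_def real)
  have four: "4 \<in> V" using int[of 4] by simp
  \<comment> \<open>The quartic equation has a unit as leading coefficient, so \<open>z\<close> is
    integral over \<open>V\<close>.\<close>
  have zV: "z \<in> V"
  proof (rule ccontr)
    assume "z \<notin> V"
    define \<mu> where "\<mu> = inverse z"
    have mu: "\<mu> \<in> maxid V" unfolding \<mu>_def using V(1) \<open>z \<notin> V\<close> by (rule maxid_of_notin)
    have z0: "z \<noteq> 0" using \<open>z \<notin> V\<close> D(2) by auto
    have "((4 - z^2) * (z^2 - C * z - E)) * (\<mu> * \<mu> * \<mu> * \<mu>) = (A^2 + B^2 - A * B * z) * (\<mu> * \<mu> * \<mu> * \<mu>)"
      unfolding eq1 ..
    then have h: "(4 * \<mu> * \<mu> - (z * \<mu>) * (z * \<mu>)) * ((z * \<mu>) * (z * \<mu>) - C * \<mu> * (z * \<mu>) - E * \<mu> * \<mu>)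
        = A * A * \<mu> * \<mu> * \<mu> * \<mu> + B * B * \<mu> * \<mu> * \<mu> * \<mu> - A * B * \<mu> * \<mu> * \<mu> * (z * \<mu>)"
      by (simp add: algebra_simps power2_eq_square)
    have "z * \<mu> = 1" using z0 by (simp add: \<mu>_def)
    from h[unfolded this] have "(4 * \<mu> * \<mu> - 1) * (1 - C * \<mu> - E * \<mu> * \<mu>) = A * A * \<mu> * \<mu> * \<mu> * \<mu> + B * B * \<mu> * \<mu> * \<mu> * \<mu> - A * B * \<mu> * \<mu> * \<mu>"
      by simp
    moreover have cm: "cg V \<mu> 0" using mu maxid_subset[OF V(1)] D(2) by (auto simp: cg_def)
    have "cg V ((4 * \<mu> * \<mu> - 1) * (1 - C * \<mu> - E * \<mu> * \<mu>)) ((4 * 0 * 0 - 1) * (1 - 0 * 0 - 0 * 0 * 0))"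
      using cm cgz four D(1) by (intro cg_mult[OF V(1)] cg_diff[OF V(1)] cg_refl[OF V(1)])
    moreover have "(4 * 0 * 0 - 1) * (1 - 0 * 0 - 0 * 0 * 0) = (- 1 :: complex)" by simp
    moreover have "cg V (A * A * \<mu> * \<mu> * \<mu> * \<mu> + B * B * \<mu> * \<mu> * \<mu> * \<mu> - A * B * \<mu> * \<mu> * \<mu>) (0 * 0 * 0 * 0 * 0 * 0 + 0 * 0 * 0 * 0 * 0 * 0 - 0 * 0 * 0 * 0 * 0)"
      using cm cgz by (intro cg_mult[OF V(1)] cg_add[OF V(1)] cg_diff[OF V(1)])
    moreover have "0 * 0 * 0 * 0 * 0 * 0 + 0 * 0 * 0 * 0 * 0 * 0 - 0 * 0 * 0 * 0 * 0 = (0 :: complex)" by simp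
    ultimately have "cg V (A * A * \<mu> * \<mu> * \<mu> * \<mu> + B * B * \<mu> * \<mu> * \<mu> * \<mu> - A * B * \<mu> * \<mu> * \<mu>) (- 1)"
      "cg V (A * A * \<mu> * \<mu> * \<mu> * \<mu> + B * B * \<mu> * \<mu> * \<mu> * \<mu> - A * B * \<mu> * \<mu> * \<mu>) 0"
      by (simp_all only:)
    then have "cg V (- 1) 0" by (rule cg_trans[OF V(1) cg_sym[OF V(1)]])
    then have "- 1 \<in> maxid V" by (simp add: cg_def)
    then show False using unit[of "-1"] by simp
  qed
  have cz: "cg V z z" using zV by (rule cg_refl[OF V(1)])
  have z2: "z^2 = z * z" by (simp add: power2_eq_square)
  have "cg V ((4 - z * z) * (z * z - C * z - E)) ((4 - z * z) * (z * z - 0 * z - 0))"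
    using cz cgz four zV by (intro cg_mult[OF V(1)] cg_diff[OF V(1)] cg_refl[OF V(1)])
  moreover have "(4 - z * z) * (z * z - 0 * z - 0) = (4 - z * z) * (z * z)" by simp
  moreover have "cg V (A * A + B * B - A * B * z) (0 * 0 + 0 * 0 - 0 * 0 * z)"
    using cz cgz by (intro cg_mult[OF V(1)] cg_diff[OF V(1)] cg_add[OF V(1)])
  moreover have "0 * 0 + 0 * 0 - 0 * 0 * z = 0" by simp
  moreover have "(4 - z * z) * (z * z - C * z - E) = A * A + B * B - A * B * z"
    using eq1 by (simp add: power2_eq_square)
  ultimately have "cg V (A * A + B * B - A * B * z) ((4 - z * z) * (z * z))" "cg V (A * A + B * B - A * B * z) 0"
    by (simp_all only:)
  then have "cg V ((4 - z * z) * (z * z)) 0" by (rule cg_trans[OF V(1) cg_sym[OF V(1)]])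
  then have "(2 - z) * ((2 + z) * (z * z)) \<in> maxid V" by (simp add: cg_def algebra_simps)
  then have zc: "2 - z \<in> maxid V \<or> 2 + z \<in> maxid V \<or> z \<in> maxid V"
    using maxid_prime[OF V(1)] by blast
  have zc': "cg V z (of_int s)" if "z - of_int s \<in> maxid V" for s using that zV int by (simp add: cg_def)
  have "\<exists>s \<in> {2, -2, 0 :: int}. cg V z (of_int s)"
    using zc
  proof (elim disjE)
    assume "2 - z \<in> maxid V"
    from maxid_uminus[OF V(1) this] show ?thesis using zc'[of 2] by auto
  next
    assume "2 + z \<in> maxid V"
    then show ?thesis using zc'[of "-2"] by (auto simp: add.commute)
  next
    assume "z \<in> maxid V"
    then show ?thesis using zc'[of 0] by auto
  qed
  then obtain s :: int where s: "s \<in> {2, -2, 0}" "cg V z (of_int s)" by blast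
  have "cg V ((4 - z * z) * (z * z - C' * z - E')) ((4 - of_int s * of_int s) * (of_int s * of_int s - of_int (c k) * of_int s - 0))"
    using s(2) cgc four unfolding A'_B'_C'_E'_def A_B_C_E_def
    by (intro cg_mult[OF V(1)] cg_diff[OF V(1)] cg_refl[OF V(1)])
  moreover have "cg V (A' * A' + B' * B' - A' * B' * z) (of_int (c i) * of_int (c i) + of_int (c j) * of_int (c j) - of_int (c i) * of_int (c j) * of_int s)"
    using s(2) cgc unfolding A'_B'_C'_E'_def A_B_C_E_def
    by (intro cg_mult[OF V(1)] cg_diff[OF V(1)] cg_add[OF V(1)])
  moreover have "(4 - z * z) * (z * z - C' * z - E') = A' * A' + B' * B' - A' * B' * z"
    using eq2 by (simp add: power2_eq_square)
  ultimately have "cg V (A' * A' + B' * B' - A' * B' * z) ((4 - of_int s * of_int s) * (of_int s * of_int s - of_int (c k) * of_int s - 0))"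
     "cg V (A' * A' + B' * B' - A' * B' * z) (of_int (c i) * of_int (c i) + of_int (c j) * of_int (c j) - of_int (c i) * of_int (c j) * of_int s)"
    by (simp_all only:)
  then have "cg V ((4 - of_int s * of_int s) * (of_int s * of_int s - of_int (c k) * of_int s - 0))
      (of_int (c i) * of_int (c i) + of_int (c j) * of_int (c j) - of_int (c i) * of_int (c j) * of_int s)"
    by (rule cg_trans[OF V(1) cg_sym[OF V(1)]])
  then have "of_int ((4 - s * s) * (s * s - c k * s) - (c i * c i + c j * c j - c i * c j * s)) \<in> maxid V"
    by (simp add: cg_def)
  moreover have "(4 - s * s) * (s * s - c k * s) - (c i * c i + c j * c j - c i * c j * s) \<noteq> 0"
    using s(1) ijk by (cases i; cases j) (auto simp: c_def)
  ultimately show False using unit by blast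
qed

section \<open>Eigenvalues at fixed points\<close>

lemma dt_add: "dt g (v + w) = dt g v + dt g w"
  by (cases g; cases v; cases w) (simp add: algebra_simps)

lemma tangent_basis:
  assumes "g \<noteq> 0"
  obtains e1 e2 \<omega> where "\<omega> \<noteq> 0" "cr e1 e2 = csc \<omega> g" "dt g e1 = 0" "dt g e2 = 0"
    "\<And>v. dt g v = 0 \<Longrightarrow> \<exists>a b. v = csc a e1 + csc b e2"
proof -
  obtain g1 g2 g3 where g: "g = (g1, g2, g3)" by (cases g)
  consider "g1 \<noteq> 0" | "g2 \<noteq> 0" | "g3 \<noteq> 0" using assms by (auto simp: g zero_prod_def)
  then show ?thesis
  proof cases
    case 1
    show ?thesis
    proof (rule that[of g1 "(g2, - g1, 0)" "(g3, 0, - g1)"])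
      fix v assume v: "dt g v = 0"
      obtain v1 v2 v3 where v': "v = (v1, v2, v3)" by (cases v)
      have "g1 * v1 = - (g2 * v2 + g3 * v3)" using v unfolding g v' dt.simps by algebra
      then have "v1 = - (g2 * v2 + g3 * v3) / g1" using 1 by (simp add: field_simps)
      then show "\<exists>a b. v = csc a (g2, - g1, 0) + csc b (g3, 0, - g1)"
        using 1 by (intro exI[of _ "- v2 / g1"] exI[of _ "- v3 / g1"]) (simp add: v' field_simps)
    qed (use 1 in \<open>simp_all add: g algebra_simps\<close>)
  next
    case 2
    show ?thesis
    proof (rule that[of g2 "(0, g3, - g2)" "(- g2, g1, 0)"])
      fix v assume v: "dt g v = 0"
      obtain v1 v2 v3 where v': "v = (v1, v2, v3)" by (cases v)
      have "g2 * v2 = - (g1 * v1 + g3 * v3)" using v unfolding g v' dt.simps by algebra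
      then have "v2 = - (g1 * v1 + g3 * v3) / g2" using 2 by (simp add: field_simps)
      then show "\<exists>a b. v = csc a (0, g3, - g2) + csc b (- g2, g1, 0)"
        using 2 by (intro exI[of _ "- v3 / g2"] exI[of _ "- v1 / g2"]) (simp add: v' field_simps)
    qed (use 2 in \<open>simp_all add: g algebra_simps\<close>)
  next
    case 3
    show ?thesis
    proof (rule that[of g3 "(g3, 0, - g1)" "(0, g3, - g2)"])
      fix v assume v: "dt g v = 0"
      obtain v1 v2 v3 where v': "v = (v1, v2, v3)" by (cases v)
      have "g3 * v3 = - (g1 * v1 + g2 * v2)" using v unfolding g v' dt.simps by algebra
      then have "v3 = - (g1 * v1 + g2 * v2) / g3" using 3 by (simp add: field_simps)
      then show "\<exists>a b. v = csc a (g3, 0, - g1) + csc b (0, g3, - g2)"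
        using 3 by (intro exI[of _ "v1 / g3"] exI[of _ "v2 / g3"]) (simp add: v' field_simps)
    qed (use 3 in \<open>simp_all add: g algebra_simps\<close>)
  qed
qed

lemma reciprocal_roots_real:
  assumes "r * s = 1" "cmod r = 1"
  shows "r + s \<in> of_real ` {-2..2}"
proof -
  have "r * cnj r = 1" using assms(2) by (simp add: complex_norm_square[symmetric])
  moreover have "r \<noteq> 0" using assms by auto
  ultimately have "s = cnj r" using assms(1) by (metis mult_left_cancel)
  then have "r + s = of_real (2 * Re r)" by (simp add: complex_add_cnj)
  moreover have "\<bar>Re r\<bar> \<le> 1" using abs_Re_le_cmod[of r] assms by simp
  ultimately show ?thesis by (intro image_eqI[of _ _ "2 * Re r"]) auto
qed

text \<open>The roots have product 1. Either one of them lies outside the unit circle, or both lie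
  on it and are conjugate, with real sum in \<open>[-2, 2]\<close>.\<close>

lemma expanding_root:
  assumes "t \<notin> of_real ` {-2..2}"
  obtains r :: complex where "1 < cmod r" "r^2 - t * r + 1 = 0"
proof -
  obtain r s where rs: "r + s = - (- t)" "r * s = 1" using quadratic_roots by blast
  have roots: "r^2 - t * r + 1 = 0" "s^2 - t * s + 1 = 0"
    using quadratic_factor[OF rs, of r] quadratic_factor[OF rs, of s] by auto
  have n1: "cmod r \<noteq> 1" using reciprocal_roots_real[OF rs(2)] rs(1) assms by auto
  have n2: "cmod r * cmod s = 1" using rs(2) by (metis norm_mult norm_one)
  show ?thesis
  proof (cases "1 < cmod r")
    case False
    then have "cmod r < 1" using n1 by simp
    moreover have "0 < cmod s" using n2 by (metis mult_zero_right norm_ge_zero order_le_less zero_neq_one)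
    ultimately have "cmod r * cmod s < 1 * cmod s" by (intro mult_strict_right_mono)
    then show ?thesis using n2 roots that by simp
  qed (use that roots in blast)
qed

lemma kernel_2x2:
  fixes a b c d :: complex
  assumes "a * d - b * c = 0"
  obtains \<alpha> \<beta> where "a * \<alpha> + c * \<beta> = 0" "b * \<alpha> + d * \<beta> = 0" "\<alpha> \<noteq> 0 \<or> \<beta> \<noteq> 0"
proof (cases "a = 0 \<and> c = 0")
  case True
  show ?thesis
  proof (cases "b = 0 \<and> d = 0")
    case True
    then show ?thesis using that[of 1 0] \<open>a = 0 \<and> c = 0\<close> by simp
  next
    case False
    then show ?thesis using that[of d "- b"] True by (auto simp: algebra_simps)
  qed
next
  case False
  then show ?thesis using that[of c "- a"] assms by (auto simp: algebra_simps)
qed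

text \<open>The derivative preserves the gradient and the area form, so on the tangent plane it has
  determinant 1 and trace \<open>tr3 (dact P w p) - 1\<close>.\<close>

lemma expanding_eigenvector:
  assumes fix_p: "act P w p = p" and ev: "even (length w)" and smooth: "grad P p \<noteq> 0"
    and t: "tr3 (dact P w p) - 1 \<notin> of_real ` {-2..2}"
  obtains v r where "1 < cmod r" "v \<noteq> 0" "dt (grad P p) v = 0" "dact P w p v = csc r v"
proof -
  define L where "L = dact P w p"
  define g where "g = grad P p"
  have lin: "L (v + v') = L v + L v'" "L (csc u v) = csc u (L v)" for u v v'
    by (simp_all add: L_def dact_linear)
  have gL: "dt g (L v) = dt g v" for v using grad_dact[of P w p v] fix_p by (simp add: L_def g_def)
  obtain e1 e2 \<omega> where e: "\<omega> \<noteq> 0" "cr e1 e2 = csc \<omega> g" "dt g e1 = 0" "dt g e2 = 0"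
    "\<And>v. dt g v = 0 \<Longrightarrow> \<exists>a b. v = csc a e1 + csc b e2"
    by (rule tangent_basis[OF smooth[folded g_def]]) (rule that)
  obtain a b where L1: "L e1 = csc a e1 + csc b e2" using e(5)[of "L e1"] gL e(3) by auto
  obtain c d where L2: "L e2 = csc c e1 + csc d e2" using e(5)[of "L e2"] gL e(4) by auto
  have "cr (L e1) (L e2) = cr e1 e2"
    using cr_dact[OF e(2)[unfolded g_def] ev] fix_p e(2) by (simp add: L_def g_def)
  moreover have "cr (L e1) (L e2) = csc (a * d - b * c) (cr e1 e2)"
    unfolding L1 L2 by (cases e1; cases e2) (simp add: algebra_simps)
  moreover obtain w0 where w0: "dt g w0 \<noteq> 0"
  proof -
    have "\<exists>v. dt g v \<noteq> 0"
    proof (rule ccontr)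
      assume "\<not> ?thesis"
      then have "dt g (1, 0, 0) = 0" "dt g (0, 1, 0) = 0" "dt g (0, 0, 1) = 0" by blast+
      then show False using smooth unfolding g_def[symmetric] by (cases g) (simp add: zero_prod_def)
    qed
    then show ?thesis using that by blast
  qed
  ultimately have "dt (csc (a * d - b * c) (cr e1 e2)) w0 = dt (cr e1 e2) w0" by simp
  then have "(a * d - b * c) * (\<omega> * dt g w0) = \<omega> * dt g w0" unfolding e(2) dt_csc .
  then have det: "a * d - b * c = 1" using e(1) w0 by simp
  have "tr3 L * dt (cr e1 e2) w0 = dt (cr (L e1) e2) w0 + dt (cr e1 (L e2)) w0 + dt (cr e1 e2) (L w0)"
    by (rule trace_identity[OF lin])
  also have "cr (L e1) e2 = csc a (cr e1 e2)" unfolding L1 by (cases e1; cases e2) (simp add: algebra_simps)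
  also have "cr e1 (L e2) = csc d (cr e1 e2)" unfolding L2 by (cases e1; cases e2) (simp add: algebra_simps)
  also have "dt (cr e1 e2) (L w0) = dt (cr e1 e2) w0" unfolding e(2) dt_csc gL ..
  finally have "(tr3 L - (a + d + 1)) * (\<omega> * dt g w0) = 0" by (simp add: e(2) dt_csc algebra_simps)
  then have "tr3 L - (a + d + 1) = 0" using w0 e(1) by (simp only: mult_eq_0_iff) simp
  then have tr: "tr3 L - 1 = a + d" by (simp add: algebra_simps)
  obtain r where r: "1 < cmod r" "r^2 - (a + d) * r + 1 = 0"
    using expanding_root[OF t[folded L_def, unfolded tr]] by blast
  have "(a - r) * (d - r) - b * c = r^2 - (a + d) * r + (a * d - b * c)" by (simp add: algebra_simps power2_eq_square)
  then have "(a - r) * (d - r) - b * c = 0" using det r(2) by simp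
  then obtain \<alpha> \<beta> where ab: "(a - r) * \<alpha> + c * \<beta> = 0" "b * \<alpha> + (d - r) * \<beta> = 0" "\<alpha> \<noteq> 0 \<or> \<beta> \<noteq> 0"
    using kernel_2x2 by metis
  define v where "v = csc \<alpha> e1 + csc \<beta> e2"
  have "L v = csc (a * \<alpha> + c * \<beta>) e1 + csc (b * \<alpha> + d * \<beta>) e2"
    unfolding v_def lin L1 L2 by (cases e1; cases e2) (simp add: algebra_simps)
  moreover have "a * \<alpha> + c * \<beta> = r * \<alpha>" "b * \<alpha> + d * \<beta> = r * \<beta>"
    using ab by (auto simp: algebra_simps)
  ultimately have "L v = csc r v" unfolding v_def by (cases e1; cases e2) (simp add: algebra_simps)
  moreover have "v \<noteq> 0"
  proof
    assume "v = 0"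
    have "cr v e2 = csc \<alpha> (cr e1 e2)" "cr e1 v = csc \<beta> (cr e1 e2)"
      unfolding v_def by (cases e1; cases e2; simp add: algebra_simps)+
    moreover have "dt (cr v e2) w0 = 0" "dt (cr e1 v) w0 = 0"
      unfolding \<open>v = 0\<close> by (cases e1; cases e2; cases w0; simp add: zero_prod_def)+
    ultimately show False using w0 e(1) ab(3) by (simp add: dt_csc e(2))
  qed
  moreover have "dt g v = 0" unfolding v_def dt_add dt_csc using e(3,4) by simp
  ultimately show ?thesis using that r(1) by (simp add: L_def g_def)
qed

section \<open>Holomorphic curves in the surface\<close>

lemma co_zero [simp]: "co l 0 = 0"
  by (cases l) (auto simp: zero_prod_def)

lemma co_dinvol_other: "i \<noteq> j \<Longrightarrow> co i (dinvol j p v) = co i v"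
  by (cases p; cases v; cases i; cases j) auto

lemma co_dinvol_same:
  assumes "i \<noteq> j" "j \<noteq> k" "i \<noteq> k"
  shows "co i (dinvol i p v) = - co i v - co k p * co j v - co j p * co k v"
  by (cases p; cases v; cases i; cases j; cases k; insert assms; simp)

lemma co_grad:
  assumes "i \<noteq> j" "j \<noteq> k" "i \<noteq> k"
  shows "co i (grad P p) = 2 * co i p + co j p * co k p - par i P"
  by (cases p; cases P; cases i; cases j; cases k; insert assms; simp)

lemma dt_letters:
  assumes "i \<noteq> j" "j \<noteq> k" "i \<noteq> k"
  shows "dt u v = co i u * co i v + co j u * co j v + co k u * co k v"
  by (cases u; cases v; cases i; cases j; cases k; insert assms; simp)

definition mk :: "(letter \<Rightarrow> complex) \<Rightarrow> point" where
  "mk f = (f X, f Y, f Z)"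

lemma co_mk [simp]: "co l (mk f) = f l" by (cases l) (auto simp: mk_def)

definition has_velocity :: "(complex \<Rightarrow> point) \<Rightarrow> point \<Rightarrow> complex \<Rightarrow> bool" where
  "has_velocity c v t \<longleftrightarrow> (\<forall>l. ((\<lambda>s. co l (c s)) has_field_derivative co l v) (at t))"

lemma other_letters:
  obtains j k :: letter where "i \<noteq> j" "j \<noteq> k" "i \<noteq> k"
proof (cases i)
  case X then show ?thesis using that[of Y Z] by auto
next
  case Y then show ?thesis using that[of X Z] by auto
next
  case Z then show ?thesis using that[of X Y] by auto
qed

lemma has_velocity_act:
  assumes "has_velocity c v t"
  shows "has_velocity (\<lambda>s. act P w (c s)) (dact P w (c t) v) t"
proof (induction w)
  case Nil
  then show ?case using assms by simp
next
  case (Cons i w)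
  obtain j k where ijk: "i \<noteq> j" "j \<noteq> k" "i \<noteq> k" by (rule other_letters)
  let ?c = "\<lambda>s. act P w (c s)" let ?v = "dact P w (c t) v"
  have d: "((\<lambda>s. co l (?c s)) has_field_derivative co l ?v) (at t)" for l
    using Cons by (simp add: has_velocity_def)
  have "((\<lambda>s. co l (invol P i (?c s))) has_field_derivative co l (dinvol i (?c t) ?v)) (at t)" for l
  proof (cases "l = i")
    case True
    have "((\<lambda>s. - co i (?c s) - co j (?c s) * co k (?c s) + par i P) has_field_derivative
        - co i ?v - (co j ?v * co k (?c t) + co k ?v * co j (?c t)) + 0) (at t)"
      by (intro DERIV_add DERIV_diff DERIV_minus DERIV_mult d DERIV_const)
    then show ?thesis using True by (simp add: co_invol_same[OF ijk] co_dinvol_same[OF ijk] algebra_simps)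
  qed (use d in \<open>simp add: co_invol_other co_dinvol_other\<close>)
  then show ?case by (simp add: has_velocity_def)
qed

lemma holomorphic_act:
  assumes "\<And>l. (\<lambda>s. co l (c s)) holomorphic_on A"
  shows "(\<lambda>s. co l (act P w (c s))) holomorphic_on A"
proof (induction w arbitrary: l)
  case Nil
  then show ?case using assms by simp
next
  case (Cons i w)
  obtain j k where ijk: "i \<noteq> j" "j \<noteq> k" "i \<noteq> k" by (rule other_letters)
  show ?case
  proof (cases "l = i")
    case True
    then show ?thesis using Cons by (simp add: co_invol_same[OF ijk]) (intro holomorphic_intros; simp)
  qed (use Cons in \<open>simp add: co_invol_other\<close>)
qed

text \<open>Two coordinates move linearly along \<open>v\<close>. The third, chosen with non-zero
  partial derivative, solves the quadratic surface equation through the square root of the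
  discriminant.\<close>

lemma tangent_curve:
  assumes p: "p \<in> cubic_surface P" and smooth: "grad P p \<noteq> 0" and v: "dt (grad P p) v = 0"
  obtains \<rho> c where "0 < \<rho>" "\<And>t. c t \<in> cubic_surface P" "\<And>l. (\<lambda>t. co l (c t)) holomorphic_on ball 0 \<rho>"
    "c 0 = p" "has_velocity c v 0"
proof -
  obtain i where i: "co i (grad P p) \<noteq> 0"
  proof -
    have "\<exists>i. co i (grad P p) \<noteq> 0"
    proof (rule ccontr)
      assume "\<not> ?thesis"
      then have "co l (grad P p) = co l 0" for l by simp
      then show False using smooth co_eqI by blast
    qed
    then show ?thesis using that by blast
  qed
  obtain j k where ijk: "i \<noteq> j" "j \<noteq> k" "i \<noteq> k" by (rule other_letters)
  define g where "g = co i (grad P p)"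
  have g0: "g \<noteq> 0" using i by (simp add: g_def)
  define y where "y t = co j p + t * co j v" for t
  define z where "z t = co k p + t * co k v" for t
  define \<beta> where "\<beta> t = y t * z t - par i P" for t
  define \<gamma> where "\<gamma> t = (y t)^2 + (z t)^2 - par j P * y t - par k P * z t - par0 P" for t
  \<comment> \<open>Division by \<open>g^2\<close> normalizes the discriminant to 1 at the base
    point, where the principal square root is holomorphic and selects the given point.\<close>
  define \<delta> where "\<delta> t = ((\<beta> t)^2 - 4 * \<gamma> t) / g^2" for t
  define x where "x t = (- \<beta> t + g * csqrt (\<delta> t)) / 2" for t
  define c where "c t = mk (\<lambda>l. if l = i then x t else if l = j then y t else z t)" for t
  have cc: "co i (c t) = x t" "co j (c t) = y t" "co k (c t) = z t" for t using ijk by (auto simp: c_def)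
  have y0: "y 0 = co j p" "z 0 = co k p" by (auto simp: y_def z_def)
  have surf: "(co i p)^2 + \<beta> 0 * co i p + \<gamma> 0 = 0"
    using p unfolding surface_iff[OF ijk] \<beta>_def \<gamma>_def y0 by (simp add: algebra_simps)
  have gb: "g = 2 * co i p + \<beta> 0" by (simp add: g_def co_grad[OF ijk] \<beta>_def y0)
  have "g^2 = (\<beta> 0)^2 - 4 * \<gamma> 0 + 4 * ((co i p)^2 + \<beta> 0 * co i p + \<gamma> 0)"
    unfolding gb by (simp add: algebra_simps power2_eq_square)
  then have "(\<beta> 0)^2 - 4 * \<gamma> 0 = g^2" using surf by simp
  then have d0: "\<delta> 0 = 1" unfolding \<delta>_def using g0 by simp
  have "c t \<in> cubic_surface P" for t
  proof -
    have "(g * csqrt (\<delta> t))^2 = (\<beta> t)^2 - 4 * \<gamma> t" using g0 by (simp add: power_mult_distrib \<delta>_def)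
    moreover have "g * csqrt (\<delta> t) = 2 * x t + \<beta> t" by (simp add: x_def field_simps)
    ultimately have "(2 * x t + \<beta> t)^2 = (\<beta> t)^2 - 4 * \<gamma> t" by simp
    then have "(x t)^2 + \<beta> t * x t + \<gamma> t = 0" by algebra
    then show ?thesis unfolding surface_iff[OF ijk] cc \<beta>_def \<gamma>_def by (simp add: algebra_simps)
  qed
  moreover have c0: "c 0 = p"
  proof (rule co_eqI)
    fix l
    have "x 0 = co i p" using gb by (simp add: x_def d0)
    then show "co l (c 0) = co l p"
      using letter_distinct_cases[OF ijk, of l] by (auto simp: cc y0)
  qed
  moreover
  have hol\<delta>: "\<delta> holomorphic_on UNIV"
    unfolding \<delta>_def \<beta>_def \<gamma>_def y_def z_def using g0 by (intro holomorphic_intros) auto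
  obtain \<rho> where \<rho>: "0 < \<rho>" "\<And>t. t \<in> ball 0 \<rho> \<Longrightarrow> 0 < Re (\<delta> t)"
  proof -
    have "continuous_on UNIV \<delta>" using hol\<delta> by (rule holomorphic_on_imp_continuous_on)
    then have "open ((\<lambda>t. Re (\<delta> t)) -` {0<..})" by (intro open_vimage continuous_intros) auto
    moreover have "0 \<in> (\<lambda>t. Re (\<delta> t)) -` {0<..}" by (simp add: d0)
    ultimately obtain \<rho> where \<rho>: "0 < \<rho>" "ball 0 \<rho> \<subseteq> (\<lambda>t. Re (\<delta> t)) -` {0<..}"
      by (rule openE)
    have "0 < Re (\<delta> t)" if "t \<in> ball 0 \<rho>" for t using subsetD[OF \<rho>(2) that] by simp
    then show ?thesis using that \<rho>(1) by blast
  qed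
  have np: "\<delta> t \<notin> \<real>\<^sub>\<le>\<^sub>0" if "t \<in> ball 0 \<rho>" for t
    using \<rho>(2)[OF that] by (auto simp: complex_nonpos_Reals_iff)
  have "(\<lambda>t. co l (c t)) holomorphic_on ball 0 \<rho>" for l
  proof -
    have "x holomorphic_on ball 0 \<rho>"
      unfolding x_def \<beta>_def y_def z_def
      by (intro holomorphic_intros np holomorphic_on_subset[OF hol\<delta>]) auto
    moreover have "y holomorphic_on ball 0 \<rho>" "z holomorphic_on ball 0 \<rho>"
      unfolding y_def z_def by (intro holomorphic_intros)+
    ultimately show ?thesis using letter_distinct_cases[OF ijk, of l] by (auto simp: cc)
  qed
  moreover have "has_velocity c v 0"
  proof -
    have dy: "(y has_field_derivative co j v) (at 0)" "(z has_field_derivative co k v) (at 0)"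
      unfolding y_def z_def by (auto intro!: derivative_eq_intros)
    define \<beta>' where "\<beta>' = co j v * co k p + co k v * co j p"
    define \<gamma>' where "\<gamma>' = 2 * co j p * co j v + 2 * co k p * co k v - par j P * co j v - par k P * co k v"
    have d\<beta>: "(\<beta> has_field_derivative \<beta>') (at 0)"
      unfolding \<beta>_def \<beta>'_def by (rule derivative_eq_intros dy refl | simp add: y0)+
    have d\<gamma>: "(\<gamma> has_field_derivative \<gamma>') (at 0)"
      unfolding \<gamma>_def \<gamma>'_def by (rule derivative_eq_intros dy refl | simp add: y0)+
    have d\<delta>: "(\<delta> has_field_derivative (2 * \<beta> 0 * \<beta>' - 4 * \<gamma>') / g^2) (at 0)"
    proof -
      have "((\<lambda>t. (\<beta> t)^2 - 4 * \<gamma> t) has_field_derivative 2 * \<beta> 0 * \<beta>' - 4 * \<gamma>') (at 0)"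
        by (rule derivative_eq_intros d\<beta> d\<gamma> refl | simp)+
      then show ?thesis unfolding \<delta>_def by (rule DERIV_cdivide)
    qed
    have "((\<lambda>t. csqrt (\<delta> t)) has_field_derivative ((2 * \<beta> 0 * \<beta>' - 4 * \<gamma>') / g^2) / (2 * csqrt (\<delta> 0))) (at 0)"
      by (rule has_field_derivative_csqrt'[OF d\<delta>]) (simp add: d0)
    then have "((\<lambda>t. csqrt (\<delta> t)) has_field_derivative ((2 * \<beta> 0 * \<beta>' - 4 * \<gamma>') / g^2) / 2) (at 0)"
      by (simp add: d0)
    then have dx: "(x has_field_derivative (- \<beta>' + g * (((2 * \<beta> 0 * \<beta>' - 4 * \<gamma>') / g^2) / 2)) / 2) (at 0)"
      unfolding x_def using d\<beta> by (intro DERIV_cdivide DERIV_add DERIV_minus DERIV_cmult)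
    have "g * co i v + \<beta>' * co i p + \<gamma>' = 0"
      using v unfolding dt_letters[OF ijk] \<beta>'_def \<gamma>'_def g_def[symmetric]
      using ijk by (simp add: co_grad[of j i k] co_grad[of k i j] algebra_simps)
    then have "\<gamma>' = - (g * co i v + \<beta>' * co i p)" by algebra
    then have "2 * \<beta> 0 * \<beta>' - 4 * \<gamma>' = 2 * g * (\<beta>' + 2 * co i v)" using gb by algebra
    then have "(- \<beta>' + g * (((2 * \<beta> 0 * \<beta>' - 4 * \<gamma>') / g^2) / 2)) / 2 = co i v"
      using g0 by (simp add: power2_eq_square field_simps)
    then have "(x has_field_derivative co i v) (at 0)" using dx by simp
    moreover have "(\<lambda>s. co i (c s)) = x" "(\<lambda>s. co j (c s)) = y" "(\<lambda>s. co k (c s)) = z"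
      by (simp_all add: cc)
    ultimately have "((\<lambda>s. co l (c s)) has_field_derivative co l v) (at 0)" for l
      using dy letter_distinct_cases[OF ijk, of l] by auto
    then show ?thesis by (simp add: has_velocity_def)
  qed
  ultimately show ?thesis using that \<rho>(1) by blast
qed

section \<open>Norm estimates, closedness of the surface and continuity of the action\<close>

lemma norm_point_le: "norm p \<le> cmod (co X p) + cmod (co Y p) + cmod (co Z p)"
proof -
  obtain x y z where p: "p = (x, y, z)" by (cases p)
  have "norm (x, (y, z)) \<le> norm x + norm (y, z)" by (rule norm_Pair_le)
  also have "norm (y, z) \<le> norm y + norm z" by (rule norm_Pair_le)
  finally show ?thesis by (simp add: p)
qed

lemma co_le_norm: "cmod (co l p) \<le> norm p"
proof -
  have "norm (fst p) \<le> norm p" "norm (fst (snd p)) \<le> norm p" "norm (snd (snd p)) \<le> norm p"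
    using norm_fst_le[of "fst p" "snd p"] norm_snd_le[of "snd p" "fst p"] norm_fst_le[of "fst (snd p)" "snd (snd p)"]
      norm_snd_le[of "snd (snd p)" "fst (snd p)"] by (auto intro: order_trans)
  then show ?thesis by (cases l) (auto simp: co_simps)
qed

lemma closed_surface: "closed (cubic_surface P)"
proof -
  have "cubic_surface P = (\<lambda>p. (co X p)^2 + (co Y p)^2 + (co Z p)^2 + co X p * co Y p * co Z p
      - (par X P * co X p + par Y P * co Y p + par Z P * co Z p + par0 P)) -` {0}"
    by (auto simp: surface_iff[of X Y Z, simplified])
  moreover have "closed \<dots>" by (intro closed_vimage continuous_intros)
  ultimately show ?thesis by simp
qed

lemma continuous_act: "continuous_on A (act P w)"
proof -
  have "continuous_on A (\<lambda>p. co l (act P w p))" for l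
  proof (induction w arbitrary: l)
    case Nil
    then show ?case by (simp add: continuous_intros)
  next
    case (Cons i w)
    obtain j k where ijk: "i \<noteq> j" "j \<noteq> k" "i \<noteq> k" by (rule other_letters)
    show ?case
    proof (cases "l = i")
      case True
      then show ?thesis using Cons by (simp add: co_invol_same[OF ijk] continuous_intros)
    qed (use Cons in \<open>simp add: co_invol_other\<close>)
  qed
  then have "continuous_on A (\<lambda>p. (co X (act P w p), co Y (act P w p), co Z (act P w p)))"
    by (intro continuous_intros)
  moreover have "(\<lambda>p. (co X (act P w p), co Y (act P w p), co Z (act P w p))) = act P w"
    by (auto simp: fun_eq_iff co_simps)
  ultimately show ?thesis by (simp only:)
qed

section \<open>Derivatives on the Fatou set\<close>

lemma velocity_bound:
  assumes r: "0 < r" and hol: "\<And>l. (\<lambda>t. co l (c t)) holomorphic_on ball 0 R" and "r < R"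
    and vel: "has_velocity c v 0" and B: "\<And>t. t \<in> cball 0 r \<Longrightarrow> norm (c t) \<le> B"
  shows "norm v \<le> 3 * (B / r)"
proof -
  have "cmod (co l v) \<le> B / r" for l
  proof -
    have "cmod ((deriv ^^ 1) (\<lambda>t. co l (c t)) 0) \<le> fact 1 * B / r ^ 1"
    proof (rule Cauchy_inequality)
      show "(\<lambda>t. co l (c t)) holomorphic_on ball 0 r" using hol \<open>r < R\<close> by (rule_tac holomorphic_on_subset) auto
      have "(\<lambda>t. co l (c t)) holomorphic_on cball 0 r" using hol \<open>r < R\<close> by (rule_tac holomorphic_on_subset) auto
      then show "continuous_on (cball 0 r) (\<lambda>t. co l (c t))" by (rule holomorphic_on_imp_continuous_on)
      fix x :: complex assume "cmod (0 - x) = r"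
      then have "norm (c x) \<le> B" by (intro B) (simp add: dist_norm)
      then show "cmod (co l (c x)) \<le> B" using co_le_norm order_trans by blast
    qed (rule r)
    moreover have "deriv (\<lambda>t. co l (c t)) 0 = co l v"
      using vel by (intro DERIV_imp_deriv) (simp add: has_velocity_def)
    ultimately show ?thesis by simp
  qed
  from this[of X] this[of Y] this[of Z] norm_point_le[of v] show ?thesis by linarith
qed

text \<open>A bounded orbit rules out convergence to infinity, so a subsequence converges uniformly
  on a holomorphic disc through \<open>p\<close> in the direction \<open>v\<close>. The uniform
  bounds pass to the derivatives by Cauchy's inequality.\<close>

lemma fatou_bounded_derivatives:
  fixes ws :: "nat \<Rightarrow> letter list"
  assumes p: "p \<in> fatou_set P" and smooth: "grad P p \<noteq> 0" and ev: "\<And>k. even (length (ws k))"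
    and bdd: "\<And>k. norm (act P (ws k) p) \<le> M"
  shows "\<exists>r :: nat \<Rightarrow> nat. strict_mono r \<and>
    (\<forall>v. dt (grad P p) v = 0 \<longrightarrow> (\<exists>B. \<forall>k. norm (dact P (ws (r k)) p v) \<le> B))"
proof -
  let ?S = "cubic_surface P"
  obtain W where W: "openin (top_of_set ?S) W" "p \<in> W" "normal_family_on P W" and pS: "p \<in> ?S"
    using p by (auto simp: fatou_set_def)
  define f where "f k = restrict (act P (ws k)) ?S" for k
  have "range f \<subseteq> group_G P" unfolding f_def using even_word_in_group[OF ev] by blast
  then obtain r where r: "strict_mono r" and
    conv: "(\<exists>g. converges_uniformly_on_compacts (f \<circ> r) g W) \<or> converges_to_infinity P (f \<circ> r) W"
    using W(3) unfolding normal_family_on_def by blast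
  have WS: "W \<subseteq> ?S" using W(1) openin_imp_subset by blast
  have "\<not> converges_to_infinity P (f \<circ> r) W"
  proof
    assume inf: "converges_to_infinity P (f \<circ> r) W"
    have "compact (?S \<inter> cball 0 M)" by (intro closed_Int_compact closed_surface compact_cball)
    then have "finite {i. (f \<circ> r) i ` {p} \<inter> (?S \<inter> cball 0 M) \<noteq> {}}"
      using inf[unfolded converges_to_infinity_def, rule_format, of "{p}" "?S \<inter> cball 0 M"] W(2) by simp
    moreover have "{i. (f \<circ> r) i ` {p} \<inter> (?S \<inter> cball 0 M) \<noteq> {}} = UNIV"
      using bdd act_surface[OF pS] pS by (auto simp: f_def)
    ultimately show False by simp
  qed
  then obtain g where g: "converges_uniformly_on_compacts (f \<circ> r) g W" using conv by blast
  have "\<exists>B. \<forall>k. norm (dact P (ws (r k)) p v) \<le> B" if v: "dt (grad P p) v = 0" for v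
  proof -
    obtain \<rho> c where c: "0 < \<rho>" "\<And>t. c t \<in> ?S" "\<And>l. (\<lambda>t. co l (c t)) holomorphic_on ball 0 \<rho>"
      "c 0 = p" "has_velocity c v 0"
      using tangent_curve[OF pS smooth v] by blast
    have contc: "continuous_on (ball 0 \<rho>) c"
    proof -
      have "continuous_on (ball 0 \<rho>) (\<lambda>t. (co X (c t), co Y (c t), co Z (c t)))"
        using c(3) by (intro continuous_intros holomorphic_on_imp_continuous_on) auto
      moreover have "(\<lambda>t. (co X (c t), co Y (c t), co Z (c t))) = c" by (auto simp: fun_eq_iff co_simps)
      ultimately show ?thesis by (simp only:)
    qed
    obtain T where T: "open T" "W = ?S \<inter> T" using W(1) by (auto simp: openin_open)
    have "open (ball 0 \<rho> \<inter> c -` T)"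
      using continuous_open_preimage[OF contc open_ball T(1)] by simp
    moreover have "0 \<in> ball 0 \<rho> \<inter> c -` T" using c(1,4) W(2) T(2) by auto
    ultimately obtain \<sigma> where \<sigma>: "0 < \<sigma>" "ball 0 \<sigma> \<subseteq> ball 0 \<rho> \<inter> c -` T" by (meson openE)
    define s where "s = \<sigma> / 2"
    have s: "0 < s" "cball (0 :: complex) s \<subseteq> ball 0 \<sigma>" using \<sigma>(1) by (auto simp: s_def)
    have "ball (0 :: complex) \<sigma> \<subseteq> ball 0 \<rho>" by (rule subset_trans[OF \<sigma>(2) Int_lower1])
    with s(2) have cs: "cball (0 :: complex) s \<subseteq> ball 0 \<rho>" by (rule order_trans)
    have "s < \<rho>"
    proof -
      have "complex_of_real s \<in> cball 0 s" using s by simp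
      then have "complex_of_real s \<in> ball 0 \<rho>" using cs by blast
      then show ?thesis using s by simp
    qed
    define K where "K = c ` cball 0 s"
    have K: "compact K" unfolding K_def using continuous_on_subset[OF contc cs] by (intro compact_continuous_image) auto
    have KW: "K \<subseteq> W" unfolding K_def T(2) using c(2) s(2) \<sigma>(2) by auto
    have "uniform_limit K (f \<circ> r) g sequentially"
      using g K KW unfolding converges_uniformly_on_compacts_def by blast
    then have "\<forall>\<^sub>F n in sequentially. \<forall>x\<in>K. dist ((f \<circ> r) n x) (g x) < 1"
      by (rule uniform_limitD) simp
    then obtain N where N: "\<And>n x. n \<ge> N \<Longrightarrow> x \<in> K \<Longrightarrow> dist ((f \<circ> r) n x) (g x) < 1"
      unfolding eventually_sequentially by blast
    have "compact (act P (ws (r N)) ` K)" using K by (intro compact_continuous_image continuous_act)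
    then obtain M' where M': "\<And>x. x \<in> K \<Longrightarrow> norm (act P (ws (r N)) x) \<le> M'"
      by (meson bounded_iff compact_imp_bounded imageI)
    \<comment> \<open>Beyond \<open>N\<close> both maps are within 1 of the limit, hence within 2 of
      each other, and the map of index \<open>N\<close> is bounded on \<open>K\<close>.\<close>
    have big: "norm (act P (ws (r n)) x) \<le> M' + 2" if "n \<ge> N" "x \<in> K" for n x
    proof -
      have fx: "(f \<circ> r) n x = act P (ws (r n)) x" for n using that KW WS by (auto simp: f_def)
      have "dist (act P (ws (r n)) x) (act P (ws (r N)) x) < 2"
        using N[OF that] N[OF order_refl that(2)] dist_triangle2[of "act P (ws (r n)) x" "act P (ws (r N)) x" "g x"]
        unfolding fx by linarith
      then have "norm (act P (ws (r n)) x) \<le> norm (act P (ws (r N)) x) + 2"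
        using norm_triangle_sub[of "act P (ws (r n)) x" "act P (ws (r N)) x"] by (simp add: dist_norm)
      then show ?thesis using M'[OF that(2)] by linarith
    qed
    have tail: "norm (dact P (ws (r n)) p v) \<le> 3 * ((M' + 2) / s)" if "n \<ge> N" for n
    proof (rule velocity_bound[OF s(1) _ \<open>s < \<rho>\<close>])
      show "(\<lambda>t. co l (act P (ws (r n)) (c t))) holomorphic_on ball 0 \<rho>" for l
        by (rule holomorphic_act[OF c(3)])
      show "has_velocity (\<lambda>t. act P (ws (r n)) (c t)) (dact P (ws (r n)) p v) 0"
        using has_velocity_act[OF c(5)] c(4) by simp
      show "norm (act P (ws (r n)) (c t)) \<le> M' + 2" if "t \<in> cball 0 s" for t
        using big[OF \<open>n \<ge> N\<close>] that by (auto simp: K_def)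
    qed
    define B where "B = max (3 * ((M' + 2) / s)) (Max ((\<lambda>k. norm (dact P (ws (r k)) p v)) ` {..N}))"
    have "norm (dact P (ws (r k)) p v) \<le> B" for k
    proof (cases "k \<ge> N")
      case True
      then show ?thesis using tail unfolding B_def by (meson max.coboundedI1)
    next
      case False
      then have "norm (dact P (ws (r k)) p v) \<le> Max ((\<lambda>k. norm (dact P (ws (r k)) p v)) ` {..N})"
        by (intro Max_ge) auto
      then show ?thesis unfolding B_def by (rule max.coboundedI2)
    qed
    then show ?thesis by blast
  qed
  then show ?thesis using r by blast
qed

text \<open>The words are rearranged so that the derivatives tend to infinity; then no subsequence
  of them is bounded.\<close>

lemma fixed_point_in_julia:
  assumes p: "p \<in> cubic_surface P" and smooth: "grad P p \<noteq> 0" and v: "dt (grad P p) v = 0"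
    and ws: "\<And>k :: nat. even (length (ws k))" "\<And>k. act P (ws k) p = p"
    and unb: "\<And>B. \<exists>k. B < norm (dact P (ws k) p v)"
  shows "p \<in> julia_set P"
proof (rule ccontr)
  assume "p \<notin> julia_set P"
  then have pf: "p \<in> fatou_set P" using p by (simp add: julia_set_def)
  have "\<exists>k. real n < norm (dact P (ws k) p v)" for n using unb by blast
  then obtain \<kappa> where \<kappa>: "\<And>n. real n < norm (dact P (ws (\<kappa> n)) p v)" by metis
  have "\<exists>r :: nat \<Rightarrow> nat. strict_mono r \<and>
      (\<forall>v. dt (grad P p) v = 0 \<longrightarrow> (\<exists>B. \<forall>k. norm (dact P (ws (\<kappa> (r k))) p v) \<le> B))"
    by (rule fatou_bounded_derivatives[OF pf smooth, of "\<lambda>n. ws (\<kappa> n)" "norm p"]) (use ws in simp_all)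
  then obtain r :: "nat \<Rightarrow> nat" where r: "strict_mono r"
      "\<forall>v. dt (grad P p) v = 0 \<longrightarrow> (\<exists>B. \<forall>k. norm (dact P (ws (\<kappa> (r k))) p v) \<le> B)" by blast
  obtain B where B: "\<And>k. norm (dact P (ws (\<kappa> (r k))) p v) \<le> B" using r(2) v by blast
  obtain n where "B < real n" using reals_Archimedean2 by blast
  moreover have "n \<le> r n" using r(1) by (rule seq_suble)
  ultimately have "B < norm (dact P (ws (\<kappa> (r n))) p v)" using \<kappa>[of "r n"] by (smt (verit) of_nat_le_iff)
  then show False using B[of n] by simp
qed

section \<open>Parabolic elements\<close>

text \<open>For \<open>z = 2 cos \<phi>\<close> the components of \<open>ch n z\<close> are \<open>sin (n \<phi>) / sin \<phi>\<close> and \<open>cos (n \<phi>)\<close>.\<close>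

fun ch :: "nat \<Rightarrow> complex \<Rightarrow> complex \<times> complex" where
  "ch 0 z = (0, 1)"
| "ch (Suc n) z = (fst (ch n z) * z / 2 + snd (ch n z), snd (ch n z) * z / 2 - (1 - z^2 / 4) * fst (ch n z))"

definition chS :: "nat \<Rightarrow> complex \<Rightarrow> complex" where "chS n z = fst (ch n z)"
definition chC :: "nat \<Rightarrow> complex \<Rightarrow> complex" where "chC n z = snd (ch n z)"

lemma ch_simps [simp]: "chS 0 z = 0" "chC 0 z = 1"
  "chS (Suc n) z = chS n z * z / 2 + chC n z" "chC (Suc n) z = chC n z * z / 2 - (1 - z^2 / 4) * chS n z"
  by (simp_all add: chS_def chC_def)

lemma ch_pythagoras: "(chC n z)^2 + (1 - z^2 / 4) * (chS n z)^2 = 1"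
proof (induction n)
  case (Suc n)
  have "(C * z / 2 - (1 - z^2 / 4) * S)^2 + (1 - z^2 / 4) * (S * z / 2 + C)^2 = C^2 + (1 - z^2 / 4) * S^2"
    for C S :: complex
    by (simp add: field_simps power2_eq_square)
  then show ?case using Suc by simp
qed simp

lemma ch_trig: "chS n (2 * cos \<phi>) * sin \<phi> = sin (of_nat n * \<phi>)" "chC n (2 * cos \<phi>) = cos (of_nat n * \<phi>)"
proof -
  have s: "1 - (2 * cos \<phi>)^2 / 4 = (sin \<phi>)^2"
    by (simp add: power_mult_distrib sin_squared_eq)
  have "chS n (2 * cos \<phi>) * sin \<phi> = sin (of_nat n * \<phi>) \<and> chC n (2 * cos \<phi>) = cos (of_nat n * \<phi>)"
  proof (induction n)
    case (Suc n)
    have e: "of_nat (Suc n) * \<phi> = of_nat n * \<phi> + \<phi>" by (simp add: algebra_simps)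
    have "chS (Suc n) (2 * cos \<phi>) * sin \<phi> = (chS n (2 * cos \<phi>) * sin \<phi>) * cos \<phi> + chC n (2 * cos \<phi>) * sin \<phi>"
      by (simp add: algebra_simps)
    moreover have "chC (Suc n) (2 * cos \<phi>) = chC n (2 * cos \<phi>) * cos \<phi> - (chS n (2 * cos \<phi>) * sin \<phi>) * sin \<phi>"
      unfolding ch_simps s by (simp add: power2_eq_square algebra_simps)
    ultimately show ?case using Suc unfolding e sin_add cos_add by (simp add: algebra_simps)
  qed simp
  then show "chS n (2 * cos \<phi>) * sin \<phi> = sin (of_nat n * \<phi>)" "chC n (2 * cos \<phi>) = cos (of_nat n * \<phi>)" by auto
qed

text \<open>The quotient of sines takes its limit value here, which is \<open>n\<close> up to
  sign.\<close>

lemma chS_at_two: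
  assumes "z^2 = 4" "0 < n"
  shows "chS n z \<noteq> 0"
proof -
  have z2: "(z / 2)^2 = 1" using assms(1) by (simp add: power_divide)
  have "chS n z * (z / 2) = of_nat n * (z / 2) ^ n \<and> chC n z = (z / 2) ^ n"
  proof (induction n)
    case (Suc n)
    have "chS n z = chS n z * (z / 2) * (z / 2)" using z2 by (simp add: power2_eq_square)
    also have "\<dots> = of_nat n * (z / 2) ^ Suc n" using Suc by simp
    finally have "chS n z = of_nat n * (z / 2) ^ Suc n" .
    moreover have "chS (Suc n) z * (z / 2) = chS n z * (z / 2)^2 + chC n z * (z / 2)"
      by (simp add: algebra_simps power2_eq_square)
    ultimately show ?case using Suc z2 assms(1) by (simp add: algebra_simps)
  qed simp
  moreover have "z / 2 \<noteq> 0" using z2 by auto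
  ultimately show ?thesis using assms(2) by auto
qed

text \<open>Differentiate \<open>sin (n \<phi>) / sin \<phi>\<close> and
  \<open>cos (n \<phi>)\<close> along \<open>dz = - 2 sin \<phi> d\<phi>\<close>; the induction
  avoids the choice of an angle.\<close>

lemma ch_deriv:
  assumes "z^2 \<noteq> 4"
  shows "(chS n has_field_derivative (z * chS n z - 2 * of_nat n * chC n z) / (4 - z^2)) (at z)"
    "(chC n has_field_derivative of_nat n * chS n z / 2) (at z)"
proof -
  have nz: "4 - z^2 \<noteq> 0" using assms by simp
  have "(chS n has_field_derivative (z * chS n z - 2 * of_nat n * chC n z) / (4 - z^2)) (at z) \<and>
    (chC n has_field_derivative of_nat n * chS n z / 2) (at z)"
  proof (induction n)
    case 0
    have "chS 0 = (\<lambda>_. 0)" "chC 0 = (\<lambda>_. 1)" by auto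
    then show ?case by simp
  next
    case (Suc n)
    let ?S = "chS n z" let ?C = "chC n z"
    define S' where "S' = (z * ?S - 2 * of_nat n * ?C) / (4 - z^2)"
    define C' where "C' = of_nat n * ?S / 2"
    have dS: "(chS n has_field_derivative S') (at z)" and dC: "(chC n has_field_derivative C') (at z)"
      using Suc by (auto simp: S'_def C'_def)
    have fe: "chS (Suc n) = (\<lambda>z. chS n z * z / 2 + chC n z)"
      "chC (Suc n) = (\<lambda>z. chC n z * z / 2 - (1 - z^2 / 4) * chS n z)" by auto
    have d1: "(chS (Suc n) has_field_derivative (S' * z + ?S) / 2 + C') (at z)"
      unfolding fe by (rule derivative_eq_intros dS dC refl | simp add: algebra_simps)+
    have d2: "(chC (Suc n) has_field_derivative (C' * z + ?C) / 2 - (- (2 * z / 4) * ?S + (1 - z^2 / 4) * S')) (at z)"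
      unfolding fe by (rule derivative_eq_intros dS dC refl | simp add: algebra_simps)+
    have nS: "(4 - z^2) * S' = z * ?S - 2 * of_nat n * ?C" using nz by (simp add: S'_def)
    have "(1 - z^2 / 4) * S' = ((4 - z^2) * S') / 4" by (simp add: field_simps)
    then have q: "(1 - z^2 / 4) * S' = (z * ?S - 2 * of_nat n * ?C) / 4" unfolding nS .
    have e2: "(C' * z + ?C) / 2 - (- (2 * z / 4) * ?S + (1 - z^2 / 4) * S') = of_nat (Suc n) * chS (Suc n) z / 2"
      unfolding q C'_def by (simp add: field_simps)
    have "(4 - z^2) * ((S' * z + ?S) / 2 + C') = (((4 - z^2) * S') * z + (4 - z^2) * ?S) / 2 + (4 - z^2) * C'"
      by (simp add: field_simps)
    also have "\<dots> = z * chS (Suc n) z - 2 * of_nat (Suc n) * chC (Suc n) z"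
      unfolding nS C'_def by (simp add: field_simps power2_eq_square)
    finally have e1: "(S' * z + ?S) / 2 + C' = (z * chS (Suc n) z - 2 * of_nat (Suc n) * chC (Suc n) z) / (4 - z^2)"
      using nz by (simp add: nonzero_eq_divide_eq mult.commute)
    show ?case using d1 d2 unfolding e1 e2 by blast
  qed
  then show "(chS n has_field_derivative (z * chS n z - 2 * of_nat n * chC n z) / (4 - z^2)) (at z)"
    "(chC n has_field_derivative of_nat n * chS n z / 2) (at z)" by auto
qed

definition pw :: "nat \<Rightarrow> letter list \<Rightarrow> letter list" where
  "pw n w = concat (replicate n w)"

lemma pw_simps [simp]: "pw 0 w = []" "pw (Suc n) w = w @ pw n w" "length (pw n w) = n * length w"
  by (simp_all add: pw_def length_concat sum_list_replicate)

lemma pw_add: "pw (m + n) w = pw m w @ pw n w"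
  by (induction m) auto

lemma pw_mult: "pw m (pw n w) = pw (m * n) w"
  by (induction m) (auto simp: pw_add)

text \<open>\<open>(N1, N2)\<close> is the Hamiltonian vector field of the preserved coordinate \<open>z\<close>.\<close>

lemma act_pw:
  assumes ijk: "i \<noteq> j" "j \<noteq> k" "i \<noteq> k"
    and xyz: "x = co j p" "y = co i p" "z = co k p"
    and N: "N1 = z * x + 2 * y - par i P" "N2 = par j P - 2 * x - z * y"
  shows "co j (act P (pw n [i, j]) p) = x + chS n z * (chS n z / 2 * (z * N1 + 2 * N2) - chC n z * N1)
    \<and> co i (act P (pw n [i, j]) p) = y + chS n z * (chS n z / 2 * (- 2 * N1 - z * N2) - chC n z * N2)
    \<and> co k (act P (pw n [i, j]) p) = z"
proof (induction n)
  case (Suc n)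
  let ?q = "act P (pw n [i, j]) p"
  define S C where "S = chS n z" "C = chC n z"
  have py: "C * C = 1 - (1 - z * z / 4) * (S * S)"
    using ch_pythagoras[of n z] by (simp add: S_C_def power2_eq_square algebra_simps)
  have k: "co k (act P (pw (Suc n) [i, j]) p) = z" using Suc ijk by (simp add: co_invol_other)
  have pi: "par i P = z * x + 2 * y - N1" and pj: "par j P = N2 + 2 * x + z * y" using N by auto
  define X Y where "X = x + S * (S / 2 * (z * N1 + 2 * N2) - C * N1)" "Y = y + S * (S / 2 * (- 2 * N1 - z * N2) - C * N2)"
  have q: "co j ?q = X" "co i ?q = Y" "co k ?q = z" using Suc by (auto simp: X_Y_def S_C_def)
  have s1: "co j (invol P j ?q) = - X - z * Y + par j P" using ijk q by (subst co_invol_same[of j k i]) auto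
  have s2: "co i (invol P j ?q) = Y" "co k (invol P j ?q) = z" using ijk q by (auto simp: co_invol_other)
  have s3: "co i (invol P i (invol P j ?q)) = - Y - z * (- X - z * Y + par j P) + par i P"
    using ijk s1 s2 by (subst co_invol_same[of i k j]) auto
  have s4: "co j (invol P i (invol P j ?q)) = - X - z * Y + par j P"
    using ijk s1 by (simp add: co_invol_other)
  \<comment> \<open>The two sides differ by a multiple of the relation
    \<open>ch_pythagoras\<close>.\<close>
  have "- X - z * Y + par j P = x + (S * z / 2 + C) * ((S * z / 2 + C) / 2 * (z * N1 + 2 * N2) - (C * z / 2 - (1 - z * z / 4) * S) * N1)"
  proof -
    have "- X - z * Y + par j P - (x + (S * z / 2 + C) * ((S * z / 2 + C) / 2 * (z * N1 + 2 * N2) - (C * z / 2 - (1 - z * z / 4) * S) * N1))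
       = N2 * ((1 - (1 - z * z / 4) * (S * S)) - C * C)"
      unfolding X_Y_def pj by (simp add: field_simps)
    then show ?thesis using py by simp
  qed
  moreover have "- Y - z * (- X - z * Y + par j P) + par i P
      = y + (S * z / 2 + C) * ((S * z / 2 + C) / 2 * (- 2 * N1 - z * N2) - (C * z / 2 - (1 - z * z / 4) * S) * N2)"
  proof -
    have "- Y - z * (- X - z * Y + par j P) + par i P
      - (y + (S * z / 2 + C) * ((S * z / 2 + C) / 2 * (- 2 * N1 - z * N2) - (C * z / 2 - (1 - z * z / 4) * S) * N2))
       = (- N1 - z * N2) * ((1 - (1 - z * z / 4) * (S * S)) - C * C)"
      unfolding X_Y_def pj pi by (simp add: field_simps)
    then show ?thesis using py by simp
  qed
  ultimately show ?case using k s3 s4 by (simp add: S_C_def power2_eq_square)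
qed (simp add: xyz)

text \<open>The displacement is \<open>chS n z\<close> times the image of \<open>(N1, N2)\<close>
  under a matrix whose determinant is 1 by \<open>ch_pythagoras\<close>.\<close>

lemma pw_fixed:
  assumes ijk: "i \<noteq> j" "j \<noteq> k" "i \<noteq> k"
    and xyz: "x = co j p" "y = co i p" "z = co k p"
    and N: "N1 = z * x + 2 * y - par i P" "N2 = par j P - 2 * x - z * y"
    and fix_p: "act P (pw n [i, j]) p = p"
  shows "chS n z = 0 \<or> N1 = 0 \<and> N2 = 0"
proof (rule disjCI)
  assume "\<not> (N1 = 0 \<and> N2 = 0)"
  show "chS n z = 0"
  proof (rule ccontr)
    assume S0: "chS n z \<noteq> 0"
    define S C where "S = chS n z" "C = chC n z"
    have py: "C * C + (1 - z * z / 4) * (S * S) = 1"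
      using ch_pythagoras[of n z] by (simp add: S_C_def power2_eq_square)
    have e: "S / 2 * (z * N1 + 2 * N2) - C * N1 = 0" "S / 2 * (- 2 * N1 - z * N2) - C * N2 = 0"
      using act_pw[OF ijk xyz N, of n] fix_p S0 xyz by (auto simp: S_C_def)
    have "N1 * (C * C + (1 - z * z / 4) * (S * S)) = (- (S * z / 2) - C) * (S / 2 * (z * N1 + 2 * N2) - C * N1) - S * (S / 2 * (- 2 * N1 - z * N2) - C * N2)"
      by (simp add: field_simps)
    then have "N1 = 0" unfolding e py by simp
    have "N2 * (C * C + (1 - z * z / 4) * (S * S)) = S * (S / 2 * (z * N1 + 2 * N2) - C * N1) + (S * z / 2 - C) * (S / 2 * (- 2 * N1 - z * N2) - C * N2)"
      by (simp add: field_simps)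
    then have "N2 = 0" unfolding e py by simp
    with \<open>N1 = 0\<close> \<open>\<not> (N1 = 0 \<and> N2 = 0)\<close> show False by simp
  qed
qed

text \<open>Where \<open>chS n z\<close> vanishes only its derivative contributes, so the power acts
  by a shear along the Hamiltonian field. The coefficient comes from \<open>ch_deriv\<close>, with
  the square of \<open>chC n z\<close> equal to 1.\<close>

lemma dact_pw:
  assumes ijk: "i \<noteq> j" "j \<noteq> k" "i \<noteq> k"
    and xyz: "x = co j p" "y = co i p" "z = co k p"
    and N: "N1 = z * x + 2 * y - par i P" "N2 = par j P - 2 * x - z * y"
    and S0: "chS n z = 0" and z4: "z^2 \<noteq> 4"
  shows "co j (dact P (pw n [i, j]) p v) = co j v + 2 * of_nat n / (4 - z^2) * co k v * N1"
    "co i (dact P (pw n [i, j]) p v) = co i v + 2 * of_nat n / (4 - z^2) * co k v * N2"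
    "co k (dact P (pw n [i, j]) p v) = co k v"
proof -
  define c where "c t = mk (\<lambda>l. co l p + t * co l v)" for t
  have c0: "c 0 = p" by (rule co_eqI) (simp add: c_def)
  have vel: "has_velocity c v 0"
    unfolding has_velocity_def c_def by (auto intro!: derivative_eq_intros)
  have vact: "((\<lambda>t. co l (act P (pw n [i, j]) (c t))) has_field_derivative co l (dact P (pw n [i, j]) p v)) (at 0)" for l
    using has_velocity_act[OF vel, of P "pw n [i, j]"] by (simp add: has_velocity_def c0)
  have dcl: "((\<lambda>t. co l (c t)) has_field_derivative co l v) (at 0)" for l
    using vel by (simp add: has_velocity_def)
  have dcl': "((\<lambda>t. co l (c t)) has_field_derivative co l v) (at 0)" for l by (rule dcl)
  define M1 where "M1 t = co k (c t) * co j (c t) + 2 * co i (c t) - par i P" for t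
  define M2 where "M2 t = par j P - 2 * co j (c t) - co k (c t) * co i (c t)" for t
  have M0: "M1 0 = N1" "M2 0 = N2" by (simp_all add: M1_def M2_def c0 N xyz)
  have dM: "\<exists>m. (M1 has_field_derivative m) (at 0)" "\<exists>m. (M2 has_field_derivative m) (at 0)"
    unfolding M1_def M2_def
    by (rule exI, (rule derivative_eq_intros dcl refl)+)+
  have z0: "co k (c 0) = z" by (simp add: c0 xyz)
  have C2: "chC n z * chC n z = 1" using ch_pythagoras[of n z] S0 by (simp add: power2_eq_square)
  have dS: "((\<lambda>t. chS n (co k (c t))) has_field_derivative (z * chS n z - 2 * of_nat n * chC n z) / (4 - z^2) * co k v) (at 0)"
    by (rule DERIV_chain2[OF _ dcl]) (simp add: z0 ch_deriv[OF z4])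
  have dC: "((\<lambda>t. chC n (co k (c t))) has_field_derivative (of_nat n * chS n z / 2) * co k v) (at 0)"
    by (rule DERIV_chain2[OF _ dcl]) (simp add: z0 ch_deriv[OF z4])
  have prod: "((\<lambda>t. a t + chS n (co k (c t)) * G t) has_field_derivative a' + (- 2 * of_nat n * chC n z) / (4 - z^2) * co k v * G 0) (at 0)"
    if aG: "(a has_field_derivative a') (at 0)" "\<exists>g. (G has_field_derivative g) (at 0)" for a a' G
  proof -
    obtain g where g: "(G has_field_derivative g) (at 0)" using aG(2) by blast
    show ?thesis using DERIV_add[OF aG(1) DERIV_mult[OF dS g]] by (simp add: z0 S0)
  qed
  have j: "co j (act P (pw n [i, j]) (c t)) = co j (c t) + chS n (co k (c t)) * (chS n (co k (c t)) / 2 * (co k (c t) * M1 t + 2 * M2 t) - chC n (co k (c t)) * M1 t)"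
    and i: "co i (act P (pw n [i, j]) (c t)) = co i (c t) + chS n (co k (c t)) * (chS n (co k (c t)) / 2 * (- 2 * M1 t - co k (c t) * M2 t) - chC n (co k (c t)) * M2 t)"
    and k: "co k (act P (pw n [i, j]) (c t)) = co k (c t)" for t
    using act_pw[OF ijk refl refl refl M1_def M2_def, of n] by blast+
  obtain m1 where m1: "(M1 has_field_derivative m1) (at 0)" using dM by blast
  obtain m2 where m2: "(M2 has_field_derivative m2) (at 0)" using dM by blast
  have "\<exists>g. ((\<lambda>t. chS n (co k (c t)) / 2 * (co k (c t) * M1 t + 2 * M2 t) - chC n (co k (c t)) * M1 t) has_field_derivative g) (at 0)"
    by (rule exI, (rule derivative_eq_intros dcl dS dC m1 m2 refl | simp)+)
  from prod[OF dcl[of j] this]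
  have "co j (dact P (pw n [i, j]) p v) = co j v + (- 2 * of_nat n * chC n z) / (4 - z^2) * co k v * (- chC n z * N1)"
    using vact[of j] unfolding j by (intro DERIV_unique) (auto simp: z0 S0 M0)
  also have "\<dots> = co j v + 2 * of_nat n / (4 - z^2) * co k v * N1 * (chC n z * chC n z)" by simp
  finally show "co j (dact P (pw n [i, j]) p v) = co j v + 2 * of_nat n / (4 - z^2) * co k v * N1" unfolding C2 by simp
  have "\<exists>g. ((\<lambda>t. chS n (co k (c t)) / 2 * (- 2 * M1 t - co k (c t) * M2 t) - chC n (co k (c t)) * M2 t) has_field_derivative g) (at 0)"
    by (rule exI, (rule derivative_eq_intros dcl dS dC m1 m2 refl | simp)+)
  from prod[OF dcl[of i] this]
  have "co i (dact P (pw n [i, j]) p v) = co i v + (- 2 * of_nat n * chC n z) / (4 - z^2) * co k v * (- chC n z * N2)"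
    using vact[of i] unfolding i by (intro DERIV_unique) (auto simp: z0 S0 M0)
  also have "\<dots> = co i v + 2 * of_nat n / (4 - z^2) * co k v * N2 * (chC n z * chC n z)" by simp
  finally show "co i (dact P (pw n [i, j]) p v) = co i v + 2 * of_nat n / (4 - z^2) * co k v * N2" unfolding C2 by simp
  show "co k (dact P (pw n [i, j]) p v) = co k v"
    using vact[of k] dcl[of k] unfolding k by (intro DERIV_unique)
qed

lemma dact_csc_pw:
  assumes "act P w p = p" "dact P w p v = csc r v"
  shows "act P (pw n w) p = p" "dact P (pw n w) p v = csc (r ^ n) v"
proof -
  show a: "act P (pw n w) p = p" for n by (induction n) (auto simp: assms)
  show "dact P (pw n w) p v = csc (r ^ n) v"
    by (induction n) (auto simp: assms a dact_linear mult.commute)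
qed

lemma norm_csc: "norm (csc u v) = cmod u * norm v"
  by (cases v) (simp add: norm_Pair norm_mult power_mult_distrib real_sqrt_mult flip: distrib_left)

lemma power_unbounded:
  assumes "1 < cmod r" "v \<noteq> 0"
  shows "\<exists>n. B < norm (csc (r ^ n) v)"
proof -
  obtain n where "B / norm v < cmod r ^ n" using real_arch_pow[OF assms(1)] by blast
  then have "B < cmod r ^ n * norm v" using assms(2) by (simp add: pos_divide_less_eq)
  then show ?thesis by (auto simp: norm_csc norm_power)
qed

text \<open>If \<open>(N1, N2)\<close> is non-zero, the iterates act by shears whose size grows
  linearly. Otherwise both involutions fix \<open>p\<close>, and their product has eigenvalues with
  sum \<open>z^2 - 2\<close> on the tangent plane; \<open>center_not_real\<close> makes one of them
  expanding.\<close>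

lemma parabolic_unbounded:
  assumes gen: "P \<notin> nongeneric" and p: "p \<in> cubic_surface P" and "i \<noteq> j" "0 < m"
    and fix_p: "act P (pw m [i, j]) p = p"
  shows "\<exists>v. dt (grad P p) v = 0 \<and> (\<forall>B. \<exists>n. B < norm (dact P (pw n (pw m [i, j])) p v))"
proof -
  obtain k where ijk: "i \<noteq> j" "j \<noteq> k" "i \<noteq> k" using third_letter[OF \<open>i \<noteq> j\<close>] \<open>i \<noteq> j\<close> by metis
  define x y z where "x = co j p" "y = co i p" "z = co k p"
  note xyz = x_y_z_def
  define N1 N2 where "N1 = z * x + 2 * y - par i P" "N2 = par j P - 2 * x - z * y"
  note N = N1_N2_def
  have gN: "co i (grad P p) = N1" "co j (grad P p) = - N2"
    using ijk by (simp_all add: co_grad[of i j k] co_grad[of j i k] xyz N algebra_simps)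
  have smooth: "grad P p \<noteq> 0" by (rule smooth_of_generic[OF gen p])
  show ?thesis
  proof (cases "N1 = 0 \<and> N2 = 0")
    case False
    have S0: "chS (n * m) z = 0" for n
    proof -
      have "act P (pw n (pw m [i, j])) p = p" by (induction n) (auto simp: fix_p)
      then have "act P (pw (n * m) [i, j]) p = p" by (simp add: pw_mult)
      then show ?thesis using pw_fixed[OF ijk xyz N] False by blast
    qed
    have z4: "z^2 \<noteq> 4" using chS_at_two[of z m] S0[of 1] \<open>0 < m\<close> by auto
    define g where "g = co k (grad P p)"
    have "\<exists>a b. - N2 * a + N1 * b + g = 0"
    proof (cases "N1 = 0")
      case True
      then show ?thesis using False by (intro exI[of _ "g / N2"] exI[of _ 0]) simp
    next
      case False
      then show ?thesis by (intro exI[of _ 0] exI[of _ "- g / N1"]) simp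
    qed
    then obtain a b where ab: "- N2 * a + N1 * b + g = 0" by blast
    \<comment> \<open>A vector with coordinate 1 in the direction \<open>k\<close>, so that the
      shear acts on it; \<open>a\<close> and \<open>b\<close> make it tangent.\<close>
    define v where "v = mk (\<lambda>l. if l = j then a else if l = i then b else 1)"
    have v: "co j v = a" "co i v = b" "co k v = 1" using ijk by (auto simp: v_def)
    have "dt (grad P p) v = 0"
      unfolding dt_letters[OF ijk] gN g_def[symmetric] v using ab by (simp add: algebra_simps)
    moreover have "\<exists>n. B < norm (dact P (pw n (pw m [i, j])) p v)" for B
    proof -
      define c where "c = 2 * of_nat m / (4 - z^2)"
      have c0: "c \<noteq> 0" using z4 \<open>0 < m\<close> by (simp add: c_def)
      have d: "co j (dact P (pw n (pw m [i, j])) p v) = a + of_nat n * (c * N1)"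
        "co i (dact P (pw n (pw m [i, j])) p v) = b + of_nat n * (c * N2)" for n
        unfolding pw_mult dact_pw(1,2)[OF ijk xyz N S0 z4] v by (simp_all add: c_def)
      have unb: "\<exists>n. B < cmod (a + of_nat n * e)" if "e \<noteq> 0" for a e
      proof -
        obtain n where "(B + cmod a) / cmod e < real n" using reals_Archimedean2 by blast
        then have "B + cmod a < cmod (of_nat n * e)" using that by (simp add: pos_divide_less_eq norm_mult)
        also have "\<dots> \<le> cmod (a + of_nat n * e) + cmod a"
          using norm_triangle_ineq4[of "a + of_nat n * e" a] by simp
        finally show ?thesis by auto
      qed
      show ?thesis
      proof (cases "N1 = 0")
        case True
        then obtain n where "B < cmod (b + of_nat n * (c * N2))" using unb[of "c * N2" b] False c0 by auto
        then have "B < norm (dact P (pw n (pw m [i, j])) p v)" using co_le_norm unfolding d(2)[symmetric] by (rule less_le_trans)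
        then show ?thesis by blast
      next
        case False
        then obtain n where "B < cmod (a + of_nat n * (c * N1))" using unb[of "c * N1" a] c0 by auto
        then have "B < norm (dact P (pw n (pw m [i, j])) p v)" using co_le_norm unfolding d(1)[symmetric] by (rule less_le_trans)
        then show ?thesis by blast
      qed
    qed
    ultimately show ?thesis by blast
  next
    case True
    have fixij: "invol P i p = p" "invol P j p = p"
    proof -
      have "co l (invol P i p) = co l p" for l
      proof (cases "l = i")
        case True
        have "2 * y + z * x - par i P = 0" using \<open>N1 = 0 \<and> N2 = 0\<close> by (simp add: N algebra_simps)
        then show ?thesis using True ijk by (subst True) (simp add: co_invol_same[of i j k] xyz algebra_simps eq_diff_eq)
      qed (simp add: co_invol_other)
      then show "invol P i p = p" by (rule co_eqI)
      have "co l (invol P j p) = co l p" for l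
      proof (cases "l = j")
        case True
        have "2 * x + z * y - par j P = 0" using \<open>N1 = 0 \<and> N2 = 0\<close> by (simp add: N algebra_simps)
        then show ?thesis using True ijk by (subst True) (simp add: co_invol_same[of j i k] xyz algebra_simps eq_diff_eq)
      qed (simp add: co_invol_other)
      then show "invol P j p = p" by (rule co_eqI)
    qed
    have pij: "par i P = z * x + 2 * y" "par j P = 2 * x + z * y" using True by (auto simp: N algebra_simps)
    have surf: "x^2 + y^2 + z^2 + x * y * z = par j P * x + par i P * y + par k P * z + par0 P"
      using p surface_iff[of j i k p P] ijk by (simp add: xyz)
    have eq: "(4 - z^2) * (z^2 - par k P * z - par0 P) = (par i P)^2 + (par j P)^2 - par i P * par j P * z"
    proof -
      have e: "z^2 - par k P * z - par0 P = par j P * x + par i P * y - x^2 - y^2 - x * y * z"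
        using surf by (simp add: algebra_simps)
      show ?thesis unfolding e unfolding pij by (simp add: algebra_simps power2_eq_square)
    qed
    \<comment> \<open>A value in \<open>[-2, 2]\<close> would put \<open>z^2\<close> into
      \<open>[0, 4]\<close> and make \<open>z\<close> real.\<close>
    have notreal: "z^2 - 2 \<notin> of_real ` {-2..2}"
    proof
      assume "z^2 - 2 \<in> of_real ` {-2..2}"
      then obtain r where r: "z^2 - 2 = of_real r" "-2 \<le> r" "r \<le> 2" by auto
      then have "z^2 = of_real (r + 2)" by (simp add: algebra_simps)
      also have "\<dots> = (of_real (sqrt (r + 2)))^2" using r by (simp flip: of_real_power)
      finally have "z = of_real (sqrt (r + 2)) \<or> z = - of_real (sqrt (r + 2))" by (simp add: power2_eq_iff)
      then have "cnj z = z" by auto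
      then show False using center_not_real[OF gen ijk eq] by blast
    qed
    obtain r where r: "1 < cmod r" "r^2 - (z^2 - 2) * r + 1 = 0" using expanding_root[OF notreal] by blast
    \<comment> \<open>An eigenvector of the product of the two reflections for the eigenvalue
      \<open>r\<close>; its tangency holds because only the direction \<open>k\<close> of the
      gradient is non-zero.\<close>
    define v where "v = mk (\<lambda>l. if l = j then - z else if l = i then 1 + r else 0)"
    have v: "co j v = - z" "co i v = 1 + r" "co k v = 0" using ijk by (auto simp: v_def)
    have "dt (grad P p) v = 0" unfolding dt_letters[OF ijk] gN v using True by simp
    moreover have "dact P [i, j] p v = csc r v"
    proof (rule co_eqI)
      fix l
      let ?v = "dinvol j p v"
      have s: "co j ?v = z - z * (1 + r)" "co i ?v = 1 + r" "co k ?v = 0"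
        using ijk v by (auto simp: co_dinvol_other co_dinvol_same[of j k i] xyz)
      have t: "co i (dinvol i p ?v) = - (1 + r) - z * (z - z * (1 + r))" "co j (dinvol i p ?v) = z - z * (1 + r)" "co k (dinvol i p ?v) = 0"
        using ijk s by (auto simp: co_dinvol_other co_dinvol_same[of i j k] xyz)
      have cs: "co l (csc r v) = r * co l v" for l by (cases v; cases l) auto
      have "- (1 + r) - z * (z - z * (1 + r)) = r * (1 + r)" using r(2) by algebra
      then show "co l (dact P [i, j] p v) = co l (csc r v)"
        using letter_distinct_cases[OF ijk, of l] t v by (auto simp: fixij cs algebra_simps)
    qed
    then have "dact P (pw m [i, j]) p v = csc (r ^ m) v"
      by (intro dact_csc_pw(2)) (simp_all add: fixij)
    then have d: "dact P (pw n (pw m [i, j])) p v = csc ((r ^ m) ^ n) v" for n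
      by (rule dact_csc_pw(2)[OF fix_p])
    have "1 < cmod (r ^ m)" using r(1) \<open>0 < m\<close> by (simp add: norm_power one_less_power)
    moreover have "v \<noteq> 0"
    proof
      assume "v = 0"
      then have "1 + r = 0" using v(2) by simp
      then have "r = - 1" by (simp add: add_eq_0_iff)
      then show False using r(1) by simp
    qed
    ultimately show ?thesis using power_unbounded[of "r ^ m" v] by (intro exI[of _ v]) (simp add: d)
  qed
qed

section \<open>Fixed points lie in the Julia set\<close>

lemma cyclic_reduction:
  assumes "distinct_adj w" "even (length w)" "w \<noteq> []"
  obtains u v where "w = u @ v @ rev u" "distinct_adj v" "even (length v)" "v \<noteq> []" "hd v \<noteq> last v"
proof -
  have "\<exists>u v. w = u @ v @ rev u \<and> distinct_adj v \<and> even (length v) \<and> v \<noteq> [] \<and> hd v \<noteq> last v"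
    using assms
  proof (induction "length w" arbitrary: w rule: less_induct)
    case less
    show ?case
    proof (cases "hd w = last w")
      case False
      then show ?thesis using less.prems by (intro exI[of _ "[]"] exI[of _ w]) simp
    next
      case True
      obtain l m where w: "w = l # m" using less.prems by (cases w) auto
      then have "m \<noteq> []" using less.prems(2) by auto
      then obtain m' l' where m: "m = m' @ [l']" by (metis rev_exhaust)
      then have l: "l' = l" using True w by simp
      have ne: "m' \<noteq> []" using less.prems(1) w m l by (auto simp: distinct_adj_Cons)
      have "distinct_adj m'" using less.prems(1) w m by (auto simp: distinct_adj_Cons dest: distinct_adj_appendD1)
      moreover have "even (length m')" using less.prems(2) w m by simp
      ultimately obtain u v where "m' = u @ v @ rev u" "distinct_adj v" "even (length v)" "v \<noteq> []" "hd v \<noteq> last v"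
        using less.hyps[of m'] ne w m by auto
      then show ?thesis using w m l by (intro exI[of _ "l # u"] exI[of _ v]) simp
    qed
  qed
  then show ?thesis using that by blast
qed

lemma alternating_word:
  assumes "distinct_adj w" "even (length w)" "set w \<subseteq> {i, j}" "w = [] \<or> hd w = i"
  shows "\<exists>m. w = pw m [i, j]"
  using assms
proof (induction w rule: induct_list012)
  case 1
  then show ?case by (intro exI[of _ 0]) simp
next
  case (3 a b w)
  have a: "a = i" "b = j" using 3 by (auto simp: distinct_adj_Cons)
  have "w = [] \<or> hd w = i" using 3 a by (cases w) (auto simp: distinct_adj_Cons)
  then obtain m where "w = pw m [i, j]" using 3 by (auto simp: distinct_adj_Cons)
  then show ?case using a by (intro exI[of _ "Suc m"]) simp
qed simp

lemma dinvol_bound: "norm (dinvol l p v) \<le> (3 + 2 * norm p) * norm v"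
proof -
  obtain j k where ijk: "l \<noteq> j" "j \<noteq> k" "l \<noteq> k" by (rule other_letters)
  have b: "cmod (co m v) \<le> norm v" "cmod (co m p) \<le> norm p" for m by (rule co_le_norm)+
  have "cmod (co l (dinvol l p v)) \<le> cmod (- co l v - co k p * co j v) + cmod (co j p * co k v)"
    unfolding co_dinvol_same[OF ijk] by (rule norm_triangle_ineq4)
  also have "cmod (- co l v - co k p * co j v) \<le> cmod (- co l v) + cmod (co k p * co j v)" by (rule norm_triangle_ineq4)
  finally have "cmod (co l (dinvol l p v)) \<le> norm v + norm p * norm v + norm p * norm v"
    using b[of l] mult_mono[OF b(2)[of k] b(1)[of j]] mult_mono[OF b(2)[of j] b(1)[of k]] by (simp add: norm_mult)
  then have d: "cmod (co m (dinvol l p v)) \<le> (if m = l then norm v + 2 * (norm p * norm v) else norm v)" for m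
    using b(1)[of m] by (cases "m = l") (auto simp: co_dinvol_other)
  show ?thesis
    using norm_point_le[of "dinvol l p v"] d[of X] d[of Y] d[of Z]
    by (cases l) (auto simp: algebra_simps)
qed

lemma dact_bound: "\<exists>K. \<forall>v. norm (dact P w p v) \<le> K * norm v"
proof (induction w)
  case Nil
  show ?case by (intro exI[of _ 1]) simp
next
  case (Cons l w)
  then obtain K where K: "\<And>v. norm (dact P w p v) \<le> K * norm v" by blast
  have "norm (dact P (l # w) p v) \<le> ((3 + 2 * norm (act P w p)) * K) * norm v" for v
  proof -
    have "norm (dact P (l # w) p v) \<le> (3 + 2 * norm (act P w p)) * norm (dact P w p v)"
      using dinvol_bound by simp
    also have "\<dots> \<le> (3 + 2 * norm (act P w p)) * (K * norm v)" using K by (intro mult_left_mono) auto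
    finally show ?thesis by (simp add: mult.assoc)
  qed
  then show ?case by blast
qed

text \<open>Conjugation by \<open>u\<close> moves the fixed point to one of the cyclically reduced
  word \<open>v\<close>, where the derivatives of powers are unbounded, and this property survives
  conjugation.\<close>

theorem fixed_points_in_julia:
  assumes gen: "P \<notin> nongeneric" and g: "\<gamma> \<in> group_G P" "\<gamma> \<noteq> \<one>\<^bsub>bijections P\<^esub>"
    and p: "p \<in> cubic_surface P" "\<gamma> p = p"
  shows "p \<in> julia_set P"
proof -
  obtain w where w: "distinct_adj w" "even (length w)" "\<gamma> = restrict (act P w) (cubic_surface P)"
    using group_G_reduced[OF g(1)] by blast
  have "w \<noteq> []" using w(3) g(2) by (auto simp: bij_one)
  then obtain u v where uv: "w = u @ v @ rev u" "distinct_adj v" "even (length v)" "v \<noteq> []" "hd v \<noteq> last v"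
    using cyclic_reduction[OF w(1,2)] by blast
  define q where "q = act P (rev u) p"
  have q: "q \<in> cubic_surface P" unfolding q_def using p(1) by (rule act_surface)
  have pq: "p = act P u q" by (simp add: q_def)
  have "act P w p = p" using p w(3) by simp
  then have "act P u (act P v q) = act P u q" by (simp add: uv(1) q_def)
  then have "act P (rev u) (act P u (act P v q)) = act P (rev u) (act P u q)" by simp
  then have fix_q: "act P v q = q" by simp
  have smooth: "grad P p \<noteq> 0" "grad P q \<noteq> 0" by (rule smooth_of_generic[OF gen p(1)], rule smooth_of_generic[OF gen q])
  have "\<exists>x. dt (grad P q) x = 0 \<and> (\<forall>B. \<exists>n. B < norm (dact P (pw n v) q x))"
  proof (cases "set v = UNIV")
    case True
    then have full: "full_cyclic v" using uv by (simp add: full_cyclic_def)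
    obtain x r where x: "1 < cmod r" "x \<noteq> 0" "dt (grad P q) x = 0" "dact P v q x = csc r x"
      using expanding_eigenvector[OF fix_q uv(3) smooth(2) fixed_point_trace[OF gen full uv(3) q fix_q]] by blast
    have "dact P (pw n v) q x = csc (r ^ n) x" for n by (rule dact_csc_pw(2)[OF fix_q x(4)])
    then show ?thesis using x power_unbounded by (intro exI[of _ x]) simp
  next
    case False
    then obtain l where l: "l \<notin> set v" by blast
    define i j where "i = hd v" "j = last v"
    have ij: "i \<in> set v" "j \<in> set v" "i \<noteq> j" using uv by (auto simp: i_j_def)
    have "set v \<subseteq> {i, j}"
    proof
      fix m assume "m \<in> set v"
      then show "m \<in> {i, j}" using letter_distinct_cases[of i j l m] ij l by auto
    qed
    then have "\<exists>m. v = pw m [i, j]" by (rule alternating_word[OF uv(2,3)]) (simp add: i_j_def)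
    then obtain m where m: "v = pw m [i, j]" by blast
    have "0 < m" using m uv(4) by (cases m) auto
    then show ?thesis using parabolic_unbounded[OF gen q ij(3)] fix_q unfolding m by blast
  qed
  then obtain x where x: "dt (grad P q) x = 0" "\<And>B. \<exists>n. B < norm (dact P (pw n v) q x)" by blast
  define ws where "ws n = u @ pw n v @ rev u" for n
  have fixn: "act P (pw n v) q = q" for n by (induction n) (auto simp: fix_q)
  have undo_u: "dact P (rev u) p (dact P u q y) = y" for y unfolding pq by simp
  show ?thesis
  proof (rule fixed_point_in_julia[OF p(1) smooth(1), of "dact P u q x" ws])
    show "dt (grad P p) (dact P u q x) = 0" unfolding pq grad_dact by (rule x(1))
    show "even (length (ws n))" for n using uv(3) by (simp add: ws_def)
    show "act P (ws n) p = p" for n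
      using fixn[of n] pq by (simp add: ws_def q_def[symmetric])
    fix B
    \<comment> \<open>The derivative of \<open>rev u\<close> is bounded, so vectors that are large
      before the conjugation stay large after it; \<open>max B 0\<close> covers negative
      bounds.\<close>
    obtain K where K: "\<And>y. norm (dact P (rev u) p y) \<le> K * norm y" using dact_bound by blast
    obtain n where n: "max B 0 * (\<bar>K\<bar> + 1) < norm (dact P (pw n v) q x)" using x(2) by blast
    have d: "dact P (ws n) p (dact P u q x) = dact P u q (dact P (pw n v) q x)"
      using fixn[of n] undo_u[of x] by (simp add: ws_def q_def[symmetric])
    have "norm (dact P (pw n v) q x) \<le> K * norm (dact P (ws n) p (dact P u q x))"
      using K[of "dact P u q (dact P (pw n v) q x)"] unfolding d undo_u .
    also have "\<dots> \<le> (\<bar>K\<bar> + 1) * norm (dact P (ws n) p (dact P u q x))" by (intro mult_right_mono) auto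
    finally have "max B 0 * (\<bar>K\<bar> + 1) < norm (dact P (ws n) p (dact P u q x)) * (\<bar>K\<bar> + 1)" using n by (simp add: mult.commute)
    then have "max B 0 < norm (dact P (ws n) p (dact P u q x))" by (rule mult_right_less_imp_less) simp
    then show "\<exists>n. B < norm (dact P (ws n) p (dact P u q x))" by (intro exI[of _ n]) simp
  qed
qed

section \<open>Iterated commutators\<close>

definition near_id :: "param \<Rightarrow> point \<Rightarrow> real \<Rightarrow> real \<Rightarrow> letter list \<Rightarrow> bool" where
  "near_id P q r \<epsilon> w \<longleftrightarrow> (\<forall>x\<in>ball q r. norm (act P w x - x) \<le> \<epsilon>)"

lemma co_diff: "co l (p - q) = co l p - co l q"
  by (cases p; cases q; cases l) auto

lemma co_plus: "co l (p + q) = co l p + co l q"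
  by (cases p; cases q; cases l) auto

lemma co_csc: "co l (csc u v) = u * co l v"
  by (cases v; cases l) auto

text \<open>Cauchy's estimate on the complex line through two points.\<close>

lemma near_id_lipschitz:
  assumes near: "near_id P q r \<epsilon> w" and \<tau>: "0 < \<tau>" and xy: "x \<in> ball q (r - \<tau>)" "y \<in> ball q (r - \<tau>)"
  shows "norm ((act P w x - x) - (act P w y - y)) \<le> 3 * (\<epsilon> / \<tau>) * norm (x - y)"
proof (cases "x = y")
  case False
  define d where "d = norm (x - y)"
  have d: "0 < d" using False by (simp add: d_def)
  define v where "v = csc (of_real (1 / d)) (x - y)"
  have v1: "norm v = 1" using d by (simp add: v_def norm_csc norm_divide d_def[symmetric])
  define c where "c t = y + csc t v" for t
  have cd: "c (of_real d) = x" using d by (simp add: c_def v_def)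
  have c0: "c 0 = y" by (simp add: c_def)
  have "0 \<le> \<epsilon>"
  proof -
    have "x \<in> ball q r" using xy \<tau> by auto
    then show ?thesis using near unfolding near_id_def by (meson norm_ge_zero order_trans)
  qed
  have on_line: "c (of_real s) \<in> ball q (r - \<tau>)" if "0 \<le> s" "s \<le> d" for s
  proof -
    have "csc (of_real s) v = (s / d) *\<^sub>R (x - y)"
    proof -
      obtain x1 x2 x3 y1 y2 y3 where "x = (x1, x2, x3)" "y = (y1, y2, y3)" by (metis prod.exhaust)
      then show ?thesis by (simp add: v_def scaleR_conv_of_real)
    qed
    then have "c (of_real s) = (1 - s / d) *\<^sub>R y + (s / d) *\<^sub>R x" by (simp add: c_def algebra_simps)
    then show ?thesis using convexD[OF convex_ball xy(2,1), of "1 - s / d" "s / d"] that d by (simp add: field_simps)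
  qed
  have comp: "cmod (co l ((act P w x - x) - (act P w y - y))) \<le> (\<epsilon> / \<tau>) * d" for l
  proof -
    define g where "g t = co l (act P w (c t)) - co l (c t)" for t
    have holc: "(\<lambda>t. co m (c t)) holomorphic_on A" for m A
      unfolding c_def co_plus co_csc by (intro holomorphic_intros)
    have holg: "g holomorphic_on A" for A
      unfolding g_def by (intro holomorphic_intros holomorphic_act holc)
    have der: "(g has_field_derivative deriv g z) (at z)" for z
      using holg[of UNIV] by (simp add: holomorphic_derivI)
    have bound: "cmod (deriv g (of_real s)) \<le> \<epsilon> / \<tau>" if "0 \<le> s" "s \<le> d" for s
    proof -
      have "cmod ((deriv ^^ 1) g (of_real s)) \<le> fact 1 * \<epsilon> / \<tau> ^ 1"
      proof (rule Cauchy_inequality[OF holg _ \<tau>])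
        show "continuous_on (cball (of_real s) \<tau>) g" using holg by (rule holomorphic_on_imp_continuous_on)
        fix t assume t: "cmod (of_real s - t) = \<tau>"
        have "c t - c (of_real s) = csc (t - of_real s) v"
          by (rule co_eqI) (simp add: c_def co_plus co_diff co_csc algebra_simps)
        then have "dist (c t) (c (of_real s)) = \<tau>" using t v1 by (simp add: dist_norm norm_csc norm_minus_commute)
        moreover have "dist q (c (of_real s)) < r - \<tau>" using on_line[OF that] by simp
        ultimately have "c t \<in> ball q r" using dist_triangle[of q "c t" "c (of_real s)"] by (simp add: dist_commute)
        then have "norm (act P w (c t) - c t) \<le> \<epsilon>" using near by (simp add: near_id_def)
        then have "cmod (co l (act P w (c t) - c t)) \<le> \<epsilon>" using co_le_norm order_trans by blast
        then show "cmod (g t) \<le> \<epsilon>" by (simp add: g_def co_diff)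
      qed
      then show ?thesis by simp
    qed
    have "cmod (g (of_real d) - g 0) \<le> (\<epsilon> / \<tau>) * cmod (of_real d - 0)"
    proof (rule field_differentiable_bound)
      show "convex (closed_segment 0 (complex_of_real d))" by (rule convex_closed_segment)
      fix z assume "z \<in> closed_segment 0 (complex_of_real d)"
      then obtain u where u: "0 \<le> u" "u \<le> 1" "z = of_real (u * d)"
        by (auto simp: in_segment scaleR_conv_of_real)
      show "(g has_field_derivative deriv g z) (at z within closed_segment 0 (complex_of_real d))"
        using der by (rule has_field_derivative_at_within)
      have "u * d \<le> d" using u d by (simp add: mult_left_le_one_le)
      then show "cmod (deriv g z) \<le> \<epsilon> / \<tau>" using bound[of "u * d"] u d by simp
    qed auto
    then show ?thesis using d by (simp add: g_def cd c0 co_diff)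
  qed
  show ?thesis
    using norm_point_le[of "(act P w x - x) - (act P w y - y)"] comp[of X] comp[of Y] comp[of Z]
    by (simp add: d_def)
qed simp

text \<open>The displacement of a commutator is a difference of two increments of maps minus the
  identity. Points move by at most \<open>\<epsilon>\<close> and the Lipschitz constant is
  \<open>3 * (\<epsilon> / \<tau>)\<close>, so the bound is quadratic. One \<open>\<tau>\<close> of
  the radius is reserved for the intermediate points, the other for Cauchy's estimate.\<close>

lemma near_id_commutator:
  assumes n: "near_id P q r \<epsilon> u" "near_id P q r \<epsilon> (rev u)" "near_id P q r \<epsilon> v" "near_id P q r \<epsilon> (rev v)"
    and \<tau>: "0 < \<tau>" "4 * \<epsilon> \<le> \<tau>" and \<epsilon>: "0 \<le> \<epsilon>"
  shows "near_id P q (r - 2 * \<tau>) (6 * \<epsilon>^2 / \<tau>) (u @ v @ rev u @ rev v)"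
  unfolding near_id_def
proof
  fix x assume x: "x \<in> ball q (r - 2 * \<tau>)"
  have move: "act P w y \<in> ball q (s + \<epsilon>)" if "near_id P q r \<epsilon> w" "y \<in> ball q s" "s \<le> r" for w y s
  proof -
    have "y \<in> ball q r" using that by auto
    then have "norm (act P w y - y) \<le> \<epsilon>" using that(1) by (simp add: near_id_def)
    then show ?thesis using that(2) dist_triangle[of q "act P w y" y] by (simp add: dist_norm norm_minus_commute)
  qed
  define s where "s = act P (rev u) (act P (rev v) x)"
  have b1: "act P (rev v) x \<in> ball q (r - 2 * \<tau> + \<epsilon>)" by (rule move[OF n(4) x]) (use \<tau> in auto)
  have b2: "s \<in> ball q (r - 2 * \<tau> + \<epsilon> + \<epsilon>)" unfolding s_def by (rule move[OF n(2) b1]) (use \<tau> \<epsilon> in auto)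
  have b3: "act P v s \<in> ball q (r - 2 * \<tau> + \<epsilon> + \<epsilon> + \<epsilon>)" "act P u s \<in> ball q (r - 2 * \<tau> + \<epsilon> + \<epsilon> + \<epsilon>)"
    using move[OF n(3) b2] move[OF n(1) b2] \<tau> \<epsilon> by auto
  have sub: "ball q t \<subseteq> ball q (r - \<tau>)" if "t \<le> r - \<tau>" for t using that by auto
  have in': "s \<in> ball q (r - \<tau>)" "act P v s \<in> ball q (r - \<tau>)" "act P u s \<in> ball q (r - \<tau>)"
    using subsetD[OF sub b2] subsetD[OF sub b3(1)] subsetD[OF sub b3(2)] \<tau> \<epsilon> by auto
  then have sr: "s \<in> ball q r" using \<tau> by auto
  have moves: "norm (act P v s - s) \<le> \<epsilon>" "norm (act P u s - s) \<le> \<epsilon>"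
    using n(1,3) sr by (auto simp: near_id_def)
  have xs: "x = act P v (act P u s)" by (simp add: s_def)
  have "act P (u @ v @ rev u @ rev v) x - x = act P u (act P v s) - act P v (act P u s)"
    by (simp add: s_def)
  also have "\<dots> = ((act P u (act P v s) - act P v s) - (act P u s - s)) - ((act P v (act P u s) - act P u s) - (act P v s - s))"
    by simp
  finally have "norm (act P (u @ v @ rev u @ rev v) x - x) \<le>
      norm ((act P u (act P v s) - act P v s) - (act P u s - s)) + norm ((act P v (act P u s) - act P u s) - (act P v s - s))"
    by (simp only: norm_triangle_ineq4)
  also have "norm ((act P u (act P v s) - act P v s) - (act P u s - s)) \<le> 3 * (\<epsilon> / \<tau>) * norm (act P v s - s)"
    by (rule near_id_lipschitz[OF n(1) \<tau>(1) in'(2,1)])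
  also have "norm ((act P v (act P u s) - act P u s) - (act P v s - s)) \<le> 3 * (\<epsilon> / \<tau>) * norm (act P u s - s)"
    by (rule near_id_lipschitz[OF n(3) \<tau>(1) in'(3,1)])
  also have "3 * (\<epsilon> / \<tau>) * norm (act P v s - s) \<le> 3 * (\<epsilon> / \<tau>) * \<epsilon>" using moves \<epsilon> \<tau> by (intro mult_left_mono) auto
  also have "3 * (\<epsilon> / \<tau>) * norm (act P u s - s) \<le> 3 * (\<epsilon> / \<tau>) * \<epsilon>" using moves \<epsilon> \<tau> by (intro mult_left_mono) auto
  finally show "norm (act P (u @ v @ rev u @ rev v) x - x) \<le> 6 * \<epsilon>^2 / \<tau>"
    by (simp add: power2_eq_square)
qed

text \<open>The second word is the commutator of the inverses; this choice keeps the pair in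
  ping-pong position.\<close>

fun comm_seq :: "letter list \<times> letter list \<Rightarrow> nat \<Rightarrow> letter list \<times> letter list" where
  "comm_seq uv 0 = uv"
| "comm_seq uv (Suc k) = (case comm_seq uv k of (u, v) \<Rightarrow> (u @ v @ rev u @ rev v, rev u @ rev v @ u @ v))"

text \<open>The radius loses \<open>\<rho> / 4 / 2 ^ k\<close> at step \<open>k\<close>, in total
  half of \<open>\<rho>\<close>. As \<open>384 = 8 * 48\<close>, the quadratic estimate shrinks the
  displacement at least by the factor 8 at each step.\<close>

lemma comm_seq_near_id:
  assumes n: "near_id P q \<rho> (\<rho> / 384) u" "near_id P q \<rho> (\<rho> / 384) (rev u)"
    "near_id P q \<rho> (\<rho> / 384) v" "near_id P q \<rho> (\<rho> / 384) (rev v)" and \<rho>: "0 < \<rho>"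
  shows "case comm_seq (u, v) k of (u, v) \<Rightarrow> \<forall>w \<in> {u, rev u, v, rev v}.
     near_id P q (\<rho> / 2 + \<rho> / 2 / 2 ^ k) (\<rho> / 384 / 8 ^ k) w"
proof (induction k)
  case 0
  then show ?case using n by simp
next
  case (Suc k)
  obtain a b where ab: "comm_seq (u, v) k = (a, b)" by fastforce
  define r where "r = \<rho> / 2 + \<rho> / 2 / 2 ^ k"
  define \<epsilon> where "\<epsilon> = \<rho> / 384 / 8 ^ k"
  define \<tau> where "\<tau> = \<rho> / 8 / 2 ^ k"
  have IH: "near_id P q r \<epsilon> a" "near_id P q r \<epsilon> (rev a)" "near_id P q r \<epsilon> b" "near_id P q r \<epsilon> (rev b)"
    using Suc ab by (auto simp: r_def \<epsilon>_def)
  have \<tau>: "0 < \<tau>" "0 \<le> \<epsilon>" using \<rho> by (auto simp: \<tau>_def \<epsilon>_def)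
  have pow: "(2::real) ^ k \<le> 8 ^ k" by (intro power_mono) auto
  have "\<epsilon> \<le> \<rho> / 384 / 2 ^ k" unfolding \<epsilon>_def using pow \<rho> by (intro divide_left_mono) auto
  also have "4 * (\<rho> / 384 / 2 ^ k) \<le> \<tau>" unfolding \<tau>_def using \<rho> by (simp add: field_simps)
  finally have \<tau>4: "4 * \<epsilon> \<le> \<tau>" by simp
  have r: "r - 2 * \<tau> = \<rho> / 2 + \<rho> / 2 / 2 ^ Suc k" by (simp add: r_def \<tau>_def field_simps)
  have e: "6 * \<epsilon>^2 / \<tau> \<le> \<rho> / 384 / 8 ^ Suc k"
  proof -
    have "6 * \<epsilon>^2 / \<tau> = \<rho> / 384 / 8 ^ k * (48 / 384 * (2 ^ k / 8 ^ k))"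
      using \<rho> by (simp add: \<epsilon>_def \<tau>_def power2_eq_square field_simps)
    also have "\<dots> \<le> \<rho> / 384 / 8 ^ k * (48 / 384 * 1)"
      using pow \<rho> by (intro mult_left_mono) auto
    also have "\<dots> = \<rho> / 384 / 8 ^ Suc k" by simp
    finally show ?thesis .
  qed
  have main: "near_id P q (\<rho> / 2 + \<rho> / 2 / 2 ^ Suc k) (\<rho> / 384 / 8 ^ Suc k) (c @ d @ rev c @ rev d)"
    if "c \<in> {a, b, rev a, rev b}" "d \<in> {a, b, rev a, rev b}" for c d
  proof -
    have "near_id P q (r - 2 * \<tau>) (6 * \<epsilon>^2 / \<tau>) (c @ d @ rev c @ rev d)"
      using that IH by (intro near_id_commutator[OF _ _ _ _ \<tau>(1) \<tau>4 \<tau>(2)]) auto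
    then show ?thesis using e unfolding near_id_def r by (meson order_trans)
  qed
  show ?case
    using main[of a b] main[of b a] main[of "rev a" "rev b"] main[of "rev b" "rev a"]
    by (simp add: ab)
qed

text \<open>Attracting sets \<open>a1\<close>, \<open>a2\<close> and repelling sets
  \<open>r1\<close>, \<open>r2\<close> for left multiplication of words by \<open>u\<close> and
  \<open>v\<close>; the empty word is a base point outside all four.\<close>

definition ping_pong :: "letter list \<Rightarrow> letter list \<Rightarrow> letter list set \<Rightarrow> letter list set \<Rightarrow>
    letter list set \<Rightarrow> letter list set \<Rightarrow> bool" where
  "ping_pong u v a1 r1 a2 r2 \<longleftrightarrow>
     (\<forall>t. t \<notin> r1 \<longrightarrow> tact u t \<in> a1) \<and> (\<forall>t. t \<notin> a1 \<longrightarrow> tact (rev u) t \<in> r1) \<and>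
     (\<forall>t. t \<notin> r2 \<longrightarrow> tact v t \<in> a2) \<and> (\<forall>t. t \<notin> a2 \<longrightarrow> tact (rev v) t \<in> r2) \<and>
     a1 \<inter> r1 = {} \<and> a1 \<inter> a2 = {} \<and> a1 \<inter> r2 = {} \<and> r1 \<inter> a2 = {} \<and> r1 \<inter> r2 = {} \<and> a2 \<inter> r2 = {} \<and>
     [] \<notin> a1 \<union> r1 \<union> a2 \<union> r2"

text \<open>A product lands in the set of its first factor. The two commutators and their inverses
  begin with the four different factors \<open>u\<close>, \<open>v\<close>, \<open>rev u\<close>,
  \<open>rev v\<close>, so the four sets are merely permuted.\<close>

lemma ping_pong_step:
  assumes "ping_pong u v a1 r1 a2 r2"
  shows "ping_pong (u @ v @ rev u @ rev v) (rev u @ rev v @ u @ v) a1 a2 r1 r2"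
proof -
  have u: "tact u t \<in> a1" if "t \<notin> r1" for t using assms that by (simp add: ping_pong_def)
  have u': "tact (rev u) t \<in> r1" if "t \<notin> a1" for t using assms that by (simp add: ping_pong_def)
  have v: "tact v t \<in> a2" if "t \<notin> r2" for t using assms that by (simp add: ping_pong_def)
  have v': "tact (rev v) t \<in> r2" if "t \<notin> a2" for t using assms that by (simp add: ping_pong_def)
  have d: "a1 \<inter> r1 = {}" "a1 \<inter> a2 = {}" "a1 \<inter> r2 = {}" "r1 \<inter> a2 = {}" "r1 \<inter> r2 = {}" "a2 \<inter> r2 = {}"
    "[] \<notin> a1 \<union> r1 \<union> a2 \<union> r2" using assms by (auto simp: ping_pong_def)
  have D: "x \<notin> r1" "x \<notin> a2" "x \<notin> r2" if "x \<in> a1" for x using that d by blast+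
  have E: "x \<notin> a1" "x \<notin> a2" "x \<notin> r2" if "x \<in> r1" for x using that d by blast+
  have F: "x \<notin> a1" "x \<notin> r1" "x \<notin> r2" if "x \<in> a2" for x using that d by blast+
  have G: "x \<notin> a1" "x \<notin> r1" "x \<notin> a2" if "x \<in> r2" for x using that d by blast+
  have 1: "tact u (tact v (tact (rev u) (tact (rev v) t))) \<in> a1" if "t \<notin> a2" for t
    using u[OF F(2)[OF v[OF E(3)[OF u'[OF G(1)[OF v'[OF that]]]]]]] .
  have 2: "tact v (tact u (tact (rev v) (tact (rev u) t))) \<in> a2" if "t \<notin> a1" for t
    using v[OF D(3)[OF u[OF G(2)[OF v'[OF E(2)[OF u'[OF that]]]]]]] .
  have 3: "tact (rev u) (tact (rev v) (tact u (tact v t))) \<in> r1" if "t \<notin> r2" for t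
    using u'[OF G(1)[OF v'[OF D(2)[OF u[OF F(2)[OF v[OF that]]]]]]] .
  have 4: "tact (rev v) (tact (rev u) (tact v (tact u t))) \<in> r2" if "t \<notin> r1" for t
    using v'[OF E(2)[OF u'[OF F(1)[OF v[OF D(3)[OF u[OF that]]]]]]] .
  show ?thesis unfolding ping_pong_def using 1 2 3 4 d by auto
qed

lemma ping_pong_comm_seq:
  assumes "ping_pong u v a1 r1 a2 r2"
  shows "\<exists>a1 r1 a2 r2. case comm_seq (u, v) k of (u, v) \<Rightarrow> ping_pong u v a1 r1 a2 r2"
proof (induction k)
  case 0
  then show ?case using assms by auto
next
  case (Suc k)
  obtain a b where ab: "comm_seq (u, v) k = (a, b)" by fastforce
  then obtain a1 r1 a2 r2 where "ping_pong a b a1 r1 a2 r2" using Suc by auto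
  from ping_pong_step[OF this] show ?case by (auto simp: ab)
qed

text \<open>The two products send the empty word into the disjoint sets \<open>a1\<close> and
  \<open>a2\<close>, so by \<open>faithful\<close> they differ as maps.\<close>

lemma ping_pong_noncommuting:
  assumes "ping_pong u v a1 r1 a2 r2"
  obtains p where "p \<in> cubic_surface P" "act P (u @ v) p \<noteq> act P (v @ u) p"
proof -
  have 1: "tact u [] \<in> a1" "tact v [] \<in> a2" using assms by (auto simp: ping_pong_def)
  then have 2: "tact u [] \<notin> r2" "tact v [] \<notin> r1" using assms unfolding ping_pong_def by blast+
  then have "tact (u @ v) [] \<in> a1" "tact (v @ u) [] \<in> a2" using assms by (auto simp: ping_pong_def)
  then have "tact (u @ v) [] \<noteq> tact (v @ u) []" using assms unfolding ping_pong_def by (metis IntI empty_iff)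
  then have "\<not> (\<forall>p\<in>cubic_surface P. act P (u @ v) p = act P (v @ u) p)" using faithful by blast
  then show ?thesis using that by blast
qed

lemma rev_pw: "rev (pw n [i, j]) = pw n [j, i]"
proof (induction n)
  case (Suc n)
  have "pw n [j, i] @ [j, i] = [j, i] @ pw n [j, i]" by (induction n) auto
  then show ?case using Suc by simp
qed simp

lemma tact_pw:
  assumes "i \<noteq> j" "0 < n" "t = [] \<or> hd t \<noteq> j"
  shows "tact (pw n [i, j]) t = pw n [i, j] @ t"
proof -
  have "tact (pw n [i, j]) t = pw n [i, j] @ t \<and> (pw n [i, j] @ t = [] \<or> hd (pw n [i, j] @ t) \<noteq> j)"
  proof (induction n)
    case (Suc n)
    then have "app j (tact (pw n [i, j]) t) = j # pw n [i, j] @ t"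
      by (cases "pw n [i, j] @ t") (auto simp: app_def)
    then show ?case using Suc assms by (simp add: app_def)
  qed (use assms in simp)
  then show ?thesis by blast
qed

text \<open>The sets collect words by their first letters: powers of \<open>[Y, X]\<close> put
  \<open>Y\<close> in front, their inverses \<open>X\<close>, and conjugation by \<open>Z\<close>
  prefixes a \<open>Z\<close>.\<close>

lemma ping_pong_initial:
  assumes "0 < n"
  shows "ping_pong (pw n [Y, X]) (Z # pw n [Y, X] @ [Z])
    {t. \<exists>s. t = Y # s} {t. \<exists>s. t = X # s} {t. \<exists>s. t = Z # Y # s} {t. \<exists>s. t = Z # X # s}"
proof -
  obtain m where m: "n = Suc m" using assms by (cases n) auto
  have head: "\<exists>s. pw n [i, j] @ t = i # s" for i j t by (simp add: m)
  have a: "\<exists>s. tact (pw n [i, j]) t = i # s" if "i \<noteq> j" "\<nexists>s. t = j # s" for i j t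
  proof -
    have "t = [] \<or> hd t \<noteq> j" using that(2) by (cases t) auto
    then show ?thesis using tact_pw[OF that(1) assms] head by metis
  qed
  have b: "\<exists>s. app Z (tact (pw n [i, j]) (app Z t)) = Z # i # s"
    if "i \<noteq> j" "i \<noteq> Z" "j \<noteq> Z" "\<nexists>s. t = Z # j # s" for i j t
  proof -
    have "\<nexists>s. app Z t = j # s" using that(3,4) by (cases t) (auto simp: app_def)
    from a[OF that(1) this] obtain s where "tact (pw n [i, j]) (app Z t) = i # s" by blast
    then show ?thesis using that(2) by (simp add: app_def)
  qed
  show ?thesis
    unfolding ping_pong_def
    apply (intro conjI)
    subgoal using a[of Y X] by blast
    subgoal using a[of X Y] by (simp add: rev_pw)
    subgoal using b[of Y X] by (simp add: tact_def)
    subgoal using b[of X Y] by (simp add: rev_pw tact_def)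
    by auto
qed

theorem noncommuting_sequences:
  assumes "0 < n" "0 < \<rho>" "u = pw n [Y, X]" "v = Z # pw n [Y, X] @ [Z]"
    and near: "near_id P q \<rho> (\<rho> / 384) u" "near_id P q \<rho> (\<rho> / 384) (rev u)"
      "near_id P q \<rho> (\<rho> / 384) v" "near_id P q \<rho> (\<rho> / 384) (rev v)"
  obtains us vs where "\<And>k :: nat. even (length (us k)) \<and> even (length (vs k))"
    "\<And>k x. x \<in> ball q (\<rho> / 2) \<Longrightarrow> norm (act P (us k) x - x) \<le> \<rho> / 384 / 8 ^ k \<and> norm (act P (vs k) x - x) \<le> \<rho> / 384 / 8 ^ k"
    "\<And>k. \<exists>p\<in>cubic_surface P. act P (us k @ vs k) p \<noteq> act P (vs k @ us k) p"
proof (rule that[of "\<lambda>k. fst (comm_seq (u, v) k)" "\<lambda>k. snd (comm_seq (u, v) k)"])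
  fix k
  have "case comm_seq (u, v) k of (u, v) \<Rightarrow> even (length u) \<and> even (length v)"
    by (induction k) (auto simp: assms split: prod.splits)
  then show "even (length (fst (comm_seq (u, v) k))) \<and> even (length (snd (comm_seq (u, v) k)))"
    by (simp add: case_prod_beta)
  obtain a1 r1 a2 r2 where "ping_pong (fst (comm_seq (u, v) k)) (snd (comm_seq (u, v) k)) a1 r1 a2 r2"
    using ping_pong_comm_seq[OF ping_pong_initial[OF assms(1)], of k] unfolding assms(3,4) by (auto simp: case_prod_beta)
  then show "\<exists>p\<in>cubic_surface P. act P (fst (comm_seq (u, v) k) @ snd (comm_seq (u, v) k)) p \<noteq> act P (snd (comm_seq (u, v) k) @ fst (comm_seq (u, v) k)) p"
    by (rule ping_pong_noncommuting) blast
  fix x assume x: "x \<in> ball q (\<rho> / 2)"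
  have sub: "ball q (\<rho> / 2) \<subseteq> ball q (\<rho> / 2 + \<rho> / 2 / 2 ^ k)" using assms(2) by (intro subset_ball) simp
  show "norm (act P (fst (comm_seq (u, v) k)) x - x) \<le> \<rho> / 384 / 8 ^ k \<and> norm (act P (snd (comm_seq (u, v) k)) x - x) \<le> \<rho> / 384 / 8 ^ k"
    using comm_seq_near_id[OF near assms(2), of k] subsetD[OF sub x]
    by (auto simp: near_id_def case_prod_beta)
qed

section \<open>Common fixed points of two almost trivial shears\<close>

text \<open>The last inequality bounds the shear coefficient times the size of the Hamiltonian
  vector; the squared factor accounts for the derivative of \<open>s_z\<close>, which enters the
  conjugate shear twice. The commutator iteration requires a bound of at most
  \<open>1 / 384\<close>.\<close>

definition shear_point :: "param \<Rightarrow> nat \<Rightarrow> real \<Rightarrow> point \<Rightarrow> bool" where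
  "shear_point P n t q \<longleftrightarrow> 0 < n \<and> q \<in> cubic_surface P \<and> co Z q = of_real t \<and> \<bar>t\<bar> < 2 \<and>
     chS n (of_real t) = 0 \<and> invol P Z q = q \<and>
     2 * real n / (4 - t^2) * (cmod (co X (grad P q)) + cmod (co Y (grad P q))) * (3 + 2 * norm q)^2 < 1 / 1000"

text \<open>The value at \<open>x\<close> is the product of the distances to the roots; if all of
  these were at least \<open>e\<close>, it would be at least \<open>e ^ degree p\<close>.\<close>

lemma monic_near_root:
  fixes p :: "complex poly"
  assumes "lead_coeff p = 1" "cmod (poly p x) < e ^ degree p" "0 < e"
  obtains r where "poly p r = 0" "cmod (r - x) < e"
proof -
  have "p \<noteq> 0" using assms(1) by auto
  from alg_closed_imp_factorization[OF this]
  obtain A where A: "size A = degree p" "p = smult (lead_coeff p) (\<Prod>x\<in>#A. [:-x, 1:])"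
    by (elim exE conjE)
  have p: "p = (\<Prod>x\<in>#A. [:-x, 1:])" using A(2) unfolding assms(1) smult_1_left .
  have val: "poly (\<Prod>x\<in>#A. [:-x, 1:]) z = (\<Prod>a\<in>#A. z - a)" for z
    by (induction A) (auto simp: algebra_simps)
  have pv: "poly p z = (\<Prod>a\<in>#A. z - a)" for z using val[of z] by (simp only: p[symmetric])
  show thesis
  proof (cases "\<exists>a\<in>#A. cmod (a - x) < e")
    case True
    then obtain a where a: "a \<in># A" "cmod (a - x) < e" by blast
    have "poly p a = 0" unfolding pv using a(1) by (auto simp: prod_mset_zero_iff)
    then show ?thesis using that a(2) by blast
  next
    case False
    have "e ^ size B \<le> cmod (\<Prod>a\<in>#B. x - a)" if "\<forall>a\<in>#B. e \<le> cmod (a - x)" for B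
      using that
    proof (induction B)
      case (add b B)
      have "e * e ^ size B \<le> cmod (x - b) * cmod (\<Prod>a\<in>#B. x - a)"
        using add assms(3) by (intro mult_mono) (auto simp: norm_minus_commute)
      then show ?case by (simp add: norm_mult)
    qed simp
    then have "e ^ size A \<le> cmod (\<Prod>a\<in>#A. x - a)" using False by force
    then show ?thesis using assms(2) A(1) by (simp add: pv)
  qed
qed

text \<open>Eliminating \<open>y\<close> from \<open>x y = \<kappa>\<close> and \<open>x\<^sup>2 + y\<^sup>2 - A x - B y = E\<close> gives a monic quartic for \<open>x\<close>.\<close>

definition quartic :: "param \<Rightarrow> complex \<Rightarrow> complex \<Rightarrow> complex" where
  "quartic P t x = x^4 - par X P * x^3 - (par0 P + t^2) * x^2 - par Y P * (par Z P - 2 * t) * x + (par Z P - 2 * t)^2"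

lemma quartic_near_root:
  assumes "cmod (quartic P t x) < e ^ 4" "0 < e"
  obtains r where "quartic P t r = 0" "cmod (r - x) < e"
proof -
  let ?p = "[:(par Z P - 2 * t)^2, - (par Y P * (par Z P - 2 * t)), - (par0 P + t^2), - par X P, 1:]"
  have "poly ?p z = quartic P t z" for z
    by (simp add: quartic_def algebra_simps power2_eq_square power3_eq_cube power4_eq_xxxx)
  then show ?thesis using monic_near_root[of ?p x e] assms that by (auto simp: eval_nat_numeral)
qed

lemma tendsto_quartic: "((\<lambda>P. quartic P t x) \<longlongrightarrow> quartic P0 t x) (nhds P0)"
  unfolding quartic_def by (intro tendsto_intros tendsto_par)

lemma surface_fixed_iff:
  assumes "x * y = par Z P - 2 * t"
  shows "(x, y, t) \<in> cubic_surface P \<longleftrightarrow> x^2 + y^2 - par X P * x - par Y P * y = par0 P + t^2"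
proof -
  have "x^2 + y^2 + t^2 + x * y * t = par X P * x + par Y P * y + par Z P * t + par0 P \<longleftrightarrow>
    x^2 + y^2 - par X P * x - par Y P * y = par0 P + t^2"
    unfolding assms by (auto simp: algebra_simps power2_eq_square)
  then show ?thesis by (cases P) simp
qed

lemma quartic_solution:
  assumes "x \<noteq> 0" "x * y = par Z P - 2 * t"
  shows "quartic P t x = 0 \<longleftrightarrow> (x, y, t) \<in> cubic_surface P"
proof -
  have "quartic P t x = x^2 * (x^2 + y^2 - par X P * x - par Y P * y - (par0 P + t^2))"
    unfolding quartic_def assms(2)[symmetric] by (simp add: algebra_simps power2_eq_square power3_eq_cube power4_eq_xxxx)
  then show ?thesis using assms(1) surface_fixed_iff[OF assms(2)] by auto
qed

text \<open>The condition \<open>x * y = par Z P - 2 * t\<close> says that \<open>s_z\<close> fixes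
  \<open>(x, y, t)\<close>; such points persist with the same third coordinate.\<close>

definition nearby_solutions :: "param \<Rightarrow> complex \<Rightarrow> complex \<Rightarrow> complex \<Rightarrow> bool" where
  "nearby_solutions P0 t x0 y0 \<longleftrightarrow> (\<forall>e>0. \<forall>\<^sub>F P in nhds P0. \<exists>x y. cmod (x - x0) < e \<and> cmod (y - y0) < e \<and>
     x * y = par Z P - 2 * t \<and> (x, y, t) \<in> cubic_surface P)"

text \<open>The monic quartic has a root near \<open>x0\<close>, and as \<open>x0\<close> is not
  zero, \<open>y\<close> is recovered by division.\<close>

lemma nearby_solutions:
  assumes x0: "x0 \<noteq> 0" and prod0: "x0 * y0 = par Z P0 - 2 * t" and surf: "(x0, y0, t) \<in> cubic_surface P0"
  shows "nearby_solutions P0 t x0 y0"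
  unfolding nearby_solutions_def
proof (intro allI impI)
  fix e :: real assume e: "0 < e"
  define m where "m = cmod x0"
  have m: "0 < m" using x0 by (simp add: m_def)
  \<comment> \<open>The second entry keeps \<open>x\<close> away from zero, the third makes
    \<open>y0 * (x - x0)\<close> at most \<open>e * m / 4\<close> in modulus.\<close>
  define d where "d = Min {e, m / 2, e * m / (4 * (cmod y0 + 1))}"
  have d: "0 < d" using e m by (simp add: d_def add_nonneg_pos)
  have d2: "d \<le> e" "d \<le> m / 2" "d \<le> e * m / (4 * (cmod y0 + 1))" unfolding d_def by (intro Min_le; simp)+
  have "d * (4 * (cmod y0 + 1)) \<le> e * m" using d2(3) by (simp add: pos_le_divide_eq add_nonneg_pos)
  then have d3: "4 * (cmod y0 * d) \<le> e * m" using d by (simp add: algebra_simps)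
  have "quartic P0 t x0 = 0" using quartic_solution[OF x0 prod0] surf by simp
  then have "((\<lambda>P. cmod (quartic P t x0)) \<longlongrightarrow> 0) (nhds P0)"
    using tendsto_quartic[of t x0 P0] by (simp add: tendsto_norm_zero)
  then have ev1: "\<forall>\<^sub>F P in nhds P0. cmod (quartic P t x0) < d ^ 4" using d by (intro order_tendstoD) auto
  have "((\<lambda>P. cmod (par Z P - par Z P0)) \<longlongrightarrow> 0) (nhds P0)"
    using tendsto_par(1)[of Z P0] LIM_zero tendsto_norm_zero by fastforce
  then have ev2: "\<forall>\<^sub>F P in nhds P0. cmod (par Z P - par Z P0) < e * m / 4" using e m by (intro order_tendstoD) auto
  show "\<forall>\<^sub>F P in nhds P0. \<exists>x y. cmod (x - x0) < e \<and> cmod (y - y0) < e \<and>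
     x * y = par Z P - 2 * t \<and> (x, y, t) \<in> cubic_surface P"
    using ev1 ev2
  proof eventually_elim
    case (elim P)
    obtain x where x: "quartic P t x = 0" "cmod (x - x0) < d" using quartic_near_root[OF elim(1) d] .
    have "m \<le> cmod x + cmod (x - x0)" unfolding m_def
      using norm_triangle_ineq4[of x "x - x0"] by simp
    then have mx: "m / 2 < cmod x" using x(2) d2 by linarith
    then have xnz: "x \<noteq> 0" using m by auto
    define y where "y = (par Z P - 2 * t) / x"
    have xy: "x * y = par Z P - 2 * t" using xnz by (simp add: y_def)
    have "x * (y - y0) = (par Z P - par Z P0) - y0 * (x - x0)"
    proof -
      have "par Z P = x * y + 2 * t" "par Z P0 = x0 * y0 + 2 * t" using xy prod0 by simp_all
      then show ?thesis by (simp add: algebra_simps)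
    qed
    then have "cmod x * cmod (y - y0) \<le> cmod (par Z P - par Z P0) + cmod y0 * cmod (x - x0)"
      by (metis norm_mult norm_triangle_ineq4)
    also have "\<dots> < e * m / 4 + e * m / 4"
    proof -
      have "cmod y0 * cmod (x - x0) \<le> cmod y0 * d" using x(2) by (intro mult_left_mono) auto
      then show ?thesis using elim(2) d3 by linarith
    qed
    finally have a: "cmod x * cmod (y - y0) < e * m / 2" by simp
    have "cmod (y - y0) < e"
    proof (rule ccontr)
      assume "\<not> ?thesis"
      then have "m / 2 * e \<le> cmod x * cmod (y - y0)" using mx e by (intro mult_mono) auto
      then show False using a by (simp add: mult.commute)
    qed
    moreover have "(x, y, t) \<in> cubic_surface P" using quartic_solution[OF xnz xy] x(1) by simp
    ultimately show ?case using xy x(2) d2(1) by (intro exI[of _ x] exI[of _ y]) auto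
  qed
qed

text \<open>Division by \<open>x\<close> is not controlled near 0. If the root \<open>x\<close>
  vanishes, \<open>y\<close> solves a quadratic; otherwise the surface equation bounds
  \<open>y * (y - par Y P)\<close> and thereby \<open>y\<close>.\<close>

lemma nearby_solutions_zero: "nearby_solutions (0, 0, 0, 0) 0 0 0"
  unfolding nearby_solutions_def
proof (intro allI impI)
  fix e :: real assume e: "0 < e"
  let ?o = "(0, 0, 0, 0) :: param"
  have p0: "par l ?o = 0" "par0 ?o = 0" for l by (cases l; simp)+
  have par_small: "\<forall>\<^sub>F P in nhds ?o. cmod (par l P) < e'" "\<forall>\<^sub>F P in nhds ?o. cmod (par0 P) < e'" if "0 < e'" for l e'
    using tendsto_norm[OF tendsto_par(1), of l ?o] tendsto_norm[OF tendsto_par(2), of ?o] that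
    by (auto simp: p0 order_tendsto_iff)
  have "quartic ?o 0 0 = 0" by (simp add: quartic_def p0)
  then have "((\<lambda>P. cmod (quartic P 0 0)) \<longlongrightarrow> 0) (nhds ?o)"
    using tendsto_quartic[of 0 0 ?o] by (simp add: tendsto_norm_zero)
  then have ev1: "\<forall>\<^sub>F P in nhds ?o. cmod (quartic P 0 0) < (e / 4) ^ 4" using e by (intro order_tendstoD) auto
  have e4: "0 < e / 4" "0 < e^2 / 8" using e by auto
  show "\<forall>\<^sub>F P in nhds ?o. \<exists>x y. cmod (x - 0) < e \<and> cmod (y - 0) < e \<and>
     x * y = par Z P - 2 * 0 \<and> (x, y, 0) \<in> cubic_surface P"
    using ev1 par_small(1)[OF e4(1), of X] par_small(1)[OF e4(1), of Y] par_small(2)[OF e4(2)]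
  proof eventually_elim
    case (elim P)
    obtain x where x: "quartic P 0 x = 0" "cmod x < e / 4" using quartic_near_root[OF elim(1) e4(1)] by auto
    show ?case
    proof (cases "x = 0")
      case True
      then have k: "par Z P = 0" using x(1) by (simp add: quartic_def)
      have "0 \<le> e^2" by simp
      then have "cmod (par0 P) < e^2" using elim(4) by linarith
      then have "cmod (0^2 + (- par Y P) * 0 + (- par0 P)) < e^2" by simp
      then obtain y where y: "y^2 + (- par Y P) * y + (- par0 P) = 0" "cmod (y - 0) < e"
        using quadratic_near_root[OF _ e] by blast
      have "(0, y, 0) \<in> cubic_surface P" using surface_fixed_iff[of 0 y P 0] k y(1) by (simp add: algebra_simps)
      then show ?thesis using y(2) k e by (intro exI[of _ 0] exI[of _ y]) auto
    next
      case False
      define y where "y = par Z P / x"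
      have xy: "x * y = par Z P - 2 * 0" using False by (simp add: y_def)
      have s: "(x, y, 0) \<in> cubic_surface P" using quartic_solution[OF False xy] x(1) by simp
      have "y * (y - par Y P) = par0 P + par X P * x - x^2"
        using surface_fixed_iff[OF xy] s by (simp add: algebra_simps power2_eq_square)
      then have "cmod y * cmod (y - par Y P) = cmod (par0 P + par X P * x - x^2)" by (simp flip: norm_mult)
      also have "\<dots> \<le> cmod (par0 P) + cmod (par X P) * cmod x + cmod x ^ 2"
        by (metis (no_types, opaque_lifting) add_mono_thms_linordered_semiring(3) norm_mult norm_power norm_triangle_ineq norm_triangle_ineq4 order_trans)
      also have "\<dots> < e^2 / 8 + e / 4 * (e / 4) + (e / 4)^2"
      proof -
        have "cmod (par X P) * cmod x \<le> e / 4 * (e / 4)" using elim(2) x(2) e by (intro mult_mono) auto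
        moreover have "cmod x ^ 2 \<le> (e / 4)^2" using x(2) by (intro power_mono) auto
        ultimately show ?thesis using elim(4) by linarith
      qed
      also have "\<dots> = e * (e / 4)" by (simp add: power2_eq_square)
      finally have a: "cmod y * cmod (y - par Y P) < e * (e / 4)" .
      have "cmod y < e"
      proof (rule ccontr)
        assume "\<not> ?thesis"
        moreover have "cmod y \<le> cmod (y - par Y P) + cmod (par Y P)"
          using norm_triangle_ineq[of "y - par Y P" "par Y P"] by simp
        ultimately have "e * (e / 4) \<le> cmod y * cmod (y - par Y P)"
          using elim(3) e by (intro mult_mono) auto
        then show False using a by simp
      qed
      then show ?thesis using xy s x(2) e by (intro exI[of _ x] exI[of _ y]) auto
    qed
  qed
qed

text \<open>The smallness condition is a strict inequality for a continuous function of parameter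
  and point; \<open>n\<close> and \<open>t\<close> stay fixed while the point follows the
  parameter.\<close>

lemma eventually_shear_point:
  assumes base: "shear_point P0 n t (x0, y0, of_real t)" and sol: "nearby_solutions P0 (of_real t) x0 y0"
  shows "\<forall>\<^sub>F P in nhds P0. \<exists>q. shear_point P n t q"
proof -
  define q0 where "q0 = (x0, y0, complex_of_real t)"
  define K where "K = 2 * real n / (4 - t^2)"
  define h :: "param \<times> point \<Rightarrow> real" where
    "h = (\<lambda>(P, q). K * (cmod (co X (grad P q)) + cmod (co Y (grad P q))) * (3 + 2 * norm q)^2)"
  have "continuous_on UNIV (\<lambda>z :: param \<times> point. par l (fst z))" for l
  proof -
    have "continuous_on UNIV (par l)" using tendsto_par(1) by (auto simp: continuous_on_def tendsto_nhds_iff intro: tendsto_mono[OF at_le])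
    then show ?thesis by (rule continuous_on_compose2) (auto intro: continuous_intros)
  qed
  moreover have "continuous_on UNIV (\<lambda>z :: param \<times> point. co l (snd z))" for l
    by (rule continuous_on_compose2[OF continuous_co[of UNIV]]) (auto intro: continuous_intros)
  moreover have "h = (\<lambda>z. K * (cmod (2 * co X (snd z) + co Y (snd z) * co Z (snd z) - par X (fst z))
      + cmod (2 * co Y (snd z) + co Z (snd z) * co X (snd z) - par Y (fst z))) * (3 + 2 * norm (snd z))^2)"
    by (auto simp: h_def co_grad[of X Y Z] co_grad[of Y Z X])
  ultimately have "continuous_on UNIV h" by (simp only:) (intro continuous_intros)
  then have "isCont h (P0, q0)" using continuous_on_eq_continuous_at[OF open_UNIV] by blast
  moreover have "h (P0, q0) < 1 / 1000" using base by (simp add: h_def K_def shear_point_def q0_def)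
  ultimately have "\<forall>\<^sub>F z in nhds (P0, q0). h z < 1 / 1000"
    by (intro order_tendstoD(2)[of h "h (P0, q0)"]) (auto simp: isCont_def tendsto_at_iff_tendsto_nhds)
  then obtain d where d: "0 < d" "\<And>z. dist z (P0, q0) < d \<Longrightarrow> h z < 1 / 1000"
    unfolding eventually_nhds_metric by blast
  have "\<forall>\<^sub>F P in nhds P0. dist P P0 < d / 3" unfolding eventually_nhds_metric using d(1) by (intro exI[of _ "d / 3"]) auto
  moreover have "\<forall>\<^sub>F P in nhds P0. \<exists>x y. cmod (x - x0) < d / 3 \<and> cmod (y - y0) < d / 3 \<and>
     x * y = par Z P - 2 * of_real t \<and> (x, y, of_real t) \<in> cubic_surface P"
    using sol[unfolded nearby_solutions_def, rule_format, of "d / 3"] d(1) by simp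
  ultimately show ?thesis
  proof eventually_elim
    case (elim P)
    then obtain x y where xy: "cmod (x - x0) < d / 3" "cmod (y - y0) < d / 3"
      "x * y = par Z P - 2 * of_real t" "(x, y, of_real t) \<in> cubic_surface P" by blast
    define q where "q = (x, y, complex_of_real t)"
    have "norm (q - q0) \<le> cmod (x - x0) + cmod (y - y0)"
      using norm_point_le[of "q - q0"] by (simp add: q_def q0_def)
    moreover have "dist (P, q) (P0, q0) \<le> dist P P0 + dist q q0"
      unfolding dist_Pair_Pair using sqrt_sum_squares_le_sum[of "dist P P0" "dist q q0"] by simp
    ultimately have "h (P, q) < 1 / 1000" using d(2)[of "(P, q)"] xy(1,2) elim(1) by (simp add: dist_norm)
    moreover have "invol P Z q = q"
      using xy(3) by (cases P) (simp add: q_def algebra_simps)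
    ultimately have "shear_point P n t q" using base xy(4) by (simp add: shear_point_def h_def K_def q_def)
    then show ?case by blast
  qed
qed

text \<open>At the origin the gradient vanishes, so the smallness condition is trivial;
  \<open>n = 2\<close> and \<open>t = 0\<close> belong to the angle
  \<open>\<pi> / 2\<close>.\<close>

lemma shear_zero: "\<forall>\<^sub>F P in nhds (0, 0, 0, 0). \<exists>n t q. shear_point P n t q"
proof -
  have "shear_point (0, 0, 0, 0) 2 0 (0, 0, of_real 0)"
    by (simp add: shear_point_def numeral_2_eq_2)
  from eventually_shear_point[OF this] have "\<forall>\<^sub>F P in nhds (0, 0, 0, 0). \<exists>q. shear_point P 2 0 q"
    using nearby_solutions_zero by simp
  then show ?thesis by (rule eventually_mono) blast
qed

text \<open>Dirichlet approximates \<open>\<phi> / \<pi>\<close> by \<open>h / n\<close> up to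
  \<open>1 / (n * N)\<close>, so even \<open>n\<close> times the distance is small. This matters
  because the shear coefficient grows with \<open>n\<close>.\<close>

lemma rational_angle_near:
  assumes a: "-2 < a" "a < 2" and e: "0 < e"
  obtains n :: nat and t :: real where "0 < n" "\<bar>t\<bar> < 2" "chS n (of_real t) = 0" "real n * \<bar>a - t\<bar> < e" "\<bar>a - t\<bar> < e"
proof -
  define \<phi> where "\<phi> = arccos (a / 2)"
  have \<phi>: "2 * cos \<phi> = a" using a by (simp add: \<phi>_def cos_arccos)
  \<comment> \<open>Staying within \<open>2 - a\<close> and \<open>2 + a\<close> keeps
    \<open>t\<close> between -2 and 2.\<close>
  define e' where "e' = min e (min (2 - a) (2 + a))"
  have e': "0 < e'" "e' \<le> e" "e' \<le> 2 - a" "e' \<le> 2 + a" using a e by (auto simp: e'_def)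
  obtain N :: nat where N: "2 * pi / e' < N" using reals_Archimedean2 by blast
  moreover have "0 < 2 * pi / e'" using e' by simp
  ultimately have N0: "0 < N" by linarith
  obtain h k where hk: "0 < k" "k \<le> int N" "\<bar>of_int k * (\<phi> / pi) - of_int h\<bar> < 1 / N"
    using Dirichlet_approx[OF N0, of "\<phi> / pi"] by blast
  define n where "n = nat k"
  have n: "0 < n" "real n = of_int k" using hk by (auto simp: n_def)
  define \<psi> where "\<psi> = pi * of_int h / n"
  define t where "t = 2 * cos \<psi>"
  have "real n * (\<phi> - \<psi>) = pi * (of_int k * (\<phi> / pi) - of_int h)"
    using n by (simp add: \<psi>_def field_simps)
  then have "real n * \<bar>\<phi> - \<psi>\<bar> = pi * \<bar>of_int k * (\<phi> / pi) - of_int h\<bar>"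
    by (metis abs_mult abs_of_nat abs_of_pos pi_gt_zero)
  also have "\<dots> < pi * (1 / N)" using hk(3) by (intro mult_strict_left_mono) auto
  finally have 1: "real n * \<bar>\<phi> - \<psi>\<bar> < pi / N" by simp
  have 2: "\<bar>a - t\<bar> \<le> 2 * \<bar>\<phi> - \<psi>\<bar>"
  proof -
    have "cos \<phi> - cos \<psi> = 2 * sin ((\<phi> + \<psi>) / 2) * sin ((\<psi> - \<phi>) / 2)" by (rule cos_diff_cos)
    then have "\<bar>cos \<phi> - cos \<psi>\<bar> = 2 * (\<bar>sin ((\<phi> + \<psi>) / 2)\<bar> * \<bar>sin ((\<psi> - \<phi>) / 2)\<bar>)" by (simp add: abs_mult)
    also have "\<dots> \<le> 2 * (1 * \<bar>(\<psi> - \<phi>) / 2\<bar>)"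
      by (intro mult_left_mono mult_mono abs_sin_le_one abs_sin_x_le_abs_x) auto
    finally have c: "\<bar>cos \<phi> - cos \<psi>\<bar> \<le> \<bar>\<phi> - \<psi>\<bar>" by (simp add: abs_minus_commute)
    have "a - t = 2 * (cos \<phi> - cos \<psi>)" using \<phi> by (simp add: t_def)
    then have "\<bar>a - t\<bar> = 2 * \<bar>cos \<phi> - cos \<psi>\<bar>" by (smt (verit))
    then show ?thesis using c by simp
  qed
  have Ne: "2 * (pi / N) < e'" using N e'(1) N0 by (simp add: field_simps)
  have 3: "real n * \<bar>a - t\<bar> < e'"
  proof -
    have "real n * \<bar>a - t\<bar> \<le> real n * (2 * \<bar>\<phi> - \<psi>\<bar>)" using 2 by (intro mult_left_mono) auto
    then show ?thesis using 1 Ne by argo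
  qed
  have "1 * \<bar>a - t\<bar> \<le> real n * \<bar>a - t\<bar>" using n by (intro mult_right_mono) auto
  then have 4: "\<bar>a - t\<bar> < e'" using 3 by simp
  have t2: "\<bar>t\<bar> < 2" using 4 e'(3,4) by linarith
  have S: "chS n (of_real t) = 0"
  proof -
    have "complex_of_real t = 2 * cos (of_real \<psi>)" by (simp add: t_def cos_of_real)
    moreover have "chS n (2 * cos (of_real \<psi>)) * sin (of_real \<psi>) = sin (of_nat n * complex_of_real \<psi>)" by (rule ch_trig)
    moreover have "sin (of_nat n * complex_of_real \<psi>) = 0"
    proof -
      have "of_nat n * complex_of_real \<psi> = of_real (of_int h * pi)" using n(1) by (simp add: \<psi>_def)
      then show ?thesis by (simp add: sin_int_times_real sin_zero_iff_int2)
    qed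
    moreover have "sin (complex_of_real \<psi>) \<noteq> 0"
    proof
      assume "sin (complex_of_real \<psi>) = 0"
      then have "sin \<psi> = 0" by (metis of_real_eq_0_iff sin_of_real)
      then have "\<bar>cos \<psi>\<bar> = 1" by (metis abs_1 abs_minus_cancel sin_zero_abs_cos_one)
      then show False using t2 by (simp add: t_def abs_mult)
    qed
    ultimately show ?thesis by simp
  qed
  show thesis using that n(1) t2 S 3 4 e'(2) by (meson less_le_trans)
qed

text \<open>For the special parameter \<open>(2, 2, a)\<close> is a singular point of the surface.
  The points \<open>(2 + \<eta>, 2, a - \<eta>)\<close> lie on the surface, are fixed by
  \<open>s_z\<close> and have a gradient of order \<open>\<eta>\<close>.\<close>

lemma shear_special:
  assumes a: "a \<in> {-2<..<2}"
  shows "\<forall>\<^sub>F P in nhds (special_param a). \<exists>n t q. shear_point P n t q"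
proof -
  define g where "g = 4 - a^2"
  have g: "0 < g"
  proof -
    have "4 - a^2 = (2 - a) * (2 + a)" by (simp add: algebra_simps power2_eq_square)
    then show ?thesis using a by (simp add: g_def)
  qed
  \<comment> \<open>\<open>20 * 17^2\<close> is 5780, where 17 bounds \<open>3 + 2 * norm q\<close>;
    divided by ten million it is below \<open>1 / 1000\<close>.\<close>
  define e where "e = min 1 (g / 10000000)"
  have e: "0 < e" "e \<le> 1" "e \<le> g / 10000000" using g by (auto simp: e_def)
  obtain n t where nt: "0 < n" "\<bar>t\<bar> < 2" "chS n (of_real t) = 0" "real n * \<bar>a - t\<bar> < e" "\<bar>a - t\<bar> < e"
    using rational_angle_near[of a e] a e(1) by auto
  define \<eta> where "\<eta> = a - t"
  have \<eta>: "\<bar>\<eta>\<bar> < e" "real n * \<bar>\<eta>\<bar> < e" using nt by (auto simp: \<eta>_def)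
  have ta: "t = a - \<eta>" by (simp add: \<eta>_def)
  define x where "x = complex_of_real (2 + \<eta>)"
  let ?P = "special_param a" let ?q = "(x, 2 :: complex, complex_of_real t)"
  have parP: "par l ?P = of_real (2 * a + 4)" "par0 ?P = of_real (- (a^2 + 8 * a + 8))" for l
    by (cases l; simp add: special_param_def Let_def)+
  have prod0: "x * 2 = par Z ?P - 2 * of_real t"
  proof -
    have "(2 + \<eta>) * 2 = 2 * a + 4 - 2 * t" by (simp add: \<eta>_def)
    then show ?thesis unfolding parP x_def
      by (metis of_real_diff of_real_mult of_real_numeral)
  qed
  have surf: "?q \<in> cubic_surface ?P"
  proof -
    have "(2 + \<eta>)^2 + 2^2 - (2 * a + 4) * (2 + \<eta>) - (2 * a + 4) * 2 = - (a^2 + 8 * a + 8) + t^2"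
      unfolding ta by (simp add: algebra_simps power2_eq_square)
    then have "complex_of_real ((2 + \<eta>)^2 + 2^2 - (2 * a + 4) * (2 + \<eta>) - (2 * a + 4) * 2) = of_real (- (a^2 + 8 * a + 8) + t^2)"
      by (rule arg_cong)
    then have "x^2 + 2^2 - par X ?P * x - par Y ?P * 2 = par0 ?P + (of_real t)^2" unfolding parP x_def by simp
    then show ?thesis using surface_fixed_iff[OF prod0] by blast
  qed
  have fixq: "invol ?P Z ?q = ?q"
    using prod0 parP by (simp add: special_param_def Let_def algebra_simps)
  have gX: "co X (grad ?P ?q) = 0"
  proof -
    have "2 * (2 + \<eta>) + 2 * t - (2 * a + 4) = 0" by (simp add: ta)
    then have "complex_of_real (2 * (2 + \<eta>) + 2 * t - (2 * a + 4)) = of_real 0" by (rule arg_cong)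
    then show ?thesis unfolding co_grad[of X Y Z, simplified] parP x_def by simp
  qed
  have gY: "cmod (co Y (grad ?P ?q)) \<le> 5 * \<bar>\<eta>\<bar>"
  proof -
    have "2 * 2 + t * (2 + \<eta>) - (2 * a + 4) = \<eta> * (t - 2)" by (simp add: ta algebra_simps)
    then have "complex_of_real (2 * 2 + t * (2 + \<eta>) - (2 * a + 4)) = of_real (\<eta> * (t - 2))" by (rule arg_cong)
    then have "co Y (grad ?P ?q) = of_real (\<eta> * (t - 2))" unfolding co_grad[of Y Z X, simplified] parP x_def by simp
    then have "cmod (co Y (grad ?P ?q)) = \<bar>\<eta>\<bar> * \<bar>t - 2\<bar>" by (simp only: norm_of_real abs_mult)
    also have "\<dots> \<le> \<bar>\<eta>\<bar> * 5" using nt(2) by (intro mult_left_mono) auto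
    finally show ?thesis by simp
  qed
  have t4: "g / 2 \<le> 4 - t^2"
  proof -
    have "t^2 - a^2 = - \<eta> * (t + a)" by (simp add: ta algebra_simps power2_eq_square)
    then have "\<bar>t^2 - a^2\<bar> = \<bar>\<eta>\<bar> * \<bar>t + a\<bar>" by (simp add: abs_mult)
    also have "\<dots> \<le> e * 4" using \<eta>(1) nt(2) a by (intro mult_mono) auto
    finally show ?thesis using e(3) unfolding g_def by argo
  qed
  have nq: "norm ?q \<le> 7"
  proof -
    have "cmod x = \<bar>2 + \<eta>\<bar>" unfolding x_def by (rule norm_of_real)
    then show ?thesis using norm_point_le[of ?q] nt(2) \<eta>(1) e(2) by simp
  qed
  have "2 * real n / (4 - t^2) * (cmod (co X (grad ?P ?q)) + cmod (co Y (grad ?P ?q))) * (3 + 2 * norm ?q)^2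
      \<le> 2 * real n / (g / 2) * (5 * \<bar>\<eta>\<bar>) * 17^2"
    using t4 g gY nq by (intro mult_mono frac_le power_mono) (auto simp: gX)
  also have "\<dots> = (real n * \<bar>\<eta>\<bar>) * (20 * 17^2 / g)" by (simp add: field_simps)
  also have "\<dots> \<le> e * (20 * 17^2 / g)" using \<eta>(2) g by (intro mult_right_mono) auto
  also have "\<dots> \<le> g / 10000000 * (20 * 17^2 / g)" using e(3) g by (intro mult_right_mono) auto
  also have "\<dots> < 1 / 1000" using g by simp
  finally have "shear_point ?P n t ?q" using nt surf fixq by (simp add: shear_point_def)
  moreover have "x \<noteq> 0" using \<eta>(1) e(2) unfolding x_def by (metis abs_minus_commute add_eq_0_iff abs_numeral linorder_not_less numeral_le_one_iff of_real_eq_0_iff order_less_le_trans semiring_norm(69) abs_minus_cancel order.strict_implies_order)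
  ultimately have "\<forall>\<^sub>F P in nhds ?P. \<exists>q. shear_point P n t q"
    using nearby_solutions[OF _ prod0 surf] eventually_shear_point by blast
  then show ?thesis by (rule eventually_mono) blast
qed

section \<open>The two shears\<close>

lemma has_derivative_co_act:
  "((\<lambda>p. co l (act P w p)) has_derivative (\<lambda>v. co l (dact P w p v))) (at p)"
proof (induction w arbitrary: l)
  case Nil
  have "((\<lambda>p. co l p) has_derivative co l) (at p)"
    by (cases l) (auto simp: co_simps intro!: derivative_eq_intros)
  then show ?case by simp
next
  case (Cons i w)
  obtain j k where ijk: "i \<noteq> j" "j \<noteq> k" "i \<noteq> k" by (rule other_letters)
  show ?case
  proof (cases "l = i")
    case True
    show ?thesis unfolding True act_Cons dact.simps co_invol_same[OF ijk] co_dinvol_same[OF ijk]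
      by (rule derivative_eq_intros Cons refl)+ (simp add: fun_eq_iff algebra_simps)
  qed (use Cons in \<open>simp add: co_invol_other co_dinvol_other\<close>)
qed

lemma has_derivative_act: "(act P w has_derivative dact P w p) (at p)"
proof -
  have "((\<lambda>p. (co X (act P w p), co Y (act P w p), co Z (act P w p))) has_derivative
      (\<lambda>v. (co X (dact P w p v), co Y (dact P w p v), co Z (dact P w p v)))) (at p)"
    by (intro has_derivative_Pair has_derivative_co_act)
  then show ?thesis by (simp add: co_simps)
qed

lemma derivative_remainder:
  assumes "act P w q = q" "0 < e"
  obtains d where "0 < d" "\<And>p. norm (p - q) < d \<Longrightarrow> norm (act P w p - q - dact P w q (p - q)) \<le> e * norm (p - q)"
proof -
  from has_derivative_act[of P w q, unfolded has_derivative_at_alt] assms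
  obtain d where "0 < d" "\<forall>p. norm (p - q) < d \<longrightarrow> norm (act P w p - act P w q - dact P w q (p - q)) \<le> e * norm (p - q)"
    by blast
  then show ?thesis using that assms(1) by (metis (no_types, lifting))
qed

lemma near_id_of_derivative:
  assumes fix_q: "act P w q = q" and D: "\<And>v. norm (dact P w q v - v) \<le> L * norm v" and L: "L < e" and e: "0 < e"
  obtains d where "0 < d" "\<And>\<rho>. 0 < \<rho> \<Longrightarrow> \<rho> \<le> d \<Longrightarrow> near_id P q \<rho> (\<rho> * e) w"
proof -
  have "0 < e - L" using L by simp
  from derivative_remainder[OF fix_q this] obtain d where d: "0 < d"
    "\<And>p. norm (p - q) < d \<Longrightarrow> norm (act P w p - q - dact P w q (p - q)) \<le> (e - L) * norm (p - q)"
    by blast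
  show thesis
  proof (rule that[OF d(1)])
    fix \<rho> assume \<rho>: "0 < \<rho>" "\<rho> \<le> d"
    show "near_id P q \<rho> (\<rho> * e) w"
      unfolding near_id_def
    proof
      fix p assume "p \<in> ball q \<rho>"
      then have p: "norm (p - q) < \<rho>" by (simp add: dist_norm norm_minus_commute)
      have "act P w p - p = (act P w p - q - dact P w q (p - q)) + (dact P w q (p - q) - (p - q))" by simp
      then have "norm (act P w p - p) \<le> norm (act P w p - q - dact P w q (p - q)) + norm (dact P w q (p - q) - (p - q))"
        by (metis norm_triangle_ineq)
      also have "\<dots> \<le> (e - L) * norm (p - q) + L * norm (p - q)"
        using d(2)[of p] D[of "p - q"] p \<rho> by (intro add_mono) auto
      also have "\<dots> = e * norm (p - q)" by (simp add: algebra_simps)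
      also have "\<dots> \<le> \<rho> * e" using p e by (simp add: mult.commute mult_left_mono)
      finally show "norm (act P w p - p) \<le> \<rho> * e" .
    qed
  qed
qed

locale shear =
  fixes P :: param and n :: nat and t :: real and q :: point
  assumes shear: "shear_point P n t q"
begin

text \<open>\<open>N\<close> is the Hamiltonian vector of the third coordinate at \<open>q\<close>.
  The shear has the derivative \<open>v + csc (\<mu> * co Z v) N\<close>, the other one is its
  conjugate by the reflection \<open>\<sigma>\<close>. As \<open>\<nu>\<close> is the third
  coordinate of \<open>\<sigma> N\<close>, for non-zero \<open>\<nu>\<close> both become
  transvections with entry \<open>\<tau>\<close> in the basis \<open>N\<close>,
  \<open>\<sigma> N\<close>.\<close>

definition \<mu> :: complex where "\<mu> = of_real (2 * real n / (4 - t^2))"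
definition N :: point where "N = (co Y (grad P q), - co X (grad P q), 0)"
definition \<nu> :: complex where "\<nu> = co X q * co X (grad P q) - co Y q * co Y (grad P q)"
definition \<tau> :: complex where "\<tau> = \<mu> * \<nu>"
definition \<sigma> :: "point \<Rightarrow> point" where "\<sigma> = dinvol Z q"
definition aw :: "letter list" where "aw = pw n [Y, X]"
definition aw' :: "letter list" where "aw' = pw n [X, Y]"

lemma q_facts: "0 < n" "q \<in> cubic_surface P" "co Z q = of_real t" "\<bar>t\<bar> < 2" "chS n (of_real t) = 0" "invol P Z q = q"
  and small: "cmod \<mu> * (cmod (co X (grad P q)) + cmod (co Y (grad P q))) * (3 + 2 * norm q)^2 < 1 / 1000"
proof -
  show "0 < n" "q \<in> cubic_surface P" "co Z q = of_real t" "\<bar>t\<bar> < 2" "chS n (of_real t) = 0" "invol P Z q = q"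
    using shear by (auto simp: shear_point_def)
  then have "t^2 < 4" using abs_le_square_iff[of 2 t] by simp
  then have "cmod \<mu> = 2 * real n / (4 - t^2)" unfolding \<mu>_def norm_of_real by simp
  then show "cmod \<mu> * (cmod (co X (grad P q)) + cmod (co Y (grad P q))) * (3 + 2 * norm q)^2 < 1 / 1000"
    using shear by (simp add: shear_point_def)
qed

lemma t4: "(of_real t :: complex)^2 \<noteq> 4" "t^2 < 4"
proof -
  show "t^2 < 4" using q_facts(4) abs_le_square_iff[of 2 t] by simp
  then have "complex_of_real (t^2) \<noteq> of_real 4" by (metis less_irrefl of_real_eq_iff)
  then show "(of_real t :: complex)^2 \<noteq> 4" by simp
qed

lemma \<mu>_nz: "\<mu> \<noteq> 0"
  using q_facts(1) t4 by (simp add: \<mu>_def)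

lemma \<mu>_eq: "2 * of_nat n / (4 - (of_real t)^2) = \<mu>"
  by (simp add: \<mu>_def)

lemma grad_Z: "co Z (grad P q) = 0"
  using q_facts(6) co_invol_same[of Z X Y P q] by (simp add: co_grad[of Z X Y] algebra_simps)

lemma grad_XY: "co Z q * co Y q + 2 * co X q - par X P = co X (grad P q)"
  "co Z q * co X q + 2 * co Y q - par Y P = co Y (grad P q)"
  "par X P - 2 * co X q - co Z q * co Y q = - co X (grad P q)"
  "par Y P - 2 * co Y q - co Z q * co X q = - co Y (grad P q)"
  by (simp_all add: co_grad[of X Y Z] co_grad[of Y Z X] algebra_simps)

lemma words_fix: "act P aw q = q" "act P aw' q = q" "act P [Z] q = q"
proof -
  have "co l (act P aw q) = co l q" for l
    using act_pw[of Y X Z "co X q" q "co Y q" "of_real t" _ P _ n] q_facts by (cases l) (auto simp: aw_def)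
  then show "act P aw q = q" by (rule co_eqI)
  have "co l (act P aw' q) = co l q" for l
    using act_pw[of X Y Z "co Y q" q "co X q" "of_real t" _ P _ n] q_facts by (cases l) (auto simp: aw'_def)
  then show "act P aw' q = q" by (rule co_eqI)
  show "act P [Z] q = q" using q_facts by simp
qed

lemma dact_a: "dact P aw q v = v + csc (\<mu> * co Z v) N"
proof (rule co_eqI)
  fix l
  note D = dact_pw[OF _ _ _ refl refl refl refl refl, of Y X Z n q P v]
  show "co l (dact P aw q v) = co l (v + csc (\<mu> * co Z v) N)"
    unfolding aw_def co_plus co_csc N_def
    using D q_facts(3,5) t4(1) by (cases l) (auto simp: grad_XY[unfolded q_facts(3)] \<mu>_eq)
qed

lemma dact_a': "dact P aw' q v = v + csc (- (\<mu> * co Z v)) N"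
proof (rule co_eqI)
  fix l
  note D = dact_pw[OF _ _ _ refl refl refl refl refl, of X Y Z n q P v]
  show "co l (dact P aw' q v) = co l (v + csc (- (\<mu> * co Z v)) N)"
    unfolding aw'_def co_plus co_csc N_def
    using D q_facts(3,5) t4(1) by (cases l) (auto simp: grad_XY[unfolded q_facts(3)] \<mu>_eq)
qed

lemma \<sigma>\<sigma>: "\<sigma> (\<sigma> v) = v"
  using dinvol_dinvol[of Z P q v] q_facts(6) by (simp add: \<sigma>_def)

lemma \<sigma>_Z: "co Z (\<sigma> v) = - co Z v - co Y q * co X v - co X q * co Y v"
  using co_dinvol_same[of Z X Y q v] by (simp add: \<sigma>_def)

lemma \<sigma>_N: "co Z N = 0" "co Z (\<sigma> N) = \<nu>"
  by (simp_all add: \<sigma>_Z N_def \<nu>_def)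

lemma \<sigma>_linear: "\<sigma> (v + w) = \<sigma> v + \<sigma> w" "\<sigma> (csc u v) = csc u (\<sigma> v)"
  by (simp_all add: \<sigma>_def dinvol_linear)

lemma dact_b:
  "dact P (Z # aw @ [Z]) q v = v + csc (\<mu> * co Z (\<sigma> v)) (\<sigma> N)"
  "dact P (Z # aw' @ [Z]) q v = v + csc (- (\<mu> * co Z (\<sigma> v))) (\<sigma> N)"
proof -
  have *: "dact P (Z # w @ [Z]) q v = \<sigma> (dact P w q (\<sigma> v))" if "act P w q = q" for w
    using that q_facts(6) by (simp add: \<sigma>_def)
  show "dact P (Z # aw @ [Z]) q v = v + csc (\<mu> * co Z (\<sigma> v)) (\<sigma> N)"
    "dact P (Z # aw' @ [Z]) q v = v + csc (- (\<mu> * co Z (\<sigma> v))) (\<sigma> N)"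
    unfolding *[OF words_fix(1)] *[OF words_fix(2)] by (simp_all only: dact_a dact_a' \<sigma>_linear \<sigma>\<sigma>)
qed

lemma b_fix: "act P (Z # aw @ [Z]) q = q" "act P (Z # aw' @ [Z]) q = q"
  using words_fix q_facts(6) by auto

lemma rev_words: "rev aw = aw'" "rev aw' = aw" "rev (Z # aw @ [Z]) = Z # aw' @ [Z]"
  by (simp_all add: aw_def aw'_def rev_pw)

lemma even_words: "even (length aw)" "even (length aw')"
  by (simp_all add: aw_def aw'_def)

text \<open>The derivatives differ from the identity by at most the small quantity in
  \<open>shear_point\<close>, which is below \<open>1 / 384\<close>; on small balls the non-linear
  remainder fits into the gap.\<close>

lemma near_id_words:
  obtains \<rho>0 where "0 < \<rho>0" "\<And>\<rho> w. 0 < \<rho> \<Longrightarrow> \<rho> \<le> \<rho>0 \<Longrightarrow> w \<in> {aw, aw', Z # aw @ [Z], Z # aw' @ [Z]} \<Longrightarrow> near_id P q \<rho> (\<rho> / 384) w"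
proof -
  define L where "L = cmod \<mu> * (cmod (co X (grad P q)) + cmod (co Y (grad P q))) * (3 + 2 * norm q)^2"
  have L: "L < 1 / 384" using small by (simp add: L_def)
  have nN: "norm N \<le> cmod (co X (grad P q)) + cmod (co Y (grad P q))"
    using norm_point_le[of N] by (simp add: N_def)
  have ns: "norm (\<sigma> v) \<le> (3 + 2 * norm q) * norm v" for v
    unfolding \<sigma>_def by (rule dinvol_bound)
  have one: "1 \<le> 3 + 2 * norm q" by simp
  have D: "norm (dact P w q v - v) \<le> L * norm v" if w: "w \<in> {aw, aw', Z # aw @ [Z], Z # aw' @ [Z]}" for w v
  proof -
    have a: "norm (csc u N) \<le> cmod \<mu> * norm v * norm N" if "cmod u = cmod \<mu> * cmod (co Z v)" for u
      unfolding norm_csc that by (intro mult_right_mono mult_left_mono co_le_norm) auto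
    have b: "norm (csc u (\<sigma> N)) \<le> cmod \<mu> * ((3 + 2 * norm q) * norm v) * ((3 + 2 * norm q) * norm N)"
      if "cmod u = cmod \<mu> * cmod (co Z (\<sigma> v))" for u
      unfolding norm_csc that using order_trans[OF co_le_norm[of Z "\<sigma> v"] ns]
      by (intro mult_mono mult_left_mono ns) auto
    have c: "cmod \<mu> * norm v * norm N \<le> L * norm v"
    proof -
      have "cmod \<mu> * norm N * 1 \<le> L" unfolding L_def
        using nN one by (intro mult_mono) (auto simp: one_le_power)
      from mult_right_mono[OF this, of "norm v"] show ?thesis by (simp add: mult_ac)
    qed
    have d: "cmod \<mu> * ((3 + 2 * norm q) * norm v) * ((3 + 2 * norm q) * norm N) \<le> L * norm v"
    proof -
      have "cmod \<mu> * norm N * (3 + 2 * norm q)^2 \<le> L" unfolding L_def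
        using nN by (intro mult_mono) auto
      from mult_right_mono[OF this, of "norm v"] show ?thesis by (simp add: mult_ac power2_eq_square)
    qed
    from w consider "w = aw" | "w = aw'" | "w = Z # aw @ [Z]" | "w = Z # aw' @ [Z]" by blast
    then show ?thesis
    proof cases
      case 1
      then show ?thesis using order_trans[OF a c] by (simp add: dact_a norm_mult)
    next
      case 2
      then show ?thesis using order_trans[OF a c] by (simp add: dact_a' norm_mult)
    next
      case 3
      show ?thesis unfolding 3 dact_b using order_trans[OF b d] by (simp add: norm_mult)
    next
      case 4
      show ?thesis unfolding 4 dact_b using order_trans[OF b d] by (simp add: norm_mult)
    qed
  qed
  define W where "W = {aw, aw', Z # aw @ [Z], Z # aw' @ [Z]}"
  have W: "finite W" "W \<noteq> {}" by (auto simp: W_def)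
  have "\<exists>d. 0 < d \<and> (\<forall>\<rho>. 0 < \<rho> \<and> \<rho> \<le> d \<longrightarrow> near_id P q \<rho> (\<rho> / 384) w)" if w: "w \<in> W" for w
  proof -
    have fix_w: "act P w q = q" using w words_fix b_fix unfolding W_def by blast
    have "(0::real) < 1 / 384" by simp
    from near_id_of_derivative[OF fix_w D[OF w[unfolded W_def]] L this] obtain d where
      "0 < d" "\<And>\<rho>. 0 < \<rho> \<Longrightarrow> \<rho> \<le> d \<Longrightarrow> near_id P q \<rho> (\<rho> * (1 / 384)) w" by blast
    then show ?thesis by (intro exI[of _ d]) simp
  qed
  then have "\<exists>d. \<forall>w\<in>W. 0 < d w \<and> (\<forall>\<rho>. 0 < \<rho> \<and> \<rho> \<le> d w \<longrightarrow> near_id P q \<rho> (\<rho> / 384) w)"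
    by (intro bchoice ballI)
  then obtain d where d: "\<forall>w\<in>W. 0 < d w \<and> (\<forall>\<rho>. 0 < \<rho> \<and> \<rho> \<le> d w \<longrightarrow> near_id P q \<rho> (\<rho> / 384) w)" by (elim exE)
  show thesis
  proof (rule that[of "Min (d ` W)"])
    have "Min (d ` W) \<in> d ` W" using W by (intro Min_in) auto
    then show "0 < Min (d ` W)" using d by auto
    fix \<rho> w assume *: "0 < \<rho>" "\<rho> \<le> Min (d ` W)" "w \<in> {aw, aw', Z # aw @ [Z], Z # aw' @ [Z]}"
    then have w: "w \<in> W" by (simp only: W_def)
    then have "Min (d ` W) \<le> d w" using W by (intro Min_le) auto
    then show "near_id P q \<rho> (\<rho> / 384) w" using bspec[OF d w] * by simp
  qed
qed

lemma \<tau>_small: "cmod \<tau> < 1 / 2"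
proof -
  let ?m = "cmod (co X (grad P q)) + cmod (co Y (grad P q))"
  have "cmod \<nu> \<le> cmod (co X q) * cmod (co X (grad P q)) + cmod (co Y q) * cmod (co Y (grad P q))"
    unfolding \<nu>_def by (metis norm_mult norm_triangle_ineq4)
  also have "\<dots> \<le> norm q * cmod (co X (grad P q)) + norm q * cmod (co Y (grad P q))"
    by (intro add_mono mult_right_mono co_le_norm) auto
  also have "\<dots> = ?m * norm q" by (simp add: algebra_simps)
  also have "\<dots> \<le> ?m * (3 + 2 * norm q)^2"
  proof (intro mult_left_mono)
    have "norm q \<le> 1 * (3 + 2 * norm q)" by simp
    also have "\<dots> \<le> (3 + 2 * norm q) * (3 + 2 * norm q)" by (intro mult_right_mono) auto
    finally show "norm q \<le> (3 + 2 * norm q)^2" by (simp add: power2_eq_square)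
  qed auto
  finally have "cmod \<mu> * cmod \<nu> \<le> cmod \<mu> * (?m * (3 + 2 * norm q)^2)" by (intro mult_left_mono) auto
  then show ?thesis using small by (simp add: \<tau>_def norm_mult mult.assoc)
qed

lemma full_words: "full_cyclic (aw @ Z # aw @ [Z])" "full_cyclic (aw @ Z # aw' @ [Z])"
proof -
  obtain m where m: "n = Suc m" using q_facts(1) by (cases n) auto
  have adj: "distinct_adj (pw k [i, j])" "k \<noteq> 0 \<Longrightarrow> hd (pw k [i, j]) = i \<and> last (pw k [i, j]) = j \<and> pw k [i, j] \<noteq> []"
    if "i \<noteq> j" for i j k
  proof -
    have "distinct_adj (pw k [i, j]) \<and> (k \<noteq> 0 \<longrightarrow> hd (pw k [i, j]) = i \<and> last (pw k [i, j]) = j \<and> pw k [i, j] \<noteq> [])"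
      using that by (induction k) (auto simp: distinct_adj_Cons split: if_splits)
    then show "distinct_adj (pw k [i, j])" "k \<noteq> 0 \<Longrightarrow> hd (pw k [i, j]) = i \<and> last (pw k [i, j]) = j \<and> pw k [i, j] \<noteq> []"
      by auto
  qed
  have s: "X \<in> set aw" "Y \<in> set aw" unfolding aw_def by (auto simp: m)
  have "set (aw @ Z # v) = UNIV" for v
  proof -
    have "l \<in> set (aw @ Z # v)" for l using s by (cases l) auto
    then show ?thesis by blast
  qed
  then show "full_cyclic (aw @ Z # aw @ [Z])" "full_cyclic (aw @ Z # aw' @ [Z])"
    unfolding full_cyclic_def using adj[of Y X n] adj[of X Y n] q_facts(1)
    by (auto simp: aw_def aw'_def distinct_adj_append_iff distinct_adj_Cons)
qed

text \<open>The two products of the shear with its conjugate and with the inverse of the conjugate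
  have traces \<open>3 + \<tau>^2\<close> and \<open>3 - \<tau>^2\<close>. If
  \<open>\<tau>^2\<close> were real, its smallness would put one of them, minus 1, into
  \<open>[-2, 2]\<close>, contrary to \<open>fixed_point_trace\<close>.\<close>

lemma \<tau>_not_real:
  assumes gen: "P \<notin> nongeneric"
  shows "\<tau>^2 \<notin> \<real>"
proof
  assume "\<tau>^2 \<in> \<real>"
  then obtain r where r: "\<tau>^2 = of_real r" by (auto elim: Reals_cases)
  have "\<bar>r\<bar> = cmod (\<tau>^2)" using r by simp
  also have "\<dots> \<le> (1 / 2)^2" unfolding norm_power using \<tau>_small by (intro power_mono) auto
  finally have r1: "\<bar>r\<bar> \<le> 1" by (simp add: power2_eq_square)
  have Ns: "co X N = co Y (grad P q)" "co Y N = - co X (grad P q)" by (simp_all add: N_def)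
  have sN: "co X (\<sigma> N) = co X N" "co Y (\<sigma> N) = co Y N" by (simp_all add: \<sigma>_def co_dinvol_other)
  have tr: "tr3 (dact P (aw @ Z # aw @ [Z]) q) = 3 + \<tau>^2" "tr3 (dact P (aw @ Z # aw' @ [Z]) q) = 3 - \<tau>^2"
    unfolding tr3_def dact_append b_fix dact_a dact_b co_plus co_csc \<sigma>_Z \<sigma>_N sN Ns
    by (simp_all add: \<tau>_def \<nu>_def algebra_simps power2_eq_square)
  have "tr3 (dact P (aw @ Z # aw @ [Z]) q) - 1 \<notin> of_real ` {-2..2}"
    using words_fix b_fix q_facts(2,6) even_words by (intro fixed_point_trace[OF gen full_words(1)]) auto
  moreover have "tr3 (dact P (aw @ Z # aw' @ [Z]) q) - 1 \<notin> of_real ` {-2..2}"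
    using words_fix b_fix q_facts(2,6) even_words by (intro fixed_point_trace[OF gen full_words(2)]) auto
  moreover have "tr3 (dact P (aw @ Z # aw @ [Z]) q) - 1 = of_real (2 + r)"
    "tr3 (dact P (aw @ Z # aw' @ [Z]) q) - 1 = of_real (2 - r)"
    unfolding tr r by simp_all
  ultimately have "2 + r \<notin> {-2..2}" "2 - r \<notin> {-2..2}" by (metis image_eqI)+
  then show False using r1 by auto
qed

end

section \<open>Contraction by a group generated by two small transvections\<close>

fun mt :: "complex \<times> complex \<times> complex \<times> complex \<Rightarrow> complex \<times> complex \<Rightarrow> complex \<times> complex" where
  "mt (a, b, c, d) (x, y) = (a * x + b * y, c * x + d * y)"

fun cs :: "complex \<Rightarrow> complex \<times> complex \<Rightarrow> complex \<times> complex" where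
  "cs u (x, y) = (u * x, u * y)"

lemma norm_cs: "norm (cs u v) = cmod u * norm v"
  by (cases v) (simp add: norm_Pair norm_mult power_mult_distrib real_sqrt_mult flip: distrib_left)

lemma mt_linear: "linear (mt m)"
proof -
  obtain a b c d where m: "m = (a, b, c, d)" by (metis prod.exhaust)
  show ?thesis
  proof (rule linearI)
    fix v w :: "complex \<times> complex" and r :: real
    show "mt m (v + w) = mt m v + mt m w" by (cases v; cases w) (simp add: m algebra_simps)
    show "mt m (r *\<^sub>R v) = r *\<^sub>R mt m v" by (cases v) (simp add: m scaleR_conv_of_real algebra_simps)
  qed
qed

text \<open>At a minimum the one-sided derivative of the squared norm is non-negative;
  \<open>u\<close> is the limiting direction of the steps \<open>s n\<close>.\<close>

lemma first_variation:
  assumes ge: "\<And>n. norm w \<le> norm (w + cs (s n) (y n))"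
    and y: "y \<longlonglongrightarrow> y0" and s: "s \<longlonglongrightarrow> 0" "\<And>n. s n \<noteq> 0" and u: "(\<lambda>n. s n / of_real (cmod (s n))) \<longlonglongrightarrow> u"
  shows "0 \<le> w \<bullet> cs u y0"
proof -
  have ineq: "0 \<le> 2 * (w \<bullet> cs (s n / of_real (cmod (s n))) (y n)) + cmod (s n) * (norm (y n))^2" for n
  proof -
    let ?r = "cmod (s n)"
    have r: "0 < ?r" using s(2) by simp
    have cs: "cs (s n) (y n) = ?r *\<^sub>R cs (s n / of_real ?r) (y n)"
      using r by (cases "y n") (simp add: scaleR_conv_of_real)
    have "(norm w)^2 \<le> (norm (w + cs (s n) (y n)))^2" using ge by (intro power_mono) auto
    also have "\<dots> = (norm w)^2 + 2 * (w \<bullet> cs (s n) (y n)) + (norm (cs (s n) (y n)))^2"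
      by (simp add: power2_norm_eq_inner inner_add inner_commute)
    also have "w \<bullet> cs (s n) (y n) = ?r * (w \<bullet> cs (s n / of_real ?r) (y n))" by (subst cs) simp
    also have "(norm (cs (s n) (y n)))^2 = ?r * (?r * (norm (y n))^2)" by (simp add: norm_cs power2_eq_square)
    finally have "0 \<le> ?r * (2 * (w \<bullet> cs (s n / of_real ?r) (y n)) + ?r * (norm (y n))^2)"
      by (simp add: algebra_simps)
    then show ?thesis using r by (simp add: zero_le_mult_iff)
  qed
  have cs_eq: "cs u v = (u * fst v, u * snd v)" for u v by (cases v) simp
  have "(\<lambda>n. 2 * (w \<bullet> cs (s n / of_real (cmod (s n))) (y n)) + cmod (s n) * (norm (y n))^2)
      \<longlonglongrightarrow> 2 * (w \<bullet> cs u y0) + cmod 0 * (norm y0)^2"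
    unfolding cs_eq by (intro tendsto_intros y s u)
  then have "0 \<le> 2 * (w \<bullet> cs u y0) + cmod 0 * (norm y0)^2"
    by (rule LIMSEQ_le_const) (use ineq in blast)
  then show ?thesis by simp
qed

text \<open>Shimizu's sequence: \<open>A\<^sub>0 = A\<close> and \<open>A\<^sub>n\<^sub>+\<^sub>1\<close> is the commutator of \<open>A\<^sub>n\<close> with \<open>B\<close>, where \<open>A\<close> and \<open>B\<close> are
  the upper and the lower unitriangular matrix with off-diagonal entry \<open>\<tau>\<close>.\<close>

fun shimizu :: "complex \<Rightarrow> nat \<Rightarrow> complex \<times> complex \<times> complex \<times> complex" where
  "shimizu \<tau> 0 = (1, \<tau>, 0, 1)"
| "shimizu \<tau> (Suc n) = (case shimizu \<tau> n of (a, b, c, d) \<Rightarrow>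
     (1 + \<tau> * b * d + \<tau>^2 * b^2, - \<tau> * b^2, \<tau> * (d^2 - 1) + \<tau>^2 * b * d, 1 - \<tau> * b * d))"

context
  fixes \<tau> :: complex and \<Lambda> :: "(complex \<times> complex \<Rightarrow> complex \<times> complex) set"
  assumes \<tau>: "cmod \<tau> < 1 / 2" "\<tau>^2 \<notin> \<real>"
    and gens: "mt (1, \<tau>, 0, 1) \<in> \<Lambda>" "mt (1, - \<tau>, 0, 1) \<in> \<Lambda>" "mt (1, 0, \<tau>, 1) \<in> \<Lambda>" "mt (1, 0, - \<tau>, 1) \<in> \<Lambda>"
    and comp: "\<And>f g. f \<in> \<Lambda> \<Longrightarrow> g \<in> \<Lambda> \<Longrightarrow> f \<circ> g \<in> \<Lambda>"
begin

lemma \<tau>_nz: "\<tau> \<noteq> 0"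
  using \<tau>(2) by auto

text \<open>The upper right entry is squared and multiplied by \<open>- \<tau>\<close> at each step,
  so it decays. Inverses are carried along because the next commutator uses them.\<close>

lemma shimizu_mem: "case shimizu \<tau> n of (a, b, c, d) \<Rightarrow>
    a * d - b * c = 1 \<and> b \<noteq> 0 \<and> cmod b \<le> (1 / 2) ^ Suc n \<and> cmod d \<le> 2 \<and> mt (a, b, c, d) \<in> \<Lambda> \<and> mt (d, - b, - c, a) \<in> \<Lambda>"
proof (induction n)
  case 0
  then show ?case using gens \<tau> \<tau>_nz by simp
next
  case (Suc n)
  obtain a b c d where abcd: "shimizu \<tau> n = (a, b, c, d)" by (metis prod.exhaust)
  have IH: "a * d - b * c = 1" "b \<noteq> 0" "cmod b \<le> (1 / 2) ^ Suc n" "cmod d \<le> 2" "mt (a, b, c, d) \<in> \<Lambda>" "mt (d, - b, - c, a) \<in> \<Lambda>"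
    using Suc by (auto simp: abcd)
  define a' b' c' d' where "a' = 1 + \<tau> * b * d + \<tau>^2 * b^2" "b' = - \<tau> * b^2"
    "c' = \<tau> * (d^2 - 1) + \<tau>^2 * b * d" "d' = 1 - \<tau> * b * d"
  note defs = this
  have bc: "b * c = a * d - 1" using IH(1) by (simp add: algebra_simps)
  have "(mt (a, b, c, d) \<circ> mt (1, 0, \<tau>, 1)) \<circ> (mt (d, - b, - c, a) \<circ> mt (1, 0, - \<tau>, 1)) = mt (a', b', c', d')"
  proof
    fix v :: "complex \<times> complex"
    obtain x y where v: "v = (x, y)" by (cases v)
    show "((mt (a, b, c, d) \<circ> mt (1, 0, \<tau>, 1)) \<circ> (mt (d, - b, - c, a) \<circ> mt (1, 0, - \<tau>, 1))) v = mt (a', b', c', d') v"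
      unfolding v comp_apply mt.simps defs using IH(1) by (intro prod_eqI; simp only: fst_conv snd_conv; algebra)
  qed
  then have 1: "mt (a', b', c', d') \<in> \<Lambda>" using IH(5,6) gens comp by metis
  have "(mt (1, 0, \<tau>, 1) \<circ> mt (a, b, c, d)) \<circ> (mt (1, 0, - \<tau>, 1) \<circ> mt (d, - b, - c, a)) = mt (d', - b', - c', a')"
  proof
    fix v :: "complex \<times> complex"
    obtain x y where v: "v = (x, y)" by (cases v)
    show "((mt (1, 0, \<tau>, 1) \<circ> mt (a, b, c, d)) \<circ> (mt (1, 0, - \<tau>, 1) \<circ> mt (d, - b, - c, a))) v = mt (d', - b', - c', a') v"
      unfolding v comp_apply mt.simps defs using IH(1) by (intro prod_eqI; simp only: fst_conv snd_conv; algebra)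
  qed
  then have 2: "mt (d', - b', - c', a') \<in> \<Lambda>" using IH(5,6) gens comp by metis
  have 3: "a' * d' - b' * c' = 1" unfolding defs by algebra
  have 4: "b' \<noteq> 0" using IH(2) \<tau>_nz by (simp add: defs)
  have pw: "(1 / 2 :: real) ^ Suc n \<le> 1" by (rule power_le_one) auto
  have 5: "cmod b' \<le> (1 / 2) ^ Suc (Suc n)"
  proof -
    have "cmod b' = cmod \<tau> * (cmod b * cmod b)" by (simp add: defs norm_mult power2_eq_square)
    also have "\<dots> \<le> 1 / 2 * ((1 / 2) ^ Suc n * 1)" using \<tau>(1) IH(3) pw by (intro mult_mono) auto
    finally show ?thesis by simp
  qed
  have 6: "cmod d' \<le> 2"
  proof -
    have "cmod d' \<le> 1 + cmod \<tau> * cmod b * cmod d" using norm_triangle_ineq4[of 1 "\<tau> * b * d"] by (simp add: defs norm_mult)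
    also have "cmod \<tau> * cmod b * cmod d \<le> 1 / 2 * 1 * 2" using \<tau>(1) IH(3,4) pw by (intro mult_mono) auto
    finally show ?thesis by simp
  qed
  show ?case using 1 2 3 4 5 6 unfolding shimizu.simps abcd prod.case defs by simp
qed

text \<open>To first order, the members of Shimizu's sequence approach the identity along \<open>E\<^sub>2\<^sub>1\<close>.\<close>

lemma shimizu_direction:
  "\<exists>s x1 x2 x3 x4. s \<longlonglongrightarrow> 0 \<and> (\<forall>n :: nat. s n \<noteq> 0) \<and>
    x1 \<longlonglongrightarrow> 0 \<and> x2 \<longlonglongrightarrow> 0 \<and> x3 \<longlonglongrightarrow> 1 \<and> x4 \<longlonglongrightarrow> 0 \<and>
    (\<forall>n. mt (1 + s n * x1 n, s n * x2 n, s n * x3 n, 1 + s n * x4 n) \<in> \<Lambda> \<and>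
      mt (1 + s n * x4 n, - (s n * x2 n), - (s n * x3 n), 1 + s n * x1 n) \<in> \<Lambda>)"
proof -
  define b d where "b n = fst (snd (shimizu \<tau> n))" "d n = snd (snd (snd (shimizu \<tau> n)))" for n
  note bd = this
  have b: "b n \<noteq> 0" "cmod (b n) \<le> (1 / 2) ^ Suc n" "cmod (d n) \<le> 2" for n
    using shimizu_mem[of n] by (auto simp: bd split: prod.splits)
  have step: "b (Suc n) = - \<tau> * (b n)^2" "d (Suc n) = 1 - \<tau> * b n * d n" for n
    by (auto simp: bd split: prod.splits)
  have half: "(\<lambda>n. (1 / 2 :: real) ^ Suc n) \<longlonglongrightarrow> 0" by real_asymp
  have b0: "b \<longlonglongrightarrow> 0"
    by (rule Lim_null_comparison[OF _ half]) (use b(2) in auto)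
  have bd0: "(\<lambda>n. b n * d n) \<longlonglongrightarrow> 0"
  proof (rule Lim_null_comparison)
    show "\<forall>\<^sub>F n in sequentially. norm (b n * d n) \<le> (1 / 2) ^ Suc n * 2"
      unfolding norm_mult using b by (intro always_eventually allI mult_mono) auto
    show "(\<lambda>n. (1 / 2 :: real) ^ Suc n * 2) \<longlonglongrightarrow> 0" by real_asymp
  qed
  have d1': "(\<lambda>n. d (Suc n)) \<longlonglongrightarrow> 1"
    unfolding step mult.assoc using tendsto_diff[OF tendsto_const tendsto_mult_left[OF bd0, of \<tau>], of 1] by simp
  then have d1: "d \<longlonglongrightarrow> 1" by (rule LIMSEQ_imp_Suc)
  \<comment> \<open>The leading term of the lower left entry two steps later, by which the deviation
    from the identity is normalized.\<close>
  define s where "s n = - 2 * \<tau>^2 * b n" for n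
  define x1 where "x1 n = b n * d (Suc n) / 2 - \<tau>^2 * (b n)^3 / 2" for n
  define x2 where "x2 n = \<tau> * (b n)^3 / 2" for n
  define x3 where "x3 n = d n - \<tau> * b n * (d n)^2 / 2 + \<tau> * b n * d (Suc n) / 2" for n
  define x4 where "x4 n = - (b n * d (Suc n) / 2)" for n
  have sh: "shimizu \<tau> (Suc (Suc n)) = (1 + s n * x1 n, s n * x2 n, s n * x3 n, 1 + s n * x4 n)" for n
  proof -
    obtain a c where "shimizu \<tau> (Suc n) = (a, b (Suc n), c, d (Suc n))" by (metis bd prod.collapse)
    moreover have "1 + \<tau> * b (Suc n) * d (Suc n) + \<tau>^2 * (b (Suc n))^2 = 1 + s n * x1 n"
      unfolding s_def x1_def step(1) by (simp add: field_simps power2_eq_square power3_eq_cube)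
    moreover have "- \<tau> * (b (Suc n))^2 = s n * x2 n"
      unfolding s_def x2_def step(1) by (simp add: field_simps power2_eq_square power3_eq_cube)
    moreover have "\<tau> * ((d (Suc n))^2 - 1) + \<tau>^2 * b (Suc n) * d (Suc n) = s n * x3 n"
      unfolding s_def x3_def step by (simp add: field_simps power2_eq_square power3_eq_cube)
    moreover have "1 - \<tau> * b (Suc n) * d (Suc n) = 1 + s n * x4 n"
      unfolding s_def x4_def step(1) by (simp add: field_simps power2_eq_square)
    ultimately show ?thesis by (simp only: shimizu.simps prod.case)
  qed
  show ?thesis
  proof (intro exI conjI allI)
    show "s \<longlonglongrightarrow> 0" unfolding s_def using b0 by (auto intro!: tendsto_eq_intros)
    show "s n \<noteq> 0" for n using b(1) \<tau>_nz by (simp add: s_def)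
    show "x1 \<longlonglongrightarrow> 0" unfolding x1_def by (rule tendsto_eq_intros b0 d1' refl | simp)+
    show "x2 \<longlonglongrightarrow> 0" unfolding x2_def by (rule tendsto_eq_intros b0 d1' refl | simp)+
    show "x3 \<longlonglongrightarrow> 1" unfolding x3_def by (rule tendsto_eq_intros b0 d1 d1' refl | simp)+
    show "x4 \<longlonglongrightarrow> 0" unfolding x4_def by (rule tendsto_eq_intros b0 d1' refl | simp)+
    show "mt (1 + s n * x1 n, s n * x2 n, s n * x3 n, 1 + s n * x4 n) \<in> \<Lambda>"
      "mt (1 + s n * x4 n, - (s n * x2 n), - (s n * x3 n), 1 + s n * x1 n) \<in> \<Lambda>" for n
      using shimizu_mem[of "Suc (Suc n)"] unfolding sh by auto
  qed
qed

text \<open>Conjugating Shimizu's sequence by a matrix of \<open>\<Lambda>\<close> gives elements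
  that approach the identity along the conjugate of the elementary matrix, here written out. Applied
  to the sequence and to its inverses, \<open>first_variation\<close> yields both signs.\<close>

lemma critical_conjugates:
  assumes ge: "\<And>f. f \<in> \<Lambda> \<Longrightarrow> norm w \<le> norm (f w)"
  obtains u where "cmod u = 1"
    "\<And>p q r s. mt (p, q, r, s) \<in> \<Lambda> \<Longrightarrow> mt (s, - q, - r, p) \<in> \<Lambda> \<Longrightarrow> p * s - q * r = 1 \<Longrightarrow>
       w \<bullet> cs u (mt (q * s, - (q^2), s^2, - (q * s)) w) = 0"
proof -
  obtain s x1 x2 x3 x4 where s: "s \<longlonglongrightarrow> 0" "\<And>n :: nat. s n \<noteq> 0"
    and x: "x1 \<longlonglongrightarrow> 0" "x2 \<longlonglongrightarrow> 0" "x3 \<longlonglongrightarrow> 1" "x4 \<longlonglongrightarrow> 0"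
    and mem: "\<And>n. mt (1 + s n * x1 n, s n * x2 n, s n * x3 n, 1 + s n * x4 n) \<in> \<Lambda>"
      "\<And>n. mt (1 + s n * x4 n, - (s n * x2 n), - (s n * x3 n), 1 + s n * x1 n) \<in> \<Lambda>"
    using shimizu_direction by (elim exE conjE) (metis (no_types))
  have "s n / of_real (cmod (s n)) \<in> sphere 0 1" for n using s(2) by (simp add: norm_divide)
  then obtain u and \<phi> :: "nat \<Rightarrow> nat" where u: "u \<in> sphere 0 1" "strict_mono \<phi>"
    "((\<lambda>n. s n / of_real (cmod (s n))) \<circ> \<phi>) \<longlonglongrightarrow> u"
    using compact_sphere[of "0::complex" 1] unfolding compact_def by meson
  obtain w1 w2 where w: "w = (w1, w2)" by (cases w)
  have half: "0 \<le> w \<bullet> cs u (mt (e * (q * s'), - e * q^2, e * s'^2, - e * (q * s')) w)"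
    if g: "mt (p, q, r, s') \<in> \<Lambda>" "mt (s', - q, - r, p) \<in> \<Lambda>" "p * s' - q * r = 1"
      and z: "z1 \<longlonglongrightarrow> 0" "z2 \<longlonglongrightarrow> 0" "z3 \<longlonglongrightarrow> e" "z4 \<longlonglongrightarrow> 0"
      and mz: "\<And>n. mt (1 + s n * z1 n, s n * z2 n, s n * z3 n, 1 + s n * z4 n) \<in> \<Lambda>"
    for p q r s' z1 z2 z3 z4 e
  proof -
    define h1 h2 where "h1 = s' * w1 - q * w2" "h2 = - r * w1 + p * w2"
    note h = this
    define y where "y n = (p * (z1 n * h1 + z2 n * h2) + q * (z3 n * h1 + z4 n * h2),
        r * (z1 n * h1 + z2 n * h2) + s' * (z3 n * h1 + z4 n * h2))" for n
    have "(mt (p, q, r, s') \<circ> mt (1 + s n * z1 n, s n * z2 n, s n * z3 n, 1 + s n * z4 n) \<circ> mt (s', - q, - r, p)) w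
        = w + cs (s n) (y n)" for n
    proof -
      have a: "p * h1 + q * h2 = w1" "r * h1 + s' * h2 = w2" unfolding h using g(3) by algebra+
      have hh: "mt (s', - q, - r, p) w = (h1, h2)" by (simp add: w h)
      show ?thesis unfolding comp_apply hh
        unfolding mt.simps w y_def cs.simps add_Pair a[symmetric] by (simp add: algebra_simps)
    qed
    then have ge': "norm w \<le> norm (w + cs (s n) (y n))" for n
      using ge[OF comp[OF comp[OF g(1) mz[of n]] g(2)]] by metis
    have "y \<longlonglongrightarrow> (p * (0 * h1 + 0 * h2) + q * (e * h1 + 0 * h2), r * (0 * h1 + 0 * h2) + s' * (e * h1 + 0 * h2))"
      unfolding y_def by (intro tendsto_intros z)
    then have y: "y \<longlonglongrightarrow> (q * (e * h1), s' * (e * h1))" by simp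
    have "0 \<le> w \<bullet> cs u (q * (e * h1), s' * (e * h1))"
    proof (rule first_variation[of w "s \<circ> \<phi>" "y \<circ> \<phi>"])
      show "norm w \<le> norm (w + cs ((s \<circ> \<phi>) n) ((y \<circ> \<phi>) n))" for n using ge' by simp
      show "(y \<circ> \<phi>) \<longlonglongrightarrow> (q * (e * h1), s' * (e * h1))" using LIMSEQ_subseq_LIMSEQ[OF y u(2)] .
      show "(s \<circ> \<phi>) \<longlonglongrightarrow> 0" using LIMSEQ_subseq_LIMSEQ[OF s(1) u(2)] .
      show "(s \<circ> \<phi>) n \<noteq> 0" for n using s(2) by simp
      show "(\<lambda>n. (s \<circ> \<phi>) n / of_real (cmod ((s \<circ> \<phi>) n))) \<longlonglongrightarrow> u" using u(3) by (simp add: comp_def)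
    qed
    moreover have "mt (e * (q * s'), - e * q^2, e * s'^2, - e * (q * s')) w = (q * (e * h1), s' * (e * h1))"
      by (simp add: w h algebra_simps power2_eq_square)
    ultimately show ?thesis by simp
  qed
  show thesis
  proof (rule that)
    show "cmod u = 1" using u(1) by simp
    fix p q r s'
    assume g: "mt (p, q, r, s') \<in> \<Lambda>" "mt (s', - q, - r, p) \<in> \<Lambda>" "p * s' - q * r = 1"
    let ?v = "mt (q * s', - (q^2), s'^2, - (q * s')) w"
    have "0 \<le> w \<bullet> cs u ?v" using half[OF g x mem(1)] by simp
    moreover have "0 \<le> w \<bullet> cs u (- ?v)"
    proof -
      have "0 \<le> w \<bullet> cs u (mt (- 1 * (q * s'), - (- 1) * q^2, (- 1) * s'^2, - (- 1) * (q * s')) w)"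
      proof (rule half[OF g, of x4 "\<lambda>n. - x2 n" "\<lambda>n. - x3 n" _ x1])
        show "(\<lambda>n. - x2 n) \<longlonglongrightarrow> 0" "(\<lambda>n. - x3 n) \<longlonglongrightarrow> - 1" using x(2,3) by (auto intro!: tendsto_eq_intros)
        show "mt (1 + s n * x4 n, s n * - x2 n, s n * - x3 n, 1 + s n * x1 n) \<in> \<Lambda>" for n using mem(2)[of n] by simp
      qed (use x in auto)
      moreover have "mt (- 1 * (q * s'), - (- 1) * q^2, (- 1) * s'^2, - (- 1) * (q * s')) w = - ?v" by (simp add: w)
      ultimately show ?thesis by metis
    qed
    moreover have "cs u (- ?v) = - cs u ?v" by (cases "?v") simp
    ultimately show "w \<bullet> cs u ?v = 0" by simp
  qed
qed

text \<open>At a vector that nothing contracts, all conjugates of the limiting direction are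
  critical. The resulting equations say that \<open>u * e\<close> and
  \<open>\<delta> * u * \<tau>\<close> have real part zero, also after multiplication by
  \<open>\<tau>^2\<close>. As \<open>\<tau>^2\<close> is not real, both vanish, so the components of
  \<open>w\<close> have equal modulus and product of moduli zero.\<close>

theorem transvection_contraction:
  assumes "w \<noteq> 0"
  shows "\<exists>f\<in>\<Lambda>. norm (f w) < norm w"
proof (rule ccontr)
  assume "\<not> ?thesis"
  then have ge: "norm w \<le> norm (f w)" if "f \<in> \<Lambda>" for f using that by force
  obtain u where u: "cmod u = 1"
    and crit: "\<And>p q r s. mt (p, q, r, s) \<in> \<Lambda> \<Longrightarrow> mt (s, - q, - r, p) \<in> \<Lambda> \<Longrightarrow> p * s - q * r = 1 \<Longrightarrow>
       w \<bullet> cs u (mt (q * s, - (q^2), s^2, - (q * s)) w) = 0"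
    using critical_conjugates[of w] ge by blast
  obtain w1 w2 where w: "w = (w1, w2)" by (cases w)
  define \<delta> where "\<delta> = (cmod w1)^2 - (cmod w2)^2"
  define e where "e = w1 * cnj w2"
  have A: "mt (1, of_int k * \<tau>, 0, 1) \<in> \<Lambda>" and B: "mt (1, 0, of_int k * \<tau>, 1) \<in> \<Lambda>" if "k \<in> {-1, 0, 1}" for k :: int
  proof -
    have "mt (1, \<tau>, 0, 1) \<circ> mt (1, - \<tau>, 0, 1) = mt (1, 0, 0, 1)" by (auto simp: fun_eq_iff algebra_simps)
    then have "mt (1, 0, 0, 1) \<in> \<Lambda>" using comp[OF gens(1,2)] by simp
    then show "mt (1, of_int k * \<tau>, 0, 1) \<in> \<Lambda>" "mt (1, 0, of_int k * \<tau>, 1) \<in> \<Lambda>" using that gens by auto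
  qed
  \<comment> \<open>Criticality at the product of the \<open>m\<close>-th power of the lower and the
    \<open>k\<close>-th power of the upper transvection, expanded in \<open>k\<close> and
    \<open>m\<close>.\<close>
  have R: "Re (u * e) + k * (\<delta> * Re (u * \<tau>)) - k^2 * Re (u * cnj e * \<tau>^2) + 2 * m * k * Re (u * e * \<tau>^2)
      + m * k^2 * (\<delta> * Re (u * \<tau>^3)) + m^2 * k^2 * Re (u * e * \<tau>^4) = 0"
    if km: "k \<in> {-1, 0, 1}" "m \<in> {-1, 0, 1}" for k m :: int
  proof -
    let ?q = "of_int k * \<tau>" let ?s = "1 + of_int m * of_int k * \<tau>^2"
    have "mt (1, 0, of_int m * \<tau>, 1) \<circ> mt (1, ?q, 0, 1) = mt (1, ?q, of_int m * \<tau>, ?s)"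
      by (auto simp: fun_eq_iff algebra_simps power2_eq_square)
    then have 1: "mt (1, ?q, of_int m * \<tau>, ?s) \<in> \<Lambda>" using comp[OF B[OF km(2)] A[OF km(1)]] by simp
    have "- k \<in> {-1, 0, 1}" "- m \<in> {-1, 0, 1}" using km by auto
    note inv = comp[OF A[OF this(1)] B[OF this(2)]]
    have "mt (1, of_int (- k) * \<tau>, 0, 1) \<circ> mt (1, 0, of_int (- m) * \<tau>, 1) = mt (?s, - ?q, - (of_int m * \<tau>), 1)"
      by (auto simp: fun_eq_iff algebra_simps power2_eq_square)
    then have 2: "mt (?s, - ?q, - (of_int m * \<tau>), 1) \<in> \<Lambda>" using inv by simp
    have "w \<bullet> cs u (mt (?q * ?s, - (?q^2), ?s^2, - (?q * ?s)) w) = 0"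
      by (rule crit[OF 1 2]) (simp add: algebra_simps power2_eq_square)
    moreover have "w \<bullet> cs u (mt (?q * ?s, - (?q^2), ?s^2, - (?q * ?s)) w)
        = Re (u * (of_real \<delta> * (?q * ?s) - cnj e * ?q^2 + e * ?s^2))"
    proof -
      have inn: "x \<bullet> y = Re (cnj x * y)" for x y :: complex by (simp add: inner_complex_def)
      have "of_real \<delta> = cnj w1 * w1 - cnj w2 * w2"
        by (simp only: \<delta>_def of_real_diff complex_norm_square mult.commute)
      then show ?thesis
        by (simp only: w mt.simps cs.simps inner_Pair inn plus_complex.sel(1)[symmetric] e_def complex_cnj_mult complex_cnj_cnj)
           (rule arg_cong[of _ _ Re], simp add: algebra_simps power2_eq_square)
    qed
    moreover have "u * (of_real \<delta> * (?q * ?s) - cnj e * ?q^2 + e * ?s^2) =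
        u * e + of_int k * (of_real \<delta> * (u * \<tau>)) - of_int (k^2) * (u * cnj e * \<tau>^2) + of_int (2 * m * k) * (u * e * \<tau>^2)
        + of_int (m * k^2) * (of_real \<delta> * (u * \<tau>^3)) + of_int (m^2 * k^2) * (u * e * \<tau>^4)"
      by (simp add: algebra_simps power2_eq_square power3_eq_cube power4_eq_xxxx)
    moreover have ri: "Re (of_int j * z) = of_int j * Re z" "Re (of_real r * z) = r * Re z" for j r z by simp_all
    ultimately show ?thesis by (simp only: ri plus_complex.sel minus_complex.sel)
  qed
  define r0 r1 r2 r3 r4 r5 where "r0 = Re (u * e)" "r1 = \<delta> * Re (u * \<tau>)" "r2 = Re (u * cnj e * \<tau>^2)"
    "r3 = Re (u * e * \<tau>^2)" "r4 = \<delta> * Re (u * \<tau>^3)" "r5 = Re (u * e * \<tau>^4)"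
  note rs = this
  have R': "r0 = 0" "r0 + r1 - r2 = 0" "r0 - r1 - r2 = 0" "r0 + r1 - r2 + 2 * r3 + r4 + r5 = 0"
    "r0 + r1 - r2 - 2 * r3 - r4 + r5 = 0" "r0 - r1 - r2 - 2 * r3 + r4 + r5 = 0"
    using R[of 0 0] R[of 1 0] R[of "-1" 0] R[of 1 1] R[of 1 "-1"] R[of "-1" 1] unfolding rs[symmetric] by simp_all
  have e0: "Re (u * e) = 0" and e2: "Re (u * e * \<tau>^2) = 0" and \<delta>1: "\<delta> * Re (u * \<tau>) = 0" and \<delta>3: "\<delta> * Re (u * \<tau>^3) = 0"
    using R' unfolding rs[symmetric] by linarith+
  have im: "Im (\<tau>^2) \<noteq> 0" using \<tau>(2) by (simp add: complex_is_Real_iff)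
  have zero: "z = 0" if "Re z = 0" "Re (z * \<tau>^2) = 0" for z
    using that im by (simp add: complex_eq_iff)
  have "u \<noteq> 0" using u by auto
  have "u * e = 0" using zero[OF e0 e2] .
  then have e: "e = 0" using \<open>u \<noteq> 0\<close> by simp
  have "\<delta> = 0"
  proof (rule ccontr)
    assume "\<delta> \<noteq> 0"
    then have "Re (u * \<tau>) = 0" "Re (u * \<tau> * \<tau>^2) = 0" using \<delta>1 \<delta>3 by (simp_all add: power2_eq_square power3_eq_cube mult.assoc)
    then have "u * \<tau> = 0" by (rule zero)
    then show False using \<open>u \<noteq> 0\<close> \<tau>_nz by simp
  qed
  then have "cmod w1 = cmod w2" by (simp add: \<delta>_def power2_eq_iff_nonneg)
  then have "w = 0" using e by (auto simp: e_def w zero_prod_def)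
  then show False using assms by simp
qed

end

section \<open>The Julia set near the common fixed point\<close>

lemma tendsto_co: "(f \<longlongrightarrow> p) F \<Longrightarrow> ((\<lambda>x. co l (f x)) \<longlongrightarrow> co l p) F"
  by (rule isCont_tendsto_compose[OF continuous_on_interior[OF continuous_co[of UNIV]]]) simp

lemma tendsto_act: "(f \<longlongrightarrow> p) F \<Longrightarrow> ((\<lambda>x. act P w (f x)) \<longlongrightarrow> act P w p) F"
  by (rule isCont_tendsto_compose[OF continuous_on_interior[OF continuous_act[of UNIV]]]) simp

lemma tendsto_co_dact: "(f \<longlongrightarrow> p) F \<Longrightarrow> ((\<lambda>x. co l (dact P w (f x) v)) \<longlongrightarrow> co l (dact P w p v)) F"
proof (induction w arbitrary: l)
  case (Cons i w)
  obtain j k where ijk: "i \<noteq> j" "j \<noteq> k" "i \<noteq> k" by (rule other_letters)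
  show ?case
  proof (cases "l = i")
    case True
    show ?thesis unfolding True dact.simps co_dinvol_same[OF ijk]
      by (intro tendsto_intros Cons tendsto_co tendsto_act)
  qed (use Cons in \<open>simp add: co_dinvol_other\<close>)
qed simp

lemma eventually_dact_close:
  assumes "0 < e"
  shows "\<forall>\<^sub>F p in nhds q. \<forall>v. norm (dact P w p v - dact P w q v) \<le> e * norm v"
proof -
  let ?b = "\<lambda>l. mk (\<lambda>m. if m = l then 1 else 0)"
  let ?d = "\<lambda>p l m. cmod (co m (dact P w p (?b l)) - co m (dact P w q (?b l)))"
  have "\<forall>\<^sub>F p in nhds q. \<forall>l. \<forall>m. ?d p l m < e / 9"
  proof (intro eventually_all_finite)
    fix l m
    have "((\<lambda>p. co m (dact P w p (?b l)) - co m (dact P w q (?b l))) \<longlongrightarrow>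
        co m (dact P w q (?b l)) - co m (dact P w q (?b l))) (nhds q)"
      by (intro tendsto_intros tendsto_co_dact filterlim_ident)
    then have "((\<lambda>p. ?d p l m) \<longlongrightarrow> 0) (nhds q)" by (simp add: tendsto_norm_zero)
    then show "\<forall>\<^sub>F p in nhds q. ?d p l m < e / 9" using assms by (intro order_tendstoD) auto
  qed
  then show ?thesis
  proof eventually_elim
    case (elim p)
    show ?case
    proof
      fix v
      have v: "v = csc (co X v) (?b X) + (csc (co Y v) (?b Y) + csc (co Z v) (?b Z))"
        by (cases v) (simp add: mk_def)
      have comp: "cmod (co m (dact P w p v - dact P w q v)) \<le> e / 3 * norm v" for m
      proof -
        let ?D = "\<lambda>l. co m (dact P w p (?b l)) - co m (dact P w q (?b l))"
        have sum: "co m (dact P w p v - dact P w q v) = co X v * ?D X + (co Y v * ?D Y + co Z v * ?D Z)"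
          by (subst (1 2) v) (simp add: dact_linear co_diff co_plus co_csc algebra_simps)
        have D: "cmod (?D l) \<le> e / 9" for l using elim[rule_format, of m l] by (rule less_imp_le)
        have "cmod (co l v * ?D l) \<le> norm v * (e / 9)" for l
          unfolding norm_mult by (rule mult_mono[OF co_le_norm D]) simp_all
        from this[of X] this[of Y] this[of Z] show ?thesis
          unfolding sum using norm_triangle_ineq[of "co X v * ?D X" "co Y v * ?D Y + co Z v * ?D Z"]
            norm_triangle_ineq[of "co Y v * ?D Y" "co Z v * ?D Z"] by argo
      qed
      show "norm (dact P w p v - dact P w q v) \<le> e * norm v"
        using norm_point_le[of "dact P w p v - dact P w q v"] comp[of X] comp[of Y] comp[of Z] by simp
    qed
  qed
qed

lemma co_cr: "co X (cr u v) = co Y u * co Z v - co Z u * co Y v" "co Y (cr u v) = co Z u * co X v - co X u * co Z v"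
  by (cases u; cases v; simp)+

context shear
begin

lemma iterate_a: "act P (pw k aw) q = q" "dact P (pw k aw) q v = v + csc (of_nat k * \<mu> * co Z v) N"
proof -
  show a: "act P (pw k aw) q = q" for k by (induction k) (auto simp: words_fix)
  show "dact P (pw k aw) q v = v + csc (of_nat k * \<mu> * co Z v) N"
  proof (induction k)
    case (Suc k)
    have "csc x N + csc y N = csc (x + y) N" for x y by (cases N) (simp add: algebra_simps)
    then show ?case using Suc by (simp add: a dact_a co_plus co_csc \<sigma>_N add.assoc algebra_simps)
  qed simp
qed

text \<open>If the orbit of \<open>p\<close> comes close to \<open>q\<close>, one may follow it by a long power of the shear at \<open>q\<close>.
  Boundedness of all derivatives forces both tangent directions to become invisible in the third
  coordinate, which contradicts the invariance of the area form.\<close>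

lemma accumulation_in_julia:
  assumes gen: "P \<notin> nongeneric" and p: "p \<in> cubic_surface P"
    and G: "\<And>j :: nat. even (length (G j))" "(\<lambda>j. act P (G j) p) \<longlonglongrightarrow> q"
  shows "p \<in> julia_set P"
proof (rule ccontr)
  assume "p \<notin> julia_set P"
  then have fatou: "p \<in> fatou_set P" using p by (simp add: julia_set_def)
  have smooth: "grad P p \<noteq> 0" using smooth_of_generic[OF gen p] .
  \<comment> \<open>The orbit is followed until the \<open>k\<close>-th power of the shear keeps its
    point within distance 1 of \<open>q\<close> and has nearly the same derivative there as at
    \<open>q\<close>.\<close>
  have "\<exists>j\<ge>k. norm (act P (G j) p - q) < 1 \<and> norm (act P (pw k aw) (act P (G j) p) - q) < 1 \<and>
      (\<forall>v. norm (dact P (pw k aw) (act P (G j) p) v - dact P (pw k aw) q v) \<le> 1 * norm v)" for k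
  proof -
    have ball: "\<forall>\<^sub>F j in sequentially. norm (f j - q) < 1" if "f \<longlonglongrightarrow> q" for f :: "nat \<Rightarrow> point"
      using that by (auto simp: tendsto_iff dist_norm)
    have "\<forall>\<^sub>F j in sequentially. norm (act P (G j) p - q) < 1" by (rule ball[OF G(2)])
    moreover have "\<forall>\<^sub>F j in sequentially. norm (act P (pw k aw) (act P (G j) p) - q) < 1"
      using ball[OF tendsto_act[OF G(2), of P "pw k aw", unfolded iterate_a(1)]] .
    moreover have "\<forall>\<^sub>F j in sequentially. \<forall>v. norm (dact P (pw k aw) (act P (G j) p) v - dact P (pw k aw) q v) \<le> 1 * norm v"
      by (rule eventually_compose_filterlim[OF eventually_dact_close G(2)]) simp
    moreover have "\<forall>\<^sub>F j in sequentially. k \<le> j" by (rule eventually_ge_at_top)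
    ultimately have "\<forall>\<^sub>F j in sequentially. k \<le> j \<and> norm (act P (G j) p - q) < 1 \<and> norm (act P (pw k aw) (act P (G j) p) - q) < 1 \<and>
      (\<forall>v. norm (dact P (pw k aw) (act P (G j) p) v - dact P (pw k aw) q v) \<le> 1 * norm v)"
      by eventually_elim blast
    then show ?thesis unfolding eventually_sequentially by blast
  qed
  then obtain J :: "nat \<Rightarrow> nat" where J: "\<And>k. k \<le> J k" "\<And>k. norm (act P (G (J k)) p - q) < 1"
    "\<And>k. norm (act P (pw k aw) (act P (G (J k)) p) - q) < 1"
    "\<And>k v. norm (dact P (pw k aw) (act P (G (J k)) p) v - dact P (pw k aw) q v) \<le> norm v"
    unfolding mult_1_left by metis
  have near: "norm x \<le> norm q + 1" if "norm (x - q) < 1" for x :: point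
    using that norm_triangle_ineq[of "x - q" q] by simp
  have "\<exists>r :: nat \<Rightarrow> nat. strict_mono r \<and> (\<forall>v. dt (grad P p) v = 0 \<longrightarrow>
      (\<exists>B. \<forall>k. norm (dact P (pw (r k) aw @ G (J (r k))) p v) \<le> B))"
    using fatou_bounded_derivatives[OF fatou smooth, of "\<lambda>k. pw k aw @ G (J k)" "norm q + 1"]
      G(1) even_words(1) near[OF J(3)] by simp
  then obtain r :: "nat \<Rightarrow> nat" where r: "strict_mono r" "\<And>v. dt (grad P p) v = 0 \<Longrightarrow>
      \<exists>B. \<forall>k. norm (dact P (pw (r k) aw @ G (J (r k))) p v) \<le> B" by blast
  \<comment> \<open>The derivatives must be bounded along the orbit itself as well as after the
    shear, so a second subsequence is extracted.\<close>
  have "\<exists>r' :: nat \<Rightarrow> nat. strict_mono r' \<and> (\<forall>v. dt (grad P p) v = 0 \<longrightarrow>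
      (\<exists>B. \<forall>k. norm (dact P (G (J (r (r' k)))) p v) \<le> B))"
    using fatou_bounded_derivatives[OF fatou smooth, of "\<lambda>k. G (J (r k))" "norm q + 1"]
      G(1) near[OF J(2)] by simp
  then obtain r' :: "nat \<Rightarrow> nat" where r': "strict_mono r'" "\<And>v. dt (grad P p) v = 0 \<Longrightarrow>
      \<exists>B. \<forall>k. norm (dact P (G (J (r (r' k)))) p v) \<le> B" by blast
  define idx where "idx m = r (r' m)" for m
  have idx: "m \<le> idx m" for m
    using seq_suble[OF strict_mono_o[OF r(1) r'(1)], of m] by (simp add: idx_def)
  define E where "E v m = dact P (G (J (idx m))) p v" for v m
  define x where "x m = act P (G (J (idx m))) p" for m
  have xq: "x \<longlonglongrightarrow> q"
  proof -
    have "filterlim (\<lambda>m. J (idx m)) at_top sequentially"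
    proof (rule filterlim_at_top_mono[OF filterlim_ident], intro always_eventually allI)
      show "m \<le> J (idx m)" for m using J(1)[of "idx m"] idx[of m] by simp
    qed
    then show ?thesis unfolding x_def by (rule filterlim_compose[OF G(2)])
  qed
  have N_nz: "N \<noteq> 0"
  proof
    assume "N = 0"
    then have "co l (grad P q) = co l 0" for l using grad_Z by (cases l) (auto simp: N_def zero_prod_def)
    then have "grad P q = 0" by (rule co_eqI)
    then show False using smooth_of_generic[OF gen q_facts(2)] by blast
  qed
  \<comment> \<open>The power of the shear adds \<open>idx m * \<mu> * co Z (E v m)\<close> times
    \<open>N\<close>, up to a bounded error. As the total stays bounded, the third coordinates tend
    to zero.\<close>
  have small: "(\<exists>B. \<forall>m l. cmod (co l (E v m)) \<le> B) \<and> (\<lambda>m. co Z (E v m)) \<longlonglongrightarrow> 0" if v: "dt (grad P p) v = 0" for v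
  proof -
    obtain B1 where B1: "\<And>m. norm (E v m) \<le> B1" using r'(2)[OF v] unfolding E_def idx_def by blast
    obtain B2 where "\<And>k. norm (dact P (pw (r k) aw @ G (J (r k))) p v) \<le> B2" using r(2)[OF v] by blast
    then have B2: "norm (dact P (pw (idx m) aw) (x m) (E v m)) \<le> B2" for m
      unfolding idx_def E_def x_def by (metis dact_append)
    define c where "c = cmod \<mu> * norm N"
    have c: "0 < c" using \<mu>_nz N_nz by (simp add: c_def)
    have bound: "cmod (co Z (E v m)) \<le> (B2 + 2 * B1) / c * (1 / real m)" if "1 \<le> m" for m
    proof -
      let ?D = "dact P (pw (idx m) aw)"
      have "csc (of_nat (idx m) * \<mu> * co Z (E v m)) N = ?D (x m) (E v m) - (?D (x m) (E v m) - ?D q (E v m)) - E v m"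
        by (simp add: iterate_a(2))
      then have "norm (csc (of_nat (idx m) * \<mu> * co Z (E v m)) N) \<le>
          norm (?D (x m) (E v m)) + norm (?D (x m) (E v m) - ?D q (E v m)) + norm (E v m)"
        by (metis (no_types, lifting) add_mono_thms_linordered_semiring(3) norm_triangle_ineq4 order_trans)
      also have "norm (?D (x m) (E v m) - ?D q (E v m)) \<le> norm (E v m)" unfolding x_def by (rule J(4))
      finally have "real (idx m) * (c * cmod (co Z (E v m))) \<le> B2 + 2 * B1"
        using B1[of m] B2[of m] by (simp add: norm_csc norm_mult c_def mult_ac)
      moreover have "real m * (c * cmod (co Z (E v m))) \<le> real (idx m) * (c * cmod (co Z (E v m)))"
        using idx[of m] c by (intro mult_right_mono) auto
      ultimately have 1: "real m * (c * cmod (co Z (E v m))) \<le> B2 + 2 * B1" by linarith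
      then show ?thesis using c that by (simp add: field_simps)
    qed
    have "(\<lambda>m. co Z (E v m)) \<longlonglongrightarrow> 0"
    proof (rule Lim_null_comparison)
      show "\<forall>\<^sub>F m in sequentially. norm (co Z (E v m)) \<le> (B2 + 2 * B1) / c * (1 / real m)"
        using eventually_ge_at_top[of 1] by eventually_elim (rule bound)
      show "(\<lambda>m. (B2 + 2 * B1) / c * (1 / real m)) \<longlonglongrightarrow> 0"
        by (rule tendsto_mult_right_zero[OF lim_1_over_n])
    qed
    moreover have "cmod (co l (E v m)) \<le> B1" for l m using co_le_norm B1 order_trans by blast
    ultimately show ?thesis by blast
  qed
  obtain e1 e2 \<omega> where e: "\<omega> \<noteq> 0" "cr e1 e2 = csc \<omega> (grad P p)" "dt (grad P p) e1 = 0" "dt (grad P p) e2 = 0"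
    using tangent_basis[OF smooth] by metis
  \<comment> \<open>The cross product of the transported vectors is \<open>\<omega>\<close> times
    the gradient. Its first two components tend to zero with the third coordinates, so in the limit
    the gradient at \<open>q\<close> would lose them and \<open>N\<close> would vanish.\<close>
  have area: "cr (E e1 m) (E e2 m) = csc \<omega> (grad P (x m))" for m
    unfolding E_def x_def using cr_dact[OF e(2)] G(1) by blast
  have null: "(\<lambda>m. f m * g m) \<longlonglongrightarrow> 0" if "\<And>m. cmod (f m) \<le> B" "g \<longlonglongrightarrow> 0" for f g :: "nat \<Rightarrow> complex" and B
  proof (rule Lim_null_comparison)
    show "\<forall>\<^sub>F m in sequentially. norm (f m * g m) \<le> B * cmod (g m)"
      unfolding norm_mult using that(1) by (intro always_eventually allI mult_right_mono) auto
    show "(\<lambda>m. B * cmod (g m)) \<longlonglongrightarrow> 0" using tendsto_mult_right_zero[OF tendsto_norm_zero[OF that(2)]] .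
  qed
  obtain B1 B2 where B: "\<And>m l. cmod (co l (E e1 m)) \<le> B1" "\<And>m l. cmod (co l (E e2 m)) \<le> B2"
    using small[OF e(3)] small[OF e(4)] by blast
  note z = conjunct2[OF small[OF e(3)]] conjunct2[OF small[OF e(4)]]
  have "(\<lambda>m. co X (cr (E e1 m) (E e2 m))) \<longlonglongrightarrow> 0 - 0"
    unfolding co_cr mult.commute[of "co Z _"] by (intro tendsto_diff null[OF B(1) z(2)] null[OF B(2) z(1)])
  then have X0: "(\<lambda>m. \<omega> * co X (grad P (x m))) \<longlonglongrightarrow> 0" by (simp add: area co_csc)
  have "(\<lambda>m. co Y (cr (E e1 m) (E e2 m))) \<longlonglongrightarrow> 0 - 0"
    unfolding co_cr mult.commute[of "co Z _"] by (intro tendsto_diff null[OF B(1) z(2)] null[OF B(2) z(1)])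
  then have Y0: "(\<lambda>m. \<omega> * co Y (grad P (x m))) \<longlonglongrightarrow> 0" by (simp add: area co_csc)
  have "(\<lambda>m. \<omega> * co X (grad P (x m))) \<longlonglongrightarrow> \<omega> * co X (grad P q)"
    unfolding co_grad[of X Y Z, simplified] by (intro tendsto_intros tendsto_co xq)
  then have 1: "co X (grad P q) = 0" using LIMSEQ_unique[OF X0] e(1) by fastforce
  have "(\<lambda>m. \<omega> * co Y (grad P (x m))) \<longlonglongrightarrow> \<omega> * co Y (grad P q)"
    unfolding co_grad[of Y Z X, simplified] by (intro tendsto_intros tendsto_co xq)
  then have 2: "co Y (grad P q) = 0" using LIMSEQ_unique[OF Y0] e(1) by fastforce
  show False using N_nz 1 2 by (simp add: N_def zero_prod_def)
qed

end

text \<open>Pairing each map with a bound below 1 lets compactness of the unit sphere select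
  finitely many maps with one common bound; linearity extends it to all vectors.\<close>

lemma open_uniform_contraction:
  fixes F :: "(complex \<times> complex \<Rightarrow> complex \<times> complex) set"
  assumes lin: "\<And>f. f \<in> F \<Longrightarrow> linear f" and contr: "\<And>w. w \<noteq> 0 \<Longrightarrow> \<exists>f\<in>F. norm (f w) < norm w"
  obtains F' \<kappa> where "finite F'" "F' \<subseteq> F" "0 \<le> \<kappa>" "\<kappa> < 1" "\<And>w. \<exists>f\<in>F'. norm (f w) \<le> \<kappa> * norm w"
proof -
  define I where "I = F \<times> {..<1::real}"
  define O' where "O' = (\<lambda>(f :: complex \<times> complex \<Rightarrow> complex \<times> complex, \<kappa>). {w. norm (f w) < \<kappa>})"
  have op: "open (O' i)" if i: "i \<in> I" for i
  proof -
    obtain f \<kappa> where f: "i = (f, \<kappa>)" "linear f" using i lin by (auto simp: I_def)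
    then have "continuous_on UNIV f" by (simp add: linear_conv_bounded_linear linear_continuous_on)
    then show ?thesis using f(1) by (auto simp: O'_def intro!: open_Collect_less continuous_intros)
  qed
  have cov: "sphere 0 1 \<subseteq> (\<Union>i\<in>I. O' i)"
  proof
    fix w :: "complex \<times> complex" assume w: "w \<in> sphere 0 1"
    then obtain f where f: "f \<in> F" "norm (f w) < 1" using contr[of w] by force
    then obtain \<kappa> where "norm (f w) < \<kappa>" "\<kappa> < 1" using dense by blast
    then show "w \<in> (\<Union>i\<in>I. O' i)" using f by (auto simp: I_def O'_def)
  qed
  obtain J where J: "J \<subseteq> I" "finite J" "sphere 0 1 \<subseteq> (\<Union>i\<in>J. O' i)"
    using compactE_image[OF compact_sphere op cov] by blast
  define \<kappa> where "\<kappa> = Max (insert 0 (snd ` J))"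
  have "\<kappa> \<in> insert 0 (snd ` J)" unfolding \<kappa>_def using J(2) by (intro Max_in) auto
  then have k1: "\<kappa> < 1" using J(1) by (auto simp: I_def)
  have k0: "0 \<le> \<kappa>" unfolding \<kappa>_def using J(2) by (intro Max_ge) auto
  have unit: "\<exists>f\<in>fst ` J. norm (f w) \<le> \<kappa>" if "norm w = 1" for w
  proof -
    have "w \<in> (\<Union>i\<in>J. O' i)" using that by (intro subsetD[OF J(3)]) simp
    then obtain f k where fk: "(f, k) \<in> J" "norm (f w) < k" by (auto simp: O'_def)
    have "k \<le> \<kappa>" unfolding \<kappa>_def using J(2) fk(1) by (intro Max_ge) (auto intro: image_eqI[of _ _ "(f, k)"])
    then show ?thesis using fk by (intro bexI[of _ f]) (auto intro: image_eqI[of _ _ "(f, k)"])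
  qed
  have linJ: "linear f" if "f \<in> fst ` J" for f using that J(1) lin by (auto simp: I_def)
  show thesis
  proof (rule that[of "fst ` J" \<kappa>])
    show "finite (fst ` J)" "fst ` J \<subseteq> F" "0 \<le> \<kappa>" "\<kappa> < 1" using J k0 k1 by (auto simp: I_def)
    fix w :: "complex \<times> complex"
    show "\<exists>f\<in>fst ` J. norm (f w) \<le> \<kappa> * norm w"
    proof (cases "w = 0")
      case True
      have "norm (1 :: complex, 0 :: complex) = 1" by (simp add: norm_Pair)
      then obtain f where f: "f \<in> fst ` J" using unit by blast
      then have "f w = 0" using True linear_0[OF linJ] by simp
      then show ?thesis using f True by (intro bexI[of _ f]) auto
    next
      case False
      define w' where "w' = (1 / norm w) *\<^sub>R w"
      have "norm w' = 1" using False by (simp add: w'_def)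
      then obtain f where f: "f \<in> fst ` J" "norm (f w') \<le> \<kappa>" using unit by blast
      have "w = norm w *\<^sub>R w'" using False by (simp add: w'_def)
      then have "norm (f w) = norm w * norm (f w')"
        by (metis abs_norm_cancel linear_cmul[OF linJ[OF f(1)]] norm_scaleR)
      also have "\<dots> \<le> norm w * \<kappa>" using f(2) by (intro mult_left_mono) auto
      finally show ?thesis using f(1) by (auto simp: mult.commute)
    qed
  qed
qed

context shear
begin

text \<open>On the span of \<open>N\<close> and \<open>\<sigma> N\<close> these are the coordinates
  in that basis when \<open>\<nu>\<close> is non-zero, because \<open>co Z N = 0\<close> and
  \<open>co Z (\<sigma> N) = \<nu>\<close>.\<close>

definition \<Phi> :: "point \<Rightarrow> complex \<times> complex" where
  "\<Phi> v = (co Z (\<sigma> v) / \<nu>, co Z v / \<nu>)"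

definition \<Lambda> :: "(complex \<times> complex \<Rightarrow> complex \<times> complex) set" where
  "\<Lambda> = {f. linear f \<and> (\<exists>w. even (length w) \<and> act P w q = q \<and> (\<forall>v. \<Phi> (dact P w q v) = f (\<Phi> v)))}"

lemma \<Phi>_add: "\<Phi> (u + v) = \<Phi> u + \<Phi> v"
  by (simp add: \<Phi>_def \<sigma>_linear co_plus add_divide_distrib)

lemma \<Lambda>_comp: "f \<in> \<Lambda> \<Longrightarrow> g \<in> \<Lambda> \<Longrightarrow> f \<circ> g \<in> \<Lambda>"
proof -
  assume "f \<in> \<Lambda>" "g \<in> \<Lambda>"
  then obtain u w where u: "linear f" "even (length u)" "act P u q = q" "\<And>v. \<Phi> (dact P u q v) = f (\<Phi> v)"
    and w: "linear g" "even (length w)" "act P w q = q" "\<And>v. \<Phi> (dact P w q v) = g (\<Phi> v)"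
    unfolding \<Lambda>_def by blast
  have "even (length (u @ w))" "act P (u @ w) q = q" "\<forall>v. \<Phi> (dact P (u @ w) q v) = (f \<circ> g) (\<Phi> v)"
    using u w by simp_all
  then show "f \<circ> g \<in> \<Lambda>" unfolding \<Lambda>_def using linear_compose[OF w(1) u(1)] by blast
qed

lemma \<Lambda>_gens:
  assumes \<nu>: "\<nu> \<noteq> 0"
  shows "mt (1, \<tau>, 0, 1) \<in> \<Lambda>" "mt (1, - \<tau>, 0, 1) \<in> \<Lambda>" "mt (1, 0, \<tau>, 1) \<in> \<Lambda>" "mt (1, 0, - \<tau>, 1) \<in> \<Lambda>"
proof -
  have N: "\<sigma> (\<sigma> N) = N" by (rule \<sigma>\<sigma>)
  have "\<Phi> (dact P aw q v) = mt (1, \<tau>, 0, 1) (\<Phi> v)" "\<Phi> (dact P aw' q v) = mt (1, - \<tau>, 0, 1) (\<Phi> v)"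
    "\<Phi> (dact P (Z # aw @ [Z]) q v) = mt (1, 0, \<tau>, 1) (\<Phi> v)" "\<Phi> (dact P (Z # aw' @ [Z]) q v) = mt (1, 0, - \<tau>, 1) (\<Phi> v)" for v
    unfolding \<Phi>_def dact_a dact_a' dact_b \<sigma>_linear co_plus co_csc N \<sigma>_N mt.simps
    using \<nu> by (simp_all add: \<tau>_def field_simps)
  then show "mt (1, \<tau>, 0, 1) \<in> \<Lambda>" "mt (1, - \<tau>, 0, 1) \<in> \<Lambda>" "mt (1, 0, \<tau>, 1) \<in> \<Lambda>" "mt (1, 0, - \<tau>, 1) \<in> \<Lambda>"
    unfolding \<Lambda>_def using mt_linear words_fix b_fix even_words
    by (auto intro: exI[of _ aw] exI[of _ aw'] exI[of _ "Z # aw @ [Z]"] exI[of _ "Z # aw' @ [Z]"])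
qed

lemma uniform_contraction:
  assumes gen: "P \<notin> nongeneric"
  obtains W \<kappa> where "finite W" "0 \<le> \<kappa>" "\<kappa> < 1" "\<And>w. w \<in> W \<Longrightarrow> even (length w) \<and> act P w q = q"
    "\<And>v. \<exists>w\<in>W. norm (\<Phi> (dact P w q v)) \<le> \<kappa> * norm (\<Phi> v)"
proof -
  have "\<nu> \<noteq> 0" using \<tau>_not_real[OF gen] by (auto simp: \<tau>_def)
  note gens = \<Lambda>_gens[OF this]
  obtain F \<kappa> where F: "finite F" "F \<subseteq> \<Lambda>" "0 \<le> \<kappa>" "\<kappa> < 1" "\<And>w. \<exists>f\<in>F. norm (f w) \<le> \<kappa> * norm w"
  proof (rule open_uniform_contraction[of \<Lambda>])
    show "linear f" if "f \<in> \<Lambda>" for f using that by (simp add: \<Lambda>_def)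
    show "\<exists>f\<in>\<Lambda>. norm (f w) < norm w" if "w \<noteq> 0" for w
      using transvection_contraction[OF \<tau>_small \<tau>_not_real[OF gen] gens \<Lambda>_comp that] .
  qed blast
  have "\<forall>f\<in>F. \<exists>w. even (length w) \<and> act P w q = q \<and> (\<forall>v. \<Phi> (dact P w q v) = f (\<Phi> v))"
    using F(2) unfolding \<Lambda>_def by blast
  then obtain wf where wf: "\<forall>f\<in>F. even (length (wf f)) \<and> act P (wf f) q = q \<and> (\<forall>v. \<Phi> (dact P (wf f) q v) = f (\<Phi> v))"
    by (metis (no_types, lifting))
  show thesis
  proof (rule that[of "wf ` F" \<kappa>])
    show "\<exists>w\<in>wf ` F. norm (\<Phi> (dact P w q v)) \<le> \<kappa> * norm (\<Phi> v)" for v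
    proof -
      obtain f where f: "f \<in> F" "norm (f (\<Phi> v)) \<le> \<kappa> * norm (\<Phi> v)" using F(5) by blast
      then show ?thesis using bspec[OF wf f(1)] by (intro bexI[of _ "wf f"]) (simp_all del: split_paired_All)
    qed
  qed (use F wf in auto)
qed

lemma \<Phi>_bound: "\<exists>C. \<forall>v. norm (\<Phi> v) \<le> C * norm v"
proof (intro exI allI)
  fix v
  have "norm (\<Phi> v) \<le> cmod (co Z (\<sigma> v) / \<nu>) + cmod (co Z v / \<nu>)" unfolding \<Phi>_def by (rule norm_Pair_le)
  also have "\<dots> \<le> (3 + 2 * norm q) * norm v / cmod \<nu> + norm v / cmod \<nu>"
    unfolding norm_divide using co_le_norm[of Z "\<sigma> v"] dinvol_bound[of Z q v]
    by (intro add_mono divide_right_mono co_le_norm) (auto simp: \<sigma>_def)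
  also have "\<dots> = ((3 + 2 * norm q) / cmod \<nu> + 1 / cmod \<nu>) * norm v" by (simp add: algebra_simps add_divide_distrib)
  finally show "norm (\<Phi> v) \<le> ((3 + 2 * norm q) / cmod \<nu> + 1 / cmod \<nu>) * norm v" .
qed

lemma surface_increment:
  assumes "q + v \<in> cubic_surface P"
  shows "dt (grad P q) v = - ((co X v)^2 + (co Y v)^2 + (co Z v)^2 + co X v * co Y v * co Z q
      + co X v * co Z v * co Y q + co Y v * co Z v * co X q + co X v * co Y v * co Z v)"
proof -
  obtain A B C D where P: "P = (A, B, C, D)" by (metis prod.exhaust)
  obtain x y z where q: "q = (x, y, z)" by (metis prod.exhaust)
  obtain a b c where v: "v = (a, b, c)" by (metis prod.exhaust)
  have "(x + a)^2 + (y + b)^2 + (z + c)^2 + (x + a) * (y + b) * (z + c) = A * (x + a) + B * (y + b) + C * (z + c) + D"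
    using assms by (simp add: P q v)
  moreover have "x^2 + y^2 + z^2 + x * y * z = A * x + B * y + C * z + D"
    using q_facts(2) by (simp add: P q)
  ultimately have "(2 * x + y * z - A) * a + (2 * y + x * z - B) * b + (2 * z + x * y - C) * c =
    - (a^2 + b^2 + c^2 + a * b * z + a * c * y + b * c * x + a * b * c)" by algebra
  then show ?thesis by (simp add: P q v)
qed

text \<open>\<open>\<Phi>\<close> is a local coordinate system of the surface at \<open>q\<close>, by the implicit function theorem made explicit.\<close>

lemma coordinates:
  assumes \<nu>: "\<nu> \<noteq> 0"
  obtains C \<delta> where "0 < C" "0 < \<delta>" "\<And>p. p \<in> cubic_surface P \<Longrightarrow> norm (p - q) < \<delta> \<Longrightarrow> norm (p - q) \<le> C * norm (\<Phi> (p - q))"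
proof -
  define a where "a = cmod (co X (grad P q)) + cmod (co Y (grad P q)) + cmod (co X q) + cmod (co Y q)"
  define K1 where "K1 = 4 * a + cmod \<nu>"
  define K2 where "K2 = 2 * a / cmod \<nu>"
  define K3 where "K3 = 4 + 3 * norm q"
  have a: "0 \<le> a" "cmod (co X (grad P q)) \<le> a" "cmod (co Y (grad P q)) \<le> a" "cmod (co X q) \<le> a" "cmod (co Y q) \<le> a"
    by (auto simp: a_def)
  have K: "0 < K1" "0 \<le> K2" "0 \<le> K3" using a(1) \<nu> by (auto simp: K1_def K2_def K3_def add_nonneg_pos)
  define \<delta> where "\<delta> = min 1 (1 / (2 * (K2 * K3 + 1)))"
  have K23: "0 \<le> K2 * K3" using K by simp
  have \<delta>: "0 < \<delta>" "\<delta> \<le> 1" "\<delta> \<le> 1 / (2 * (K2 * K3 + 1))" using K23 by (auto simp: \<delta>_def)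
  have main: "norm v \<le> 2 * K1 * norm (\<Phi> v)" if S: "q + v \<in> cubic_surface P" and v: "norm v < \<delta>" for v
  proof -
    let ?gX = "co X (grad P q)" let ?gY = "co Y (grad P q)" let ?x = "co X q" let ?y = "co Y q"
    \<comment> \<open>The derivative of the defining polynomial in the direction \<open>v\<close>,
      which the surface equation makes quadratically small.\<close>
    define r where "r = ?gX * co X v + ?gY * co Y v"
    define \<alpha> \<beta> where "\<alpha> = co Z (\<sigma> v) / \<nu>" "\<beta> = co Z v / \<nu>"
    note \<alpha>\<beta> = this
    have \<Phi>: "\<Phi> v = (\<alpha>, \<beta>)" by (simp add: \<Phi>_def \<alpha>\<beta>)
    have ab: "cmod \<alpha> \<le> norm (\<Phi> v)" "cmod \<beta> \<le> norm (\<Phi> v)"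
      using norm_fst_le[of \<alpha> \<beta>] norm_snd_le[of \<beta> \<alpha>] by (simp_all add: \<Phi>)
    have s: "?y * co X v + ?x * co Y v = - \<nu> * (\<alpha> + \<beta>)"
      using \<nu> \<sigma>_Z[of v] by (simp add: \<alpha>\<beta> algebra_simps)
    have v3: "co Z v = \<nu> * \<beta>" using \<nu> by (simp add: \<alpha>\<beta>)
    have "\<nu> * co X v = \<nu> * (?gY * (\<alpha> + \<beta>)) + ?x * r"
    proof -
      have "\<nu> * co X v = - (?gY * (?y * co X v + ?x * co Y v)) + ?x * r" unfolding \<nu>_def r_def by (simp add: algebra_simps)
      then show ?thesis unfolding s by (simp add: algebra_simps)
    qed
    then have v1: "co X v = ?gY * (\<alpha> + \<beta>) + ?x * r / \<nu>" using \<nu> by (simp add: field_simps)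
    have "\<nu> * co Y v = - (\<nu> * (?gX * (\<alpha> + \<beta>))) - ?y * r"
    proof -
      have "\<nu> * co Y v = ?gX * (?y * co X v + ?x * co Y v) - ?y * r" unfolding \<nu>_def r_def by (simp add: algebra_simps)
      then show ?thesis unfolding s by (simp add: algebra_simps)
    qed
    then have v2: "co Y v = - (?gX * (\<alpha> + \<beta>)) - ?y * r / \<nu>" using \<nu> by (simp add: field_simps)
    have ab2: "cmod (\<alpha> + \<beta>) \<le> 2 * norm (\<Phi> v)" using norm_triangle_ineq[of \<alpha> \<beta>] ab by linarith
    have t1: "cmod (?gY * (\<alpha> + \<beta>)) \<le> a * (2 * norm (\<Phi> v))" "cmod (?gX * (\<alpha> + \<beta>)) \<le> a * (2 * norm (\<Phi> v))"
      unfolding norm_mult using a ab2 by (auto intro!: mult_mono)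
    have t2: "cmod (?x * r / \<nu>) \<le> a * cmod r / cmod \<nu>" "cmod (?y * r / \<nu>) \<le> a * cmod r / cmod \<nu>"
      unfolding norm_mult norm_divide using a by (auto intro!: divide_right_mono mult_right_mono)
    have n1: "cmod (co X v) \<le> a * (2 * norm (\<Phi> v)) + a * cmod r / cmod \<nu>"
      unfolding v1 using norm_triangle_ineq[of "?gY * (\<alpha> + \<beta>)" "?x * r / \<nu>"] t1 t2 by linarith
    have n2: "cmod (co Y v) \<le> a * (2 * norm (\<Phi> v)) + a * cmod r / cmod \<nu>"
      unfolding v2 using norm_triangle_ineq4[of "- (?gX * (\<alpha> + \<beta>))" "?y * r / \<nu>"] t1 t2 by (simp only: norm_minus_cancel)
    have n3: "cmod (co Z v) \<le> cmod \<nu> * norm (\<Phi> v)"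
      unfolding v3 norm_mult using ab by (intro mult_left_mono) auto
    have "norm v \<le> 4 * a * norm (\<Phi> v) + cmod \<nu> * norm (\<Phi> v) + 2 * (a * cmod r / cmod \<nu>)"
      using norm_point_le[of v] n1 n2 n3 by linarith
    also have "\<dots> = K1 * norm (\<Phi> v) + K2 * cmod r" by (simp add: K1_def K2_def algebra_simps)
    finally have nv: "norm v \<le> K1 * norm (\<Phi> v) + K2 * cmod r" .
    have "dt (grad P q) v = r" unfolding r_def using dt_letters[of X Y Z] grad_Z by simp
    then have r: "r = - ((co X v)^2 + (co Y v)^2 + (co Z v)^2 + co X v * co Y v * co Z q
      + co X v * co Z v * co Y q + co Y v * co Z v * co X q + co X v * co Y v * co Z v)"
      using surface_increment[OF S] by simp
    have "cmod r \<le> K3 * (norm v)^2"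
    proof -
      have c: "cmod (co l v) \<le> norm v" "cmod (co l q) \<le> norm q" for l by (rule co_le_norm)+
      have p2: "cmod ((co l v)^2) \<le> (norm v)^2" for l unfolding norm_power using c by (intro power_mono) auto
      have p3: "cmod (co l v * co m v * co k q) \<le> (norm v)^2 * norm q" for l m k
        unfolding norm_mult power2_eq_square using c by (intro mult_mono) auto
      have p4: "cmod (co X v * co Y v * co Z v) \<le> (norm v)^2 * 1"
        unfolding norm_mult power2_eq_square using c order_trans[OF c(1)[of Z], of 1] v \<delta>(2) by (intro mult_mono) auto
      have "cmod r \<le> cmod ((co X v)^2) + cmod ((co Y v)^2) + cmod ((co Z v)^2) + cmod (co X v * co Y v * co Z q)
        + cmod (co X v * co Z v * co Y q) + cmod (co Y v * co Z v * co X q) + cmod (co X v * co Y v * co Z v)"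
        unfolding r norm_minus_cancel by (intro norm_triangle_mono norm_triangle_ineq order_refl)
      also have "\<dots> \<le> (norm v)^2 + (norm v)^2 + (norm v)^2 + (norm v)^2 * norm q + (norm v)^2 * norm q + (norm v)^2 * norm q + (norm v)^2 * 1"
        by (intro add_mono p2 p3 p4)
      also have "\<dots> = K3 * (norm v)^2" by (simp add: K3_def algebra_simps)
      finally show ?thesis .
    qed
    then have "K2 * cmod r \<le> K2 * (K3 * (norm v)^2)" using K by (intro mult_left_mono) auto
    also have "\<dots> = (K2 * K3) * norm v * norm v" by (simp add: power2_eq_square)
    also have "\<dots> \<le> 1 / 2 * norm v"
    proof (intro mult_right_mono)
      have "(K2 * K3 + 1) * norm v \<le> (K2 * K3 + 1) * (1 / (2 * (K2 * K3 + 1)))" using v \<delta>(3) K23 by (intro mult_left_mono) auto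
      also have "\<dots> = 1 / 2" using K23 by simp
      finally show "K2 * K3 * norm v \<le> 1 / 2" by (simp add: algebra_simps) (smt (verit) norm_ge_zero)
    qed auto
    finally show ?thesis using nv by simp
  qed
  show thesis
  proof (rule that[of "2 * K1" \<delta>])
    show "norm (p - q) \<le> 2 * K1 * norm (\<Phi> (p - q))" if "p \<in> cubic_surface P" "norm (p - q) < \<delta>" for p
      using main[of "p - q"] that by simp
  qed (use K \<delta> in auto)
qed

text \<open>At every step a word of the finite set \<open>W\<close> that contracts the current value
  of \<open>\<Phi>\<close> is applied. The word depends on the point reached, so the sequence is
  built by dependent choice.\<close>

lemma attracted:
  assumes gen: "P \<notin> nongeneric"
  obtains \<delta> where "0 < \<delta>" "\<And>p. p \<in> cubic_surface P \<Longrightarrow> norm (p - q) < \<delta> \<Longrightarrow>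
    \<exists>G. (\<forall>j :: nat. even (length (G j))) \<and> (\<lambda>j. act P (G j) p) \<longlonglongrightarrow> q"
proof -
  have \<nu>: "\<nu> \<noteq> 0" using \<tau>_not_real[OF gen] by (auto simp: \<tau>_def)
  obtain W \<kappa> where W: "finite W" "0 \<le> \<kappa>" "\<kappa> < 1" "\<And>w. w \<in> W \<Longrightarrow> even (length w) \<and> act P w q = q"
    "\<And>v. \<exists>w\<in>W. norm (\<Phi> (dact P w q v)) \<le> \<kappa> * norm (\<Phi> v)" using uniform_contraction[OF gen] by blast
  obtain C \<delta>1 where C: "0 < C" "0 < \<delta>1" "\<And>p. p \<in> cubic_surface P \<Longrightarrow> norm (p - q) < \<delta>1 \<Longrightarrow> norm (p - q) \<le> C * norm (\<Phi> (p - q))"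
    using coordinates[OF \<nu>] by blast
  obtain C1' where C1': "\<And>v. norm (\<Phi> v) \<le> C1' * norm v" using \<Phi>_bound by blast
  define C1 where "C1 = \<bar>C1'\<bar> + 1"
  have C1: "0 < C1" "norm (\<Phi> v) \<le> C1 * norm v" for v
  proof -
    have "C1' * norm v \<le> C1 * norm v" by (intro mult_right_mono) (auto simp: C1_def)
    then show "norm (\<Phi> v) \<le> C1 * norm v" using C1' order_trans by blast
  qed (simp add: C1_def)
  \<comment> \<open>Half of the gap \<open>1 - \<kappa>\<close> is reserved for the non-linear
    error, measured through \<open>C1\<close> and \<open>C\<close>.\<close>
  define e where "e = (1 - \<kappa>) / (2 * C1 * C)"
  have e: "0 < e" using W(3) C(1) C1(1) by (simp add: e_def)
  define \<kappa>' where "\<kappa>' = (1 + \<kappa>) / 2"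
  have \<kappa>': "0 \<le> \<kappa>'" "\<kappa>' < 1" using W(2,3) by (auto simp: \<kappa>'_def)
  have ke: "\<kappa> + C1 * e * C = \<kappa>'" using C(1) C1(1) by (simp add: e_def \<kappa>'_def field_simps)
  have "\<forall>w\<in>W. \<forall>\<^sub>F p in nhds q. norm (act P w p - q - dact P w q (p - q)) \<le> e * norm (p - q)"
  proof
    fix w assume "w \<in> W"
    from derivative_remainder[OF conjunct2[OF W(4)[OF this]] e] obtain d where
      "0 < d" "\<And>p. norm (p - q) < d \<Longrightarrow> norm (act P w p - q - dact P w q (p - q)) \<le> e * norm (p - q)" by blast
    then show "\<forall>\<^sub>F p in nhds q. norm (act P w p - q - dact P w q (p - q)) \<le> e * norm (p - q)"
      unfolding eventually_nhds_metric dist_norm by blast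
  qed
  then have "\<forall>\<^sub>F p in nhds q. \<forall>w\<in>W. norm (act P w p - q - dact P w q (p - q)) \<le> e * norm (p - q)"
    using W(1) by (simp add: eventually_ball_finite)
  then obtain \<delta>2 where \<delta>2: "0 < \<delta>2" "\<And>p w. norm (p - q) < \<delta>2 \<Longrightarrow> w \<in> W \<Longrightarrow> norm (act P w p - q - dact P w q (p - q)) \<le> e * norm (p - q)"
    unfolding eventually_nhds_metric dist_norm by blast
  define \<delta>3 where "\<delta>3 = min \<delta>1 \<delta>2"
  have "\<exists>K. \<forall>w\<in>W. \<forall>v. norm (dact P w q v) \<le> K * norm v"
  proof -
    obtain K where K: "\<And>w v. norm (dact P w q v) \<le> K w * norm v" using dact_bound[of P _ q] by metis
    have "norm (dact P w q v) \<le> (\<Sum>w\<in>W. \<bar>K w\<bar>) * norm v" if "w \<in> W" for w v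
    proof -
      have "\<bar>K w\<bar> \<le> (\<Sum>w\<in>W. \<bar>K w\<bar>)" using that W(1) by (intro member_le_sum) auto
      then have "K w * norm v \<le> (\<Sum>w\<in>W. \<bar>K w\<bar>) * norm v" by (intro mult_right_mono) auto
      then show ?thesis using K order_trans by blast
    qed
    then show ?thesis by blast
  qed
  then obtain K where K: "\<And>w v. w \<in> W \<Longrightarrow> norm (dact P w q v) \<le> K * norm v" by blast
  define L where "L = \<bar>K\<bar> + e + 1"
  have L: "0 < L" "1 \<le> L" using e by (auto simp: L_def)
  \<comment> \<open>The estimates hold within radius \<open>\<delta>3\<close>. Although
    \<open>\<Phi>\<close> shrinks, the distance to \<open>q\<close> may grow relative to the
    starting point by up to \<open>L * C * C1\<close>.\<close>
  define \<delta> where "\<delta> = min \<delta>3 (\<delta>3 / (L * C * C1))"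
  have LC: "0 < L * C * C1" using L C(1) C1(1) by simp
  have \<delta>3: "0 < \<delta>3" "\<delta>3 \<le> \<delta>1" "\<delta>3 \<le> \<delta>2" using C(2) \<delta>2(1) by (auto simp: \<delta>3_def)
  have \<delta>: "0 < \<delta>" "\<delta> \<le> \<delta>3" "\<delta> * (L * C * C1) \<le> \<delta>3"
  proof -
    show "0 < \<delta>" "\<delta> \<le> \<delta>3" using \<delta>3 LC by (auto simp: \<delta>_def)
    have "\<delta> \<le> \<delta>3 / (L * C * C1)" by (simp add: \<delta>_def)
    then show "\<delta> * (L * C * C1) \<le> \<delta>3" using LC by (simp add: pos_le_divide_eq)
  qed
  show thesis
  proof (rule that[OF \<delta>(1)])
    fix p assume p: "p \<in> cubic_surface P" "norm (p - q) < \<delta>"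
    define M where "M = norm (\<Phi> (p - q))"
    define good where "good j w \<longleftrightarrow> even (length w) \<and> norm (act P w p - q) < \<delta>3 \<and>
      norm (\<Phi> (act P w p - q)) \<le> \<kappa>' ^ j * M" for j :: nat and w
    have "\<exists>G. \<forall>j. good j (G j) \<and> True"
    proof (rule dependent_nat_choice[of good "\<lambda>_ _ _. True"])
      show "\<exists>w. good 0 w" using p(2) \<delta>(2) by (intro exI[of _ "[]"]) (simp add: good_def M_def)
    next
      fix w j assume g: "good j w"
      define x where "x = act P w p"
      have x: "x \<in> cubic_surface P" "norm (x - q) < \<delta>3" "norm (\<Phi> (x - q)) \<le> \<kappa>' ^ j * M" "even (length w)"
        using g act_surface[OF p(1)] by (auto simp: good_def x_def)
      obtain u where u: "u \<in> W" "norm (\<Phi> (dact P u q (x - q))) \<le> \<kappa> * norm (\<Phi> (x - q))" using W(5) by blast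
      define y where "y = act P u x - q - dact P u q (x - q)"
      have y: "norm y \<le> e * norm (x - q)" unfolding y_def using \<delta>2(2)[OF _ u(1)] x(2) \<delta>3 by simp
      have xC: "norm (x - q) \<le> C * norm (\<Phi> (x - q))" using C(3)[OF x(1)] x(2) \<delta>3 by simp
      have dec: "act P u x - q = dact P u q (x - q) + y" by (simp add: y_def)
      have "norm (\<Phi> (act P u x - q)) \<le> norm (\<Phi> (dact P u q (x - q))) + norm (\<Phi> y)"
        unfolding dec \<Phi>_add by (rule norm_triangle_ineq)
      also have "norm (\<Phi> y) \<le> C1 * e * C * norm (\<Phi> (x - q))"
      proof -
        have "norm (\<Phi> y) \<le> C1 * norm y" by (rule C1(2))
        also have "\<dots> \<le> C1 * (e * (C * norm (\<Phi> (x - q))))"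
          using C1(1) e y xC by (intro mult_left_mono order_trans[OF y]) auto
        finally show ?thesis by (simp add: mult.assoc)
      qed
      also have "norm (\<Phi> (dact P u q (x - q))) + C1 * e * C * norm (\<Phi> (x - q)) \<le> \<kappa>' * norm (\<Phi> (x - q))"
        using u(2) unfolding ke[symmetric] by (simp add: algebra_simps)
      also have "\<dots> \<le> \<kappa>' * (\<kappa>' ^ j * M)" using x(3) \<kappa>' by (intro mult_left_mono) auto
      finally have 1: "norm (\<Phi> (act P u x - q)) \<le> \<kappa>' ^ Suc j * M" by simp
      have "norm (act P u x - q) \<le> norm (dact P u q (x - q)) + norm y" unfolding dec by (rule norm_triangle_ineq)
      also have "\<dots> \<le> K * norm (x - q) + e * norm (x - q)" using K[OF u(1)] y by (intro add_mono) auto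
      also have "\<dots> \<le> L * norm (x - q)" unfolding L_def distrib_right[symmetric] by (intro mult_right_mono) auto
      also have "\<dots> \<le> L * (C * M)"
      proof -
        have "\<kappa>' ^ j * M \<le> 1 * M" using \<kappa>' by (intro mult_right_mono power_le_one) (auto simp: M_def)
        then have "C * norm (\<Phi> (x - q)) \<le> C * M" using x(3) C(1) by (intro mult_left_mono) auto
        then show ?thesis using xC L(1) by (intro mult_left_mono) auto
      qed
      also have "\<dots> \<le> L * (C * (C1 * norm (p - q)))" unfolding M_def using C1(2) L(1) C(1) by (intro mult_left_mono) auto
      also have "\<dots> < L * (C * (C1 * \<delta>))" using p(2) L(1) C(1) C1(1) by (intro mult_strict_left_mono) auto
      also have "\<dots> \<le> \<delta>3" using \<delta>(3) by (simp add: mult_ac)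
      finally have 2: "norm (act P u x - q) < \<delta>3" .
      have "good (Suc j) (u @ w)" using 1 2 x(4) W(4)[OF u(1)] by (simp add: good_def x_def)
      then show "\<exists>w'. good (Suc j) w' \<and> True" by blast
    qed
    then obtain G where G: "\<And>j. good j (G j)" by blast
    have "(\<lambda>j. act P (G j) p - q) \<longlonglongrightarrow> 0"
    proof (rule Lim_null_comparison)
      show "\<forall>\<^sub>F j in sequentially. norm (act P (G j) p - q) \<le> C * (\<kappa>' ^ j * M)"
      proof (intro always_eventually allI)
        fix j
        have "norm (act P (G j) p - q) \<le> C * norm (\<Phi> (act P (G j) p - q))"
          using G[of j] C(3)[OF act_surface[OF p(1)]] \<delta>3 by (simp add: good_def)
        also have "\<dots> \<le> C * (\<kappa>' ^ j * M)" using G[of j] C(1) by (intro mult_left_mono) (auto simp: good_def)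
        finally show "norm (act P (G j) p - q) \<le> C * (\<kappa>' ^ j * M)" .
      qed
      have "(\<lambda>j. C * (\<kappa>' ^ j * M)) \<longlonglongrightarrow> C * (0 * M)"
        by (intro tendsto_intros LIMSEQ_realpow_zero \<kappa>')
      then show "(\<lambda>j. C * (\<kappa>' ^ j * M)) \<longlonglongrightarrow> 0" by simp
    qed
    then have "(\<lambda>j. act P (G j) p) \<longlonglongrightarrow> q" by (simp add: LIM_zero_cancel)
    then show "\<exists>G. (\<forall>j :: nat. even (length (G j))) \<and> (\<lambda>j. act P (G j) p) \<longlonglongrightarrow> q"
      using G unfolding good_def by blast
  qed
qed

end

section \<open>Wandering sets: proper discontinuity, local discreteness and normality\<close>

lemma wandering_disjoint:
  assumes V: "wandering P V" and g: "\<gamma> \<in> group_G P" "\<gamma> \<noteq> \<one>\<^bsub>bijections P\<^esub>" and p: "p \<in> V" "p \<in> cubic_surface P"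
  shows "\<gamma> p \<notin> V"
proof
  assume gV: "\<gamma> p \<in> V"
  obtain w where w: "distinct_adj w" "\<gamma> = restrict (act P w) (cubic_surface P)"
    using group_G_reduced[OF g(1)] by blast
  have "w \<noteq> []" using w(2) g(2) by (auto simp: bij_one)
  obtain R c where Rc: "0 < c" "\<And>p l. p \<in> V \<Longrightarrow> cmod (co l p) < R"
    "\<And>p w. p \<in> V \<Longrightarrow> distinct_adj w \<Longrightarrow> w \<noteq> [] \<Longrightarrow> \<exists>l. R + c * (real (length w) - 1) \<le> cmod (co l (act P w p))"
    using V unfolding wandering_def by blast
  obtain l where l: "R + c * (real (length w) - 1) \<le> cmod (co l (act P w p))" using Rc(3)[OF p(1) w(1) \<open>w \<noteq> []\<close>] by blast
  have "1 \<le> length w" using \<open>w \<noteq> []\<close> by (cases w) auto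
  then have "0 \<le> c * (real (length w) - 1)" using Rc(1) by simp
  moreover have "act P w p \<in> V" using gV w(2) p(2) by simp
  ultimately show False using l Rc(2)[of "act P w p" l] by linarith
qed

lemma wandering_properly_discontinuous:
  assumes V: "wandering P V" "V \<subseteq> cubic_surface P"
  shows "properly_discontinuous_on P V"
  unfolding properly_discontinuous_on_def
proof (intro allI impI)
  fix K assume K: "compact K \<and> K \<subseteq> V"
  have "{\<gamma> \<in> group_G P. \<gamma> ` K \<inter> K \<noteq> {}} \<subseteq> {\<one>\<^bsub>bijections P\<^esub>}"
  proof
    fix \<gamma> assume "\<gamma> \<in> {\<gamma> \<in> group_G P. \<gamma> ` K \<inter> K \<noteq> {}}"
    then obtain p where "\<gamma> \<in> group_G P" "p \<in> K" "\<gamma> p \<in> K" by blast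
    then show "\<gamma> \<in> {\<one>\<^bsub>bijections P\<^esub>}" using wandering_disjoint[OF V(1)] K V(2) by blast
  qed
  then show "finite {\<gamma> \<in> group_G P. \<gamma> ` K \<inter> K \<noteq> {}}" by (rule finite_subset) simp
qed

text \<open>Convergence to the identity at the single point \<open>p\<close> would bring some image
  \<open>f n p\<close> back into the open set \<open>V\<close>, which
  \<open>wandering_disjoint\<close> forbids.\<close>

lemma wandering_locally_discrete:
  assumes V: "wandering P V" "openin (top_of_set (cubic_surface P)) V" and p: "p \<in> V" "p \<in> W"
  shows "locally_discrete_on P W"
proof
  assume "locally_nondiscrete_on P W"
  then obtain f :: "nat \<Rightarrow> point \<Rightarrow> point" where f: "range f \<subseteq> group_G P - {\<one>\<^bsub>bijections P\<^esub>}"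
    "converges_uniformly_on_compacts f (\<lambda>p. p) W" unfolding locally_nondiscrete_on_def by blast
  obtain T where T: "open T" "V = cubic_surface P \<inter> T" using V(2) unfolding openin_open by blast
  have pS: "p \<in> cubic_surface P" using p(1) T(2) by blast
  have "compact {p} \<and> {p} \<subseteq> W" using p(2) by simp
  then have "uniform_limit {p} f (\<lambda>p. p) sequentially"
    using f(2) unfolding converges_uniformly_on_compacts_def by blast
  then have "(\<lambda>n. f n p) \<longlonglongrightarrow> p" by simp
  then have "\<forall>\<^sub>F n in sequentially. f n p \<in> T" using T p(1) by (intro topological_tendstoD) auto
  then obtain n where n: "f n p \<in> T" by (auto simp: eventually_sequentially)
  have fn: "f n \<in> group_G P" "f n \<noteq> \<one>\<^bsub>bijections P\<^esub>" using f(1) by auto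
  obtain w where "f n = restrict (act P w) (cubic_surface P)" using group_G_reduced[OF fn(1)] by blast
  then have "f n p \<in> V" using n T(2) pS act_surface by simp
  then show False using wandering_disjoint[OF V(1) fn p(1) pS] by blast
qed

text \<open>Either infinitely many words have bounded length, and then one of them repeats; or the
  lengths tend to infinity, and the growth bound in \<open>wandering\<close> pushes \<open>V\<close>
  out of every compact set.\<close>

lemma wandering_normal:
  assumes V: "wandering P V" "V \<subseteq> cubic_surface P"
  shows "normal_family_on P V"
  unfolding normal_family_on_def
proof (intro allI impI)
  fix f :: "nat \<Rightarrow> point \<Rightarrow> point" assume f: "range f \<subseteq> group_G P"
  have "\<exists>w. distinct_adj w \<and> f i = restrict (act P w) (cubic_surface P)" for i
    using group_G_reduced[of "f i" P] f by blast
  then obtain w where w: "\<And>i. distinct_adj (w i)" "\<And>i. f i = restrict (act P (w i)) (cubic_surface P)" by metis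
  show "\<exists>r :: nat \<Rightarrow> nat. strict_mono r \<and> ((\<exists>g. converges_uniformly_on_compacts (f \<circ> r) g V) \<or> converges_to_infinity P (f \<circ> r) V)"
  proof (cases "\<exists>L. infinite {i. length (w i) \<le> L}")
    case True
    then obtain L where L: "infinite {i. length (w i) \<le> L}" by blast
    have "finite {u :: letter list. set u \<subseteq> UNIV \<and> length u \<le> L}" by (rule finite_lists_length_le) simp
    then have "finite (w ` {i. length (w i) \<le> L})" by (rule rev_finite_subset) auto
    from pigeonhole_infinite[OF L this] obtain a where "infinite {i \<in> {i. length (w i) \<le> L}. w i = w a}" by blast
    then obtain r :: "nat \<Rightarrow> nat" where r: "strict_mono r" "\<And>n. r n \<in> {i \<in> {i. length (w i) \<le> L}. w i = w a}"
      using infinite_enumerate by blast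
    have "f (r n) = f a" for n using r(2)[of n] w(2) by simp
    then have "f \<circ> r = (\<lambda>_. f a)" by (simp add: fun_eq_iff)
    then have "converges_uniformly_on_compacts (f \<circ> r) (f a) V"
      by (simp add: converges_uniformly_on_compacts_def uniform_limit_const)
    then show ?thesis using r(1) by blast
  next
    case False
    have "converges_to_infinity P f V"
      unfolding converges_to_infinity_def
    proof (intro allI impI)
      fix V' K assume VK: "compact V' \<and> V' \<subseteq> V \<and> compact K \<and> K \<subseteq> cubic_surface P"
      then obtain M where M: "\<And>x. x \<in> K \<Longrightarrow> norm x \<le> M" using compact_imp_bounded bounded_iff by metis
      obtain R c where Rc: "0 < c"
        "\<And>p w. p \<in> V \<Longrightarrow> distinct_adj w \<Longrightarrow> w \<noteq> [] \<Longrightarrow> \<exists>l. R + c * (real (length w) - 1) \<le> cmod (co l (act P w p))"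
        using V(1) unfolding wandering_def by blast
      have "length (w i) \<le> nat \<lceil>(M - R) / c + 1\<rceil>" if i: "f i ` V' \<inter> K \<noteq> {}" for i
      proof (cases "w i = []")
        case False
        obtain p where p: "p \<in> V'" "f i p \<in> K" using i by blast
        then have pV: "p \<in> V" using VK by blast
        then have "f i p = act P (w i) p" using w(2) V(2) by auto
        then have "norm (act P (w i) p) \<le> M" using M p(2) by simp
        moreover obtain l where "R + c * (real (length (w i)) - 1) \<le> cmod (co l (act P (w i) p))"
          using Rc(2)[OF pV w(1) False] by blast
        ultimately have "R + c * (real (length (w i)) - 1) \<le> M" using co_le_norm[of l "act P (w i) p"] by linarith
        then have "real (length (w i)) \<le> (M - R) / c + 1" using Rc(1) by (simp add: field_simps)
        then show ?thesis by linarith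
      qed simp
      then have "{i. f i ` V' \<inter> K \<noteq> {}} \<subseteq> {i. length (w i) \<le> nat \<lceil>(M - R) / c + 1\<rceil>}" by blast
      then show "finite {i. f i ` V' \<inter> K \<noteq> {}}" by (rule finite_subset) (use False in blast)
    qed
    then show ?thesis by (intro exI[of _ id]) (simp add: strict_mono_id)
  qed
qed

context shear
begin

lemma near_q_in_julia:
  assumes gen: "P \<notin> nongeneric"
  obtains \<delta> where "0 < \<delta>" "cubic_surface P \<inter> ball q \<delta> \<subseteq> julia_set P"
proof -
  obtain \<delta> where \<delta>: "0 < \<delta>" "\<And>p. p \<in> cubic_surface P \<Longrightarrow> norm (p - q) < \<delta> \<Longrightarrow>
    \<exists>G. (\<forall>j :: nat. even (length (G j))) \<and> (\<lambda>j. act P (G j) p) \<longlonglongrightarrow> q"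
    using attracted[OF gen] by blast
  have "p \<in> julia_set P" if p: "p \<in> cubic_surface P" "p \<in> ball q \<delta>" for p
  proof -
    have "norm (p - q) < \<delta>" using p(2) by (simp add: dist_norm norm_minus_commute)
    then obtain G where "\<And>j :: nat. even (length (G j))" "(\<lambda>j. act P (G j) p) \<longlonglongrightarrow> q" using \<delta>(2)[OF p(1)] by blast
    then show ?thesis by (rule accumulation_in_julia[OF gen p(1)])
  qed
  then show thesis using that \<delta>(1) by blast
qed

lemma nondiscrete_near_q:
  "\<exists>U. openin (top_of_set (cubic_surface P)) U \<and> U \<noteq> {} \<and> (\<forall>p\<in>U. cmod (co Z p) < 2) \<and>
    locally_nondiscrete_on P U \<and> (P \<notin> nongeneric \<longrightarrow> U \<subseteq> julia_set P) \<and>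
    (\<forall>\<delta>>0. \<exists>\<gamma>\<^sub>1 \<in> group_G P. \<exists>\<gamma>\<^sub>2 \<in> group_G P.
          \<gamma>\<^sub>1 \<otimes>\<^bsub>bijections P\<^esub> \<gamma>\<^sub>2 \<noteq> \<gamma>\<^sub>2 \<otimes>\<^bsub>bijections P\<^esub> \<gamma>\<^sub>1 \<and>
          (SUP q\<in>U. ereal (norm (\<gamma>\<^sub>1 q - q))) < ereal \<delta> \<and>
          (SUP q\<in>U. ereal (norm (\<gamma>\<^sub>2 q - q))) < ereal \<delta>)"
proof -
  let ?S = "cubic_surface P"
  obtain \<rho> where \<rho>: "0 < \<rho>" and near: "\<And>w. w \<in> {aw, aw', Z # aw @ [Z], Z # aw' @ [Z]} \<Longrightarrow> near_id P q \<rho> (\<rho> / 384) w"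
    using near_id_words by (metis order_refl)
  have n: "near_id P q \<rho> (\<rho> / 384) aw" "near_id P q \<rho> (\<rho> / 384) (rev aw)" "near_id P q \<rho> (\<rho> / 384) (Z # aw @ [Z])"
    "near_id P q \<rho> (\<rho> / 384) (rev (Z # aw @ [Z]))" unfolding rev_words by (rule near; simp)+
  have "\<exists>us vs. (\<forall>k :: nat. even (length (us k)) \<and> even (length (vs k))) \<and>
    (\<forall>k. \<forall>x\<in>ball q (\<rho> / 2). norm (act P (us k) x - x) \<le> \<rho> / 384 / 8 ^ k \<and> norm (act P (vs k) x - x) \<le> \<rho> / 384 / 8 ^ k) \<and>
    (\<forall>k. \<exists>p\<in>?S. act P (us k @ vs k) p \<noteq> act P (vs k @ us k) p)"
    by (rule noncommuting_sequences[OF q_facts(1) \<rho> aw_def _ n]) (simp add: aw_def, blast)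
  then obtain us vs where ev: "\<And>k :: nat. even (length (us k))" "\<And>k. even (length (vs k))"
    and mv: "\<And>k x. x \<in> ball q (\<rho> / 2) \<Longrightarrow> norm (act P (us k) x - x) \<le> \<rho> / 384 / 8 ^ k"
      "\<And>k x. x \<in> ball q (\<rho> / 2) \<Longrightarrow> norm (act P (vs k) x - x) \<le> \<rho> / 384 / 8 ^ k"
    and nc: "\<And>k. \<exists>p\<in>?S. act P (us k @ vs k) p \<noteq> act P (vs k @ us k) p" by blast
  define g h where "g k = restrict (act P (us k)) ?S" "h k = restrict (act P (vs k)) ?S" for k
  note gh = this
  have G: "g k \<in> group_G P" "h k \<in> group_G P" for k unfolding gh using ev by (auto intro: even_word_in_group)
  have noncomm: "g k \<otimes>\<^bsub>bijections P\<^esub> h k \<noteq> h k \<otimes>\<^bsub>bijections P\<^esub> g k" for k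
  proof
    assume "g k \<otimes>\<^bsub>bijections P\<^esub> h k = h k \<otimes>\<^bsub>bijections P\<^esub> g k"
    then have "restrict (act P (us k @ vs k)) ?S = restrict (act P (vs k @ us k)) ?S" unfolding gh act_mult .
    then show False using nc[of k] by (metis restrict_apply')
  qed
  have nontriv: "g k \<noteq> \<one>\<^bsub>bijections P\<^esub>" for k
  proof
    assume "g k = \<one>\<^bsub>bijections P\<^esub>"
    then have "restrict (act P (us k)) ?S = restrict (act P []) ?S" unfolding gh bij_one .
    then have "act P (us k) p = p" if "p \<in> ?S" for p using that by (metis restrict_apply' act_Nil)
    then show False using nc[of k] act_surface by (metis act_append)
  qed
  have "\<exists>d>0. P \<notin> nongeneric \<longrightarrow> ?S \<inter> ball q d \<subseteq> julia_set P"
    using near_q_in_julia by (metis zero_less_one)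
  then obtain d where d: "0 < d" "P \<notin> nongeneric \<Longrightarrow> ?S \<inter> ball q d \<subseteq> julia_set P" by blast
  \<comment> \<open>The last bound keeps the modulus of the third coordinate below 2 on
    \<open>U\<close>.\<close>
  define s where "s = min d (min (\<rho> / 2) (2 - \<bar>t\<bar>))"
  have s: "0 < s" "s \<le> d" "s \<le> \<rho> / 2" "s \<le> 2 - \<bar>t\<bar>" using d(1) \<rho> q_facts(4) unfolding s_def by linarith+
  define U where "U = ?S \<inter> ball q s"
  have US: "x \<in> ?S" "x \<in> ball q (\<rho> / 2)" if "x \<in> U" for x using that s(3) by (auto simp: U_def)
  have moved: "norm (g k x - x) \<le> \<rho> / 384 / 8 ^ k" "norm (h k x - x) \<le> \<rho> / 384 / 8 ^ k" if "x \<in> U" for k x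
    using mv US[OF that] by (simp_all add: gh)
  have lim: "(\<lambda>k. \<rho> / 384 / 8 ^ k) \<longlonglongrightarrow> 0" by real_asymp
  have "locally_nondiscrete_on P U"
    unfolding locally_nondiscrete_on_def
  proof (intro exI conjI)
    show "range g \<subseteq> group_G P - {\<one>\<^bsub>bijections P\<^esub>}" using G(1) nontriv by auto
    show "converges_uniformly_on_compacts g (\<lambda>p. p) U"
      unfolding converges_uniformly_on_compacts_def
    proof (intro allI impI uniform_limitI)
      fix K and e :: real assume K: "compact K \<and> K \<subseteq> U" and "0 < e"
      then have "\<forall>\<^sub>F k in sequentially. \<rho> / 384 / 8 ^ k < e" using lim by (intro order_tendstoD) auto
      then show "\<forall>\<^sub>F k in sequentially. \<forall>x\<in>K. dist (g k x) x < e"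
      proof eventually_elim
        case (elim k)
        have "norm (g k x - x) < e" if "x \<in> K" for x using moved(1)[of x k] K that elim by fastforce
        then show ?case by (simp add: dist_norm)
      qed
    qed
  qed
  moreover have "\<exists>\<gamma>\<^sub>1 \<in> group_G P. \<exists>\<gamma>\<^sub>2 \<in> group_G P.
          \<gamma>\<^sub>1 \<otimes>\<^bsub>bijections P\<^esub> \<gamma>\<^sub>2 \<noteq> \<gamma>\<^sub>2 \<otimes>\<^bsub>bijections P\<^esub> \<gamma>\<^sub>1 \<and>
          (SUP q\<in>U. ereal (norm (\<gamma>\<^sub>1 q - q))) < ereal \<delta> \<and>
          (SUP q\<in>U. ereal (norm (\<gamma>\<^sub>2 q - q))) < ereal \<delta>" if \<delta>: "0 < \<delta>" for \<delta>
  proof -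
    have "\<forall>\<^sub>F k in sequentially. \<rho> / 384 / 8 ^ k < \<delta>" using lim \<delta> by (intro order_tendstoD) auto
    then obtain k where k: "\<rho> / 384 / 8 ^ k < \<delta>" by (auto simp: eventually_sequentially)
    have sup: "(SUP q\<in>U. ereal (norm (f q - q))) < ereal \<delta>"
      if "\<And>x. x \<in> U \<Longrightarrow> norm (f x - x) \<le> \<rho> / 384 / 8 ^ k" for f :: "point \<Rightarrow> point"
    proof -
      have "(SUP q\<in>U. ereal (norm (f q - q))) \<le> ereal (\<rho> / 384 / 8 ^ k)" using that by (intro SUP_least) simp
      also have "\<dots> < ereal \<delta>" using k by simp
      finally show ?thesis .
    qed
    show ?thesis using G noncomm sup[OF moved(1)] sup[OF moved(2)] by blast
  qed
  moreover have "openin (top_of_set ?S) U" unfolding U_def by (rule openin_open_Int) simp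
  moreover have "q \<in> U" using s(1) q_facts(2) by (simp add: U_def)
  moreover have "cmod (co Z p) < 2" if "p \<in> U" for p
  proof -
    have "norm (p - q) < 2 - \<bar>t\<bar>" using that s(4) by (simp add: U_def dist_norm norm_minus_commute)
    then have "cmod (co Z p - co Z q) < 2 - \<bar>t\<bar>" using co_le_norm[of Z "p - q"] by (simp add: co_diff)
    then show ?thesis using norm_triangle_ineq[of "co Z p - co Z q" "co Z q"] q_facts(3) by simp
  qed
  moreover have "U \<subseteq> julia_set P" if "P \<notin> nongeneric" using d(2)[OF that] s(2) by (auto simp: U_def)
  ultimately show ?thesis by (intro exI[of _ U]) blast
qed

end

text \<open>The parameters that admit both a wandering set and a shear point need not form an open
  set, so their interior is taken. The listed parameters belong to it because both properties hold
  throughout a neighbourhood of each.\<close>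

theorem theoremG:
  shows "\<exists>(PP :: param set) (HH :: param set).
    open PP \<and> (0, 0, 0, 0) \<in> PP \<and> (\<forall>a \<in> {-2<..<2}. special_param a \<in> PP) \<and>
    (\<exists>F. countable F \<and> (\<forall>X \<in> F. real_algebraic_hypersurface X) \<and> HH = \<Union>F) \<and>
    (\<forall>P. P \<notin> HH \<longrightarrow>
       (\<forall>\<gamma> \<in> group_G P - {\<one>\<^bsub>bijections P\<^esub>}.
          \<forall>p \<in> cubic_surface P. \<gamma> p = p \<longrightarrow> p \<in> julia_set P)) \<and>
    (\<forall>P \<in> PP. \<exists>U V.
       openin (top_of_set (cubic_surface P)) U \<and> U \<noteq> {} \<and>
       openin (top_of_set (cubic_surface P)) V \<and> V \<noteq> {} \<and>
       U \<inter> V = {} \<and>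
       locally_nondiscrete_on P U \<and>
       properly_discontinuous_on P V \<and>
       (\<forall>p \<in> V. \<forall>W. openin (top_of_set (cubic_surface P)) W \<and> p \<in> W \<longrightarrow>
          locally_discrete_on P W) \<and>
       (\<forall>\<delta> > 0. \<exists>\<gamma>\<^sub>1 \<in> group_G P. \<exists>\<gamma>\<^sub>2 \<in> group_G P.
          \<gamma>\<^sub>1 \<otimes>\<^bsub>bijections P\<^esub> \<gamma>\<^sub>2 \<noteq> \<gamma>\<^sub>2 \<otimes>\<^bsub>bijections P\<^esub> \<gamma>\<^sub>1 \<and>
          (SUP q\<in>U. ereal (norm (\<gamma>\<^sub>1 q - q))) < ereal \<delta> \<and>
          (SUP q\<in>U. ereal (norm (\<gamma>\<^sub>2 q - q))) < ereal \<delta>) \<and>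
       (P \<notin> HH \<longrightarrow> U \<subseteq> julia_set P \<and> V \<subseteq> fatou_set P))"
proof (rule exI[of _ "interior {P. has_wandering P \<and> (\<exists>n t q. shear_point P n t q)}"], rule exI[of _ nongeneric], intro conjI)
  let ?A = "{P. has_wandering P \<and> (\<exists>n t q. shear_point P n t q)}"
  have int: "P0 \<in> interior ?A" if "eventually has_wandering (nhds P0)" "\<forall>\<^sub>F P in nhds P0. \<exists>n t q. shear_point P n t q" for P0
  proof -
    have "\<forall>\<^sub>F P in nhds P0. P \<in> ?A" using that by eventually_elim blast
    then show ?thesis unfolding eventually_nhds interior_def by blast
  qed
  show "open (interior ?A)" by simp
  show "(0, 0, 0, 0) \<in> interior ?A" by (rule int[OF wandering_zero shear_zero])
  show "\<forall>a\<in>{-2<..<2}. special_param a \<in> interior ?A" using int[OF wandering_special shear_special] by blast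
  show "\<exists>F. countable F \<and> (\<forall>X\<in>F. real_algebraic_hypersurface X) \<and> nongeneric = \<Union>F" by (rule nongeneric_hypersurfaces)
  show "\<forall>P. P \<notin> nongeneric \<longrightarrow> (\<forall>\<gamma>\<in>group_G P - {\<one>\<^bsub>bijections P\<^esub>}. \<forall>p\<in>cubic_surface P. \<gamma> p = p \<longrightarrow> p \<in> julia_set P)"
  proof (intro allI impI ballI)
    fix P \<gamma> p assume *: "P \<notin> nongeneric" "\<gamma> \<in> group_G P - {\<one>\<^bsub>bijections P\<^esub>}" "p \<in> cubic_surface P" "\<gamma> p = p"
    have "\<gamma> \<in> group_G P" "\<gamma> \<noteq> \<one>\<^bsub>bijections P\<^esub>" using *(2) by blast+
    from fixed_points_in_julia[OF *(1) this *(3,4)] show "p \<in> julia_set P" .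
  qed
next
  let ?A = "{P. has_wandering P \<and> (\<exists>n t q. shear_point P n t q)}"
  show "\<forall>P \<in> interior ?A. \<exists>U V.
       openin (top_of_set (cubic_surface P)) U \<and> U \<noteq> {} \<and>
       openin (top_of_set (cubic_surface P)) V \<and> V \<noteq> {} \<and>
       U \<inter> V = {} \<and>
       locally_nondiscrete_on P U \<and>
       properly_discontinuous_on P V \<and>
       (\<forall>p \<in> V. \<forall>W. openin (top_of_set (cubic_surface P)) W \<and> p \<in> W \<longrightarrow>
          locally_discrete_on P W) \<and>
       (\<forall>\<delta> > 0. \<exists>\<gamma>\<^sub>1 \<in> group_G P. \<exists>\<gamma>\<^sub>2 \<in> group_G P.
          \<gamma>\<^sub>1 \<otimes>\<^bsub>bijections P\<^esub> \<gamma>\<^sub>2 \<noteq> \<gamma>\<^sub>2 \<otimes>\<^bsub>bijections P\<^esub> \<gamma>\<^sub>1 \<and>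
          (SUP q\<in>U. ereal (norm (\<gamma>\<^sub>1 q - q))) < ereal \<delta> \<and>
          (SUP q\<in>U. ereal (norm (\<gamma>\<^sub>2 q - q))) < ereal \<delta>) \<and>
       (P \<notin> nongeneric \<longrightarrow> U \<subseteq> julia_set P \<and> V \<subseteq> fatou_set P)"
  proof
    fix P assume "P \<in> interior ?A"
    then have "P \<in> ?A" using interior_subset by blast
    then obtain n t q where "has_wandering P" and "shear_point P n t q" by blast
    interpret shear P n t q by standard fact
    obtain V where V: "openin (top_of_set (cubic_surface P)) V" "V \<noteq> {}" "\<And>p. p \<in> V \<Longrightarrow> 2 < cmod (co Z p)" "wandering P V"
      using \<open>has_wandering P\<close> unfolding has_wandering_def by blast
    have VS: "V \<subseteq> cubic_surface P" using openin_imp_subset[OF V(1)] .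
    obtain U where U: "openin (top_of_set (cubic_surface P)) U" "U \<noteq> {}" "\<forall>p\<in>U. cmod (co Z p) < 2"
      "locally_nondiscrete_on P U" "P \<notin> nongeneric \<longrightarrow> U \<subseteq> julia_set P"
      "\<forall>\<delta>>0. \<exists>\<gamma>\<^sub>1 \<in> group_G P. \<exists>\<gamma>\<^sub>2 \<in> group_G P.
          \<gamma>\<^sub>1 \<otimes>\<^bsub>bijections P\<^esub> \<gamma>\<^sub>2 \<noteq> \<gamma>\<^sub>2 \<otimes>\<^bsub>bijections P\<^esub> \<gamma>\<^sub>1 \<and>
          (SUP q\<in>U. ereal (norm (\<gamma>\<^sub>1 q - q))) < ereal \<delta> \<and>
          (SUP q\<in>U. ereal (norm (\<gamma>\<^sub>2 q - q))) < ereal \<delta>"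
      using nondiscrete_near_q by (elim exE conjE)
    have UV: "U \<inter> V = {}" using U(3) V(3) by (force simp: disjoint_iff)
    have "V \<subseteq> fatou_set P"
      unfolding fatou_set_def using VS V(1) wandering_normal[OF V(4) VS] by blast
    then have J: "P \<notin> nongeneric \<longrightarrow> U \<subseteq> julia_set P \<and> V \<subseteq> fatou_set P" using U(5) by blast
    have D: "\<forall>p \<in> V. \<forall>W. openin (top_of_set (cubic_surface P)) W \<and> p \<in> W \<longrightarrow> locally_discrete_on P W"
      using wandering_locally_discrete[OF V(4,1)] by blast
    show "\<exists>U V.
       openin (top_of_set (cubic_surface P)) U \<and> U \<noteq> {} \<and>
       openin (top_of_set (cubic_surface P)) V \<and> V \<noteq> {} \<and>
       U \<inter> V = {} \<and>
       locally_nondiscrete_on P U \<and>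
       properly_discontinuous_on P V \<and>
       (\<forall>p \<in> V. \<forall>W. openin (top_of_set (cubic_surface P)) W \<and> p \<in> W \<longrightarrow>
          locally_discrete_on P W) \<and>
       (\<forall>\<delta> > 0. \<exists>\<gamma>\<^sub>1 \<in> group_G P. \<exists>\<gamma>\<^sub>2 \<in> group_G P.
          \<gamma>\<^sub>1 \<otimes>\<^bsub>bijections P\<^esub> \<gamma>\<^sub>2 \<noteq> \<gamma>\<^sub>2 \<otimes>\<^bsub>bijections P\<^esub> \<gamma>\<^sub>1 \<and>
          (SUP q\<in>U. ereal (norm (\<gamma>\<^sub>1 q - q))) < ereal \<delta> \<and>
          (SUP q\<in>U. ereal (norm (\<gamma>\<^sub>2 q - q))) < ereal \<delta>) \<and>
       (P \<notin> nongeneric \<longrightarrow> U \<subseteq> julia_set P \<and> V \<subseteq> fatou_set P)"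
      by (intro exI[of _ U] exI[of _ V] conjI)
         (rule U(1) U(2) V(1) V(2) UV U(4) wandering_properly_discontinuous[OF V(4) VS] D U(6) J)+
  qed
qed

end
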